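(* Let $\mathcal{R}\subset\mathbb{R}^N\setminus\{0\}$ be a reduced root system, $a>0$, and $k$ a non-negative multiplicity function on $\mathcal{R}$ satisfying $a+2\langle k\rangle+N>2$. (1) (Plancherel formula) The $(k,a)$-generalized Fourier transform $\mathcal{F}_{k,a}:L^2(\mathbb{R}^N,\vartheta_{k,a}(x)dx)\to L^2(\mathbb{R}^N,\vartheta_{k,a}(x)dx)$ is a unitary operator. That is, $\mathcal{F}_{k,a}$ is a bijective linear operator satisfying $\|\mathcal{F}_{k,a}(f)\|_k=\|f\|_k$ for any $f\in L^2(\mathbb{R}^N,\vartheta_{k,a}(x)dx)$. (2) For $\ell,m\in\mathbb{N}$ and $p\in\mathcal{H}_k^m(\mathbb{R}^N)$, the function $$\Phi_\ell^{(a)}(p,x)=p(x)\,L_\ell^{(\lambda_{k,a,m})}\Big(\frac2a\|x\|^a\Big)\exp\Big(-\frac1a\|x\|^a\Big),\qquad x\in\mathbb{R}^N,$$ is an eigenfunction of $\mathcal{F}_{k,a}$: $$\mathcal{F}_{k,a}(\Phi_\ell^{(a)}(p,\cdot))=e^{-i\pi(\ell+\frac ma)}\,\Phi_\ell^{(a)}(p,\cdot).$$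
   Context: Let $N\ge1$, $\langle\cdot,\cdot\rangle$ the standard inner product on $\mathbb{R}^N$, $\|x\|=\langle x,x\rangle^{1/2}$, $r_\alpha(x)=x-2\frac{\langle\alpha,x\rangle}{\|\alpha\|^2}\alpha$. A (reduced) root system is a finite set $\mathcal{R}\subset\mathbb{R}^N\setminus\{0\}$ with $r_\alpha(\mathcal{R})=\mathcal{R}$ and $\mathcal{R}\cap\mathbb{R}\alpha=\{\pm\alpha\}$ for all $\alpha\in\mathcal{R}$. $\mathfrak{C}$ is the finite Coxeter group generated by $\{r_\alpha\}$, $\mathcal{R}^+$ a positive subsystem. A multiplicity function is a $\mathfrak{C}$-invariant function $k=(k_\alpha)$ on $\mathcal{R}$; non-negative means all $k_\alpha\ge0$; $\langle k\rangle=\sum_{\alpha\in\mathcal{R}^+}k_\alpha$. Dunkl operators: $T_\xi(k)f(x)=\partial_\xi f(x)+\sum_{\alpha\in\mathcal{R}^+}k_\alpha\langle\alpha,\xi\rangle\frac{f(x)-f(r_\alpha x)}{\langle\alpha,x\rangle}$; Dunkl Laplacian $\Delta_k=\sum_{j=1}^NT_{\xi_j}(k)^2$ for an orthonormal basis $(\xi_j)$. $\vartheta_{k,a}(x)=\|x\|^{a-2}\prod_{\alpha\in\mathcal{R}}|\langle\alpha,x\rangle|^{k_\alpha}$; $\|\cdot\|_k$ is the norm of $L^2(\mathbb{R}^N,\vartheta_{k,a}(x)dx)$. $\mathcal{H}_k^m(\mathbb{R}^N)$ is the space of homogeneous polynomials $p$ of degree $m$ with $\Delta_kp=0$, $\lambda_{k,a,m}=\frac{2m+2\langle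 k\rangle+N-2}{a}$, and $L_\ell^{(\lambda)}(t)=\sum_{j=0}^\ell\frac{(-1)^j\Gamma(\lambda+\ell+1)}{(\ell-j)!\,\Gamma(\lambda+j+1)}\frac{t^j}{j!}$. The operator $\|x\|^{2-a}\Delta_k-\|x\|^a$ is essentially self-adjoint on $L^2(\mathbb{R}^N,\vartheta_{k,a}(x)dx)$ with domain the complex span of all $\Phi_\ell^{(a)}(p,\cdot)$, and $\mathcal{F}_{k,a}=e^{i\frac\pi2\left(\frac{2\langle k\rangle+N+a-2}{a}\right)}\exp\big(\frac{\pi i}{2a}(\|x\|^{2-a}\Delta_k-\|x\|^a)\big)$ by functional calculus of its closure. *)

theory Defs
  imports "HOL-Analysis.Analysis"
begin

section \<open>Root systems and multiplicity functions\<close>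

definition reflection :: "real^'n \<Rightarrow> real^'n \<Rightarrow> real^'n" where
  "reflection \<alpha> x = x - (2 * (\<alpha> \<bullet> x) / (norm \<alpha>)\<^sup>2) *\<^sub>R \<alpha>"

definition root_system :: "(real^'n) set \<Rightarrow> bool" where
  "root_system R \<longleftrightarrow> finite R \<and> 0 \<notin> R \<and>
     (\<forall>\<alpha>\<in>R. reflection \<alpha> ` R = R \<and> R \<inter> span {\<alpha>} = {\<alpha>, - \<alpha>})"

text \<open>Reflections are involutions, so closing under composition already gives the generated group.\<close>

inductive_set coxeter_group :: "(real^'n) set \<Rightarrow> (real^'n \<Rightarrow> real^'n) set"
  for R :: "(real^'n) set" where
  one: "id \<in> coxeter_group R"
| step: "\<alpha> \<in> R \<Longrightarrow> g \<in> coxeter_group R \<Longrightarrow> reflection \<alpha> \<circ> g \<in> coxeter_group R"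

definition positive_subsystem :: "(real^'n) set \<Rightarrow> (real^'n) set \<Rightarrow> bool" where
  "positive_subsystem R P \<longleftrightarrow>
     (\<exists>v. (\<forall>\<alpha>\<in>R. \<alpha> \<bullet> v \<noteq> 0) \<and> P = {\<alpha>\<in>R. \<alpha> \<bullet> v > 0})"

text \<open>Multiplicity functions live on \<open>R\<close>; values of \<open>k\<close> outside \<open>R\<close> are never used.\<close>

definition multiplicity_function :: "(real^'n) set \<Rightarrow> (real^'n \<Rightarrow> real) \<Rightarrow> bool" where
  "multiplicity_function R k \<longleftrightarrow> (\<forall>g\<in>coxeter_group R. \<forall>\<alpha>\<in>R. k (g \<alpha>) = k \<alpha>)"

definition mult_index :: "(real^'n) set \<Rightarrow> (real^'n \<Rightarrow> real) \<Rightarrow> real" where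
  "mult_index P k = (\<Sum>\<alpha>\<in>P. k \<alpha>)"

section \<open>Dunkl operators\<close>

definition dir_deriv :: "real^'n \<Rightarrow> (real^'n \<Rightarrow> complex) \<Rightarrow> real^'n \<Rightarrow> complex" where
  "dir_deriv \<xi> f x = vector_derivative (\<lambda>t. f (x + t *\<^sub>R \<xi>)) (at 0)"

text \<open>On the hyperplane orthogonal to \<open>\<alpha>\<close> the difference quotient of a smooth function is
  given its limit value, as usual for Dunkl operators (not the value \<open>0\<close> that division
  by zero would produce).\<close>

definition dunkl_quotient :: "real^'n \<Rightarrow> (real^'n \<Rightarrow> complex) \<Rightarrow> real^'n \<Rightarrow> complex" where
  "dunkl_quotient \<alpha> f x =
     (if \<alpha> \<bullet> x = 0 then complex_of_real (2 / (norm \<alpha>)\<^sup>2) * dir_deriv \<alpha> f x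
      else (f x - f (reflection \<alpha> x)) / complex_of_real (\<alpha> \<bullet> x))"

definition dunkl_op ::
  "(real^'n) set \<Rightarrow> (real^'n \<Rightarrow> real) \<Rightarrow> real^'n \<Rightarrow> (real^'n \<Rightarrow> complex) \<Rightarrow> real^'n \<Rightarrow> complex" where
  "dunkl_op P k \<xi> f x =
     dir_deriv \<xi> f x + (\<Sum>\<alpha>\<in>P. complex_of_real (k \<alpha> * (\<alpha> \<bullet> \<xi>)) * dunkl_quotient \<alpha> f x)"

definition dunkl_laplacian ::
  "(real^'n) set \<Rightarrow> (real^'n \<Rightarrow> real) \<Rightarrow> (real^'n \<Rightarrow> complex) \<Rightarrow> real^'n \<Rightarrow> complex" where
  "dunkl_laplacian P k f x = (\<Sum>\<xi>\<in>Basis. dunkl_op P k \<xi> (dunkl_op P k \<xi> f) x)"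

text \<open>Exponents \<open>\<nu>\<close> range over the finitely many multi-indices of total degree \<open>m\<close>; coefficients are complex.\<close>

definition homogeneous_polynomial :: "nat \<Rightarrow> (real^'n \<Rightarrow> complex) \<Rightarrow> bool" where
  "homogeneous_polynomial m p \<longleftrightarrow>
     (\<exists>c :: ('n \<Rightarrow> nat) \<Rightarrow> complex.
        p = (\<lambda>x. \<Sum>\<nu> | (\<Sum>i\<in>UNIV. \<nu> i) = m. c \<nu> * (\<Prod>i\<in>UNIV. complex_of_real (x $ i) ^ \<nu> i)))"

definition dunkl_harmonics ::
  "(real^'n) set \<Rightarrow> (real^'n \<Rightarrow> real) \<Rightarrow> nat \<Rightarrow> (real^'n \<Rightarrow> complex) set" where
  "dunkl_harmonics P k m = {p. homogeneous_polynomial m p \<and> (\<forall>x. dunkl_laplacian P k p x = 0)}"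

section \<open>The functions \<open>\<Phi>\<close>\<close>

definition laguerre :: "nat \<Rightarrow> real \<Rightarrow> real \<Rightarrow> real" where
  "laguerre l lam t =
     (\<Sum>j=0..l. ((-1) ^ j * Gamma (lam + real l + 1)) / (fact (l - j) * Gamma (lam + real j + 1))
                 * (t ^ j / fact j))"

definition lambda_kam :: "(real^'n) set \<Rightarrow> (real^'n \<Rightarrow> real) \<Rightarrow> real \<Rightarrow> nat \<Rightarrow> real" where
  "lambda_kam P k a m = (2 * real m + 2 * mult_index P k + real CARD('n) - 2) / a"

text \<open>The degree \<open>m\<close> is an explicit argument because the zero polynomial is homogeneous of every degree.\<close>

definition Phi ::
  "(real^'n) set \<Rightarrow> (real^'n \<Rightarrow> real) \<Rightarrow> real \<Rightarrow> nat \<Rightarrow> nat \<Rightarrow> (real^'n \<Rightarrow> complex) \<Rightarrow> real^'n \<Rightarrow> complex" where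
  "Phi P k a l m p x =
     p x * complex_of_real (laguerre l (lambda_kam P k a m) (2 / a * norm x powr a)
                            * exp (- (1 / a) * norm x powr a))"

section \<open>The Hilbert space of square-integrable functions\<close>

text \<open>Elements are the classes of a.e. equal square-integrable functions.\<close>

definition L2_fun :: "'a measure \<Rightarrow> ('a \<Rightarrow> complex) set" where
  "L2_fun M = {f \<in> borel_measurable M. integrable M (\<lambda>x. (cmod (f x))\<^sup>2)}"

definition ae_rel :: "'a measure \<Rightarrow> (('a \<Rightarrow> complex) \<times> ('a \<Rightarrow> complex)) set" where
  "ae_rel M = {(f, g). f \<in> L2_fun M \<and> g \<in> L2_fun M \<and> (AE x in M. f x = g x)}"

type_synonym 'a L2_elem = "('a \<Rightarrow> complex) set"

definition L2 :: "'a measure \<Rightarrow> 'a L2_elem set" where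
  "L2 M = L2_fun M // ae_rel M"

definition L2_class :: "'a measure \<Rightarrow> ('a \<Rightarrow> complex) \<Rightarrow> 'a L2_elem" where
  "L2_class M f = ae_rel M `` {f}"

definition L2_rep :: "'a L2_elem \<Rightarrow> 'a \<Rightarrow> complex" where
  "L2_rep u = (SOME f. f \<in> u)"

definition L2_add :: "'a measure \<Rightarrow> 'a L2_elem \<Rightarrow> 'a L2_elem \<Rightarrow> 'a L2_elem" where
  "L2_add M u v = L2_class M (\<lambda>x. L2_rep u x + L2_rep v x)"

definition L2_scale :: "'a measure \<Rightarrow> complex \<Rightarrow> 'a L2_elem \<Rightarrow> 'a L2_elem" where
  "L2_scale M c u = L2_class M (\<lambda>x. c * L2_rep u x)"

definition L2_inner :: "'a measure \<Rightarrow> 'a L2_elem \<Rightarrow> 'a L2_elem \<Rightarrow> complex" where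
  "L2_inner M u v = (LINT x|M. L2_rep u x * cnj (L2_rep v x))"

definition L2_norm :: "'a measure \<Rightarrow> 'a L2_elem \<Rightarrow> real" where
  "L2_norm M u = sqrt (LINT x|M. (cmod (L2_rep u x))\<^sup>2)"

definition L2_dist :: "'a measure \<Rightarrow> 'a L2_elem \<Rightarrow> 'a L2_elem \<Rightarrow> real" where
  "L2_dist M u v = sqrt (LINT x|M. (cmod (L2_rep u x - L2_rep v x))\<^sup>2)"

definition L2_linear :: "'a measure \<Rightarrow> ('a L2_elem \<Rightarrow> 'a L2_elem) \<Rightarrow> bool" where
  "L2_linear M T \<longleftrightarrow>
     (\<forall>u\<in>L2 M. T u \<in> L2 M) \<and>
     (\<forall>u\<in>L2 M. \<forall>v\<in>L2 M. T (L2_add M u v) = L2_add M (T u) (T v)) \<and>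
     (\<forall>c. \<forall>u\<in>L2 M. T (L2_scale M c u) = L2_scale M c (T u))"

section \<open>Unbounded operators and functional calculus\<close>

text \<open>An unbounded operator is represented by its graph.\<close>

type_synonym 'a L2_graph = "('a L2_elem \<times> 'a L2_elem) set"

definition graph_closure :: "'a measure \<Rightarrow> 'a L2_graph \<Rightarrow> 'a L2_graph" where
  "graph_closure M G =
     {(u, v). u \<in> L2 M \<and> v \<in> L2 M \<and>
        (\<forall>\<epsilon>>0. \<exists>(u', v')\<in>G. L2_dist M u' u < \<epsilon> \<and> L2_dist M v' v < \<epsilon>)}"

definition L2_projection :: "'a measure \<Rightarrow> ('a L2_elem \<Rightarrow> 'a L2_elem) \<Rightarrow> bool" where
  "L2_projection M Q \<longleftrightarrow>
     L2_linear M Q \<and> (\<forall>u\<in>L2 M. Q (Q u) = Q u) \<and>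
     (\<forall>u\<in>L2 M. \<forall>v\<in>L2 M. L2_inner M (Q u) v = L2_inner M u (Q v))"

text \<open>Projection-valued Borel measures on the real line.\<close>

definition spectral_measure :: "'a measure \<Rightarrow> (real set \<Rightarrow> 'a L2_elem \<Rightarrow> 'a L2_elem) \<Rightarrow> bool" where
  "spectral_measure M E \<longleftrightarrow>
     (\<forall>B\<in>sets borel. L2_projection M (E B)) \<and>
     (\<forall>u\<in>L2 M. E {} u = L2_class M (\<lambda>x. 0)) \<and>
     (\<forall>u\<in>L2 M. E UNIV u = u) \<and>
     (\<forall>B\<in>sets borel. \<forall>C\<in>sets borel. \<forall>u\<in>L2 M. E (B \<inter> C) u = E B (E C u)) \<and>
     (\<forall>B :: nat \<Rightarrow> real set. range B \<subseteq> sets borel \<longrightarrow> disjoint_family B \<longrightarrow>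
        (\<forall>u\<in>L2 M. \<forall>v\<in>L2 M.
           (\<lambda>i. L2_inner M (E (B i) u) v) sums L2_inner M (E (\<Union>i. B i) u) v))"

definition scalar_measure ::
  "'a measure \<Rightarrow> (real set \<Rightarrow> 'a L2_elem \<Rightarrow> 'a L2_elem) \<Rightarrow> 'a L2_elem \<Rightarrow> real measure" where
  "scalar_measure M E u =
     measure_of UNIV (sets borel) (\<lambda>B. ennreal (Re (L2_inner M (E B u) u)))"

definition simple_spectral_integral ::
  "'a measure \<Rightarrow> (real set \<Rightarrow> 'a L2_elem \<Rightarrow> 'a L2_elem) \<Rightarrow> (real \<Rightarrow> complex) \<Rightarrow> 'a L2_elem \<Rightarrow> 'a L2_elem" where
  "simple_spectral_integral M E s u =
     L2_class M (\<lambda>x. \<Sum>c\<in>range s. c * L2_rep (E (s -` {c}) u) x)"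

text \<open>Graph of \<open>\<integral> f dE\<close>.  Its domain is the set of \<open>u\<close> with \<open>\<integral> |f|\<^sup>2 d\<langle>E u, u\<rangle> < \<infinity>\<close>; the value is
  obtained by extending the isometry from simple functions to \<open>L2\<close> of the scalar measure of \<open>u\<close>.\<close>

definition spectral_integral ::
  "'a measure \<Rightarrow> (real set \<Rightarrow> 'a L2_elem \<Rightarrow> 'a L2_elem) \<Rightarrow> (real \<Rightarrow> complex) \<Rightarrow> 'a L2_graph" where
  "spectral_integral M E f =
     {(u, w). u \<in> L2 M \<and> w \<in> L2 M \<and> f \<in> L2_fun (scalar_measure M E u) \<and>
        (\<exists>s. (\<forall>n::nat. simple_function borel (s n)) \<and>
             (\<lambda>n. \<integral>\<^sup>+ t. ennreal ((cmod (s n t - f t))\<^sup>2) \<partial>scalar_measure M E u) \<longlonglongrightarrow> 0 \<and>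
             (\<lambda>n. L2_dist M (simple_spectral_integral M E (s n) u) w) \<longlonglongrightarrow> 0)}"

text \<open>For a self-adjoint \<open>G\<close> the spectral measure in this definition exists and is unique on Borel sets.\<close>

definition functional_calculus :: "'a measure \<Rightarrow> 'a L2_graph \<Rightarrow> (real \<Rightarrow> complex) \<Rightarrow> 'a L2_graph" where
  "functional_calculus M G f =
     spectral_integral M
       (SOME E. spectral_measure M E \<and> spectral_integral M E complex_of_real = G) f"

section \<open>The \<open>(k,a)\<close>-generalized Fourier transform\<close>

text \<open>The convention \<open>0 powr b = 0\<close> affects the weight only on a Lebesgue null set.\<close>

definition weight :: "(real^'n) set \<Rightarrow> (real^'n \<Rightarrow> real) \<Rightarrow> real \<Rightarrow> real^'n \<Rightarrow> real" where
  "weight R k a x = norm x powr (a - 2) * (\<Prod>\<alpha>\<in>R. \<bar>\<alpha> \<bullet> x\<bar> powr k \<alpha>)"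

definition weight_measure :: "(real^'n) set \<Rightarrow> (real^'n \<Rightarrow> real) \<Rightarrow> real \<Rightarrow> (real^'n) measure" where
  "weight_measure R k a = density lborel (\<lambda>x. ennreal (weight R k a x))"

definition complex_span :: "('a \<Rightarrow> complex) set \<Rightarrow> ('a \<Rightarrow> complex) set" where
  "complex_span S = {(\<lambda>x. \<Sum>f\<in>F. c f * f x) |F c. finite F \<and> F \<subseteq> S}"

definition Phi_span :: "(real^'n) set \<Rightarrow> (real^'n \<Rightarrow> real) \<Rightarrow> real \<Rightarrow> (real^'n \<Rightarrow> complex) set" where
  "Phi_span P k a = complex_span {Phi P k a l m p |l m p. p \<in> dunkl_harmonics P k m}"

definition ka_operator ::
  "(real^'n) set \<Rightarrow> (real^'n \<Rightarrow> real) \<Rightarrow> real \<Rightarrow> (real^'n \<Rightarrow> complex) \<Rightarrow> real^'n \<Rightarrow> complex" where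
  "ka_operator P k a f x =
     complex_of_real (norm x powr (2 - a)) * dunkl_laplacian P k f x
     - complex_of_real (norm x powr a) * f x"

definition ka_graph ::
  "(real^'n) set \<Rightarrow> (real^'n) set \<Rightarrow> (real^'n \<Rightarrow> real) \<Rightarrow> real \<Rightarrow> (real^'n) L2_graph" where
  "ka_graph R P k a =
     (let M = weight_measure R k a
      in {(L2_class M f, L2_class M (ka_operator P k a f)) |f. f \<in> Phi_span P k a})"

definition ka_fourier ::
  "(real^'n) set \<Rightarrow> (real^'n) set \<Rightarrow> (real^'n \<Rightarrow> real) \<Rightarrow> real \<Rightarrow> (real^'n) L2_elem \<Rightarrow> (real^'n) L2_elem" where
  "ka_fourier R P k a u =
     (let M = weight_measure R k a;
          U = functional_calculus M (graph_closure M (ka_graph R P k a))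
                (\<lambda>t. exp (\<i> * complex_of_real (pi / (2 * a) * t)))
      in L2_scale M
           (exp (\<i> * complex_of_real (pi / 2 * ((2 * mult_index P k + real CARD('n) + a - 2) / a))))
           (THE w. (u, w) \<in> U))"

end

theory Submission
  imports Defs "HOL-Computational_Algebra.Polynomial"
begin

text \<open>
  Why the theorem is true.  The functions \<open>\<Phi>\<close> diagonalise the operator
  \<open>D = norm x powr (2 - a) * \<Delta> - norm x powr a\<close>.  For a harmonic polynomial \<open>p\<close> of degree \<open>m\<close> and a
  radial factor \<open>g\<close>, the Dunkl Laplacian of \<open>p g\<close> is \<open>p\<close> times an ordinary differential operator of
  second order applied to \<open>g\<close> (\<open>dunkl_laplacian_radial\<close>), and in the variable
  \<open>t = (2/a) norm x powr a\<close> this becomes Laguerre's equation.  Hence \<open>D \<Phi> = - a (2 l + \<lambda> + 1) \<Phi>\<close>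
  off the origin (\<open>Phi_eigenfunction\<close>), and \<open>exp (i \<pi> D / (2 a))\<close> times the normalising constant
  multiplies \<open>\<Phi>\<close> by \<open>exp (- i \<pi> (l + m / a))\<close>, a number of modulus one.

  What remains is Hilbert space theory: the functions \<open>\<Phi>\<close> contain an orthonormal basis, so the closure
  of \<open>D\<close> is the diagonal operator with the eigenvalues as entries (\<open>closure_ka_graph\<close>).  The functional
  calculus of a diagonal operator applies the function to the entries
  (\<open>functional_calculus_diagonal\<close>): its spectral measure exists, and it is unique because a
  spectral measure is determined on eigenvectors.  So the transform multiplies the coefficients by
  numbers of modulus one, which makes it linear, bijective and isometric.

  Orthogonality (\<open>Phi_orthogonal\<close>).  Integrals of a homogeneous function times a radial one
  factor into a constant and a one-dimensional integral (\<open>radial_formula\<close>).  For equal degrees, the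
  one-dimensional integral is the orthogonality relation of the Laguerre polynomials.  For different
  degrees the constant vanishes.  Since it does not depend on the radial factor, one convenient
  factor is enough: a compactly supported one, for which the skew-symmetry of the Dunkl operators
  (\<open>dunkl_op_skew\<close>) and Green's formula give the claim (\<open>harmonic_orthogonal_cutoff\<close>).

  Completeness (\<open>Phi_total\<close>).  Let \<open>g\<close> be orthogonal to all \<open>\<Phi>\<close>.  Then the integrals of
  \<open>g * cnj p * t ^ j * exp (- s t)\<close> vanish for \<open>s = 1/2\<close>.  Expanding the exponential carries this from
  one value of \<open>s\<close> to all values below twice that value, hence to all \<open>s > 0\<close>.  By the theorem of
  Weierstrass in the variable \<open>exp (- t)\<close>, the integrals of \<open>g * cnj p * h t\<close> vanish for all continuous
  \<open>h\<close> of compact support.  Every polynomial is a combination of harmonic ones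
  with coefficients in the powers of \<open>norm x ^ 2\<close> (\<open>Fischer_decomposition\<close>), so \<open>g\<close> times a radial
  cut-off is orthogonal to all polynomials, and by the theorem of Stone and Weierstrass to all
  continuous functions.
\<close>


section \<open>Square-integrable functions\<close>

definition ip :: "'a measure \<Rightarrow> ('a \<Rightarrow> complex) \<Rightarrow> ('a \<Rightarrow> complex) \<Rightarrow> complex" where
  "ip M f g = (LINT x|M. f x * cnj (g x))"

definition sq :: "'a measure \<Rightarrow> ('a \<Rightarrow> complex) \<Rightarrow> real" where
  "sq M f = (LINT x|M. (cmod (f x))\<^sup>2)"

lemma L2_funD:
  assumes "f \<in> L2_fun M"
  shows "f \<in> borel_measurable M" "integrable M (\<lambda>x. (cmod (f x))\<^sup>2)"
  using assms by (auto simp: L2_fun_def)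

lemma borel_measurable_cnj [measurable]: "cnj \<in> borel_measurable borel"
  by (intro borel_measurable_continuous_onI continuous_on_cnj continuous_on_id)

lemma L2_fun_mult_integrable:
  assumes f: "f \<in> L2_fun M" and g: "g \<in> L2_fun M"
  shows "integrable M (\<lambda>x. f x * cnj (g x))"
proof (rule Bochner_Integration.integrable_bound)
  show "integrable M (\<lambda>x. (cmod (f x))\<^sup>2 + (cmod (g x))\<^sup>2)"
    using f g by (auto dest: L2_funD)
  show "(\<lambda>x. f x * cnj (g x)) \<in> borel_measurable M"
    using f[THEN L2_funD(1)] g[THEN L2_funD(1)] by measurable
  have "cmod (f x) * cmod (g x) \<le> (cmod (f x))\<^sup>2 + (cmod (g x))\<^sup>2" for x
    using sum_squares_bound[of "cmod (f x)" "cmod (g x)"] mult_nonneg_nonneg[OF norm_ge_zero[of "f x"] norm_ge_zero[of "g x"]]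
    by linarith
  then show "AE x in M. norm (f x * cnj (g x)) \<le> norm ((cmod (f x))\<^sup>2 + (cmod (g x))\<^sup>2)"
    by (auto simp: norm_mult)
qed

lemma L2_fun_cmult:
  assumes "f \<in> L2_fun M" shows "(\<lambda>x. c * f x) \<in> L2_fun M"
  using assms by (auto simp: L2_fun_def norm_mult power_mult_distrib)

lemma L2_fun_add:
  assumes f: "f \<in> L2_fun M" and g: "g \<in> L2_fun M"
  shows "(\<lambda>x. f x + g x) \<in> L2_fun M"
proof -
  have "integrable M (\<lambda>x. (cmod (f x + g x))\<^sup>2)"
  proof (rule Bochner_Integration.integrable_bound)
    show "integrable M (\<lambda>x. 2 * (cmod (f x))\<^sup>2 + 2 * (cmod (g x))\<^sup>2)"
      by (intro Bochner_Integration.integrable_add integrable_mult_right L2_funD f g)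
    show "(\<lambda>x. (cmod (f x + g x))\<^sup>2) \<in> borel_measurable M"
      using f[THEN L2_funD(1)] g[THEN L2_funD(1)] by measurable
    have "(cmod (f x + g x))\<^sup>2 \<le> 2 * (cmod (f x))\<^sup>2 + 2 * (cmod (g x))\<^sup>2" for x
    proof -
      have "(cmod (f x + g x))\<^sup>2 \<le> (cmod (f x) + cmod (g x))\<^sup>2"
        by (simp add: norm_triangle_ineq power_mono)
      also have "\<dots> \<le> 2 * (cmod (f x))\<^sup>2 + 2 * (cmod (g x))\<^sup>2"
        using sum_squares_bound[of "cmod (f x)" "cmod (g x)"] by (simp add: power2_sum)
      finally show ?thesis .
    qed
    then show "AE x in M. norm ((cmod (f x + g x))\<^sup>2) \<le> norm (2 * (cmod (f x))\<^sup>2 + 2 * (cmod (g x))\<^sup>2)"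
      by (auto intro!: AE_I2)
  qed
  then show ?thesis
    using f[THEN L2_funD(1)] g[THEN L2_funD(1)] by (auto simp: L2_fun_def)
qed

lemma L2_fun_zero: "(\<lambda>x. 0) \<in> L2_fun M"
  by (auto simp: L2_fun_def)

lemma L2_fun_diff:
  assumes f: "f \<in> L2_fun M" and g: "g \<in> L2_fun M"
  shows "(\<lambda>x. f x - g x) \<in> L2_fun M"
  using L2_fun_add[OF f L2_fun_cmult[OF g, of "-1"]] by simp

lemma L2_fun_sum:
  assumes "\<And>i. i \<in> I \<Longrightarrow> f i \<in> L2_fun M"
  shows "(\<lambda>x. \<Sum>i\<in>I. f i x) \<in> L2_fun M"
  using assms by (induction I rule: infinite_finite_induct) (auto intro: L2_fun_zero L2_fun_add)

lemmas L2_fun_intros = L2_fun_zero L2_fun_add L2_fun_diff L2_fun_cmult L2_fun_sum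

lemma ip_add_left:
  "f \<in> L2_fun M \<Longrightarrow> g \<in> L2_fun M \<Longrightarrow> h \<in> L2_fun M \<Longrightarrow>
    ip M (\<lambda>x. f x + g x) h = ip M f h + ip M g h"
  unfolding ip_def by (simp add: ring_distribs L2_fun_mult_integrable)

lemma ip_diff_left:
  "f \<in> L2_fun M \<Longrightarrow> g \<in> L2_fun M \<Longrightarrow> h \<in> L2_fun M \<Longrightarrow>
    ip M (\<lambda>x. f x - g x) h = ip M f h - ip M g h"
  unfolding ip_def by (simp add: left_diff_distrib L2_fun_mult_integrable)

lemma ip_cmult_left: "ip M (\<lambda>x. c * f x) h = c * ip M f h"
  unfolding ip_def by (simp add: mult.assoc)

lemma ip_zero_left: "ip M (\<lambda>x. 0) h = 0"
  unfolding ip_def by simp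

lemma ip_sum_left:
  assumes "\<And>i. i \<in> I \<Longrightarrow> f i \<in> L2_fun M" "h \<in> L2_fun M"
  shows "ip M (\<lambda>x. \<Sum>i\<in>I. f i x) h = (\<Sum>i\<in>I. ip M (f i) h)"
  using assms(1)
  by (induction I rule: infinite_finite_induct) (auto simp: ip_zero_left ip_add_left assms(2) L2_fun_sum)

lemma ip_commute: "ip M f g = cnj (ip M g f)"
proof -
  have "ip M f g = (LINT x|M. cnj (g x * cnj (f x)))"
    unfolding ip_def by (intro Bochner_Integration.integral_cong refl) (simp add: mult.commute)
  also have "\<dots> = cnj (ip M g f)"
    unfolding ip_def by (rule Bochner_Integration.integral_cnj)
  finally show ?thesis .
qed

lemma ip_self: "ip M f f = complex_of_real (sq M f)"
  unfolding ip_def sq_def by (simp add: complex_norm_square[symmetric] flip: integral_complex_of_real)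

lemma sq_nonneg: "0 \<le> sq M f"
  unfolding sq_def by simp

lemma sq_eq_0_iff:
  assumes "f \<in> L2_fun M" shows "sq M f = 0 \<longleftrightarrow> (AE x in M. f x = 0)"
  unfolding sq_def using integral_nonneg_eq_0_iff_AE[OF L2_funD(2)[OF assms]] by simp

lemma nn_integral_sq:
  assumes "f \<in> L2_fun M"
  shows "(\<integral>\<^sup>+x. ennreal ((cmod (f x))\<^sup>2) \<partial>M) = ennreal (sq M f)"
  unfolding sq_def using L2_funD(2)[OF assms] by (intro nn_integral_eq_integral) auto

lemma sq_cmult: "sq M (\<lambda>x. c * f x) = (cmod c)\<^sup>2 * sq M f"
  unfolding sq_def by (simp add: norm_mult power_mult_distrib)

lemma sq_commute: "sq M (\<lambda>x. f x - g x) = sq M (\<lambda>x. g x - f x)"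
  unfolding sq_def by (simp add: norm_minus_commute)

lemma sq_diff:
  assumes f: "f \<in> L2_fun M" and g: "g \<in> L2_fun M"
  shows "sq M (\<lambda>x. f x - g x) = sq M f - 2 * Re (ip M f g) + sq M g"
proof -
  have "complex_of_real (sq M (\<lambda>x. f x - g x)) = ip M (\<lambda>x. f x - g x) (\<lambda>x. f x - g x)"
    by (simp add: ip_self)
  also have "\<dots> = ip M f (\<lambda>x. f x - g x) - ip M g (\<lambda>x. f x - g x)"
    using f g by (simp add: ip_diff_left L2_fun_diff)
  also have "\<dots> = cnj (ip M (\<lambda>x. f x - g x) f) - cnj (ip M (\<lambda>x. f x - g x) g)"
    by (simp flip: ip_commute)
  also have "\<dots> = cnj (ip M f f) - cnj (ip M g f) - cnj (ip M f g) + cnj (ip M g g)"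
    using f g by (simp add: ip_diff_left)
  also have "\<dots> = sq M f - ip M f g - cnj (ip M f g) + sq M g"
    by (simp add: ip_self flip: ip_commute)
  finally have "Re (complex_of_real (sq M (\<lambda>x. f x - g x))) = Re (sq M f - ip M f g - cnj (ip M f g) + sq M g)"
    by simp
  then show ?thesis by simp
qed

lemma ip_cmult_right: "ip M f (\<lambda>x. c * g x) = cnj c * ip M f g"
  using ip_commute[of M f "\<lambda>x. c * g x"] ip_commute[of M f g] by (simp add: ip_cmult_left)

lemma ip_Cauchy_Schwarz:
  assumes f: "f \<in> L2_fun M" and g: "g \<in> L2_fun M"
  shows "(cmod (ip M f g))\<^sup>2 \<le> sq M f * sq M g"
proof (cases "sq M g = 0")
  case True
  then have "AE x in M. g x = 0" using sq_eq_0_iff g by blast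
  then have "ip M f g = 0"
    unfolding ip_def by (intro integral_eq_zero_AE) auto
  then show ?thesis using True by simp
next
  case False
  define c where "c = ip M f g / sq M g"
  have "0 \<le> sq M (\<lambda>x. f x - c * g x)" by (rule sq_nonneg)
  also have "\<dots> = sq M f - 2 * Re (cnj c * ip M f g) + (cmod c)\<^sup>2 * sq M g"
    using f g by (simp add: sq_diff L2_fun_cmult ip_cmult_right sq_cmult)
  also have "cnj c * ip M f g = complex_of_real ((cmod (ip M f g))\<^sup>2 / sq M g)"
    using complex_norm_square[of "ip M f g"] by (simp add: c_def mult.commute)
  also have "(cmod c)\<^sup>2 * sq M g = (cmod (ip M f g))\<^sup>2 / sq M g"
    using False by (simp add: c_def norm_divide power2_eq_square)
  finally have "(cmod (ip M f g))\<^sup>2 / sq M g \<le> sq M f" by simp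
  then show ?thesis
    using False sq_nonneg[of M g] by (simp add: field_simps)
qed

lemma ip_cong_AE:
  assumes "f \<in> L2_fun M" "g \<in> L2_fun M" "f' \<in> L2_fun M" "g' \<in> L2_fun M"
    "AE x in M. f x = f' x" "AE x in M. g x = g' x"
  shows "ip M f g = ip M f' g'"
  unfolding ip_def
proof (rule integral_cong_AE)
  show "AE x in M. f x * cnj (g x) = f' x * cnj (g' x)"
    using assms(5,6) by eventually_elim simp
qed (intro borel_measurable_integrable L2_fun_mult_integrable assms)+

lemma sq_cong_AE:
  assumes "f \<in> L2_fun M" "f' \<in> L2_fun M" "AE x in M. f x = f' x"
  shows "sq M f = sq M f'"
  unfolding sq_def
proof (rule integral_cong_AE)
  show "AE x in M. (cmod (f x))\<^sup>2 = (cmod (f' x))\<^sup>2"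
    using assms(3) by eventually_elim simp
qed (intro borel_measurable_integrable L2_funD assms)+

lemma sq_sum_orthogonal:
  assumes "finite I" "\<And>i. i \<in> I \<Longrightarrow> f i \<in> L2_fun M"
    and "\<And>i j. i \<in> I \<Longrightarrow> j \<in> I \<Longrightarrow> i \<noteq> j \<Longrightarrow> ip M (f i) (f j) = 0"
  shows "sq M (\<lambda>x. \<Sum>i\<in>I. c i * f i x) = (\<Sum>i\<in>I. (cmod (c i))\<^sup>2 * sq M (f i))"
proof -
  let ?S = "\<lambda>x. \<Sum>i\<in>I. c i * f i x"
  have S: "?S \<in> L2_fun M" using assms(2) by (intro L2_fun_intros)
  have "complex_of_real (sq M ?S) = ip M ?S ?S" by (simp add: ip_self)
  also have "\<dots> = (\<Sum>i\<in>I. c i * ip M (f i) ?S)"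
    using S assms(2) by (simp add: ip_sum_left L2_fun_cmult ip_cmult_left)
  also have "\<dots> = (\<Sum>i\<in>I. complex_of_real ((cmod (c i))\<^sup>2 * sq M (f i)))"
  proof (intro sum.cong refl)
    fix i assume i: "i \<in> I"
    have "ip M (f i) ?S = cnj (ip M ?S (f i))" by (rule ip_commute)
    also have "ip M ?S (f i) = (\<Sum>j\<in>I. c j * ip M (f j) (f i))"
      using i assms(2) by (simp add: ip_sum_left L2_fun_cmult ip_cmult_left)
    also have "\<dots> = (\<Sum>j\<in>I. if j = i then c i * complex_of_real (sq M (f i)) else 0)"
      using i assms(3) by (intro sum.cong refl) (auto simp: ip_self)
    also have "\<dots> = c i * complex_of_real (sq M (f i))" using i assms(1) by simp
    finally show "c i * ip M (f i) ?S = complex_of_real ((cmod (c i))\<^sup>2 * sq M (f i))"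
      by (simp add: complex_norm_square del: of_real_power)
  qed
  finally show ?thesis by (simp only: of_real_sum[symmetric] of_real_eq_iff)
qed

text \<open>Pass to a subsequence whose increments decay geometrically in norm; it converges almost
  everywhere, and Fatou's lemma identifies its pointwise limit as the limit in norm.\<close>

theorem Riesz_Fischer:
  assumes f: "\<And>n. f n \<in> L2_fun M"
    and Cauchy: "\<And>\<epsilon>. \<epsilon> > 0 \<Longrightarrow> \<exists>N::nat. \<forall>m\<ge>N. \<forall>n\<ge>N. sq M (\<lambda>x. f m x - f n x) < \<epsilon>"
  shows "\<exists>g\<in>L2_fun M. (\<lambda>n. sq M (\<lambda>x. f n x - g x)) \<longlonglongrightarrow> 0"
proof -
  note [measurable] = L2_funD(1)[OF f]
  obtain N where N: "\<And>k m n. m \<ge> N k \<Longrightarrow> n \<ge> N k \<Longrightarrow> sq M (\<lambda>x. f m x - f n x) < (1/4)^k"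
    using Cauchy[of "(1/4)^k" for k] by (metis zero_less_divide_1_iff zero_less_numeral zero_less_power)
  define r where "r k = (\<Sum>i\<le>k. N i) + k" for k
  have rN: "r k \<ge> N k" for k
  proof -
    have "N k \<le> (\<Sum>i\<le>k. N i)" by (rule member_le_sum) auto
    then show ?thesis by (simp add: r_def)
  qed
  have rmono: "r k \<le> r (Suc k)" for k by (simp add: r_def)
  have rk: "r k \<ge> k" for k by (simp add: r_def)
  define d where "d k x = f (r (Suc k)) x - f (r k) x" for k x
  have dL2: "d k \<in> L2_fun M" for k unfolding d_def by (intro L2_fun_intros f)
  note [measurable] = L2_funD(1)[OF dL2]
  have sqd: "sq M (d k) \<le> (1/4)^k" for k
    using N[of k "r (Suc k)" "r k"] rN[of k] rmono[of k] by (simp add: d_def[abs_def] less_imp_le)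
  \<comment> \<open>the weight \<open>2 ^ k\<close> still leaves a convergent sum and forces geometric decay of \<open>d k x\<close> almost everywhere\<close>
  have "(\<integral>\<^sup>+x. (\<Sum>k. ennreal (2^k * (cmod (d k x))\<^sup>2)) \<partial>M) = (\<Sum>k. \<integral>\<^sup>+x. ennreal (2^k * (cmod (d k x))\<^sup>2) \<partial>M)"
    by (intro nn_integral_suminf) measurable
  also have "\<dots> \<le> (\<Sum>k. ennreal ((1/2)^k))"
  proof (intro suminf_le allI)
    fix k
    have "(\<integral>\<^sup>+x. ennreal (2^k * (cmod (d k x))\<^sup>2) \<partial>M) = ennreal (2^k) * (\<integral>\<^sup>+x. ennreal ((cmod (d k x))\<^sup>2) \<partial>M)"
      by (subst nn_integral_cmult[symmetric]) (auto simp: ennreal_mult')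
    also have "\<dots> = ennreal (2^k * sq M (d k))"
      by (simp add: nn_integral_sq[OF dL2] ennreal_mult' sq_nonneg)
    also have "\<dots> \<le> ennreal (2^k * (1/4)^k)"
      using sqd[of k] by (intro ennreal_leI mult_left_mono) auto
    also have "2^k * (1/4)^k = ((1/2)^k :: real)"
      by (simp flip: power_mult_distrib)
    finally show "(\<integral>\<^sup>+x. ennreal (2^k * (cmod (d k x))\<^sup>2) \<partial>M) \<le> ennreal ((1/2)^k)" .
  qed auto
  also have "\<dots> = ennreal (\<Sum>k. (1/2)^k)"
    by (intro suminf_ennreal2) (auto intro: summable_geometric)
  finally have "(\<integral>\<^sup>+x. (\<Sum>k. ennreal (2^k * (cmod (d k x))\<^sup>2)) \<partial>M) \<noteq> \<infinity>"
    by (auto simp: top_unique)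
  then have "AE x in M. (\<Sum>k. ennreal (2^k * (cmod (d k x))\<^sup>2)) \<noteq> \<infinity>"
    by (intro nn_integral_noteq_infinite) measurable
  then have conv: "AE x in M. convergent (\<lambda>k. f (r k) x)"
  proof eventually_elim
    case (elim x)
    define C where "C = enn2real (\<Sum>k. ennreal (2^k * (cmod (d k x))\<^sup>2))"
    have C: "(\<Sum>k. ennreal (2^k * (cmod (d k x))\<^sup>2)) = ennreal C" "C \<ge> 0"
      using elim by (auto simp: C_def less_top)
    have bound: "cmod (d k x) \<le> sqrt C * (sqrt (1/2))^k" for k
    proof -
      define h where "h = (\<lambda>k. ennreal (2^k * (cmod (d k x))\<^sup>2))"
      have "(\<Sum>i\<in>{k}. h i) \<le> suminf h" by (rule sum_le_suminf) (auto simp: summableI)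
      then have "h k \<le> ennreal C" using C(1) by (simp add: h_def)
      then have "ennreal (2^k * (cmod (d k x))\<^sup>2) \<le> ennreal C" by (simp only: h_def)
      then have "2^k * (cmod (d k x))\<^sup>2 \<le> C" using C(2) by (simp add: ennreal_le_iff)
      then have "(cmod (d k x))\<^sup>2 \<le> C * (1/2)^k" by (simp add: field_simps power_divide)
      then have "cmod (d k x) \<le> sqrt (C * (1/2)^k)" by (simp add: real_le_rsqrt)
      then show ?thesis by (simp add: real_sqrt_mult real_sqrt_power)
    qed
    have "summable (\<lambda>k. sqrt C * (sqrt (1/2))^k)"
      by (intro summable_mult summable_geometric) simp
    then have "summable (\<lambda>k. d k x)"
      by (rule summable_comparison_test') (use bound in auto)
    then have "convergent (\<lambda>k. \<Sum>i<k. d i x)" by (simp add: summable_iff_convergent)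
    moreover have "(\<Sum>i<k. d i x) = f (r k) x - f (r 0) x" for k
      unfolding d_def by (rule sum_lessThan_telescope)
    ultimately have "convergent (\<lambda>k. f (r k) x - f (r 0) x)" by simp
    then obtain l where "(\<lambda>k. f (r k) x - f (r 0) x) \<longlonglongrightarrow> l" by (auto simp: convergent_def)
    then have "(\<lambda>k. (f (r k) x - f (r 0) x) + f (r 0) x) \<longlonglongrightarrow> l + f (r 0) x"
      by (intro tendsto_intros)
    then show ?case by (auto simp: convergent_def)
  qed
  define g where "g x = lim (\<lambda>k. f (r k) x)" for x
  have [measurable]: "g \<in> borel_measurable M"
    unfolding g_def by (intro borel_measurable_lim_metric) measurable
  \<comment> \<open>the Cauchy estimate survives the limit along the subsequence, by Fatou\<close>
  have bnd: "(\<integral>\<^sup>+x. ennreal ((cmod (f n x - g x))\<^sup>2) \<partial>M) \<le> ennreal \<epsilon>"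
    if le: "\<And>m. m \<ge> K \<Longrightarrow> sq M (\<lambda>x. f n x - f m x) \<le> \<epsilon>" for n K \<epsilon>
  proof -
    have "(\<integral>\<^sup>+x. ennreal ((cmod (f n x - g x))\<^sup>2) \<partial>M) = (\<integral>\<^sup>+x. liminf (\<lambda>k. ennreal ((cmod (f n x - f (r k) x))\<^sup>2)) \<partial>M)"
    proof (rule nn_integral_cong_AE, use conv in eventually_elim)
      case (elim x)
      then have "(\<lambda>k. f (r k) x) \<longlonglongrightarrow> g x" by (simp add: g_def convergent_LIMSEQ_iff)
      then have "(\<lambda>k. ennreal ((cmod (f n x - f (r k) x))\<^sup>2)) \<longlonglongrightarrow> ennreal ((cmod (f n x - g x))\<^sup>2)"
        by (intro tendsto_intros)
      from lim_imp_Liminf[OF trivial_limit_sequentially this] show ?case by (rule sym)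
    qed
    also have "\<dots> \<le> liminf (\<lambda>k. \<integral>\<^sup>+x. ennreal ((cmod (f n x - f (r k) x))\<^sup>2) \<partial>M)"
      by (intro nn_integral_liminf) measurable
    also have "\<dots> \<le> ennreal \<epsilon>"
    proof -
      have "eventually (\<lambda>k. (\<integral>\<^sup>+x. ennreal ((cmod (f n x - f (r k) x))\<^sup>2) \<partial>M) \<le> ennreal \<epsilon>) sequentially"
        using eventually_ge_at_top[of K]
      proof eventually_elim
        case (elim k)
        then have "sq M (\<lambda>x. f n x - f (r k) x) \<le> \<epsilon>" using rk[of k] by (intro le) simp
        then show ?case by (simp add: nn_integral_sq L2_fun_diff f ennreal_leI)
      qed
      then show ?thesis
        by (intro order_trans[OF Liminf_le_Limsup[OF trivial_limit_sequentially] Limsup_bounded])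
    qed
    finally show ?thesis .
  qed
  have diffL2: "(\<lambda>x. f n x - g x) \<in> L2_fun M \<and> sq M (\<lambda>x. f n x - g x) \<le> \<epsilon>"
    if le: "\<And>m. m \<ge> K \<Longrightarrow> sq M (\<lambda>x. f n x - f m x) \<le> \<epsilon>" and "\<epsilon> \<ge> 0" for n K \<epsilon>
  proof -
    have "(\<integral>\<^sup>+x. ennreal ((cmod (f n x - g x))\<^sup>2) \<partial>M) < \<infinity>"
      using bnd[OF le] by (auto simp: top_unique less_top[symmetric])
    then have L: "(\<lambda>x. f n x - g x) \<in> L2_fun M"
      by (auto simp: L2_fun_def intro!: integrableI_bounded)
    with bnd[OF le] have "ennreal (sq M (\<lambda>x. f n x - g x)) \<le> ennreal \<epsilon>"
      by (simp add: nn_integral_sq)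
    with L \<open>\<epsilon> \<ge> 0\<close> show ?thesis by simp
  qed
  show ?thesis
  proof (intro bexI)
    obtain K where "\<forall>m\<ge>K. \<forall>n\<ge>K. sq M (\<lambda>x. f m x - f n x) < 1" using Cauchy[of 1] by auto
    then have "(\<lambda>x. f K x - g x) \<in> L2_fun M"
      using diffL2[of K K 1] by (auto intro: less_imp_le)
    from L2_fun_diff[OF f[of K] this] show "g \<in> L2_fun M" by simp
    show "(\<lambda>n. sq M (\<lambda>x. f n x - g x)) \<longlonglongrightarrow> 0"
    proof (rule LIMSEQ_I)
      fix \<epsilon> :: real assume "\<epsilon> > 0"
      then obtain K where K: "\<forall>m\<ge>K. \<forall>n\<ge>K. sq M (\<lambda>x. f m x - f n x) < \<epsilon>/2" using Cauchy[of "\<epsilon>/2"] by auto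
      have "sq M (\<lambda>x. f n x - g x) < \<epsilon>" if "n \<ge> K" for n
      proof -
        have "sq M (\<lambda>x. f n x - f m x) \<le> \<epsilon>/2" if "m \<ge> K" for m
          using K \<open>n \<ge> K\<close> that by (auto intro: less_imp_le)
        then have "sq M (\<lambda>x. f n x - g x) \<le> \<epsilon>/2"
          using diffL2[of K n "\<epsilon>/2"] \<open>\<epsilon> > 0\<close> by auto
        then show ?thesis using \<open>\<epsilon> > 0\<close> by simp
      qed
      then show "\<exists>no. \<forall>n\<ge>no. norm (sq M (\<lambda>x. f n x - g x) - 0) < \<epsilon>"
        by (auto simp: sq_nonneg)
    qed
  qed
qed

section \<open>The classes of square-integrable functions\<close>

lemma equiv_ae_rel: "equiv (L2_fun M) (ae_rel M)"
proof (rule equivI)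
  show "ae_rel M \<subseteq> L2_fun M \<times> L2_fun M" by (auto simp: ae_rel_def)
  show "refl_on (L2_fun M) (ae_rel M)" by (auto simp: refl_on_def ae_rel_def)
  show "sym (ae_rel M)" by (auto simp: sym_def ae_rel_def elim: eventually_mono)
  show "trans (ae_rel M)"
  proof (rule transI)
    fix f g h assume "(f, g) \<in> ae_rel M" "(g, h) \<in> ae_rel M"
    then have "f \<in> L2_fun M" "h \<in> L2_fun M" "AE x in M. f x = g x" "AE x in M. g x = h x"
      by (auto simp: ae_rel_def)
    moreover from this(3,4) have "AE x in M. f x = h x" by eventually_elim simp
    ultimately show "(f, h) \<in> ae_rel M" by (simp add: ae_rel_def)
  qed
qed

lemma L2_class_in: "f \<in> L2_fun M \<Longrightarrow> L2_class M f \<in> L2 M"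
  unfolding L2_class_def L2_def by (rule quotientI)

lemma L2_class_eq_iff:
  assumes "f \<in> L2_fun M" "g \<in> L2_fun M"
  shows "L2_class M f = L2_class M g \<longleftrightarrow> (AE x in M. f x = g x)"
  unfolding L2_class_def eq_equiv_class_iff[OF equiv_ae_rel assms]
  using assms by (simp add: ae_rel_def)

lemma L2_class_mem: "f \<in> L2_class M g \<Longrightarrow> f \<in> L2_fun M \<and> (AE x in M. g x = f x)"
  by (auto simp: L2_class_def ae_rel_def)

lemma L2_rep_class:
  assumes "f \<in> L2_fun M"
  shows "L2_rep (L2_class M f) \<in> L2_fun M" "AE x in M. L2_rep (L2_class M f) x = f x"
proof -
  have "f \<in> L2_class M f"
    using assms by (auto simp: L2_class_def ae_rel_def)
  then have "L2_rep (L2_class M f) \<in> L2_class M f"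
    unfolding L2_rep_def by (rule someI[where P = "\<lambda>h. h \<in> L2_class M f"])
  from L2_class_mem[OF this]
  show "L2_rep (L2_class M f) \<in> L2_fun M" "AE x in M. L2_rep (L2_class M f) x = f x"
    by (auto elim: eventually_mono)
qed

lemma L2_cases:
  assumes "u \<in> L2 M" obtains f where "f \<in> L2_fun M" "u = L2_class M f"
  using assms by (auto simp: L2_def L2_class_def elim: quotientE)

lemma L2_rep_in: "u \<in> L2 M \<Longrightarrow> L2_rep u \<in> L2_fun M"
  by (auto elim!: L2_cases intro: L2_rep_class)

lemma L2_class_rep: "u \<in> L2 M \<Longrightarrow> L2_class M (L2_rep u) = u"
  by (erule L2_cases) (simp add: L2_class_eq_iff L2_rep_class)

lemma L2_inner_ip: "L2_inner M u v = ip M (L2_rep u) (L2_rep v)"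
  by (simp add: L2_inner_def ip_def)

lemma L2_norm_sq: "L2_norm M u = sqrt (sq M (L2_rep u))"
  by (simp add: L2_norm_def sq_def)

lemma L2_dist_sq: "L2_dist M u v = sqrt (sq M (\<lambda>x. L2_rep u x - L2_rep v x))"
  by (simp add: L2_dist_def sq_def)

lemma ip_rep_class:
  assumes "f \<in> L2_fun M" "g \<in> L2_fun M"
  shows "ip M (L2_rep (L2_class M f)) g = ip M f g"
  using assms L2_rep_class[OF assms(1)] by (intro ip_cong_AE) auto

lemma L2_add_in: "u \<in> L2 M \<Longrightarrow> v \<in> L2 M \<Longrightarrow> L2_add M u v \<in> L2 M"
  unfolding L2_add_def by (intro L2_class_in L2_fun_add L2_rep_in)

lemma L2_scale_in: "u \<in> L2 M \<Longrightarrow> L2_scale M c u \<in> L2 M"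
  unfolding L2_scale_def by (intro L2_class_in L2_fun_cmult L2_rep_in)

section \<open>Gram-Schmidt orthogonalisation\<close>

text \<open>A vector that depends on its predecessors is replaced by zero instead of being dropped.  This keeps
  the index set and spares the choice of an independent subfamily.\<close>

fun gram_schmidt :: "'a measure \<Rightarrow> (nat \<Rightarrow> 'a \<Rightarrow> complex) \<Rightarrow> nat \<Rightarrow> 'a \<Rightarrow> complex" where
  "gram_schmidt M g n =
     (let v = (\<lambda>x. g n x - (\<Sum>j\<in>{..<n}. ip M (g n) (gram_schmidt M g j) * gram_schmidt M g j x))
      in if sq M v = 0 then (\<lambda>x. 0) else (\<lambda>x. complex_of_real (1 / sqrt (sq M v)) * v x))"

declare gram_schmidt.simps [simp del]

lemma gram_schmidt_in:
  assumes g: "\<And>n. g n \<in> V" and zero: "(\<lambda>x. 0) \<in> V"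
    and add: "\<And>f h. f \<in> V \<Longrightarrow> h \<in> V \<Longrightarrow> (\<lambda>x. f x + h x) \<in> V"
    and scale: "\<And>c f. f \<in> V \<Longrightarrow> (\<lambda>x. c * f x) \<in> V"
  shows "gram_schmidt M g n \<in> V"
proof (induction n rule: less_induct)
  case (less n)
  have "(\<lambda>x. \<Sum>j\<in>J. c j * gram_schmidt M g j x) \<in> V" if "finite J" "J \<subseteq> {..<n}" for J c
    using that by (induction J rule: finite_induct) (auto intro!: zero add scale less)
  from add[OF g[of n] scale[OF this[of "{..<n}" "\<lambda>j. ip M (g n) (gram_schmidt M g j)"], of "-1"]]
  have "(\<lambda>x. g n x - (\<Sum>j\<in>{..<n}. ip M (g n) (gram_schmidt M g j) * gram_schmidt M g j x)) \<in> V"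
    by simp
  from scale[OF this] show ?case
    by (subst gram_schmidt.simps, unfold Let_def, split if_split) (intro conjI impI zero)
qed

lemma gram_schmidt:
  fixes M g
  assumes g: "\<And>n. g n \<in> L2_fun M"
  defines "e \<equiv> gram_schmidt M g"
  shows gram_schmidt_L2: "e n \<in> L2_fun M"
    and gram_schmidt_norm: "sq M (e n) = 0 \<or> sq M (e n) = 1"
    and gram_schmidt_orth: "i \<noteq> j \<Longrightarrow> ip M (e i) (e j) = 0"
    and gram_schmidt_span: "\<exists>c d. AE x in M. g n x = (\<Sum>j\<in>{..<n}. c j * e j x) + d * e n x"
proof -
  show L2: "e n \<in> L2_fun M" for n
    unfolding e_def by (rule gram_schmidt_in) (auto intro: g L2_fun_intros)
  define v where "v n = (\<lambda>x. g n x - (\<Sum>j\<in>{..<n}. ip M (g n) (e j) * e j x))" for n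
  have vL2: "v n \<in> L2_fun M" for n
    unfolding v_def by (intro L2_fun_intros g L2)
  have e_eq: "e n = (if sq M (v n) = 0 then (\<lambda>x. 0) else (\<lambda>x. complex_of_real (1 / sqrt (sq M (v n))) * v n x))" for n
    unfolding e_def v_def by (subst gram_schmidt.simps) (simp add: Let_def)
  show norm: "sq M (e n) = 0 \<or> sq M (e n) = 1" for n
  proof (cases "sq M (v n) = 0")
    case True
    then show ?thesis by (simp add: e_eq sq_def[of M "\<lambda>x. 0"])
  next
    case False
    then have "sq M (e n) = (cmod (complex_of_real (1 / sqrt (sq M (v n)))))\<^sup>2 * sq M (v n)"
      by (simp only: e_eq if_False sq_cmult)
    with False show ?thesis by (simp add: norm_divide power_divide sq_nonneg)
  qed
  have null: "ip M f (e j) = 0" if "f \<in> L2_fun M" "sq M (e j) = 0" for f j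
    using ip_Cauchy_Schwarz[OF that(1) L2[of j]] that(2) by simp
  \<comment> \<open>either \<open>e j\<close> is a unit vector, or it is a zero vector and all products with it vanish\<close>
  have lt: "ip M (e n) (e j) = 0" if "j < n" for n j
    using that
  proof (induction n arbitrary: j rule: less_induct)
    case (less n)
    have orth: "ip M (e i) (e j) = (if i = j then sq M (e j) else 0)" if "i < n" for i
    proof (cases i j rule: linorder_cases)
      case less': less
      have "ip M (e j) (e i) = 0" using less.IH[OF less.prems less'] .
      then show ?thesis using less' ip_commute[of M "e i" "e j"] by simp
    next
      case equal
      then show ?thesis by (simp add: ip_self)
    next
      case greater
      then show ?thesis using less.IH[OF that greater] by simp
    qed
    have "ip M (v n) (e j) = ip M (g n) (e j) - (\<Sum>i\<in>{..<n}. ip M (g n) (e i) * ip M (e i) (e j))"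
      unfolding v_def by (simp add: ip_diff_left ip_sum_left ip_cmult_left g L2 L2_fun_sum L2_fun_cmult)
    also have "(\<Sum>i\<in>{..<n}. ip M (g n) (e i) * ip M (e i) (e j)) = (\<Sum>i\<in>{..<n}. if i = j then ip M (g n) (e j) * sq M (e j) else 0)"
      by (intro sum.cong) (auto simp: orth)
    also have "\<dots> = ip M (g n) (e j) * sq M (e j)"
      using less.prems by simp
    also have "ip M (g n) (e j) - ip M (g n) (e j) * sq M (e j) = 0"
      using norm[of j] null[OF g, of j n] by auto
    finally have "ip M (v n) (e j) = 0" .
    then show ?case by (subst e_eq) (simp only: ip_cmult_left ip_zero_left mult_zero_right simp_thms split: if_split)
  qed
  show "ip M (e i) (e j) = 0" if "i \<noteq> j" for i j
    using that lt[of i j] lt[of j i] ip_commute[of M "e i" "e j"] by (cases "i < j") auto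
  show "\<exists>c d. AE x in M. g n x = (\<Sum>j\<in>{..<n}. c j * e j x) + d * e n x"
  proof (intro exI)
    have "AE x in M. v n x = complex_of_real (sqrt (sq M (v n))) * e n x"
    proof (cases "sq M (v n) = 0")
      case True
      then have "AE x in M. v n x = 0" using sq_eq_0_iff[OF vL2] by blast
      then show ?thesis by eventually_elim (simp add: True)
    next
      case False
      then show ?thesis by (simp add: e_eq)
    qed
    then show "AE x in M. g n x = (\<Sum>j\<in>{..<n}. ip M (g n) (e j) * e j x) + complex_of_real (sqrt (sq M (v n))) * e n x"
      by eventually_elim (simp add: v_def algebra_simps)
  qed
qed

section \<open>Expansion in an orthonormal basis\<close>

text \<open>Zero vectors are admitted, as they come out of the Gram-Schmidt process.  Coefficients at such an
  index are always zero, so the expansion theorems hold as usual.\<close>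

locale orthonormal_basis =
  fixes M :: "'a measure" and e :: "nat \<Rightarrow> 'a \<Rightarrow> complex"
  assumes e_L2: "e n \<in> L2_fun M"
    and e_orth: "i \<noteq> j \<Longrightarrow> ip M (e i) (e j) = 0"
    and e_norm: "sq M (e n) = 0 \<or> sq M (e n) = 1"
    and e_total: "f \<in> L2_fun M \<Longrightarrow> (\<And>n. ip M f (e n) = 0) \<Longrightarrow> AE x in M. f x = 0"
begin

lemma ip_null: "f \<in> L2_fun M \<Longrightarrow> sq M (e n) = 0 \<Longrightarrow> ip M f (e n) = 0"
  using ip_Cauchy_Schwarz[OF _ e_L2[of n], of f] by simp

lemma ip_absorb: "f \<in> L2_fun M \<Longrightarrow> ip M f (e n) * complex_of_real (sq M (e n)) = ip M f (e n)"
  using e_norm[of n] ip_null[of f n] by auto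

definition part :: "(nat \<Rightarrow> complex) \<Rightarrow> nat set \<Rightarrow> 'a \<Rightarrow> complex" where
  "part c A = (\<lambda>x. \<Sum>n\<in>A. c n * e n x)"

lemma part_L2: "part c A \<in> L2_fun M"
  unfolding part_def by (intro L2_fun_intros e_L2)

lemma ip_part:
  assumes "finite A"
  shows "ip M (part c A) (e k) = (if k \<in> A then c k * complex_of_real (sq M (e k)) else 0)"
proof -
  have "ip M (part c A) (e k) = (\<Sum>n\<in>A. c n * ip M (e n) (e k))"
    unfolding part_def by (simp add: ip_sum_left L2_fun_cmult e_L2 ip_cmult_left)
  also have "\<dots> = (\<Sum>n\<in>A. if n = k then c k * complex_of_real (sq M (e k)) else 0)"
    by (intro sum.cong refl) (auto simp: e_orth ip_self)
  also have "\<dots> = (if k \<in> A then c k * complex_of_real (sq M (e k)) else 0)"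
    using assms by simp
  finally show ?thesis .
qed

lemma ip_part_right:
  assumes "f \<in> L2_fun M"
  shows "ip M f (part c A) = (\<Sum>n\<in>A. cnj (c n) * ip M f (e n))"
proof -
  have "ip M f (part c A) = cnj (ip M (part c A) f)" by (rule ip_commute)
  also have "ip M (part c A) f = (\<Sum>n\<in>A. c n * ip M (e n) f)"
    unfolding part_def by (simp add: ip_sum_left L2_fun_cmult e_L2 ip_cmult_left assms)
  finally show ?thesis by (simp flip: ip_commute)
qed

lemma sq_part:
  assumes "finite A"
  shows "sq M (part c A) = (\<Sum>n\<in>A. (cmod (c n))\<^sup>2 * sq M (e n))"
  unfolding part_def by (rule sq_sum_orthogonal[OF assms]) (auto intro: e_L2 e_orth)

lemma sq_diff_part:
  assumes f: "f \<in> L2_fun M" and "finite A"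
  shows "sq M (\<lambda>x. f x - part (\<lambda>n. ip M f (e n)) A x) = sq M f - (\<Sum>n\<in>A. (cmod (ip M f (e n)))\<^sup>2)"
proof -
  have "ip M f (part (\<lambda>n. ip M f (e n)) A) = complex_of_real (\<Sum>n\<in>A. (cmod (ip M f (e n)))\<^sup>2)"
    unfolding ip_part_right[OF f] of_real_sum
    by (intro sum.cong refl) (simp add: complex_norm_square mult.commute del: of_real_power)
  moreover have "sq M (part (\<lambda>n. ip M f (e n)) A) = (\<Sum>n\<in>A. (cmod (ip M f (e n)))\<^sup>2)"
    unfolding sq_part[OF assms(2)]
  proof (intro sum.cong refl)
    fix n show "(cmod (ip M f (e n)))\<^sup>2 * sq M (e n) = (cmod (ip M f (e n)))\<^sup>2"
      using e_norm[of n] ip_null[OF f, of n] by auto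
  qed
  ultimately show ?thesis
    unfolding sq_diff[OF f part_L2] by simp
qed

text \<open>The partial sums form a Cauchy sequence.  The factors \<open>sq M (e n)\<close> are \<open>0\<close> or \<open>1\<close>; they account for
  the zero vectors, at which no coefficient can be prescribed.\<close>

lemma synthesis:
  assumes "summable (\<lambda>n. (cmod (c n))\<^sup>2 * sq M (e n))"
  shows "\<exists>g\<in>L2_fun M. (\<forall>n. ip M g (e n) = c n * complex_of_real (sq M (e n))) \<and>
    (\<lambda>N. sq M (\<lambda>x. part c {..<N} x - g x)) \<longlonglongrightarrow> 0"
proof -
  have part_diff: "(\<lambda>x. part c {..<m} x - part c {..<n} x) = part c {n..<m}" if "n \<le> m" for m n :: nat
  proof
    fix x
    have "part c {..<m} x = part c {..<n} x + part c {n..<m} x"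
      using that unfolding part_def
      by (subst sum.union_disjoint[symmetric]) (auto simp: ivl_disj_un)
    then show "part c {..<m} x - part c {..<n} x = part c {n..<m} x" by simp
  qed
  have "\<exists>N. \<forall>m\<ge>N. \<forall>n\<ge>N. sq M (\<lambda>x. part c {..<m} x - part c {..<n} x) < \<epsilon>" if "\<epsilon> > 0" for \<epsilon>
  proof -
    obtain N where N: "\<And>m n. m \<ge> N \<Longrightarrow> norm (\<Sum>k\<in>{m..<n}. (cmod (c k))\<^sup>2 * sq M (e k)) < \<epsilon>"
      using assms \<open>\<epsilon> > 0\<close> unfolding summable_Cauchy by blast
    have *: "sq M (\<lambda>x. part c {..<m} x - part c {..<n} x) < \<epsilon>" if "n \<ge> N" "n \<le> m" for m n
      using N[OF that(1), of m] by (simp add: part_diff[OF that(2)] sq_part)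
    have "sq M (\<lambda>x. part c {..<m} x - part c {..<n} x) < \<epsilon>" if "n \<ge> N" "m \<ge> N" for m n
      using *[of n m] *[of m n] that sq_commute[of M "part c {..<m}" "part c {..<n}"] by (cases "n \<le> m") auto
    then show ?thesis by blast
  qed
  from Riesz_Fischer[OF part_L2 this]
  obtain g where g: "g \<in> L2_fun M" and lim: "(\<lambda>N. sq M (\<lambda>x. part c {..<N} x - g x)) \<longlonglongrightarrow> 0"
    by blast
  have "ip M g (e n) = c n * complex_of_real (sq M (e n))" for n
  proof -
    have "(\<lambda>N. sqrt (sq M (\<lambda>x. part c {..<N} x - g x) * sq M (e n))) \<longlonglongrightarrow> sqrt (0 * sq M (e n))"
      by (intro tendsto_intros lim)
    then have l: "(\<lambda>N. sqrt (sq M (\<lambda>x. part c {..<N} x - g x) * sq M (e n))) \<longlonglongrightarrow> 0" by simp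
    have b: "cmod (ip M (part c {..<N}) (e n) - ip M g (e n)) \<le> sqrt (sq M (\<lambda>x. part c {..<N} x - g x) * sq M (e n))" for N
      using ip_Cauchy_Schwarz[OF L2_fun_diff[OF part_L2[of c "{..<N}"] g] e_L2[of n]]
      by (intro real_le_rsqrt) (simp add: ip_diff_left part_L2 g e_L2)
    have "(\<lambda>N. ip M (part c {..<N}) (e n) - ip M g (e n)) \<longlonglongrightarrow> 0"
      by (rule Lim_null_comparison[OF always_eventually l]) (rule allI, rule b)
    then have "(\<lambda>N. ip M (part c {..<N}) (e n)) \<longlonglongrightarrow> ip M g (e n)"
      by (simp add: LIM_zero_iff)
    moreover have "(\<lambda>N. ip M (part c {..<N}) (e n)) \<longlonglongrightarrow> c n * complex_of_real (sq M (e n))"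
      by (rule tendsto_eventually, rule eventually_mono[OF eventually_gt_at_top[of n]]) (simp add: ip_part)
    ultimately show ?thesis by (rule LIMSEQ_unique)
  qed
  with g lim show ?thesis by blast
qed

lemma Bessel_summable:
  assumes f: "f \<in> L2_fun M" shows "summable (\<lambda>n. (cmod (ip M f (e n)))\<^sup>2)"
proof (rule bounded_imp_summable)
  fix N
  show "(\<Sum>n\<le>N. (cmod (ip M f (e n)))\<^sup>2) \<le> sq M f"
    using sq_diff_part[OF f, of "{..N}"] sq_nonneg[of M "\<lambda>x. f x - part (\<lambda>n. ip M f (e n)) {..N} x"] by simp
qed simp

text \<open>The vector synthesised from the coefficients of \<open>f\<close> has the same coefficients as \<open>f\<close>, so it is \<open>f\<close> by
  totality.\<close>

lemma expansion:
  assumes f: "f \<in> L2_fun M"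
  shows "(\<lambda>N. sq M (\<lambda>x. f x - part (\<lambda>n. ip M f (e n)) {..<N} x)) \<longlonglongrightarrow> 0"
proof -
  let ?c = "\<lambda>n. ip M f (e n)"
  have "summable (\<lambda>n. (cmod (?c n))\<^sup>2 * sq M (e n))"
  proof (rule summable_comparison_test'[OF Bessel_summable[OF f]])
    fix n show "norm ((cmod (?c n))\<^sup>2 * sq M (e n)) \<le> (cmod (?c n))\<^sup>2" using e_norm[of n] by auto
  qed
  from synthesis[OF this] obtain g where g: "g \<in> L2_fun M"
    and ge: "\<And>n. ip M g (e n) = ?c n * complex_of_real (sq M (e n))"
    and lim: "(\<lambda>N. sq M (\<lambda>x. part ?c {..<N} x - g x)) \<longlonglongrightarrow> 0" by blast
  have "AE x in M. f x - g x = 0"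
    by (rule e_total) (auto simp: L2_fun_diff f g ip_diff_left e_L2 ge ip_absorb)
  then have "sq M (\<lambda>x. part ?c {..<N} x - g x) = sq M (\<lambda>x. part ?c {..<N} x - f x)" for N
    by (intro sq_cong_AE L2_fun_diff part_L2 f g) (auto elim: eventually_mono)
  then have "sq M (\<lambda>x. part ?c {..<N} x - g x) = sq M (\<lambda>x. f x - part ?c {..<N} x)" for N
    using sq_commute by metis
  with lim show ?thesis by simp
qed

lemma Parseval:
  assumes f: "f \<in> L2_fun M"
  shows "(\<lambda>n. (cmod (ip M f (e n)))\<^sup>2) sums sq M f"
proof -
  have "(\<lambda>N. sq M f - (sq M f - (\<Sum>n<N. (cmod (ip M f (e n)))\<^sup>2))) \<longlonglongrightarrow> sq M f - 0"
    using expansion[OF f] by (intro tendsto_diff tendsto_const) (simp add: sq_diff_part[OF f])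
  then show ?thesis by (simp add: sums_def)
qed

lemma Parseval_ip:
  assumes f: "f \<in> L2_fun M" and g: "g \<in> L2_fun M"
  shows "(\<lambda>n. ip M f (e n) * cnj (ip M g (e n))) sums ip M f g"
proof -
  let ?S = "\<lambda>N. part (\<lambda>n. ip M f (e n)) {..<N}"
  have "(\<lambda>N. sqrt (sq M (\<lambda>x. f x - ?S N x) * sq M g)) \<longlonglongrightarrow> sqrt (0 * sq M g)"
    by (intro tendsto_intros expansion[OF f])
  then have l: "(\<lambda>N. sqrt (sq M (\<lambda>x. f x - ?S N x) * sq M g)) \<longlonglongrightarrow> 0" by simp
  have b: "cmod (ip M f g - ip M (?S N) g) \<le> sqrt (sq M (\<lambda>x. f x - ?S N x) * sq M g)" for N
    using ip_Cauchy_Schwarz[OF L2_fun_diff[OF f part_L2[of "\<lambda>n. ip M f (e n)" "{..<N}"]] g]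
    by (intro real_le_rsqrt) (simp add: ip_diff_left part_L2 f g)
  have "(\<lambda>N. ip M f g - ip M (?S N) g) \<longlonglongrightarrow> 0"
    by (rule Lim_null_comparison[OF always_eventually l]) (rule allI, rule b)
  then have "(\<lambda>N. ip M f g - (ip M f g - ip M (?S N) g)) \<longlonglongrightarrow> ip M f g - 0"
    by (intro tendsto_intros)
  moreover have "ip M (?S N) g = (\<Sum>n<N. ip M f (e n) * cnj (ip M g (e n)))" for N
    using ip_commute[of M "?S N" g] by (simp add: ip_part_right[OF g])
  ultimately show ?thesis by (simp add: sums_def)
qed

definition coef :: "'a L2_elem \<Rightarrow> nat \<Rightarrow> complex" where
  "coef u n = ip M (L2_rep u) (e n)"

lemma coef_class: "f \<in> L2_fun M \<Longrightarrow> coef (L2_class M f) n = ip M f (e n)"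
  unfolding coef_def by (rule ip_rep_class[OF _ e_L2])

lemma coef_inject:
  assumes "u \<in> L2 M" "v \<in> L2 M" "\<And>n. coef u n = coef v n"
  shows "u = v"
proof -
  have "AE x in M. L2_rep u x - L2_rep v x = 0"
    using assms by (intro e_total) (auto simp: L2_fun_diff L2_rep_in ip_diff_left e_L2 coef_def)
  then have "L2_class M (L2_rep u) = L2_class M (L2_rep v)"
    using assms by (subst L2_class_eq_iff) (auto simp: L2_rep_in)
  then show ?thesis using assms by (simp add: L2_class_rep)
qed

lemma coef_add: "u \<in> L2 M \<Longrightarrow> v \<in> L2 M \<Longrightarrow> coef (L2_add M u v) n = coef u n + coef v n"
  unfolding L2_add_def by (simp add: coef_class L2_fun_add L2_rep_in ip_add_left e_L2) (simp add: coef_def)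

lemma coef_scale: "u \<in> L2 M \<Longrightarrow> coef (L2_scale M c u) n = c * coef u n"
  unfolding L2_scale_def by (simp add: coef_class L2_fun_cmult L2_rep_in ip_cmult_left) (simp add: coef_def)

lemma coef_norm: "u \<in> L2 M \<Longrightarrow> (\<lambda>n. (cmod (coef u n))\<^sup>2) sums (L2_norm M u)\<^sup>2"
  using Parseval[OF L2_rep_in[of u M]] by (simp add: coef_def L2_norm_sq sq_nonneg)

lemma coef_dist:
  assumes "u \<in> L2 M" "v \<in> L2 M"
  shows "(\<lambda>n. (cmod (coef u n - coef v n))\<^sup>2) sums (L2_dist M u v)\<^sup>2"
  using Parseval[OF L2_fun_diff[OF L2_rep_in[OF assms(1)] L2_rep_in[OF assms(2)]]] assms
  by (simp add: coef_def L2_dist_sq sq_nonneg ip_diff_left L2_rep_in e_L2)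

lemma coef_inner:
  assumes "u \<in> L2 M" "v \<in> L2 M"
  shows "(\<lambda>n. coef u n * cnj (coef v n)) sums L2_inner M u v"
  using Parseval_ip[OF L2_rep_in[OF assms(1)] L2_rep_in[OF assms(2)]]
  by (simp add: coef_def L2_inner_ip)

lemma coef_dist_le:
  assumes "u \<in> L2 M" "v \<in> L2 M"
  shows "cmod (coef u n - coef v n) \<le> L2_dist M u v"
proof -
  have "(\<Sum>k\<in>{n}. (cmod (coef u k - coef v k))\<^sup>2) \<le> (\<Sum>k. (cmod (coef u k - coef v k))\<^sup>2)"
    using sums_summable[OF coef_dist[OF assms]] by (rule sum_le_suminf) auto
  also have "\<dots> = (L2_dist M u v)\<^sup>2"
    using coef_dist[OF assms] by (simp add: sums_iff)
  finally have "(cmod (coef u n - coef v n))\<^sup>2 \<le> (L2_dist M u v)\<^sup>2" by simp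
  then show ?thesis
    by (rule power2_le_imp_le) (simp add: L2_dist_sq sq_nonneg)
qed

lemma multiplier_exists:
  assumes u: "u \<in> L2 M" and "summable (\<lambda>n. (cmod (h n * coef u n))\<^sup>2)"
  shows "\<exists>w\<in>L2 M. \<forall>n. coef w n = h n * coef u n"
proof -
  have "summable (\<lambda>n. (cmod (h n * coef u n))\<^sup>2 * sq M (e n))"
  proof (rule summable_comparison_test'[OF assms(2)])
    fix n show "norm ((cmod (h n * coef u n))\<^sup>2 * sq M (e n)) \<le> (cmod (h n * coef u n))\<^sup>2" using e_norm[of n] by auto
  qed
  from synthesis[OF this] obtain g where "g \<in> L2_fun M"
    "\<And>n. ip M g (e n) = h n * coef u n * complex_of_real (sq M (e n))" by blast
  moreover have "h n * coef u n * complex_of_real (sq M (e n)) = h n * coef u n" for n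
    using ip_absorb[OF L2_rep_in[OF u], of n] by (simp add: coef_def mult.assoc)
  ultimately show ?thesis
    by (intro bexI[of _ "L2_class M g"]) (auto simp: coef_class L2_class_in)
qed

lemma bounded_multiplier_exists:
  assumes u: "u \<in> L2 M" and h: "\<And>n. cmod (h n) \<le> 1"
  shows "\<exists>w\<in>L2 M. \<forall>n. coef w n = h n * coef u n"
proof (rule multiplier_exists[OF u])
  show "summable (\<lambda>n. (cmod (h n * coef u n))\<^sup>2)"
  proof (rule summable_comparison_test'[OF sums_summable[OF coef_norm[OF u]]])
    fix n
    have "cmod (h n) * cmod (coef u n) \<le> 1 * cmod (coef u n)" by (intro mult_right_mono h) simp
    then show "norm ((cmod (h n * coef u n))\<^sup>2) \<le> (cmod (coef u n))\<^sup>2"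
      by (simp add: norm_mult power_mono)
  qed
qed

end

section \<open>Spectral measures\<close>

lemma spectral_measureD:
  assumes "spectral_measure M E"
  shows "B \<in> sets borel \<Longrightarrow> u \<in> L2 M \<Longrightarrow> E B u \<in> L2 M"
    and "u \<in> L2 M \<Longrightarrow> E {} u = L2_class M (\<lambda>x. 0)"
    and "u \<in> L2 M \<Longrightarrow> E UNIV u = u"
    and "B \<in> sets borel \<Longrightarrow> C \<in> sets borel \<Longrightarrow> u \<in> L2 M \<Longrightarrow> E B (E C u) = E (B \<inter> C) u"
    and "B \<in> sets borel \<Longrightarrow> u \<in> L2 M \<Longrightarrow> v \<in> L2 M \<Longrightarrow> L2_inner M (E B u) v = L2_inner M u (E B v)"
    and "range A \<subseteq> sets borel \<Longrightarrow> disjoint_family A \<Longrightarrow> u \<in> L2 M \<Longrightarrow> v \<in> L2 M \<Longrightarrow>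
      (\<lambda>i::nat. L2_inner M (E (A i) u) v) sums L2_inner M (E (\<Union>i. A i) u) v"
  using assms by (auto simp: spectral_measure_def L2_projection_def L2_linear_def)

lemma L2_inner_self: "L2_inner M u u = complex_of_real (sq M (L2_rep u))"
  by (simp add: L2_inner_ip ip_self)

text \<open>Since \<open>E B\<close> is a self-adjoint idempotent; this is what makes the scalar measures positive.\<close>

lemma spectral_inner_self:
  assumes E: "spectral_measure M E" and u: "u \<in> L2 M" and B: "B \<in> sets borel"
  shows "L2_inner M (E B u) u = complex_of_real (sq M (L2_rep (E B u)))"
proof -
  have "L2_inner M (E B u) u = L2_inner M (E B (E B u)) u"
    using spectral_measureD(4)[OF E B B u] by simp
  also have "\<dots> = L2_inner M (E B u) (E B u)"
    using spectral_measureD(1,5)[OF E B] u by simp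
  finally show ?thesis by (simp add: L2_inner_self)
qed

lemma sets_scalar_measure [simp]: "sets (scalar_measure M E u) = sets borel"
  unfolding scalar_measure_def using sets.sigma_sets_eq[of borel] by (simp add: sets_measure_of_conv)

lemma space_scalar_measure [simp]: "space (scalar_measure M E u) = UNIV"
  unfolding scalar_measure_def by (simp add: space_measure_of_conv)

lemma borel_measurable_scalar_measure [simp]:
  "(borel_measurable (scalar_measure M E u) :: (real \<Rightarrow> 'b::topological_space) set) = borel_measurable borel"
  by (rule measurable_cong_sets) auto

lemma emeasure_scalar_measure:
  assumes E: "spectral_measure M E" and u: "u \<in> L2 M" and B: "B \<in> sets borel"
  shows "emeasure (scalar_measure M E u) B = ennreal (sq M (L2_rep (E B u)))"
proof -
  let ?f = "\<lambda>B. ennreal (Re (L2_inner M (E B u) u))"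
  have f: "?f B = ennreal (sq M (L2_rep (E B u)))" if "B \<in> sets borel" for B
    using spectral_inner_self[OF E u that] by simp
  have "L2_inner M (L2_class M (\<lambda>x. 0)) u = 0"
    using u by (simp add: L2_inner_ip ip_rep_class L2_fun_zero L2_rep_in ip_zero_left)
  then have pos: "positive (sets borel) ?f"
    by (simp add: positive_def spectral_measureD(2)[OF E u])
  have "countably_additive (sets borel) ?f"
    unfolding countably_additive_def
  proof (intro allI impI)
    fix A :: "nat \<Rightarrow> real set"
    assume A: "range A \<subseteq> sets borel" "disjoint_family A"
    have "(\<lambda>i. Re (L2_inner M (E (A i) u) u)) sums Re (L2_inner M (E (\<Union>i. A i) u) u)"
      using spectral_measureD(6)[OF E A u u] by (rule sums_Re)
    moreover have "0 \<le> Re (L2_inner M (E (A i) u) u)" for i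
      using A spectral_inner_self[OF E u, of "A i"] by (auto simp: sq_nonneg)
    ultimately show "(\<Sum>i. ?f (A i)) = ?f (\<Union>i. A i)"
      by (intro suminf_ennreal_eq) auto
  qed
  then have "emeasure (measure_of UNIV (sets borel) ?f) B = ?f B"
    using pos B sets.sigma_algebra_axioms[of "borel :: real measure"] by (intro emeasure_measure_of_sigma) auto
  then show ?thesis by (simp add: scalar_measure_def f[OF B])
qed

lemma spectral_orth:
  assumes E: "spectral_measure M E" and u: "u \<in> L2 M" and BC: "B \<in> sets borel" "C \<in> sets borel" "B \<inter> C = {}"
  shows "ip M (L2_rep (E B u)) (L2_rep (E C u)) = 0"
proof -
  have "L2_inner M (E B u) (E C u) = L2_inner M (E C (E B u)) u"
    using spectral_measureD(1,5)[OF E] BC u by simp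
  also have "E C (E B u) = L2_class M (\<lambda>x. 0)"
    using spectral_measureD(2,4)[OF E] BC u by (simp add: Int_commute)
  also have "L2_inner M (L2_class M (\<lambda>x. 0)) u = 0"
    using u by (simp add: L2_inner_ip ip_rep_class L2_fun_zero L2_rep_in ip_zero_left)
  finally show ?thesis by (simp add: L2_inner_ip)
qed

lemma simple_function_borelD:
  fixes s :: "real \<Rightarrow> complex"
  assumes "simple_function borel s"
  shows "finite (range s)" "s -` {c} \<in> sets borel"
  using simple_functionD(2)[OF assms, of "{c}"] simple_functionD(1)[OF assms] by auto

text \<open>This is the isometry between simple functions and vectors, applied to the simple function \<open>s - m\<close>:
  the vectors \<open>E (s -` {c}) u\<close> are orthogonal and add up to \<open>u\<close>, so both sides are the sum of
  \<open>\<bar>c - m\<bar>\<^sup>2\<close> times their squared norms.\<close>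

lemma simple_spectral_distance:
  assumes E: "spectral_measure M E" and u: "u \<in> L2 M" and s: "simple_function borel s"
  shows "(\<integral>\<^sup>+t. ennreal ((cmod (s t - m))\<^sup>2) \<partial>scalar_measure M E u)
    = ennreal ((L2_dist M (simple_spectral_integral M E s u) (L2_scale M m u))\<^sup>2)"
proof -
  define x where "x c = L2_rep (E (s -` {c}) u)" for c
  note fin = simple_function_borelD(1)[OF s] and A = simple_function_borelD(2)[OF s]
  have xL2: "x c \<in> L2_fun M" for c
    unfolding x_def by (intro L2_rep_in spectral_measureD(1)[OF E A u])
  have orth: "ip M (x c) (x d) = 0" if "c \<noteq> d" for c d
    unfolding x_def using that by (intro spectral_orth[OF E u A A]) auto
  have split: "(\<integral>\<^sup>+t. h (s t) \<partial>scalar_measure M E u) = (\<Sum>c\<in>range s. h c * ennreal (sq M (x c)))" for h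
  proof -
    have "(\<integral>\<^sup>+t. h (s t) \<partial>scalar_measure M E u) = (\<integral>\<^sup>+t. (\<Sum>c\<in>range s. h c * indicator (s -` {c}) t) \<partial>scalar_measure M E u)"
    proof (intro nn_integral_cong)
      fix t
      have "(\<Sum>c\<in>range s. h c * indicator (s -` {c}) t) = (\<Sum>c\<in>range s. if c = s t then h (s t) else 0)"
        by (intro sum.cong) (auto simp: indicator_def)
      then show "h (s t) = (\<Sum>c\<in>range s. h c * indicator (s -` {c}) t)" using fin by simp
    qed
    also have "\<dots> = (\<Sum>c\<in>range s. h c * emeasure (scalar_measure M E u) (s -` {c}))"
      using A by (subst nn_integral_sum)
        (auto simp: nn_integral_cmult_indicator intro!: borel_measurable_times_ennreal borel_measurable_indicator)
    finally show ?thesis using A by (simp add: emeasure_scalar_measure[OF E u] x_def)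
  qed
  have "ennreal (sq M (L2_rep u)) = emeasure (scalar_measure M E u) UNIV"
    by (simp add: emeasure_scalar_measure[OF E u] spectral_measureD(3)[OF E u])
  also have "\<dots> = (\<integral>\<^sup>+t. 1 \<partial>scalar_measure M E u)" by simp
  also have "\<dots> = ennreal (\<Sum>c\<in>range s. sq M (x c))"
    using split[of "\<lambda>_. 1"] by (simp add: sq_nonneg sum_ennreal)
  finally have total: "sq M (L2_rep u) = (\<Sum>c\<in>range s. sq M (x c))"
    by (simp add: sq_nonneg sum_nonneg)
  have "sq M (\<lambda>y. L2_rep u y - (\<Sum>c\<in>range s. 1 * x c y)) = 0"
  proof -
    have "ip M (L2_rep u) (x c) = complex_of_real (sq M (x c))" for c
    proof -
      have "ip M (L2_rep u) (x c) = L2_inner M u (E (s -` {c}) u)" by (simp add: L2_inner_ip x_def)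
      also have "\<dots> = L2_inner M (E (s -` {c}) u) u" using spectral_measureD(5)[OF E A u u] by simp
      finally show ?thesis using spectral_inner_self[OF E u A] by (simp add: x_def)
    qed
    note ipx = this
    have "ip M (L2_rep u) (\<lambda>y. \<Sum>c\<in>range s. 1 * x c y) = cnj (ip M (\<lambda>y. \<Sum>c\<in>range s. 1 * x c y) (L2_rep u))"
      by (rule ip_commute)
    also have "ip M (\<lambda>y. \<Sum>c\<in>range s. 1 * x c y) (L2_rep u) = (\<Sum>c\<in>range s. ip M (x c) (L2_rep u))"
      using xL2 u by (simp add: ip_sum_left L2_rep_in)
    also have "cnj \<dots> = (\<Sum>c\<in>range s. ip M (L2_rep u) (x c))"
      by (simp flip: ip_commute)
    also have "\<dots> = complex_of_real (\<Sum>c\<in>range s. sq M (x c))"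
      by (simp add: ipx)
    finally have "ip M (L2_rep u) (\<lambda>y. \<Sum>c\<in>range s. 1 * x c y) = complex_of_real (\<Sum>c\<in>range s. sq M (x c))" .
    moreover have "sq M (\<lambda>y. \<Sum>c\<in>range s. 1 * x c y) = (\<Sum>c\<in>range s. sq M (x c))"
      using sq_sum_orthogonal[of "range s" x M "\<lambda>_. 1"] fin xL2 orth by simp
    ultimately show ?thesis
      using xL2 u total by (subst sq_diff) (auto simp: L2_rep_in L2_fun_sum)
  qed
  then have u_eq: "AE y in M. L2_rep u y = (\<Sum>c\<in>range s. x c y)"
    using sq_eq_0_iff[of "\<lambda>y. L2_rep u y - (\<Sum>c\<in>range s. 1 * x c y)" M] xL2 u
    by (simp add: L2_fun_diff L2_fun_sum L2_rep_in)
  have "(L2_dist M (simple_spectral_integral M E s u) (L2_scale M m u))\<^sup>2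
    = sq M (\<lambda>y. L2_rep (simple_spectral_integral M E s u) y - L2_rep (L2_scale M m u) y)"
    by (simp add: L2_dist_sq sq_nonneg)
  also have "\<dots> = sq M (\<lambda>y. \<Sum>c\<in>range s. (c - m) * x c y)"
  proof (rule sq_cong_AE)
    have 1: "(\<lambda>y. \<Sum>c\<in>range s. c * L2_rep (E (s -` {c}) u) y) \<in> L2_fun M"
      using xL2 unfolding x_def by (intro L2_fun_intros)
    have 2: "(\<lambda>y. m * L2_rep u y) \<in> L2_fun M" using u by (intro L2_fun_intros L2_rep_in)
    show "(\<lambda>y. L2_rep (simple_spectral_integral M E s u) y - L2_rep (L2_scale M m u) y) \<in> L2_fun M"
      unfolding simple_spectral_integral_def L2_scale_def by (intro L2_fun_diff L2_rep_class 1 2)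
    show "(\<lambda>y. \<Sum>c\<in>range s. (c - m) * x c y) \<in> L2_fun M"
      using xL2 by (intro L2_fun_intros)
    show "AE y in M. L2_rep (simple_spectral_integral M E s u) y - L2_rep (L2_scale M m u) y = (\<Sum>c\<in>range s. (c - m) * x c y)"
      using L2_rep_class(2)[OF 1] L2_rep_class(2)[OF 2] u_eq
      unfolding simple_spectral_integral_def L2_scale_def
      by eventually_elim (simp add: x_def left_diff_distrib sum_subtractf sum_distrib_left)
  qed
  also have "\<dots> = (\<Sum>c\<in>range s. (cmod (c - m))\<^sup>2 * sq M (x c))"
    using sq_sum_orthogonal[of "range s" x M "\<lambda>c. c - m"] fin xL2 orth by simp
  finally have "ennreal ((L2_dist M (simple_spectral_integral M E s u) (L2_scale M m u))\<^sup>2) = (\<Sum>c\<in>range s. ennreal ((cmod (c - m))\<^sup>2) * ennreal (sq M (x c)))"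
    by (simp add: sum_ennreal sq_nonneg flip: ennreal_mult)
  then show ?thesis using split[of "\<lambda>c. ennreal ((cmod (c - m))\<^sup>2)"] by simp
qed

text \<open>In the limit of the simple functions, the isometry shows that the integral of \<open>(t - m)\<^sup>2\<close> with respect
  to the scalar measure of an eigenvector is zero.  So this measure lives on the point \<open>m\<close>.\<close>

lemma spectral_eigenvector:
  assumes E: "spectral_measure M E" and u: "u \<in> L2 M"
    and eigen: "(u, L2_scale M (complex_of_real m) u) \<in> spectral_integral M E complex_of_real"
    and B: "B \<in> sets borel"
  shows "m \<in> B \<Longrightarrow> E B u = u" and "m \<notin> B \<Longrightarrow> E B u = L2_class M (\<lambda>x. 0)"
proof -
  let ?\<nu> = "scalar_measure M E u"
  from eigen obtain s where s: "\<And>n::nat. simple_function borel (s n)"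
    and l1: "(\<lambda>n. \<integral>\<^sup>+t. ennreal ((cmod (s n t - complex_of_real t))\<^sup>2) \<partial>?\<nu>) \<longlonglongrightarrow> 0"
    and l2: "(\<lambda>n. L2_dist M (simple_spectral_integral M E (s n) u) (L2_scale M (complex_of_real m) u)) \<longlonglongrightarrow> 0"
    unfolding spectral_integral_def by blast
  have sm: "s n \<in> borel_measurable borel" for n using s by (rule borel_measurable_simple_function)
  have "(\<lambda>n. ennreal ((L2_dist M (simple_spectral_integral M E (s n) u) (L2_scale M (complex_of_real m) u))\<^sup>2)) \<longlonglongrightarrow> ennreal (0\<^sup>2)"
    by (intro tendsto_ennrealI tendsto_power l2)
  then have l3: "(\<lambda>n. \<integral>\<^sup>+t. ennreal ((cmod (s n t - complex_of_real m))\<^sup>2) \<partial>?\<nu>) \<longlonglongrightarrow> 0"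
    by (simp add: simple_spectral_distance[OF E u s])
  have bound: "(\<integral>\<^sup>+t. ennreal ((t - m)\<^sup>2) \<partial>?\<nu>) \<le>
      2 * (\<integral>\<^sup>+t. ennreal ((cmod (s n t - complex_of_real t))\<^sup>2) \<partial>?\<nu>) +
      2 * (\<integral>\<^sup>+t. ennreal ((cmod (s n t - complex_of_real m))\<^sup>2) \<partial>?\<nu>)" for n
  proof -
    have "(\<integral>\<^sup>+t. ennreal ((t - m)\<^sup>2) \<partial>?\<nu>) \<le> (\<integral>\<^sup>+t. 2 * ennreal ((cmod (s n t - complex_of_real t))\<^sup>2)
        + 2 * ennreal ((cmod (s n t - complex_of_real m))\<^sup>2) \<partial>?\<nu>)"
    proof (intro nn_integral_mono)
      fix t
      let ?a = "cmod (s n t - complex_of_real t)" and ?b = "cmod (s n t - complex_of_real m)"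
      have "\<bar>t - m\<bar> = cmod (complex_of_real t - complex_of_real m)"
        by (simp flip: of_real_diff)
      also have "\<dots> \<le> ?a + ?b"
        using norm_triangle_ineq4[of "s n t - complex_of_real m" "s n t - complex_of_real t"] by simp
      finally have "\<bar>t - m\<bar>\<^sup>2 \<le> (?a + ?b)\<^sup>2" by (intro power_mono) auto
      also have "\<dots> \<le> 2 * ?a\<^sup>2 + 2 * ?b\<^sup>2"
        using sum_squares_bound[of ?a ?b] by (simp add: power2_sum)
      finally have "ennreal ((t - m)\<^sup>2) \<le> ennreal (2 * ?a\<^sup>2 + 2 * ?b\<^sup>2)" by (intro ennreal_leI) simp
      then show "ennreal ((t - m)\<^sup>2) \<le> 2 * ennreal (?a\<^sup>2) + 2 * ennreal (?b\<^sup>2)"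
        by (simp add: ennreal_plus ennreal_mult')
    qed
    also have "\<dots> = 2 * (\<integral>\<^sup>+t. ennreal ((cmod (s n t - complex_of_real t))\<^sup>2) \<partial>?\<nu>) +
      2 * (\<integral>\<^sup>+t. ennreal ((cmod (s n t - complex_of_real m))\<^sup>2) \<partial>?\<nu>)"
      using sm by (subst nn_integral_add) (auto simp: nn_integral_cmult)
    finally show ?thesis .
  qed
  have "(\<lambda>n. 2 * (\<integral>\<^sup>+t. ennreal ((cmod (s n t - complex_of_real t))\<^sup>2) \<partial>?\<nu>) +
      2 * (\<integral>\<^sup>+t. ennreal ((cmod (s n t - complex_of_real m))\<^sup>2) \<partial>?\<nu>)) \<longlonglongrightarrow> 2 * 0 + 2 * 0"
    by (intro tendsto_add ennreal_tendsto_cmult l1 l3) auto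
  then have "(\<integral>\<^sup>+t. ennreal ((t - m)\<^sup>2) \<partial>?\<nu>) \<le> 2 * 0 + 2 * 0"
    using bound by (intro LIMSEQ_le_const) auto
  then have "(\<integral>\<^sup>+t. ennreal ((t - m)\<^sup>2) \<partial>?\<nu>) = 0" by simp
  then have AE: "AE t in ?\<nu>. t = m"
    by (subst (asm) nn_integral_0_iff_AE) auto
  have null: "sq M (L2_rep (E C u)) = 0" if "C \<in> sets borel" "m \<notin> C" for C
  proof -
    have "emeasure ?\<nu> C = emeasure ?\<nu> {}"
      by (rule emeasure_eq_AE) (use AE that in \<open>auto elim: eventually_mono\<close>)
    then show ?thesis using that by (simp add: emeasure_scalar_measure[OF E u] sq_nonneg)
  qed
  have zero: "E C u = L2_class M (\<lambda>x. 0)" if "C \<in> sets borel" "m \<notin> C" for C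
  proof -
    have EC: "E C u \<in> L2 M" using spectral_measureD(1)[OF E] that u by simp
    then have "AE x in M. L2_rep (E C u) x = 0" using null[OF that] sq_eq_0_iff L2_rep_in by blast
    then have "L2_class M (L2_rep (E C u)) = L2_class M (\<lambda>x. 0)"
      using EC by (subst L2_class_eq_iff) (auto simp: L2_rep_in L2_fun_zero)
    then show ?thesis by (simp add: L2_class_rep[OF EC])
  qed
  show "m \<notin> B \<Longrightarrow> E B u = L2_class M (\<lambda>x. 0)" by (rule zero[OF B])
  assume m: "m \<in> B"
  have EB: "E B u \<in> L2 M" using spectral_measureD(1)[OF E] B u by simp
  have "sq M (\<lambda>x. L2_rep u x - L2_rep (E B u) x) = sq M (L2_rep u) - sq M (L2_rep (E B u))"
  proof -
    have "ip M (L2_rep u) (L2_rep (E B u)) = L2_inner M (E B u) u"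
      using spectral_measureD(5)[OF E B u u] by (simp add: L2_inner_ip)
    also have "\<dots> = complex_of_real (sq M (L2_rep (E B u)))" by (rule spectral_inner_self[OF E u B])
    finally show ?thesis using u EB by (simp add: sq_diff L2_rep_in)
  qed
  also have "sq M (L2_rep u) = sq M (L2_rep (E B u))"
  proof -
    have "ennreal (sq M (L2_rep u)) = emeasure ?\<nu> UNIV"
      by (simp add: emeasure_scalar_measure[OF E u] spectral_measureD(3)[OF E u])
    also have "\<dots> = emeasure ?\<nu> B"
      by (rule emeasure_eq_AE) (use AE m B in \<open>auto elim: eventually_mono\<close>)
    finally show ?thesis by (simp add: emeasure_scalar_measure[OF E u] B sq_nonneg)
  qed
  finally have "AE x in M. L2_rep u x - L2_rep (E B u) x = 0"
    using sq_eq_0_iff[OF L2_fun_diff[OF L2_rep_in[OF u] L2_rep_in[OF EB]]] by simp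
  then have "L2_class M (L2_rep (E B u)) = L2_class M (L2_rep u)"
    using u EB by (subst L2_class_eq_iff) (auto simp: L2_rep_in elim: eventually_mono)
  then show "E B u = u" using u EB by (simp add: L2_class_rep)
qed

section \<open>Diagonal operators\<close>

context orthonormal_basis
begin

text \<open>Such an \<open>E B\<close> is the projection onto the closed span of the basis vectors with \<open>\<mu> n\<close> in \<open>B\<close>, described
  by its effect on coefficients.\<close>

definition diagonal :: "(nat \<Rightarrow> real) \<Rightarrow> (real set \<Rightarrow> 'a L2_elem \<Rightarrow> 'a L2_elem) \<Rightarrow> bool" where
  "diagonal \<mu> E \<longleftrightarrow> (\<forall>B\<in>sets borel. \<forall>u\<in>L2 M. E B u \<in> L2 M \<and>
     (\<forall>n. coef (E B u) n = (if \<mu> n \<in> B then coef u n else 0)))"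

definition diagonal_graph :: "(nat \<Rightarrow> complex) \<Rightarrow> 'a L2_graph" where
  "diagonal_graph h = {(u, w). u \<in> L2 M \<and> w \<in> L2 M \<and> (\<forall>n. coef w n = h n * coef u n)}"

lemma diagonalD:
  assumes "diagonal \<mu> E" "B \<in> sets borel" "u \<in> L2 M"
  shows "E B u \<in> L2 M" "coef (E B u) n = (if \<mu> n \<in> B then coef u n else 0)"
  using assms by (auto simp: diagonal_def)

lemma diagonal_scalar_measure:
  assumes E: "diagonal \<mu> E" and u: "u \<in> L2 M"
  shows "scalar_measure M E u = distr (density (count_space UNIV) (\<lambda>n. ennreal ((cmod (coef u n))\<^sup>2))) borel \<mu>"
    (is "_ = ?N")
proof -
  have eq: "ennreal (Re (L2_inner M (E B u) u)) = emeasure ?N B" if B: "B \<in> sets borel" for B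
  proof -
    define t where "t n = (if \<mu> n \<in> B then (cmod (coef u n))\<^sup>2 else 0)" for n
    have "(\<lambda>n. Re (coef (E B u) n * cnj (coef u n))) sums Re (L2_inner M (E B u) u)"
      by (intro sums_Re coef_inner diagonalD(1)[OF E B u] u)
    moreover have "Re (coef (E B u) n * cnj (coef u n)) = t n" for n
      by (simp only: diagonalD(2)[OF E B u] t_def) (auto simp: cmod_power2, auto simp: power2_eq_square)
    ultimately have "t sums Re (L2_inner M (E B u) u)" by simp
    then have "(\<Sum>n. ennreal (t n)) = ennreal (Re (L2_inner M (E B u) u))"
      by (rule suminf_ennreal_eq[rotated]) (simp add: t_def)
    moreover have "emeasure ?N B = (\<Sum>n. ennreal (t n))"
      using B by (subst emeasure_distr)
        (auto simp: emeasure_density nn_integral_count_space_nat t_def indicator_def intro!: suminf_cong)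
    ultimately show ?thesis by simp
  qed
  have "scalar_measure M E u = measure_of (space ?N) (sets ?N) (emeasure ?N)"
    unfolding scalar_measure_def using sets.sigma_sets_eq[of "borel :: real measure"]
    by (simp, intro measure_of_eq) (auto simp: eq)
  then show ?thesis by (simp only: measure_of_of_measure)
qed

lemma nn_integral_diagonal:
  assumes E: "diagonal \<mu> E" and u: "u \<in> L2 M" and h: "h \<in> borel_measurable borel"
  shows "(\<integral>\<^sup>+t. ennreal (h t) \<partial>scalar_measure M E u) = (\<Sum>n. ennreal ((cmod (coef u n))\<^sup>2 * h (\<mu> n)))"
  unfolding diagonal_scalar_measure[OF E u] using h
  by (subst nn_integral_distr)
    (auto simp: nn_integral_density nn_integral_count_space_nat ennreal_mult')

lemma diagonal_simple:
  assumes E: "diagonal \<mu> E" and u: "u \<in> L2 M" and s: "simple_function borel s"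
  shows "simple_spectral_integral M E s u \<in> L2 M"
    and "coef (simple_spectral_integral M E s u) n = s (\<mu> n) * coef u n"
proof -
  note fin = simple_function_borelD(1)[OF s] and A = simple_function_borelD(2)[OF s]
  have L: "L2_rep (E (s -` {c}) u) \<in> L2_fun M" for c
    by (intro L2_rep_in diagonalD(1)[OF E A u])
  then have S: "(\<lambda>x. \<Sum>c\<in>range s. c * L2_rep (E (s -` {c}) u) x) \<in> L2_fun M"
    by (intro L2_fun_intros)
  then show "simple_spectral_integral M E s u \<in> L2 M"
    unfolding simple_spectral_integral_def by (rule L2_class_in)
  have "coef (simple_spectral_integral M E s u) n = (\<Sum>c\<in>range s. c * coef (E (s -` {c}) u) n)"
    unfolding simple_spectral_integral_def coef_class[OF S]
    using L by (simp add: ip_sum_left L2_fun_cmult e_L2 ip_cmult_left coef_def)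
  also have "\<dots> = (\<Sum>c\<in>range s. if c = s (\<mu> n) then s (\<mu> n) * coef u n else 0)"
    by (intro sum.cong refl) (auto simp: diagonalD(2)[OF E A u])
  also have "\<dots> = s (\<mu> n) * coef u n" using fin by simp
  finally show "coef (simple_spectral_integral M E s u) n = s (\<mu> n) * coef u n" .
qed

text \<open>The scalar measure of \<open>u\<close> puts the mass \<open>\<bar>coef u n\<bar>\<^sup>2\<close> on \<open>\<mu> n\<close>.  So square integrability of \<open>f\<close> says
  exactly that the coefficients \<open>f (\<mu> n) * coef u n\<close> belong to a vector, and convergence of simple
  functions to \<open>f\<close> is convergence of the associated vectors.\<close>

theorem spectral_integral_diagonal:
  assumes E: "diagonal \<mu> E" and f: "f \<in> borel_measurable borel"
  shows "spectral_integral M E f = diagonal_graph (\<lambda>n. f (\<mu> n))"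
proof (intro set_eqI iffI; clarify)
  fix u w assume "(u, w) \<in> spectral_integral M E f"
  then obtain s where u: "u \<in> L2 M" and w: "w \<in> L2 M" and s: "\<And>n::nat. simple_function borel (s n)"
    and l1: "(\<lambda>n. \<integral>\<^sup>+t. ennreal ((cmod (s n t - f t))\<^sup>2) \<partial>scalar_measure M E u) \<longlonglongrightarrow> 0"
    and l2: "(\<lambda>n. L2_dist M (simple_spectral_integral M E (s n) u) w) \<longlonglongrightarrow> 0"
    unfolding spectral_integral_def by blast
  have [measurable]: "s n \<in> borel_measurable borel" for n using s by (rule borel_measurable_simple_function)
  note [measurable] = f
  have "coef w k = f (\<mu> k) * coef u k" for k
  proof -
    have "ennreal ((cmod (s n (\<mu> k) * coef u k - f (\<mu> k) * coef u k))\<^sup>2)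
        \<le> (\<integral>\<^sup>+t. ennreal ((cmod (s n t - f t))\<^sup>2) \<partial>scalar_measure M E u)" for n
    proof -
      define a where "a = (\<lambda>j. ennreal ((cmod (coef u j))\<^sup>2 * (cmod (s n (\<mu> j) - f (\<mu> j)))\<^sup>2))"
      have "(\<Sum>j\<in>{k}. a j) \<le> suminf a" by (rule sum_le_suminf) (auto simp: summableI)
      moreover have "suminf a = (\<integral>\<^sup>+t. ennreal ((cmod (s n t - f t))\<^sup>2) \<partial>scalar_measure M E u)"
        unfolding a_def by (rule nn_integral_diagonal[OF E u, symmetric]) measurable
      ultimately have "a k \<le> (\<integral>\<^sup>+t. ennreal ((cmod (s n t - f t))\<^sup>2) \<partial>scalar_measure M E u)" by simp
      moreover have "a k = ennreal ((cmod (s n (\<mu> k) * coef u k - f (\<mu> k) * coef u k))\<^sup>2)"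
        by (simp add: a_def norm_mult power_mult_distrib mult.commute flip: left_diff_distrib)
      ultimately show ?thesis by simp
    qed
    then have "(\<lambda>n. ennreal ((cmod (s n (\<mu> k) * coef u k - f (\<mu> k) * coef u k))\<^sup>2)) \<longlonglongrightarrow> 0"
      by (intro tendsto_sandwich[OF always_eventually always_eventually tendsto_const l1]) auto
    then have "(\<lambda>n. (cmod (s n (\<mu> k) * coef u k - f (\<mu> k) * coef u k))\<^sup>2) \<longlonglongrightarrow> 0"
      by (simp add: ennreal_tendsto_0_iff)
    then have 1: "(\<lambda>n. s n (\<mu> k) * coef u k - f (\<mu> k) * coef u k) \<longlonglongrightarrow> 0"
      by (simp add: tendsto_norm_zero_iff)
    have "(\<lambda>n. coef (simple_spectral_integral M E (s n) u) k - coef w k) \<longlonglongrightarrow> 0"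
      by (rule Lim_null_comparison[OF always_eventually l2])
        (intro allI coef_dist_le diagonal_simple(1)[OF E u s] w)
    then have 2: "(\<lambda>n. s n (\<mu> k) * coef u k - coef w k) \<longlonglongrightarrow> 0"
      by (simp add: diagonal_simple(2)[OF E u s])
    from 1 2 show ?thesis
      using LIMSEQ_unique[of "\<lambda>n. s n (\<mu> k) * coef u k"] by (simp add: LIM_zero_iff)
  qed
  then show "(u, w) \<in> diagonal_graph (\<lambda>n. f (\<mu> n))"
    using u w by (simp add: diagonal_graph_def)
next
  fix u w assume "(u, w) \<in> diagonal_graph (\<lambda>n. f (\<mu> n))"
  then have u: "u \<in> L2 M" and w: "w \<in> L2 M" and cw: "\<And>n. coef w n = f (\<mu> n) * coef u n"
    by (auto simp: diagonal_graph_def)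
  let ?\<nu> = "scalar_measure M E u"
  note [measurable] = f
  have fin: "(\<integral>\<^sup>+t. ennreal ((cmod (f t))\<^sup>2) \<partial>?\<nu>) < \<infinity>"
  proof -
    have "(\<integral>\<^sup>+t. ennreal ((cmod (f t))\<^sup>2) \<partial>?\<nu>) = (\<Sum>n. ennreal ((cmod (coef u n))\<^sup>2 * (cmod (f (\<mu> n)))\<^sup>2))"
      by (rule nn_integral_diagonal[OF E u]) measurable
    also have "\<dots> = (\<Sum>n. ennreal ((cmod (coef w n))\<^sup>2))"
      by (simp add: cw norm_mult power_mult_distrib mult.commute)
    also have "(\<Sum>n. ennreal ((cmod (coef w n))\<^sup>2)) = ennreal ((L2_norm M w)\<^sup>2)"
      by (intro suminf_ennreal_eq coef_norm w) simp
    finally show ?thesis by simp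
  qed
  then have fL2: "f \<in> L2_fun ?\<nu>"
    by (auto simp: L2_fun_def intro!: integrableI_bounded)
  obtain s where s: "\<And>n. simple_function borel (s n)"
    and lim: "\<And>t. (\<lambda>n. s n t) \<longlonglongrightarrow> f t" and bnd: "\<And>n t. cmod (s n t) \<le> 2 * cmod (f t)"
    using borel_measurable_implies_sequence_metric[OF f, of 0] by (auto simp: dist_norm)
  have [measurable]: "s n \<in> borel_measurable borel" for n using s by (rule borel_measurable_simple_function)
  have l1: "(\<lambda>n. \<integral>\<^sup>+t. ennreal ((cmod (s n t - f t))\<^sup>2) \<partial>?\<nu>) \<longlonglongrightarrow> (\<integral>\<^sup>+t. 0 \<partial>?\<nu>)"
  proof (rule nn_integral_dominated_convergence)
    show "(\<integral>\<^sup>+t. 9 * ennreal ((cmod (f t))\<^sup>2) \<partial>?\<nu>) < \<infinity>"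
      using fin by (subst nn_integral_cmult) (auto simp: ennreal_mult_less_top)
    fix n
    have "(cmod (s n t - f t))\<^sup>2 \<le> 9 * (cmod (f t))\<^sup>2" for t
    proof -
      have "cmod (s n t - f t) \<le> 3 * cmod (f t)" using norm_triangle_ineq4[of "s n t" "f t"] bnd[of n t] by simp
      then have "(cmod (s n t - f t))\<^sup>2 \<le> (3 * cmod (f t))\<^sup>2" by (intro power_mono) auto
      then show ?thesis by (simp add: power_mult_distrib)
    qed
    then show "AE t in ?\<nu>. ennreal ((cmod (s n t - f t))\<^sup>2) \<le> 9 * ennreal ((cmod (f t))\<^sup>2)"
      by (intro AE_I2) (metis ennreal_leI ennreal_mult' ennreal_numeral zero_le_numeral)
  next
    show "AE t in ?\<nu>. (\<lambda>n. ennreal ((cmod (s n t - f t))\<^sup>2)) \<longlonglongrightarrow> 0"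
    proof (intro AE_I2)
      fix t
      have "(\<lambda>n. (cmod (s n t - f t))\<^sup>2) \<longlonglongrightarrow> (cmod (f t - f t))\<^sup>2"
        by (intro tendsto_intros lim)
      then show "(\<lambda>n. ennreal ((cmod (s n t - f t))\<^sup>2)) \<longlonglongrightarrow> 0"
        by (simp add: ennreal_tendsto_0_iff)
    qed
  qed (auto)
  have "(\<integral>\<^sup>+t. ennreal ((cmod (s n t - f t))\<^sup>2) \<partial>?\<nu>) = ennreal ((L2_dist M (simple_spectral_integral M E (s n) u) w)\<^sup>2)" for n
  proof -
    have "(\<lambda>k. (cmod (coef (simple_spectral_integral M E (s n) u) k - coef w k))\<^sup>2) sums (L2_dist M (simple_spectral_integral M E (s n) u) w)\<^sup>2"
      by (intro coef_dist diagonal_simple[OF E u s] w)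
    moreover have "(cmod (coef (simple_spectral_integral M E (s n) u) k - coef w k))\<^sup>2 = (cmod (coef u k))\<^sup>2 * (cmod (s n (\<mu> k) - f (\<mu> k)))\<^sup>2" for k
      by (simp add: diagonal_simple(2)[OF E u s] cw norm_mult power_mult_distrib mult.commute flip: left_diff_distrib)
    ultimately have "(\<lambda>k. (cmod (coef u k))\<^sup>2 * (cmod (s n (\<mu> k) - f (\<mu> k)))\<^sup>2) sums (L2_dist M (simple_spectral_integral M E (s n) u) w)\<^sup>2"
      by simp
    then have "(\<Sum>k. ennreal ((cmod (coef u k))\<^sup>2 * (cmod (s n (\<mu> k) - f (\<mu> k)))\<^sup>2)) = ennreal ((L2_dist M (simple_spectral_integral M E (s n) u) w)\<^sup>2)"
      by (intro suminf_ennreal_eq) auto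
    moreover have "(\<integral>\<^sup>+t. ennreal ((cmod (s n t - f t))\<^sup>2) \<partial>?\<nu>) = (\<Sum>k. ennreal ((cmod (coef u k))\<^sup>2 * (cmod (s n (\<mu> k) - f (\<mu> k)))\<^sup>2))"
      by (rule nn_integral_diagonal[OF E u]) measurable
    ultimately show ?thesis by (simp only:)
  qed
  then have "(\<lambda>n. (L2_dist M (simple_spectral_integral M E (s n) u) w)\<^sup>2) \<longlonglongrightarrow> 0"
    using l1 by (simp add: ennreal_tendsto_0_iff)
  then have l2: "(\<lambda>n. L2_dist M (simple_spectral_integral M E (s n) u) w) \<longlonglongrightarrow> 0"
    by simp
  show "(u, w) \<in> spectral_integral M E f"
    unfolding spectral_integral_def using u w fL2 s l1 l2 by auto
qed

lemma diagonal_exists: "\<exists>E. diagonal \<mu> E"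
proof -
  define E where "E B u = (SOME w. w \<in> L2 M \<and> (\<forall>n. coef w n = (if \<mu> n \<in> B then 1 else 0) * coef u n))" for B u
  have "E B u \<in> L2 M \<and> (\<forall>n. coef (E B u) n = (if \<mu> n \<in> B then 1 else 0) * coef u n)" if "u \<in> L2 M" for B u
  proof -
    have "\<exists>w\<in>L2 M. \<forall>n. coef w n = (if \<mu> n \<in> B then 1 else 0) * coef u n"
      by (rule bounded_multiplier_exists[OF that]) simp
    then show ?thesis unfolding E_def Bex_def by (rule someI_ex)
  qed
  then show ?thesis by (intro exI[of _ E]) (auto simp: diagonal_def)
qed

lemma diagonal_spectral_measure:
  assumes E: "diagonal \<mu> E"
  shows "spectral_measure M E"
  unfolding spectral_measure_def
proof (intro conjI ballI allI impI)
  fix B :: "real set" assume B: "B \<in> sets borel"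
  note EB = diagonalD[OF E B]
  show "L2_projection M (E B)"
    unfolding L2_projection_def L2_linear_def
  proof (intro conjI ballI allI)
    fix u v assume u: "u \<in> L2 M" and v: "v \<in> L2 M"
    have "(\<lambda>n. coef (E B u) n * cnj (coef v n)) = (\<lambda>n. coef u n * cnj (coef (E B v) n))"
      using u v by (auto simp: EB(2))
    then show "L2_inner M (E B u) v = L2_inner M u (E B v)"
      using coef_inner[OF EB(1)[OF u] v] coef_inner[OF u EB(1)[OF v]] by (metis sums_unique2)
    show "E B (L2_add M u v) = L2_add M (E B u) (E B v)"
      using u v by (intro coef_inject) (auto simp: EB L2_add_in coef_add)
  next
    fix u assume u: "u \<in> L2 M"
    show "E B u \<in> L2 M" by (rule EB(1)[OF u])
    show "E B (E B u) = E B u"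
      using u by (intro coef_inject) (auto simp: EB)
    fix c show "E B (L2_scale M c u) = L2_scale M c (E B u)"
      using u by (intro coef_inject) (auto simp: EB L2_scale_in coef_scale)
  qed
next
  fix u assume u: "u \<in> L2 M"
  show "E {} u = L2_class M (\<lambda>x. 0)"
    using u by (intro coef_inject) (auto simp: diagonalD[OF E] L2_class_in L2_fun_zero coef_class ip_zero_left)
  show "E UNIV u = u"
    using u by (intro coef_inject) (auto simp: diagonalD[OF E])
next
  fix B C :: "real set" and u assume "B \<in> sets borel" "C \<in> sets borel" "u \<in> L2 M"
  then show "E (B \<inter> C) u = E B (E C u)"
    by (intro coef_inject) (auto simp: diagonalD[OF E])
next
  fix B :: "nat \<Rightarrow> real set" and u v
  assume B: "range B \<subseteq> sets borel" and disj: "disjoint_family B" and u: "u \<in> L2 M" and v: "v \<in> L2 M"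
  define t where "t n = coef u n * cnj (coef v n)" for n
  define cut where "cut S n = (if \<mu> n \<in> S then t n else 0)" for S n
  \<comment> \<open>absolute convergence of the coefficient series allows integration against the counting measure\<close>
  have t: "summable (\<lambda>n. norm (t n))"
  proof (rule summable_comparison_test')
    show "summable (\<lambda>n. (cmod (coef u n))\<^sup>2 + (cmod (coef v n))\<^sup>2)"
      by (intro summable_add sums_summable[OF coef_norm[OF u]] sums_summable[OF coef_norm[OF v]])
    fix n
    show "norm (norm (t n)) \<le> (cmod (coef u n))\<^sup>2 + (cmod (coef v n))\<^sup>2"
    proof -
      have "0 \<le> cmod (coef u n) * cmod (coef v n)" by simp
      moreover have "norm (norm (t n)) = cmod (coef u n) * cmod (coef v n)" by (simp add: t_def norm_mult)
      ultimately show ?thesis using sum_squares_bound[of "cmod (coef u n)" "cmod (coef v n)"] by linarith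
    qed
  qed
  have cut_int: "integrable (count_space UNIV) (cut S)" for S
    unfolding integrable_count_space_nat_iff
    by (rule summable_comparison_test'[OF t]) (auto simp: cut_def)
  have inner: "L2_inner M (E S u) v = integral\<^sup>L (count_space UNIV) (cut S)" if S: "S \<in> sets borel" for S
  proof -
    have "(\<lambda>n. coef (E S u) n * cnj (coef v n)) = cut S"
      using u by (auto simp: cut_def t_def diagonalD[OF E S])
    then have "cut S sums L2_inner M (E S u) v" using coef_inner[OF diagonalD(1)[OF E S u] v] by simp
    then show ?thesis using sums_integral_count_space_nat[OF cut_int[of S]] sums_unique2 by blast
  qed
  have "(\<Sum>i<N. L2_inner M (E (B i) u) v) = integral\<^sup>L (count_space UNIV) (cut (\<Union>i<N. B i))" for N
  proof -
    have "(\<Sum>i<N. L2_inner M (E (B i) u) v) = (\<Sum>i<N. integral\<^sup>L (count_space UNIV) (cut (B i)))"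
      using B by (intro sum.cong refl inner) auto
    also have "\<dots> = integral\<^sup>L (count_space UNIV) (\<lambda>n. \<Sum>i<N. cut (B i) n)"
      by (simp add: cut_int)
    also have "(\<lambda>n. \<Sum>i<N. cut (B i) n) = cut (\<Union>i<N. B i)"
    proof
      fix n
      show "(\<Sum>i<N. cut (B i) n) = cut (\<Union>i<N. B i) n"
      proof (cases "\<exists>i<N. \<mu> n \<in> B i")
        case True
        then obtain i where i: "i < N" "\<mu> n \<in> B i" by blast
        then have "(\<Sum>j<N. cut (B j) n) = (\<Sum>j<N. if j = i then t n else 0)"
          using disj by (intro sum.cong refl) (auto simp: cut_def disjoint_family_on_def)
        then show ?thesis using i by (auto simp: cut_def)
      qed (auto simp: cut_def)
    qed
    finally show ?thesis .
  qed
  moreover have "(\<lambda>N. integral\<^sup>L (count_space UNIV) (cut (\<Union>i<N. B i))) \<longlonglongrightarrow> integral\<^sup>L (count_space UNIV) (cut (\<Union>i. B i))"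
  proof (rule integral_dominated_convergence)
    show "integrable (count_space UNIV) (\<lambda>n. norm (t n))"
      using t by (simp add: integrable_count_space_nat_iff)
    show "AE n in count_space UNIV. (\<lambda>N. cut (\<Union>i<N. B i) n) \<longlonglongrightarrow> cut (\<Union>i. B i) n"
    proof (intro AE_I2 tendsto_eventually)
      fix n
      show "\<forall>\<^sub>F N in sequentially. cut (\<Union>i<N. B i) n = cut (\<Union>i. B i) n"
      proof (cases "\<exists>i. \<mu> n \<in> B i")
        case True
        then obtain i where "\<mu> n \<in> B i" by blast
        then show ?thesis
          by (intro eventually_mono[OF eventually_gt_at_top[of i]]) (auto simp: cut_def)
      qed (auto simp: cut_def)
    qed
    show "AE n in count_space UNIV. norm (cut (\<Union>i<N. B i) n) \<le> norm (t n)" for N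
      by (auto simp: cut_def)
  qed auto
  ultimately show "(\<lambda>i. L2_inner M (E (B i) u) v) sums L2_inner M (E (\<Union>i. B i) u) v"
    using B by (simp add: sums_def inner)
qed

text \<open>The basis vectors are eigenvectors of the given spectral integral, so \<open>E B\<close> acts on each of them as
  the identity or as zero; self-adjointness transfers this to the coefficients of \<open>E B u\<close>.\<close>

lemma diagonal_unique:
  assumes E: "spectral_measure M E"
    and G: "spectral_integral M E complex_of_real = diagonal_graph (\<lambda>n. complex_of_real (\<mu> n))"
  shows "diagonal \<mu> E"
  unfolding diagonal_def
proof (intro ballI conjI allI)
  fix B :: "real set" and u n assume B: "B \<in> sets borel" and u: "u \<in> L2 M"
  show EB: "E B u \<in> L2 M" by (rule spectral_measureD(1)[OF E B u])
  let ?v = "L2_class M (e n)"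
  have v: "?v \<in> L2 M" by (intro L2_class_in e_L2)
  have "coef (L2_scale M (complex_of_real (\<mu> n)) ?v) k = complex_of_real (\<mu> k) * coef ?v k" for k
    by (cases "k = n") (auto simp: coef_scale v coef_class e_L2 e_orth)
  then have eigen: "(?v, L2_scale M (complex_of_real (\<mu> n)) ?v) \<in> spectral_integral M E complex_of_real"
    unfolding G by (simp add: diagonal_graph_def v L2_scale_in)
  have coef_inner_class: "coef w n = L2_inner M w ?v" if "w \<in> L2 M" for w
  proof -
    have "L2_inner M w ?v = cnj (ip M (L2_rep ?v) (L2_rep w))" by (simp add: L2_inner_ip flip: ip_commute)
    also have "ip M (L2_rep ?v) (L2_rep w) = ip M (e n) (L2_rep w)" by (intro ip_rep_class e_L2 L2_rep_in that)
    finally show ?thesis by (simp add: coef_def flip: ip_commute)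
  qed
  have "coef (E B u) n = L2_inner M u (E B ?v)"
    using coef_inner_class[OF EB] spectral_measureD(5)[OF E B u v] by simp
  also have "\<dots> = (if \<mu> n \<in> B then coef u n else 0)"
  proof (cases "\<mu> n \<in> B")
    case True
    then show ?thesis using spectral_eigenvector(1)[OF E v eigen B] coef_inner_class[OF u] by simp
  next
    case False
    have "ip M (L2_rep (L2_class M (\<lambda>x. 0))) (L2_rep u) = 0"
      using u by (simp add: ip_rep_class L2_fun_zero L2_rep_in ip_zero_left)
    then have "ip M (L2_rep u) (L2_rep (L2_class M (\<lambda>x. 0))) = 0"
      using ip_commute by (metis complex_cnj_zero)
    then show ?thesis using False spectral_eigenvector(2)[OF E v eigen B] by (simp add: L2_inner_ip)
  qed
  finally show "coef (E B u) n = (if \<mu> n \<in> B then coef u n else 0)" .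
qed

text \<open>Existence and uniqueness of the diagonal spectral measure pin down the chosen one.\<close>

theorem functional_calculus_diagonal:
  assumes f: "f \<in> borel_measurable borel"
  shows "functional_calculus M (diagonal_graph (\<lambda>n. complex_of_real (\<mu> n))) f = diagonal_graph (\<lambda>n. f (\<mu> n))"
proof -
  let ?P = "\<lambda>E. spectral_measure M E \<and> spectral_integral M E complex_of_real = diagonal_graph (\<lambda>n. complex_of_real (\<mu> n))"
  obtain E0 where "diagonal \<mu> E0" using diagonal_exists by blast
  then have "?P E0" using diagonal_spectral_measure spectral_integral_diagonal by simp
  then have "?P (SOME E. ?P E)" by (rule someI[where P = ?P])
  then have "diagonal \<mu> (SOME E. ?P E)" using diagonal_unique by blast
  then show ?thesis unfolding functional_calculus_def by (rule spectral_integral_diagonal[OF _ f])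
qed

end

section \<open>Directional derivatives\<close>

lemma dir_deriv_eq:
  assumes "(f has_derivative f') (at x)"
  shows "dir_deriv \<xi> f x = f' \<xi>"
proof -
  have "((\<lambda>t::real. x + t *\<^sub>R \<xi>) has_derivative (\<lambda>t. t *\<^sub>R \<xi>)) (at 0)"
    by (auto intro!: derivative_eq_intros)
  moreover have "(f has_derivative f') (at (x + 0 *\<^sub>R \<xi>))" using assms by simp
  ultimately have "((\<lambda>t. f (x + t *\<^sub>R \<xi>)) has_derivative (\<lambda>t. f' (t *\<^sub>R \<xi>))) (at 0)"
    by (rule has_derivative_compose)
  then have "((\<lambda>t. f (x + t *\<^sub>R \<xi>)) has_vector_derivative f' \<xi>) (at 0)"
    unfolding has_vector_derivative_def
    by (simp add: linear_simps(5)[OF has_derivative_bounded_linear[OF assms]])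
  then show ?thesis unfolding dir_deriv_def by (rule vector_derivative_at)
qed

lemma dir_deriv_cong:
  assumes "open S" "x \<in> S" "\<And>y. y \<in> S \<Longrightarrow> f y = g y"
  shows "dir_deriv \<xi> f x = dir_deriv \<xi> g x"
  unfolding dir_deriv_def
proof (rule vector_derivative_cong_eq)
  have "((\<lambda>t::real. x + t *\<^sub>R \<xi>) \<longlongrightarrow> x + 0 *\<^sub>R \<xi>) (nhds 0)"
    by (intro tendsto_intros filterlim_ident)
  then have "\<forall>\<^sub>F t::real in nhds 0. x + t *\<^sub>R \<xi> \<in> S"
    using assms(1,2) by (auto simp: tendsto_def)
  then show "\<forall>\<^sub>F t::real in nhds 0. t \<in> UNIV \<longrightarrow> f (x + t *\<^sub>R \<xi>) = g (x + t *\<^sub>R \<xi>)"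
    by eventually_elim (simp add: assms(3))
qed auto

lemma dir_deriv_add:
  assumes "f differentiable (at x)" "g differentiable (at x)"
  shows "dir_deriv \<xi> (\<lambda>y. f y + g y) x = dir_deriv \<xi> f x + dir_deriv \<xi> g x"
proof -
  obtain f' g' where d: "(f has_derivative f') (at x)" "(g has_derivative g') (at x)"
    using assms by (auto simp: differentiable_def)
  show ?thesis
    using dir_deriv_eq[OF d(1)] dir_deriv_eq[OF d(2)] dir_deriv_eq[OF has_derivative_add[OF d]] by simp
qed

lemma dir_deriv_mult:
  assumes "f differentiable (at x)" "g differentiable (at x)"
  shows "dir_deriv \<xi> (\<lambda>y. f y * g y) x = dir_deriv \<xi> f x * g x + f x * dir_deriv \<xi> g x"
proof -
  obtain f' g' where d: "(f has_derivative f') (at x)" "(g has_derivative g') (at x)"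
    using assms by (auto simp: differentiable_def)
  show ?thesis
    using dir_deriv_eq[OF d(1)] dir_deriv_eq[OF d(2)] dir_deriv_eq[OF has_derivative_mult[OF d]] by simp
qed

lemma dir_deriv_const [simp]: "dir_deriv \<xi> (\<lambda>y. c) x = 0"
  by (rule dir_deriv_eq[OF has_derivative_const])

lemma dir_deriv_cmult:
  assumes "f differentiable (at x)"
  shows "dir_deriv \<xi> (\<lambda>y. c * f y) x = c * dir_deriv \<xi> f x"
  using dir_deriv_mult[of "\<lambda>y. c" x f] assms by simp

lemma dir_deriv_scaleR:
  assumes "f differentiable (at x)"
  shows "dir_deriv (c *\<^sub>R \<xi>) f x = complex_of_real c * dir_deriv \<xi> f x"
proof -
  obtain f' where d: "(f has_derivative f') (at x)"
    using assms by (auto simp: differentiable_def)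
  show ?thesis
    unfolding dir_deriv_eq[OF d] using linear_simps(5)[OF has_derivative_bounded_linear[OF d]]
    by (simp add: scaleR_conv_of_real)
qed

lemma has_derivative_inner_of_real:
  "((\<lambda>y. complex_of_real (v \<bullet> y)) has_derivative (\<lambda>h. complex_of_real (v \<bullet> h))) (at x)"
  by (intro has_derivative_of_real has_derivative_inner_right has_derivative_ident)

lemma dir_deriv_inner: "dir_deriv \<xi> (\<lambda>y. complex_of_real (v \<bullet> y)) x = complex_of_real (v \<bullet> \<xi>)"
  by (rule dir_deriv_eq[OF has_derivative_inner_of_real])

lemma has_derivative_radial:
  fixes x :: "real^'n"
  assumes "(g has_real_derivative g') (at (x \<bullet> x))"
  shows "((\<lambda>y. complex_of_real (g (y \<bullet> y))) has_derivative (\<lambda>h. complex_of_real (2 * g' * (x \<bullet> h)))) (at x)"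
proof -
  have "((\<lambda>y. y \<bullet> y) has_derivative (\<lambda>h. 2 * (x \<bullet> h))) (at x)"
    by (auto intro!: derivative_eq_intros simp: inner_commute)
  from has_derivative_compose[OF this assms[unfolded has_field_derivative_def]]
  have "((\<lambda>y. g (y \<bullet> y)) has_derivative (\<lambda>h. 2 * g' * (x \<bullet> h))) (at x)" by (simp add: mult_ac)
  then show ?thesis by (rule has_derivative_of_real)
qed

lemma dir_deriv_radial:
  fixes x :: "real^'n"
  assumes "(g has_real_derivative g') (at (x \<bullet> x))"
  shows "dir_deriv \<xi> (\<lambda>y. complex_of_real (g (y \<bullet> y))) x = complex_of_real (2 * g' * (x \<bullet> \<xi>))"
  by (rule dir_deriv_eq[OF has_derivative_radial[OF assms]])

section \<open>Reflections\<close>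

lemma reflection_inner:
  "v \<bullet> reflection \<alpha> x = v \<bullet> x - 2 * (\<alpha> \<bullet> x) / (norm \<alpha>)\<^sup>2 * (v \<bullet> \<alpha>)"
  by (simp add: reflection_def inner_diff_right)

lemma reflection_root_inner: "\<alpha> \<noteq> 0 \<Longrightarrow> \<alpha> \<bullet> reflection \<alpha> x = - (\<alpha> \<bullet> x)"
  by (simp add: reflection_inner power2_norm_eq_inner)

lemma reflection_involution: "\<alpha> \<noteq> 0 \<Longrightarrow> reflection \<alpha> (reflection \<alpha> x) = x"
  unfolding reflection_def[of \<alpha> "reflection \<alpha> x"] reflection_root_inner by (simp add: reflection_def)

lemma reflection_linear: "linear (reflection \<alpha>)"
  by (rule linearI) (simp_all add: reflection_def inner_add_right algebra_simps add_divide_distrib)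

lemma reflection_self_adjoint: "reflection \<alpha> x \<bullet> y = x \<bullet> reflection \<alpha> y"
  by (simp add: reflection_def inner_diff_left inner_diff_right inner_commute)

lemma reflection_inner_inner: "\<alpha> \<noteq> 0 \<Longrightarrow> reflection \<alpha> x \<bullet> reflection \<alpha> y = x \<bullet> y"
  by (simp add: reflection_self_adjoint reflection_involution)

lemma reflection_orthogonal: "\<alpha> \<noteq> 0 \<Longrightarrow> orthogonal_transformation (reflection \<alpha>)"
  by (simp add: orthogonal_transformation_def reflection_linear reflection_inner_inner)

lemma reflection_norm: "\<alpha> \<noteq> 0 \<Longrightarrow> norm (reflection \<alpha> x) = norm x"
  by (simp add: norm_eq_sqrt_inner reflection_inner_inner)

lemma reflection_fixed: "\<alpha> \<bullet> x = 0 \<Longrightarrow> reflection \<alpha> x = x"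
  by (simp add: reflection_def)

lemma reflection_eq_0_iff: "\<alpha> \<noteq> 0 \<Longrightarrow> reflection \<alpha> x = 0 \<longleftrightarrow> x = 0"
  using reflection_norm[of \<alpha> x] by (metis norm_eq_zero)

section \<open>Homogeneous polynomials\<close>

lemma finite_multiindices: "finite {\<nu> :: 'n::finite \<Rightarrow> nat. (\<Sum>i\<in>UNIV. \<nu> i) = m}"
proof (rule finite_subset)
  show "{\<nu> :: 'n \<Rightarrow> nat. (\<Sum>i\<in>UNIV. \<nu> i) = m} \<subseteq> PiE UNIV (\<lambda>_. {..m})"
    by (auto simp: PiE_def extensional_def intro!: member_le_sum)
qed (auto intro: finite_PiE)

lemma homogeneous_polynomial_zero: "homogeneous_polynomial m (\<lambda>x :: real^'n. 0)"
  unfolding homogeneous_polynomial_def by (intro exI[of _ "\<lambda>_. 0"]) simp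

lemma homogeneous_polynomial_add:
  assumes "homogeneous_polynomial m p" "homogeneous_polynomial m q"
  shows "homogeneous_polynomial m (\<lambda>x :: real^'n. p x + q x)"
proof -
  obtain c d where p: "p = (\<lambda>x. \<Sum>\<nu> | (\<Sum>i\<in>UNIV. \<nu> i) = m. c \<nu> * (\<Prod>i\<in>UNIV. complex_of_real (x $ i) ^ \<nu> i))"
    and q: "q = (\<lambda>x. \<Sum>\<nu> | (\<Sum>i\<in>UNIV. \<nu> i) = m. d \<nu> * (\<Prod>i\<in>UNIV. complex_of_real (x $ i) ^ \<nu> i))"
    using assms unfolding homogeneous_polynomial_def by blast
  show ?thesis
    unfolding homogeneous_polynomial_def p q
    by (intro exI[of _ "\<lambda>\<nu>. c \<nu> + d \<nu>"]) (simp add: ring_distribs sum.distrib)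
qed

lemma homogeneous_polynomial_cmult:
  assumes "homogeneous_polynomial m p"
  shows "homogeneous_polynomial m (\<lambda>x :: real^'n. b * p x)"
proof -
  obtain c where p: "p = (\<lambda>x. \<Sum>\<nu> | (\<Sum>i\<in>UNIV. \<nu> i) = m. c \<nu> * (\<Prod>i\<in>UNIV. complex_of_real (x $ i) ^ \<nu> i))"
    using assms unfolding homogeneous_polynomial_def by blast
  show ?thesis
    unfolding homogeneous_polynomial_def p
    by (intro exI[of _ "\<lambda>\<nu>. b * c \<nu>"]) (simp add: sum_distrib_left mult.assoc)
qed

lemma homogeneous_polynomial_sum:
  assumes "\<And>i. i \<in> I \<Longrightarrow> homogeneous_polynomial m (p i)"
  shows "homogeneous_polynomial m (\<lambda>x :: real^'n. \<Sum>i\<in>I. p i x)"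
  using assms
  by (induction I rule: infinite_finite_induct)
    (auto intro!: homogeneous_polynomial_zero homogeneous_polynomial_add)

lemma homogeneous_polynomial_monomial:
  assumes "(\<Sum>i\<in>UNIV. \<nu> i) = m"
  shows "homogeneous_polynomial m (\<lambda>x :: real^'n. c * (\<Prod>i\<in>UNIV. complex_of_real (x $ i) ^ \<nu> i))"
  unfolding homogeneous_polynomial_def
proof (intro exI[of _ "\<lambda>\<nu>'. if \<nu>' = \<nu> then c else 0"] ext)
  fix x :: "real^'n"
  have "(\<Sum>\<nu>' | (\<Sum>i\<in>UNIV. \<nu>' i) = m. (if \<nu>' = \<nu> then c else 0) * (\<Prod>i\<in>UNIV. complex_of_real (x $ i) ^ \<nu>' i))
     = (\<Sum>\<nu>' | (\<Sum>i\<in>UNIV. \<nu>' i) = m. if \<nu>' = \<nu> then c * (\<Prod>i\<in>UNIV. complex_of_real (x $ i) ^ \<nu> i) else 0)"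
    by (intro sum.cong) auto
  then show "c * (\<Prod>i\<in>UNIV. complex_of_real (x $ i) ^ \<nu> i) = (\<Sum>\<nu>' | (\<Sum>i\<in>UNIV. \<nu>' i) = m. (if \<nu>' = \<nu> then c else 0) * (\<Prod>i\<in>UNIV. complex_of_real (x $ i) ^ \<nu>' i))"
    using assms by (simp add: finite_multiindices)
qed

lemma monomial_Suc:
  fixes x :: "real^'n"
  shows "(\<Prod>i\<in>UNIV. complex_of_real (x $ i) ^ (\<nu>(j := Suc (\<nu> j))) i) = complex_of_real (x $ j) * (\<Prod>i\<in>UNIV. complex_of_real (x $ i) ^ \<nu> i)"
  by (subst (1 2) prod.remove[of UNIV j]) (auto simp: mult_ac intro!: prod.cong)

text \<open>Building polynomials up by multiplication with coordinates reduces all closure properties below to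
  product rules with a linear factor and avoids calculations with multi-indices.\<close>

lemma homogeneous_polynomial_induct [consumes 1, case_names zero const coord add]:
  fixes p :: "real^'n \<Rightarrow> complex"
  assumes p: "homogeneous_polynomial m p"
    and zero: "\<And>m. Q m (\<lambda>x. 0)"
    and const: "\<And>c. Q 0 (\<lambda>x. c)"
    and coord: "\<And>m i q. homogeneous_polynomial m q \<Longrightarrow> Q m q \<Longrightarrow> Q (Suc m) (\<lambda>x. complex_of_real (x $ i) * q x)"
    and add: "\<And>m p q. homogeneous_polynomial m p \<Longrightarrow> homogeneous_polynomial m q \<Longrightarrow> Q m p \<Longrightarrow> Q m q \<Longrightarrow> Q m (\<lambda>x. p x + q x)"
  shows "Q m p"
proof -
  have mono: "Q m (\<lambda>x. c * (\<Prod>i\<in>UNIV. complex_of_real (x $ i) ^ \<nu> i))" if "(\<Sum>i\<in>UNIV. \<nu> i) = m" for \<nu> m c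
    using that
  proof (induction m arbitrary: \<nu>)
    case 0
    then show ?case using const by simp
  next
    case (Suc m)
    then obtain j where j: "\<nu> j \<noteq> 0" by (metis (mono_tags) sum.neutral Zero_neq_Suc)
    define \<nu>' where "\<nu>' = \<nu>(j := \<nu> j - 1)"
    have \<nu>: "\<nu> = \<nu>'(j := Suc (\<nu>' j))" using j by (auto simp: \<nu>'_def)
    have "(\<Sum>i\<in>UNIV. \<nu> i) = \<nu> j + (\<Sum>i\<in>UNIV - {j}. \<nu> i)" by (simp add: sum.remove)
    moreover have "(\<Sum>i\<in>UNIV. \<nu>' i) = (\<nu> j - 1) + (\<Sum>i\<in>UNIV - {j}. \<nu> i)"
      by (subst sum.remove[of UNIV j]) (auto simp: \<nu>'_def intro!: sum.cong)
    ultimately have \<nu>'m: "(\<Sum>i\<in>UNIV. \<nu>' i) = m" using Suc.prems j by simp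
    have "Q (Suc m) (\<lambda>x. complex_of_real (x $ j) * (c * (\<Prod>i\<in>UNIV. complex_of_real (x $ i) ^ \<nu>' i)))"
      by (intro coord homogeneous_polynomial_monomial \<nu>'m Suc.IH)
    moreover have "complex_of_real (x $ j) * (c * (\<Prod>i\<in>UNIV. complex_of_real (x $ i) ^ \<nu>' i)) = c * (\<Prod>i\<in>UNIV. complex_of_real (x $ i) ^ \<nu> i)" for x :: "real^'n"
      by (subst \<nu>, subst monomial_Suc) simp
    ultimately show ?case by simp
  qed
  obtain c where p: "p = (\<lambda>x. \<Sum>\<nu> | (\<Sum>i\<in>UNIV. \<nu> i) = m. c \<nu> * (\<Prod>i\<in>UNIV. complex_of_real (x $ i) ^ \<nu> i))"
    using assms unfolding homogeneous_polynomial_def by blast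
  have "Q m (\<lambda>x. \<Sum>\<nu>\<in>I. c \<nu> * (\<Prod>i\<in>UNIV. complex_of_real (x $ i) ^ \<nu> i))
     \<and> homogeneous_polynomial m (\<lambda>x :: real^'n. \<Sum>\<nu>\<in>I. c \<nu> * (\<Prod>i\<in>UNIV. complex_of_real (x $ i) ^ \<nu> i))"
    if "finite I" "I \<subseteq> {\<nu>. (\<Sum>i\<in>UNIV. \<nu> i) = m}" for I
    using that
  proof (induction I rule: finite_induct)
    case empty
    then show ?case by (simp add: zero homogeneous_polynomial_zero)
  next
    case (insert \<nu> I)
    then show ?case
      by (auto intro!: add homogeneous_polynomial_add mono homogeneous_polynomial_monomial)
  qed
  from this[OF finite_multiindices order.refl] show ?thesis by (simp add: p)
qed

lemma homogeneous_polynomial_const: "homogeneous_polynomial 0 (\<lambda>x :: real^'n. c)"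
  using homogeneous_polynomial_monomial[of "\<lambda>_. 0" 0 c] by simp

lemma homogeneous_polynomial_coord:
  fixes p :: "real^'n \<Rightarrow> complex"
  assumes "homogeneous_polynomial m p"
  shows "homogeneous_polynomial (Suc m) (\<lambda>x. complex_of_real (x $ j) * p x)"
proof -
  obtain c where p: "p = (\<lambda>x. \<Sum>\<nu> | (\<Sum>i\<in>UNIV. \<nu> i) = m. c \<nu> * (\<Prod>i\<in>UNIV. complex_of_real (x $ i) ^ \<nu> i))"
    using assms unfolding homogeneous_polynomial_def by blast
  have "homogeneous_polynomial (Suc m) (\<lambda>x :: real^'n. \<Sum>\<nu> | (\<Sum>i\<in>UNIV. \<nu> i) = m.
      c \<nu> * (\<Prod>i\<in>UNIV. complex_of_real (x $ i) ^ (\<nu>(j := Suc (\<nu> j))) i))"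
  proof (intro homogeneous_polynomial_sum homogeneous_polynomial_monomial)
    fix \<nu> :: "'n \<Rightarrow> nat" assume "\<nu> \<in> {\<nu>. (\<Sum>i\<in>UNIV. \<nu> i) = m}"
    then have "m = \<nu> j + (\<Sum>i\<in>UNIV - {j}. \<nu> i)" using sum.remove[of UNIV j \<nu>] by simp
    moreover have "(\<Sum>i\<in>UNIV. (\<nu>(j := Suc (\<nu> j))) i) = Suc (\<nu> j) + (\<Sum>i\<in>UNIV - {j}. \<nu> i)"
      by (subst sum.remove[of UNIV j]) (auto intro!: sum.cong)
    ultimately show "(\<Sum>i\<in>UNIV. (\<nu>(j := Suc (\<nu> j))) i) = Suc m" by simp
  qed
  then show ?thesis unfolding monomial_Suc p by (simp add: sum_distrib_left mult_ac)
qed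

lemma homogeneous_polynomial_inner:
  fixes p :: "real^'n \<Rightarrow> complex"
  assumes "homogeneous_polynomial m p"
  shows "homogeneous_polynomial (Suc m) (\<lambda>x. complex_of_real (v \<bullet> x) * p x)"
proof -
  have "homogeneous_polynomial (Suc m) (\<lambda>x. \<Sum>i\<in>UNIV. complex_of_real (v $ i) * (complex_of_real (x $ i) * p x))"
    by (intro homogeneous_polynomial_sum homogeneous_polynomial_cmult homogeneous_polynomial_coord assms)
  then show ?thesis by (simp add: inner_vec_def sum_distrib_right mult.assoc)
qed

lemma homogeneous_polynomial_mult:
  fixes p q :: "real^'n \<Rightarrow> complex"
  assumes "homogeneous_polynomial m p" and q: "homogeneous_polynomial n q"
  shows "homogeneous_polynomial (m + n) (\<lambda>x. p x * q x)"
  using assms(1)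
proof (induction rule: homogeneous_polynomial_induct)
  case (const c)
  then show ?case using homogeneous_polynomial_cmult[OF q] by simp
next
  case (coord m i p)
  from homogeneous_polynomial_coord[OF coord(2)] show ?case by (simp add: mult.assoc)
next
  case (add m p p')
  from homogeneous_polynomial_add[OF add(3,4)] show ?case by (simp add: distrib_right)
qed (auto intro: homogeneous_polynomial_zero)

lemma homogeneous_polynomial_cnj:
  fixes p :: "real^'n \<Rightarrow> complex"
  assumes "homogeneous_polynomial m p"
  shows "homogeneous_polynomial m (\<lambda>x. cnj (p x))"
  using assms
  by (induction rule: homogeneous_polynomial_induct)
    (auto intro: homogeneous_polynomial_zero homogeneous_polynomial_const homogeneous_polynomial_coord homogeneous_polynomial_add)

lemma homogeneous_polynomial_norm_power:
  fixes p :: "real^'n \<Rightarrow> complex"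
  assumes p: "homogeneous_polynomial m p"
  shows "homogeneous_polynomial (2 * j + m) (\<lambda>x. complex_of_real ((x \<bullet> x) ^ j) * p x)"
proof (induction j)
  case (Suc j)
  have "homogeneous_polynomial (Suc (Suc (2 * j + m))) (\<lambda>x. \<Sum>i\<in>UNIV. complex_of_real (x $ i) * (complex_of_real (x $ i) * (complex_of_real ((x \<bullet> x) ^ j) * p x)))"
    by (intro homogeneous_polynomial_sum homogeneous_polynomial_coord Suc)
  then show ?case by (simp add: inner_vec_def sum_distrib_right mult.assoc)
qed (use p in simp)

lemma homogeneous_polynomial_scale:
  fixes p :: "real^'n \<Rightarrow> complex"
  assumes "homogeneous_polynomial m p"
  shows "p (c *\<^sub>R x) = complex_of_real (c ^ m) * p x"
  using assms by (induction rule: homogeneous_polynomial_induct) (auto simp: algebra_simps)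

lemma homogeneous_polynomial_reflection:
  fixes p :: "real^'n \<Rightarrow> complex"
  assumes "homogeneous_polynomial m p"
  shows "homogeneous_polynomial m (\<lambda>x. p (reflection \<alpha> x))"
  using assms
proof (induction rule: homogeneous_polynomial_induct)
  case (coord m i p)
  have "complex_of_real (reflection \<alpha> x $ i) * p (reflection \<alpha> x) =
      complex_of_real (x $ i) * p (reflection \<alpha> x) +
      complex_of_real (- 2 * \<alpha> $ i / (norm \<alpha>)\<^sup>2) * (complex_of_real (\<alpha> \<bullet> x) * p (reflection \<alpha> x))" for x
    by (simp add: reflection_def algebra_simps)
  then show ?case
    by (simp only:) (intro homogeneous_polynomial_add homogeneous_polynomial_cmult homogeneous_polynomial_coord homogeneous_polynomial_inner coord)
qed (auto intro: homogeneous_polynomial_zero homogeneous_polynomial_const homogeneous_polynomial_add)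

lemma coord_eq_inner: "complex_of_real (x $ i) = complex_of_real (axis i 1 \<bullet> x)"
  for x :: "real^'n"
  by (simp add: inner_axis')

lemma homogeneous_polynomial_differentiable:
  fixes p :: "real^'n \<Rightarrow> complex"
  assumes "homogeneous_polynomial m p"
  shows "p differentiable (at x)"
  using assms
proof (induction rule: homogeneous_polynomial_induct)
  case (coord m i p)
  then show ?case
    unfolding coord_eq_inner
    by (intro differentiable_mult) (auto simp: differentiable_def intro: has_derivative_inner_of_real)
qed (auto intro: differentiable_add)

lemma homogeneous_polynomial_continuous:
  fixes p :: "real^'n \<Rightarrow> complex"
  assumes "homogeneous_polynomial m p"
  shows "continuous_on S p"
  by (intro continuous_at_imp_continuous_on ballI differentiable_imp_continuous_within
      homogeneous_polynomial_differentiable[OF assms])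

lemma inner_of_real_differentiable:
  "(\<lambda>y. complex_of_real (v \<bullet> y)) differentiable (at x)"
  by (auto simp: differentiable_def intro: has_derivative_inner_of_real)

lemma dir_deriv_inner_mult:
  assumes "f differentiable (at x)"
  shows "dir_deriv \<xi> (\<lambda>y. complex_of_real (v \<bullet> y) * f y) x = complex_of_real (v \<bullet> \<xi>) * f x + complex_of_real (v \<bullet> x) * dir_deriv \<xi> f x"
  by (simp add: dir_deriv_mult[OF inner_of_real_differentiable assms] dir_deriv_inner)

lemma homogeneous_polynomial_dir_deriv:
  fixes p :: "real^'n \<Rightarrow> complex"
  assumes "homogeneous_polynomial m p"
  shows "if m = 0 then dir_deriv \<xi> p = (\<lambda>x. 0) else homogeneous_polynomial (m - 1) (dir_deriv \<xi> p)"
  using assms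
proof (induction rule: homogeneous_polynomial_induct)
  case (zero m)
  have "dir_deriv \<xi> (\<lambda>x. 0) = (\<lambda>x. 0)" by auto
  then show ?case by (simp add: homogeneous_polynomial_zero)
next
  case (coord m i p)
  have eq: "dir_deriv \<xi> (\<lambda>x. complex_of_real (x $ i) * p x) = (\<lambda>x. complex_of_real (\<xi> $ i) * p x + complex_of_real (x $ i) * dir_deriv \<xi> p x)"
    unfolding coord_eq_inner
    by (intro ext dir_deriv_inner_mult homogeneous_polynomial_differentiable[OF coord(1)])
  have "homogeneous_polynomial m (\<lambda>x. complex_of_real (x $ i) * dir_deriv \<xi> p x)"
  proof (cases m)
    case 0
    then show ?thesis using coord(2) homogeneous_polynomial_zero by simp
  next
    case (Suc n)
    then show ?thesis using homogeneous_polynomial_coord[of n] coord(2) by simp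
  qed
  then show ?case
    unfolding eq by (auto intro!: homogeneous_polynomial_add homogeneous_polynomial_cmult coord(1))
next
  case (add m p q)
  have eq: "dir_deriv \<xi> (\<lambda>x. p x + q x) = (\<lambda>x. dir_deriv \<xi> p x + dir_deriv \<xi> q x)"
    using add(1,2) by (intro ext dir_deriv_add homogeneous_polynomial_differentiable)
  show ?case unfolding eq using add(3,4) by (auto intro: homogeneous_polynomial_add split: if_splits)
qed auto

lemma Euler_homogeneous:
  fixes p :: "real^'n \<Rightarrow> complex"
  assumes "homogeneous_polynomial m p"
  shows "dir_deriv x p x = of_nat m * p x"
  using assms
proof (induction rule: homogeneous_polynomial_induct)
  case (coord m i p)
  then show ?case
    unfolding coord_eq_inner
    by (simp add: dir_deriv_inner_mult homogeneous_polynomial_differentiable) (simp add: algebra_simps)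
next
  case (add m p q)
  then show ?case
    by (simp add: dir_deriv_add homogeneous_polynomial_differentiable algebra_simps)
qed auto

section \<open>Dunkl operators\<close>

lemma dunkl_quotient_cong:
  assumes "open S" "x \<in> S" "reflection \<alpha> x \<in> S" "\<And>y. y \<in> S \<Longrightarrow> f y = g y"
  shows "dunkl_quotient \<alpha> f x = dunkl_quotient \<alpha> g x"
  using assms dir_deriv_cong[OF assms(1,2,4)] by (simp add: dunkl_quotient_def)

lemma dunkl_op_cong:
  assumes "open S" "x \<in> S" "\<And>\<alpha>. \<alpha> \<in> P \<Longrightarrow> reflection \<alpha> x \<in> S" "\<And>y. y \<in> S \<Longrightarrow> f y = g y"
  shows "dunkl_op P k \<xi> f x = dunkl_op P k \<xi> g x"
  unfolding dunkl_op_def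
  using dir_deriv_cong[OF assms(1,2,4)] dunkl_quotient_cong[OF assms(1,2) assms(3) assms(4)] by simp

lemma dunkl_quotient_add:
  assumes "f differentiable (at x)" "g differentiable (at x)"
  shows "dunkl_quotient \<alpha> (\<lambda>y. f y + g y) x = dunkl_quotient \<alpha> f x + dunkl_quotient \<alpha> g x"
  by (simp add: dunkl_quotient_def dir_deriv_add[OF assms] distrib_left flip: add_divide_distrib)

lemma dunkl_quotient_cmult:
  assumes "f differentiable (at x)"
  shows "dunkl_quotient \<alpha> (\<lambda>y. c * f y) x = c * dunkl_quotient \<alpha> f x"
  by (simp add: dunkl_quotient_def dir_deriv_cmult[OF assms] right_diff_distrib)

text \<open>A Leibniz rule with a linear factor: the difference quotient of a linear function is a constant, and
  it comes with the reflected value of the other factor.  The limit value on the hyperplane makes the rule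
  hold there as well.\<close>

lemma dunkl_quotient_inner_mult:
  assumes "f differentiable (at x)" "\<alpha> \<noteq> 0"
  shows "dunkl_quotient \<alpha> (\<lambda>y. complex_of_real (v \<bullet> y) * f y) x =
    complex_of_real (v \<bullet> x) * dunkl_quotient \<alpha> f x + complex_of_real (2 * (v \<bullet> \<alpha>) / (norm \<alpha>)\<^sup>2) * f (reflection \<alpha> x)"
proof (cases "\<alpha> \<bullet> x = 0")
  case True
  then show ?thesis
    by (simp add: dunkl_quotient_def dir_deriv_inner_mult[OF assms(1)] reflection_fixed) (simp add: algebra_simps add_divide_distrib)
next
  case False
  have "complex_of_real (v \<bullet> x) * f x - complex_of_real (v \<bullet> reflection \<alpha> x) * f (reflection \<alpha> x)
    = complex_of_real (v \<bullet> x) * (f x - f (reflection \<alpha> x)) + complex_of_real (\<alpha> \<bullet> x) * (complex_of_real (2 * (v \<bullet> \<alpha>) / (norm \<alpha>)\<^sup>2) * f (reflection \<alpha> x))"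
    by (simp add: reflection_inner algebra_simps)
  then show ?thesis using False by (simp add: dunkl_quotient_def add_divide_distrib)
qed

text \<open>Radial factors are invariant under reflections, so they can be pulled out.\<close>

lemma dunkl_quotient_radial:
  fixes x :: "real^'n"
  assumes f: "f differentiable (at x)" and g: "(g has_real_derivative g') (at (x \<bullet> x))" and "\<alpha> \<noteq> 0"
  shows "dunkl_quotient \<alpha> (\<lambda>y. f y * complex_of_real (g (y \<bullet> y))) x = dunkl_quotient \<alpha> f x * complex_of_real (g (x \<bullet> x))"
proof -
  have d: "(\<lambda>y. complex_of_real (g (y \<bullet> y))) differentiable (at x)"
    using has_derivative_radial[OF g] by (auto simp: differentiable_def)
  show ?thesis
    using assms(3)
    by (simp add: dunkl_quotient_def dir_deriv_mult[OF f d] dir_deriv_radial[OF g] reflection_inner_inner inner_commute left_diff_distrib)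
qed

lemma dunkl_op_add:
  assumes "f differentiable (at x)" "g differentiable (at x)"
  shows "dunkl_op P k \<xi> (\<lambda>y. f y + g y) x = dunkl_op P k \<xi> f x + dunkl_op P k \<xi> g x"
  unfolding dunkl_op_def
  by (simp add: dir_deriv_add[OF assms] dunkl_quotient_add[OF assms] distrib_left sum.distrib)

lemma dunkl_op_cmult:
  assumes "f differentiable (at x)"
  shows "dunkl_op P k \<xi> (\<lambda>y. c * f y) x = c * dunkl_op P k \<xi> f x"
  unfolding dunkl_op_def
  by (simp add: dir_deriv_cmult[OF assms] dunkl_quotient_cmult[OF assms] distrib_left sum_distrib_left mult_ac)

lemma dunkl_op_radial:
  fixes x :: "real^'n"
  assumes f: "f differentiable (at x)" and g: "(g has_real_derivative g') (at (x \<bullet> x))" and P: "0 \<notin> P"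
  shows "dunkl_op P k \<xi> (\<lambda>y. f y * complex_of_real (g (y \<bullet> y))) x =
    dunkl_op P k \<xi> f x * complex_of_real (g (x \<bullet> x)) + f x * complex_of_real (2 * g' * (x \<bullet> \<xi>))"
proof -
  have d: "(\<lambda>y. complex_of_real (g (y \<bullet> y))) differentiable (at x)"
    using has_derivative_radial[OF g] by (auto simp: differentiable_def)
  have "(\<Sum>\<alpha>\<in>P. complex_of_real (k \<alpha> * (\<alpha> \<bullet> \<xi>)) * dunkl_quotient \<alpha> (\<lambda>y. f y * complex_of_real (g (y \<bullet> y))) x)
     = (\<Sum>\<alpha>\<in>P. complex_of_real (k \<alpha> * (\<alpha> \<bullet> \<xi>)) * dunkl_quotient \<alpha> f x) * complex_of_real (g (x \<bullet> x))"
    unfolding sum_distrib_right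
  proof (intro sum.cong refl)
    fix \<alpha> assume "\<alpha> \<in> P"
    then have "\<alpha> \<noteq> 0" using P by auto
    from dunkl_quotient_radial[OF f g this]
    show "complex_of_real (k \<alpha> * (\<alpha> \<bullet> \<xi>)) * dunkl_quotient \<alpha> (\<lambda>y. f y * complex_of_real (g (y \<bullet> y))) x =
      complex_of_real (k \<alpha> * (\<alpha> \<bullet> \<xi>)) * dunkl_quotient \<alpha> f x * complex_of_real (g (x \<bullet> x))"
      by (simp only: mult.assoc)
  qed
  then show ?thesis
    unfolding dunkl_op_def by (simp add: dir_deriv_mult[OF f d] dir_deriv_radial[OF g] algebra_simps)
qed

text \<open>The numerator vanishes on the hyperplane, so the quotient is again a polynomial; the Leibniz rule
  for a linear factor proves this by induction, without any division.\<close>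

lemma homogeneous_polynomial_dunkl_quotient:
  fixes p :: "real^'n \<Rightarrow> complex"
  assumes "homogeneous_polynomial m p" and \<alpha>: "\<alpha> \<noteq> 0"
  shows "if m = 0 then dunkl_quotient \<alpha> p = (\<lambda>x. 0) else homogeneous_polynomial (m - 1) (dunkl_quotient \<alpha> p)"
  using assms(1)
proof (induction rule: homogeneous_polynomial_induct)
  case (zero m)
  have "dunkl_quotient \<alpha> (\<lambda>x. 0) = (\<lambda>x. 0)" by (auto simp: dunkl_quotient_def)
  then show ?case by (simp add: homogeneous_polynomial_zero)
next
  case (const c)
  show ?case by (auto simp: dunkl_quotient_def)
next
  case (coord m i p)
  have eq: "dunkl_quotient \<alpha> (\<lambda>x. complex_of_real (x $ i) * p x) = (\<lambda>x. complex_of_real (x $ i) * dunkl_quotient \<alpha> p x +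
      complex_of_real (2 * (axis i 1 \<bullet> \<alpha>) / (norm \<alpha>)\<^sup>2) * p (reflection \<alpha> x))"
    unfolding coord_eq_inner
    by (intro ext dunkl_quotient_inner_mult homogeneous_polynomial_differentiable[OF coord(1)] \<alpha>)
  have "homogeneous_polynomial m (\<lambda>x. complex_of_real (x $ i) * dunkl_quotient \<alpha> p x)"
  proof (cases m)
    case 0
    then show ?thesis using coord(2) homogeneous_polynomial_zero by simp
  next
    case (Suc n)
    then show ?thesis using homogeneous_polynomial_coord[of n] coord(2) by simp
  qed
  then have "homogeneous_polynomial m (dunkl_quotient \<alpha> (\<lambda>x. complex_of_real (x $ i) * p x))"
    unfolding eq
    by (rule homogeneous_polynomial_add[OF _ homogeneous_polynomial_cmult[OF homogeneous_polynomial_reflection[OF coord(1)]]])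
  then show ?case by simp
next
  case (add m p q)
  have eq: "dunkl_quotient \<alpha> (\<lambda>x. p x + q x) = (\<lambda>x. dunkl_quotient \<alpha> p x + dunkl_quotient \<alpha> q x)"
    using add(1,2) by (intro ext dunkl_quotient_add homogeneous_polynomial_differentiable)
  show ?case unfolding eq using add(3,4) by (auto intro: homogeneous_polynomial_add split: if_splits)
qed

lemma homogeneous_polynomial_dunkl_op:
  fixes p :: "real^'n \<Rightarrow> complex"
  assumes p: "homogeneous_polynomial m p" and P: "0 \<notin> P"
  shows "if m = 0 then dunkl_op P k \<xi> p = (\<lambda>x. 0) else homogeneous_polynomial (m - 1) (dunkl_op P k \<xi> p)"
proof (cases "m = 0")
  case True
  then have "dunkl_quotient \<alpha> p = (\<lambda>x. 0)" if "\<alpha> \<in> P" for \<alpha>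
    using homogeneous_polynomial_dunkl_quotient[OF p, of \<alpha>] that P by auto
  moreover have "dir_deriv \<xi> p = (\<lambda>x. 0)" using homogeneous_polynomial_dir_deriv[OF p] True by simp
  ultimately show ?thesis using True by (auto simp: dunkl_op_def)
next
  case False
  have "homogeneous_polynomial (m - 1) (\<lambda>x. dir_deriv \<xi> p x + (\<Sum>\<alpha>\<in>P. complex_of_real (k \<alpha> * (\<alpha> \<bullet> \<xi>)) * dunkl_quotient \<alpha> p x))"
  proof (intro homogeneous_polynomial_add homogeneous_polynomial_sum homogeneous_polynomial_cmult)
    show "homogeneous_polynomial (m - 1) (dir_deriv \<xi> p)"
      using homogeneous_polynomial_dir_deriv[OF p] False by simp
    fix \<alpha> assume "\<alpha> \<in> P"
    then show "homogeneous_polynomial (m - 1) (dunkl_quotient \<alpha> p)"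
      using homogeneous_polynomial_dunkl_quotient[OF p, of \<alpha>] False P by auto
  qed
  then show ?thesis using False by (simp add: dunkl_op_def[abs_def])
qed

lemma dunkl_op_zero: "dunkl_op P k \<xi> (\<lambda>x. 0) = (\<lambda>x :: real^'n. 0)"
proof -
  have "dunkl_quotient \<alpha> (\<lambda>x. 0) x = 0" for \<alpha> x :: "real^'n"
    by (simp add: dunkl_quotient_def)
  then show ?thesis by (intro ext) (simp add: dunkl_op_def)
qed

lemma homogeneous_polynomial_dunkl_laplacian:
  fixes p :: "real^'n \<Rightarrow> complex"
  assumes p: "homogeneous_polynomial m p" and P: "0 \<notin> P"
  shows "if m < 2 then dunkl_laplacian P k p = (\<lambda>x. 0) else homogeneous_polynomial (m - 2) (dunkl_laplacian P k p)"
proof -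
  have T: "if m = 0 then dunkl_op P k \<xi> p = (\<lambda>x. 0) else homogeneous_polynomial (m - 1) (dunkl_op P k \<xi> p)" for \<xi>
    by (rule homogeneous_polynomial_dunkl_op[OF p P])
  have TT: "if m < 2 then dunkl_op P k \<xi> (dunkl_op P k \<xi> p) = (\<lambda>x. 0) else homogeneous_polynomial (m - 2) (dunkl_op P k \<xi> (dunkl_op P k \<xi> p))" for \<xi>
  proof (cases "m = 0")
    case True
    then show ?thesis using T[of \<xi>] by (simp add: dunkl_op_zero)
  next
    case False
    then have "homogeneous_polynomial (m - 1) (dunkl_op P k \<xi> p)" using T[of \<xi>] by simp
    from homogeneous_polynomial_dunkl_op[OF this P, of k \<xi>] False show ?thesis
      by (auto simp: numeral_2_eq_2 split: if_splits)
  qed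
  show ?thesis
  proof (cases "m < 2")
    case True
    then show ?thesis using TT by (auto simp: dunkl_laplacian_def)
  next
    case False
    then have "homogeneous_polynomial (m - 2) (\<lambda>x. \<Sum>\<xi>\<in>Basis. dunkl_op P k \<xi> (dunkl_op P k \<xi> p) x)"
      using TT by (intro homogeneous_polynomial_sum) auto
    then show ?thesis using False by (simp add: dunkl_laplacian_def[abs_def])
  qed
qed

lemma dunkl_op_polynomial_differentiable:
  fixes p :: "real^'n \<Rightarrow> complex"
  assumes p: "homogeneous_polynomial m p" and P: "0 \<notin> P"
  shows "dunkl_op P k \<xi> p differentiable (at x)"
  using homogeneous_polynomial_dunkl_op[OF assms, of k \<xi>] homogeneous_polynomial_differentiable
  by (auto split: if_splits)

text \<open>Holds on the hyperplane too, where both sides are zero.\<close>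

lemma dunkl_quotient_times: "complex_of_real (\<alpha> \<bullet> x) * dunkl_quotient \<alpha> f x = f x - f (reflection \<alpha> x)"
  by (cases "\<alpha> \<bullet> x = 0") (auto simp: dunkl_quotient_def reflection_fixed)

lemma sum_Basis_dir_deriv:
  fixes x v :: "real^'n"
  assumes "f differentiable (at x)"
  shows "(\<Sum>\<xi>\<in>Basis. complex_of_real (v \<bullet> \<xi>) * dir_deriv \<xi> f x) = dir_deriv v f x"
proof -
  obtain f' where d: "(f has_derivative f') (at x)"
    using assms by (auto simp: differentiable_def)
  interpret f': bounded_linear f' by (rule has_derivative_bounded_linear[OF d])
  have "f' v = f' (\<Sum>\<xi>\<in>Basis. (v \<bullet> \<xi>) *\<^sub>R \<xi>)" by (simp add: euclidean_representation)
  also have "\<dots> = (\<Sum>\<xi>\<in>Basis. complex_of_real (v \<bullet> \<xi>) * f' \<xi>)"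
    by (simp only: f'.sum f'.scaleR) (simp add: scaleR_conv_of_real)
  finally show ?thesis by (simp add: dir_deriv_eq[OF d])
qed

lemma sum_Basis_inner_of_real:
  fixes v w :: "real^'n"
  shows "(\<Sum>\<xi>\<in>Basis. complex_of_real (v \<bullet> \<xi>) * complex_of_real (w \<bullet> \<xi>)) = complex_of_real (v \<bullet> w)"
  unfolding euclidean_inner[of v w] by simp

text \<open>The radial part of the Dunkl gradient: Euler's identity for the derivatives, and in the
  difference terms the factor \<open>\<alpha> \<bullet> x\<close> cancels the denominator.\<close>

lemma sum_inner_dunkl_op:
  fixes p :: "real^'n \<Rightarrow> complex"
  assumes p: "homogeneous_polynomial m p"
  shows "(\<Sum>\<xi>\<in>Basis. complex_of_real (x \<bullet> \<xi>) * dunkl_op P k \<xi> p x) =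
    of_nat m * p x + (\<Sum>\<alpha>\<in>P. complex_of_real (k \<alpha>) * (p x - p (reflection \<alpha> x)))"
proof -
  have "(\<Sum>\<xi>\<in>Basis. complex_of_real (x \<bullet> \<xi>) * dunkl_op P k \<xi> p x) =
    (\<Sum>\<xi>\<in>Basis. complex_of_real (x \<bullet> \<xi>) * dir_deriv \<xi> p x) +
    (\<Sum>\<xi>\<in>Basis. \<Sum>\<alpha>\<in>P. complex_of_real (k \<alpha>) * dunkl_quotient \<alpha> p x * (complex_of_real (\<alpha> \<bullet> \<xi>) * complex_of_real (x \<bullet> \<xi>)))"
    by (simp add: dunkl_op_def distrib_left sum.distrib sum_distrib_left mult_ac)
  also have "(\<Sum>\<xi>\<in>Basis. complex_of_real (x \<bullet> \<xi>) * dir_deriv \<xi> p x) = of_nat m * p x"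
    by (simp add: sum_Basis_dir_deriv homogeneous_polynomial_differentiable[OF p] Euler_homogeneous[OF p])
  also have "(\<Sum>\<xi>\<in>Basis. \<Sum>\<alpha>\<in>P. complex_of_real (k \<alpha>) * dunkl_quotient \<alpha> p x * (complex_of_real (\<alpha> \<bullet> \<xi>) * complex_of_real (x \<bullet> \<xi>)))
    = (\<Sum>\<alpha>\<in>P. complex_of_real (k \<alpha>) * dunkl_quotient \<alpha> p x * complex_of_real (\<alpha> \<bullet> x))"
    by (subst sum.swap) (simp add: sum_Basis_inner_of_real flip: sum_distrib_left)
  also have "\<dots> = (\<Sum>\<alpha>\<in>P. complex_of_real (k \<alpha>) * (p x - p (reflection \<alpha> x)))"
    by (simp add: mult.assoc dunkl_quotient_times mult.commute[of "dunkl_quotient _ p x"])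
  finally show ?thesis .
qed

text \<open>The Dunkl divergence of the vector field \<open>x p(x)\<close>.  The reflected values have the opposite sign of
  those in the preceding lemma, because of the extra term of the Leibniz rule.\<close>

lemma sum_dunkl_op_inner:
  fixes p :: "real^'n \<Rightarrow> complex"
  assumes p: "homogeneous_polynomial m p" and P: "0 \<notin> P"
  shows "(\<Sum>\<xi>\<in>Basis. dunkl_op P k \<xi> (\<lambda>y. complex_of_real (\<xi> \<bullet> y) * p y) x) =
    of_nat (CARD('n) + m) * p x + (\<Sum>\<alpha>\<in>P. complex_of_real (k \<alpha>) * (p x + p (reflection \<alpha> x)))"
proof -
  note dp = homogeneous_polynomial_differentiable[OF p]
  have "dunkl_op P k \<xi> (\<lambda>y. complex_of_real (\<xi> \<bullet> y) * p y) x =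
      complex_of_real (\<xi> \<bullet> \<xi>) * p x + complex_of_real (x \<bullet> \<xi>) * dir_deriv \<xi> p x +
      (\<Sum>\<alpha>\<in>P. complex_of_real (k \<alpha>) * dunkl_quotient \<alpha> p x * (complex_of_real (\<alpha> \<bullet> \<xi>) * complex_of_real (x \<bullet> \<xi>))
        + complex_of_real (k \<alpha>) * complex_of_real (2 / (norm \<alpha>)\<^sup>2) * p (reflection \<alpha> x) * (complex_of_real (\<alpha> \<bullet> \<xi>) * complex_of_real (\<alpha> \<bullet> \<xi>)))" for \<xi>
  proof -
    have S: "(\<Sum>\<alpha>\<in>P. complex_of_real (k \<alpha> * (\<alpha> \<bullet> \<xi>)) * dunkl_quotient \<alpha> (\<lambda>y. complex_of_real (\<xi> \<bullet> y) * p y) x)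
      = (\<Sum>\<alpha>\<in>P. complex_of_real (k \<alpha>) * dunkl_quotient \<alpha> p x * (complex_of_real (\<alpha> \<bullet> \<xi>) * complex_of_real (x \<bullet> \<xi>))
        + complex_of_real (k \<alpha>) * complex_of_real (2 / (norm \<alpha>)\<^sup>2) * p (reflection \<alpha> x) * (complex_of_real (\<alpha> \<bullet> \<xi>) * complex_of_real (\<alpha> \<bullet> \<xi>)))"
    proof (intro sum.cong refl)
      fix \<alpha> assume "\<alpha> \<in> P"
      then have "\<alpha> \<noteq> 0" using P by auto
      from dunkl_quotient_inner_mult[OF dp this, of \<xi> x]
      show "complex_of_real (k \<alpha> * (\<alpha> \<bullet> \<xi>)) * dunkl_quotient \<alpha> (\<lambda>y. complex_of_real (\<xi> \<bullet> y) * p y) x = complex_of_real (k \<alpha>) * dunkl_quotient \<alpha> p x * (complex_of_real (\<alpha> \<bullet> \<xi>) * complex_of_real (x \<bullet> \<xi>))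
        + complex_of_real (k \<alpha>) * complex_of_real (2 / (norm \<alpha>)\<^sup>2) * p (reflection \<alpha> x) * (complex_of_real (\<alpha> \<bullet> \<xi>) * complex_of_real (\<alpha> \<bullet> \<xi>))"
        by (simp add: inner_commute[of \<xi>] algebra_simps)
    qed
    show ?thesis
      unfolding dunkl_op_def dir_deriv_inner_mult[OF dp] S by (simp only: inner_commute[of \<xi> x])
  qed
  then have "(\<Sum>\<xi>\<in>Basis. dunkl_op P k \<xi> (\<lambda>y. complex_of_real (\<xi> \<bullet> y) * p y) x) =
     (\<Sum>\<xi>\<in>(Basis :: (real^'n) set). complex_of_real (\<xi> \<bullet> \<xi>) * p x) + (\<Sum>\<xi>\<in>Basis. complex_of_real (x \<bullet> \<xi>) * dir_deriv \<xi> p x) +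
     (\<Sum>\<alpha>\<in>P. complex_of_real (k \<alpha>) * dunkl_quotient \<alpha> p x * complex_of_real (\<alpha> \<bullet> x) +
        complex_of_real (k \<alpha>) * complex_of_real (2 / (norm \<alpha>)\<^sup>2) * p (reflection \<alpha> x) * complex_of_real (\<alpha> \<bullet> \<alpha>))"
    by (simp only: sum.distrib sum.swap[of _ P] sum_Basis_inner_of_real sum_distrib_left[symmetric])
  also have "(\<Sum>\<xi>\<in>(Basis :: (real^'n) set). complex_of_real (\<xi> \<bullet> \<xi>) * p x) = of_nat CARD('n) * p x"
    by simp
  also have "(\<Sum>\<xi>\<in>Basis. complex_of_real (x \<bullet> \<xi>) * dir_deriv \<xi> p x) = of_nat m * p x"
    by (simp add: sum_Basis_dir_deriv dp Euler_homogeneous[OF p])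
  also have "(\<Sum>\<alpha>\<in>P. complex_of_real (k \<alpha>) * dunkl_quotient \<alpha> p x * complex_of_real (\<alpha> \<bullet> x) +
        complex_of_real (k \<alpha>) * complex_of_real (2 / (norm \<alpha>)\<^sup>2) * p (reflection \<alpha> x) * complex_of_real (\<alpha> \<bullet> \<alpha>))
     = (\<Sum>\<alpha>\<in>P. complex_of_real (k \<alpha>) * (p x + p (reflection \<alpha> x)))"
  proof (intro sum.cong refl)
    fix \<alpha> assume "\<alpha> \<in> P"
    then have "\<alpha> \<noteq> 0" using P by auto
    then have "complex_of_real (2 / (norm \<alpha>)\<^sup>2) * complex_of_real (\<alpha> \<bullet> \<alpha>) = 2"
      unfolding of_real_mult[symmetric] by (simp add: power2_norm_eq_inner)
    then have "complex_of_real (k \<alpha>) * complex_of_real (2 / (norm \<alpha>)\<^sup>2) * p (reflection \<alpha> x) * complex_of_real (\<alpha> \<bullet> \<alpha>)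
      = complex_of_real (k \<alpha>) * (2 * p (reflection \<alpha> x))"
      by (metis (no_types, opaque_lifting) mult.assoc mult.commute)
    moreover have "complex_of_real (k \<alpha>) * dunkl_quotient \<alpha> p x * complex_of_real (\<alpha> \<bullet> x) = complex_of_real (k \<alpha>) * (p x - p (reflection \<alpha> x))"
      using dunkl_quotient_times[of \<alpha> x p] by (simp add: mult_ac)
    ultimately show "complex_of_real (k \<alpha>) * dunkl_quotient \<alpha> p x * complex_of_real (\<alpha> \<bullet> x) +
        complex_of_real (k \<alpha>) * complex_of_real (2 / (norm \<alpha>)\<^sup>2) * p (reflection \<alpha> x) * complex_of_real (\<alpha> \<bullet> \<alpha>)
      = complex_of_real (k \<alpha>) * (p x + p (reflection \<alpha> x))"
      by (simp add: algebra_simps)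
  qed
  finally show ?thesis by (simp add: algebra_simps)
qed

text \<open>The cross terms are the radial part of the gradient and the divergence of \<open>x p(x)\<close>.  In their sum
  the reflected values cancel, which leaves a multiple of \<open>p\<close>: the Dunkl operators act on the radial
  factor as if the dimension were \<open>N + 2\<langle>k\<rangle>\<close>.  The set \<open>S\<close> allows factors that are singular at the
  origin.\<close>

lemma dunkl_laplacian_radial:
  fixes p :: "real^'n \<Rightarrow> complex"
  assumes p: "homogeneous_polynomial m p" and P: "0 \<notin> P"
    and S: "open S" "\<And>\<alpha> y. \<alpha> \<in> P \<Longrightarrow> y \<in> S \<Longrightarrow> reflection \<alpha> y \<in> S"
    and g: "\<And>y. y \<in> S \<Longrightarrow> (g has_real_derivative g' (y \<bullet> y)) (at (y \<bullet> y))"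
    and g': "\<And>y. y \<in> S \<Longrightarrow> (g' has_real_derivative g'' (y \<bullet> y)) (at (y \<bullet> y))"
    and x: "x \<in> S"
  shows "dunkl_laplacian P k (\<lambda>y. p y * complex_of_real (g (y \<bullet> y))) x =
    dunkl_laplacian P k p x * complex_of_real (g (x \<bullet> x)) +
    complex_of_real (2 * g' (x \<bullet> x) * (2 * real m + real CARD('n) + 2 * mult_index P k) + 4 * (x \<bullet> x) * g'' (x \<bullet> x)) * p x"
proof -
  note dp = homogeneous_polynomial_differentiable[OF p]
  let ?s = "x \<bullet> x"
  have main: "dunkl_op P k \<xi> (dunkl_op P k \<xi> (\<lambda>y. p y * complex_of_real (g (y \<bullet> y)))) x =
     dunkl_op P k \<xi> (dunkl_op P k \<xi> p) x * complex_of_real (g ?s) + complex_of_real (2 * g' ?s) * (complex_of_real (x \<bullet> \<xi>) * dunkl_op P k \<xi> p x) +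
     complex_of_real (2 * g' ?s) * dunkl_op P k \<xi> (\<lambda>y. complex_of_real (\<xi> \<bullet> y) * p y) x + complex_of_real (4 * g'' ?s) * p x * (complex_of_real (x \<bullet> \<xi>) * complex_of_real (x \<bullet> \<xi>))" for \<xi>
  proof -
    let ?h = "\<lambda>y. complex_of_real (\<xi> \<bullet> y) * p y"
    have dh: "?h differentiable (at y)" for y
      by (intro differentiable_mult inner_of_real_differentiable dp)
    have dT: "dunkl_op P k \<xi> p differentiable (at y)" for y
      by (rule dunkl_op_polynomial_differentiable[OF p P])
    have d1: "(\<lambda>y. complex_of_real (g (y \<bullet> y))) differentiable (at x)"
      using has_derivative_radial[OF g[OF x]] by (auto simp: differentiable_def)
    have d2: "(\<lambda>y. complex_of_real (g' (y \<bullet> y))) differentiable (at x)"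
      using has_derivative_radial[OF g'[OF x]] by (auto simp: differentiable_def)
    have "dunkl_op P k \<xi> (dunkl_op P k \<xi> (\<lambda>y. p y * complex_of_real (g (y \<bullet> y)))) x =
      dunkl_op P k \<xi> (\<lambda>y. dunkl_op P k \<xi> p y * complex_of_real (g (y \<bullet> y)) + 2 * (?h y * complex_of_real (g' (y \<bullet> y)))) x"
    proof (rule dunkl_op_cong[OF S(1) x S(2)[OF _ x]])
      fix y assume "y \<in> S"
      from dunkl_op_radial[OF dp g[OF this] P, of k \<xi>]
      show "dunkl_op P k \<xi> (\<lambda>y. p y * complex_of_real (g (y \<bullet> y))) y = dunkl_op P k \<xi> p y * complex_of_real (g (y \<bullet> y)) + 2 * (?h y * complex_of_real (g' (y \<bullet> y)))"
        by (simp add: inner_commute mult_ac)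
    qed
    also have "\<dots> = dunkl_op P k \<xi> (\<lambda>y. dunkl_op P k \<xi> p y * complex_of_real (g (y \<bullet> y))) x
        + 2 * dunkl_op P k \<xi> (\<lambda>y. ?h y * complex_of_real (g' (y \<bullet> y))) x"
      using d1 d2 dh dT
      by (subst dunkl_op_add) (auto intro!: differentiable_mult differentiable_const simp: dunkl_op_cmult differentiable_mult)
    also have "\<dots> = (dunkl_op P k \<xi> (dunkl_op P k \<xi> p) x * complex_of_real (g ?s) + dunkl_op P k \<xi> p x * complex_of_real (2 * g' ?s * (x \<bullet> \<xi>)))
       + 2 * (dunkl_op P k \<xi> ?h x * complex_of_real (g' ?s) + ?h x * complex_of_real (2 * g'' ?s * (x \<bullet> \<xi>)))"
      using dunkl_op_radial[OF dT g[OF x] P, of k \<xi>] dunkl_op_radial[OF dh g'[OF x] P, of k \<xi>] by simp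
    finally show ?thesis by (simp add: inner_commute algebra_simps)
  qed
  have "dunkl_laplacian P k (\<lambda>y. p y * complex_of_real (g (y \<bullet> y))) x =
     dunkl_laplacian P k p x * complex_of_real (g ?s) +
     complex_of_real (2 * g' ?s) * (\<Sum>\<xi>\<in>Basis. complex_of_real (x \<bullet> \<xi>) * dunkl_op P k \<xi> p x) +
     complex_of_real (2 * g' ?s) * (\<Sum>\<xi>\<in>Basis. dunkl_op P k \<xi> (\<lambda>y. complex_of_real (\<xi> \<bullet> y) * p y) x) +
     complex_of_real (4 * g'' ?s) * p x * (\<Sum>\<xi>\<in>Basis. complex_of_real (x \<bullet> \<xi>) * complex_of_real (x \<bullet> \<xi>))"
    unfolding dunkl_laplacian_def main by (simp only: sum.distrib sum_distrib_left sum_distrib_right)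
  also have "\<dots> = dunkl_laplacian P k p x * complex_of_real (g ?s) +
     complex_of_real (2 * g' ?s) * (of_nat m * p x + (\<Sum>\<alpha>\<in>P. complex_of_real (k \<alpha>) * (p x - p (reflection \<alpha> x)))) +
     complex_of_real (2 * g' ?s) * (of_nat (CARD('n) + m) * p x + (\<Sum>\<alpha>\<in>P. complex_of_real (k \<alpha>) * (p x + p (reflection \<alpha> x)))) +
     complex_of_real (4 * g'' ?s) * p x * complex_of_real ?s"
    by (simp only: sum_inner_dunkl_op[OF p] sum_dunkl_op_inner[OF p P] sum_Basis_inner_of_real)
  also have "\<dots> = dunkl_laplacian P k p x * complex_of_real (g ?s) +
     complex_of_real (2 * g' ?s) * (of_nat (CARD('n) + m + m) * p x + ((\<Sum>\<alpha>\<in>P. complex_of_real (k \<alpha>) * (p x - p (reflection \<alpha> x))) + (\<Sum>\<alpha>\<in>P. complex_of_real (k \<alpha>) * (p x + p (reflection \<alpha> x))))) +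
     complex_of_real (4 * g'' ?s) * p x * complex_of_real ?s"
    by (simp add: algebra_simps)
  also have "(\<Sum>\<alpha>\<in>P. complex_of_real (k \<alpha>) * (p x - p (reflection \<alpha> x))) + (\<Sum>\<alpha>\<in>P. complex_of_real (k \<alpha>) * (p x + p (reflection \<alpha> x)))
     = complex_of_real (2 * mult_index P k) * p x"
    by (simp add: mult_index_def sum_distrib_left sum_distrib_right mult_ac flip: sum.distrib distrib_left)
  finally show ?thesis by (simp add: algebra_simps)
qed

section \<open>Dunkl harmonics and the Fischer decomposition\<close>

lemma dunkl_laplacian_add:
  fixes f g :: "real^'n \<Rightarrow> complex"
  assumes S: "open S" "\<And>\<alpha> y. \<alpha> \<in> P \<Longrightarrow> y \<in> S \<Longrightarrow> reflection \<alpha> y \<in> S" "x \<in> S"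
    and f: "\<And>y. y \<in> S \<Longrightarrow> f differentiable (at y)" "\<And>\<xi> y. y \<in> S \<Longrightarrow> dunkl_op P k \<xi> f differentiable (at y)"
    and g: "\<And>y. y \<in> S \<Longrightarrow> g differentiable (at y)" "\<And>\<xi> y. y \<in> S \<Longrightarrow> dunkl_op P k \<xi> g differentiable (at y)"
  shows "dunkl_laplacian P k (\<lambda>y. f y + g y) x = dunkl_laplacian P k f x + dunkl_laplacian P k g x"
proof -
  have "dunkl_op P k \<xi> (dunkl_op P k \<xi> (\<lambda>y. f y + g y)) x = dunkl_op P k \<xi> (\<lambda>y. dunkl_op P k \<xi> f y + dunkl_op P k \<xi> g y) x" for \<xi>
    using S f g by (intro dunkl_op_cong[OF S(1)]) (auto intro: dunkl_op_add)
  then show ?thesis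
    using S f g by (simp add: dunkl_laplacian_def dunkl_op_add sum.distrib)
qed

lemma dunkl_laplacian_cmult:
  fixes f :: "real^'n \<Rightarrow> complex"
  assumes S: "open S" "\<And>\<alpha> y. \<alpha> \<in> P \<Longrightarrow> y \<in> S \<Longrightarrow> reflection \<alpha> y \<in> S" "x \<in> S"
    and f: "\<And>y. y \<in> S \<Longrightarrow> f differentiable (at y)" "\<And>\<xi> y. y \<in> S \<Longrightarrow> dunkl_op P k \<xi> f differentiable (at y)"
  shows "dunkl_laplacian P k (\<lambda>y. c * f y) x = c * dunkl_laplacian P k f x"
proof -
  have "dunkl_op P k \<xi> (dunkl_op P k \<xi> (\<lambda>y. c * f y)) x = dunkl_op P k \<xi> (\<lambda>y. c * dunkl_op P k \<xi> f y) x" for \<xi>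
    using S f by (intro dunkl_op_cong[OF S(1)]) (auto intro: dunkl_op_cmult)
  then show ?thesis
    using S f by (simp add: dunkl_laplacian_def dunkl_op_cmult sum_distrib_left)
qed

lemma dunkl_laplacian_polynomial_add:
  fixes p q :: "real^'n \<Rightarrow> complex"
  assumes "homogeneous_polynomial m p" "homogeneous_polynomial n q" "0 \<notin> P"
  shows "dunkl_laplacian P k (\<lambda>y. p y + q y) x = dunkl_laplacian P k p x + dunkl_laplacian P k q x"
  using assms
  by (intro dunkl_laplacian_add[where S = UNIV])
    (auto intro: homogeneous_polynomial_differentiable dunkl_op_polynomial_differentiable)

lemma dunkl_laplacian_polynomial_cmult:
  fixes p :: "real^'n \<Rightarrow> complex"
  assumes "homogeneous_polynomial m p" "0 \<notin> P"
  shows "dunkl_laplacian P k (\<lambda>y. c * p y) x = c * dunkl_laplacian P k p x"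
  using assms
  by (intro dunkl_laplacian_cmult[where S = UNIV])
    (auto intro: homogeneous_polynomial_differentiable dunkl_op_polynomial_differentiable)

lemma dunkl_laplacian_zero: "dunkl_laplacian P k (\<lambda>x. 0) x = 0" for x :: "real^'n"
  by (simp add: dunkl_laplacian_def dunkl_op_zero)

lemma dunkl_laplacian_polynomial_sum:
  fixes p :: "'i \<Rightarrow> real^'n \<Rightarrow> complex"
  assumes "\<And>i. i \<in> I \<Longrightarrow> homogeneous_polynomial m (p i)" "0 \<notin> P"
  shows "dunkl_laplacian P k (\<lambda>y. \<Sum>i\<in>I. p i y) x = (\<Sum>i\<in>I. dunkl_laplacian P k (p i) x)"
  using assms
  by (induction I rule: infinite_finite_induct)
    (auto simp: dunkl_laplacian_zero dunkl_laplacian_polynomial_add[where m = m and n = m] homogeneous_polynomial_sum)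

lemma dunkl_harmonicsD:
  assumes "p \<in> dunkl_harmonics P k m"
  shows "homogeneous_polynomial m p" "dunkl_laplacian P k p x = 0"
  using assms by (auto simp: dunkl_harmonics_def)

lemma dunkl_harmonics_zero: "0 \<notin> P \<Longrightarrow> (\<lambda>x. 0) \<in> dunkl_harmonics P k m"
  by (simp add: dunkl_harmonics_def homogeneous_polynomial_zero dunkl_laplacian_zero)

lemma dunkl_harmonics_add:
  "0 \<notin> P \<Longrightarrow> p \<in> dunkl_harmonics P k m \<Longrightarrow> q \<in> dunkl_harmonics P k m \<Longrightarrow> (\<lambda>x. p x + q x) \<in> dunkl_harmonics P k m"
  by (auto simp: dunkl_harmonics_def homogeneous_polynomial_add dunkl_laplacian_polynomial_add)

lemma dunkl_harmonics_cmult: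
  "0 \<notin> P \<Longrightarrow> p \<in> dunkl_harmonics P k m \<Longrightarrow> (\<lambda>x. c * p x) \<in> dunkl_harmonics P k m"
  by (auto simp: dunkl_harmonics_def homogeneous_polynomial_cmult dunkl_laplacian_polynomial_cmult)

text \<open>For a non-negative multiplicity the factor is positive, so on harmonic polynomials times powers of the squared norm the Laplacian can
  be inverted explicitly.\<close>

lemma dunkl_laplacian_norm_power:
  fixes p :: "real^'n \<Rightarrow> complex"
  assumes p: "p \<in> dunkl_harmonics P k m" and P: "0 \<notin> P"
  shows "dunkl_laplacian P k (\<lambda>y. complex_of_real ((y \<bullet> y) ^ Suc j) * p y) x =
    complex_of_real (2 * real (Suc j) * (2 * real m + real CARD('n) + 2 * mult_index P k + 2 * real j)) * (complex_of_real ((x \<bullet> x) ^ j) * p x)"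
proof -
  have d1: "((\<lambda>s. s ^ Suc j) has_real_derivative (\<lambda>s. real (Suc j) * s ^ j) s) (at s)" for s :: real
    using DERIV_pow[of "Suc j" s] by simp
  have d2: "((\<lambda>s. real (Suc j) * s ^ j) has_real_derivative (\<lambda>s. real (Suc j) * (real j * s ^ (j - 1))) s) (at s)" for s :: real
    using DERIV_cmult[OF DERIV_pow[of j s], of "real (Suc j)"] by simp
  have pow: "s * (real j * s ^ (j - 1)) = real j * s ^ j" for s :: real
    by (cases j) auto
  have "dunkl_laplacian P k (\<lambda>y. p y * complex_of_real ((y \<bullet> y) ^ Suc j)) x =
    complex_of_real (2 * (real (Suc j) * (x \<bullet> x) ^ j) * (2 * real m + real CARD('n) + 2 * mult_index P k) + 4 * real (Suc j) * ((x \<bullet> x) * (real j * (x \<bullet> x) ^ (j - 1)))) * p x"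
    using dunkl_laplacian_radial[OF dunkl_harmonicsD(1)[OF p] P open_UNIV _ d1 d2, of x k]
    by (simp add: dunkl_harmonicsD(2)[OF p] mult_ac)
  moreover have "2 * (real (Suc j) * (x \<bullet> x) ^ j) * (2 * real m + real CARD('n) + 2 * mult_index P k) + 4 * real (Suc j) * ((x \<bullet> x) * (real j * (x \<bullet> x) ^ (j - 1)))
    = 2 * real (Suc j) * (2 * real m + real CARD('n) + 2 * mult_index P k + 2 * real j) * (x \<bullet> x) ^ j"
    unfolding pow by (simp add: algebra_simps)
  moreover have "(\<lambda>y. complex_of_real ((y \<bullet> y) ^ Suc j) * p y) = (\<lambda>y. p y * complex_of_real ((y \<bullet> y) ^ Suc j))"
    by (simp only: mult.commute)
  ultimately show ?thesis by (simp only: of_real_mult mult.assoc)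
qed

text \<open>Decompose the Laplacian of \<open>q\<close>, which has degree \<open>m - 2\<close>, by induction.  Dividing each component by the
  factor of the preceding lemma yields a polynomial \<open>t\<close> that has the same Laplacian and is a multiple of
  the squared norm; the difference \<open>q - t\<close> is the new harmonic component.\<close>

theorem Fischer_decomposition:
  fixes q :: "real^'n \<Rightarrow> complex"
  assumes P: "0 \<notin> P" and k: "0 \<le> mult_index P k" and q: "homogeneous_polynomial m q"
  shows "\<exists>h. (\<forall>i\<le>m div 2. h i \<in> dunkl_harmonics P k (m - 2 * i)) \<and>
    q = (\<lambda>x. \<Sum>i\<le>m div 2. complex_of_real ((x \<bullet> x) ^ i) * h i x)"
  using q
proof (induction m arbitrary: q rule: less_induct)
  case (less m)
  note hL = homogeneous_polynomial_dunkl_laplacian[OF less.prems P, of k]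
  show ?case
  proof (cases "m < 2")
    case True
    with hL have "q \<in> dunkl_harmonics P k m"
      using less.prems by (simp add: dunkl_harmonics_def)
    then show ?thesis using True by (intro exI[of _ "\<lambda>_. q"]) auto
  next
    case False
    define n where "n = m - 2"
    have m: "m = Suc (Suc n)" using False by (simp add: n_def)
    obtain h where h: "\<And>i. i \<le> n div 2 \<Longrightarrow> h i \<in> dunkl_harmonics P k (n - 2 * i)"
      and hq: "dunkl_laplacian P k q = (\<lambda>x. \<Sum>i\<le>n div 2. complex_of_real ((x \<bullet> x) ^ i) * h i x)"
      using less.IH[of n "dunkl_laplacian P k q"] hL False by (auto simp: n_def)
    define b where "b i = 2 * real (Suc i) * (2 * real (n - 2 * i) + real CARD('n) + 2 * mult_index P k + 2 * real i)" for i
    have b: "b i \<noteq> 0" for i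
    proof -
      have "real CARD('n) > 0" by simp
      then have "2 * real (n - 2 * i) + real CARD('n) + 2 * mult_index P k + 2 * real i > 0"
        using k by (intro add_pos_nonneg add_nonneg_pos) auto
      then show ?thesis by (simp add: b_def)
    qed
    define h' where "h' i = (\<lambda>x. complex_of_real (1 / b i) * h i x)" for i
    have h': "h' i \<in> dunkl_harmonics P k (n - 2 * i)" if "i \<le> n div 2" for i
      unfolding h'_def by (intro dunkl_harmonics_cmult P h that)
    define t where "t = (\<lambda>x. \<Sum>i\<le>n div 2. complex_of_real ((x \<bullet> x) ^ Suc i) * h' i x)"
    have thp: "homogeneous_polynomial m (\<lambda>x. complex_of_real ((x \<bullet> x) ^ Suc i) * h' i x)" if "i \<in> {..n div 2}" for i
    proof -
      have "homogeneous_polynomial (2 * Suc i + (n - 2 * i)) (\<lambda>x. complex_of_real ((x \<bullet> x) ^ Suc i) * h' i x)"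
        using that by (intro homogeneous_polynomial_norm_power dunkl_harmonicsD(1)[OF h']) auto
      moreover have "2 * Suc i + (n - 2 * i) = m" using that m by auto
      ultimately show ?thesis by simp
    qed
    have t: "homogeneous_polynomial m t"
      unfolding t_def by (intro homogeneous_polynomial_sum thp)
    have "dunkl_laplacian P k t x = dunkl_laplacian P k q x" for x
    proof -
      have "dunkl_laplacian P k t x = (\<Sum>i\<le>n div 2. dunkl_laplacian P k (\<lambda>x. complex_of_real ((x \<bullet> x) ^ Suc i) * h' i x) x)"
        unfolding t_def by (rule dunkl_laplacian_polynomial_sum[OF thp P])
      also have "\<dots> = (\<Sum>i\<le>n div 2. complex_of_real ((x \<bullet> x) ^ i) * h i x)"
      proof (intro sum.cong refl)
        fix i assume i: "i \<in> {..n div 2}"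
        have "complex_of_real (b i) * complex_of_real (1 / b i) = 1"
          using b[of i] by (simp flip: of_real_mult)
        then have "complex_of_real (b i) * (c * (complex_of_real (1 / b i) * d)) = c * d" for c d
          by (metis mult.assoc mult.left_commute mult_1)
        then show "dunkl_laplacian P k (\<lambda>x. complex_of_real ((x \<bullet> x) ^ Suc i) * h' i x) x = complex_of_real ((x \<bullet> x) ^ i) * h i x"
          using i by (simp only: dunkl_laplacian_norm_power[OF h' P] b_def[symmetric] atMost_iff) (simp only: h'_def)
      qed
      finally show ?thesis by (simp add: hq)
    qed
    then have h0: "(\<lambda>x. q x + (- 1) * t x) \<in> dunkl_harmonics P k m"
      using less.prems t P
      by (simp add: dunkl_harmonics_def homogeneous_polynomial_add[OF less.prems homogeneous_polynomial_cmult[OF t, of "-1"], simplified]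
          dunkl_laplacian_polynomial_add[OF less.prems homogeneous_polynomial_cmult[OF t, of "-1"] P, simplified]
          dunkl_laplacian_polynomial_cmult[OF t P, of k "-1", simplified])
    define H where "H i = (case i of 0 \<Rightarrow> (\<lambda>x. q x + (- 1) * t x) | Suc j \<Rightarrow> h' j)" for i
    have md: "m div 2 = Suc (n div 2)" by (simp add: m)
    have "H i \<in> dunkl_harmonics P k (m - 2 * i)" if "i \<le> m div 2" for i
      using that h0 h' by (cases i) (auto simp: H_def md m)
    moreover have "q = (\<lambda>x. \<Sum>i\<le>m div 2. complex_of_real ((x \<bullet> x) ^ i) * H i x)"
      unfolding md sum.atMost_Suc_shift by (simp add: H_def t_def)
    ultimately show ?thesis by blast
  qed
qed

section \<open>Laguerre polynomials\<close>

text \<open>The value zero for \<open>j > l\<close> lets the recursion of the coefficients hold for all \<open>j\<close>.\<close>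

definition laguerre_coeff :: "nat \<Rightarrow> real \<Rightarrow> nat \<Rightarrow> real" where
  "laguerre_coeff l lam j = (if j \<le> l then (-1) ^ j * Gamma (lam + real l + 1) / (fact (l - j) * Gamma (lam + real j + 1)) / fact j else 0)"

definition laguerre_poly :: "nat \<Rightarrow> real \<Rightarrow> real poly" where
  "laguerre_poly l lam = (\<Sum>j\<le>l. monom (laguerre_coeff l lam j) j)"

lemma poly_laguerre: "poly (laguerre_poly l lam) t = laguerre l lam t"
  unfolding laguerre_poly_def laguerre_def poly_sum poly_monom
  by (intro sum.cong) (auto simp: laguerre_coeff_def)

lemma coeff_laguerre: "coeff (laguerre_poly l lam) j = laguerre_coeff l lam j"
proof -
  have "coeff (laguerre_poly l lam) j = (\<Sum>i\<le>l. if i = j then laguerre_coeff l lam j else 0)"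
    unfolding laguerre_poly_def coeff_sum by (intro sum.cong) auto
  then show ?thesis by (auto simp: laguerre_coeff_def)
qed

lemma laguerre_coeff_rec:
  assumes "lam > -1"
  shows "real (Suc j) * (lam + real j + 1) * laguerre_coeff l lam (Suc j) = - (real l - real j) * laguerre_coeff l lam j"
proof (cases "j < l")
  case True
  have pos: "lam + real j + 1 > 0" using assms by simp
  have G: "Gamma (lam + real (Suc j) + 1) = (lam + real j + 1) * Gamma (lam + real j + 1)"
  proof -
    have "lam + real j + 1 \<notin> \<int>\<^sub>\<le>\<^sub>0" using pos nonpos_Ints_nonpos[of "lam + real j + 1"] by auto
    from Gamma_plus1[OF this] show ?thesis by (simp add: add_ac)
  qed
  have F: "fact (l - j) = (real l - real j) * (fact (l - Suc j) :: real)"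
    using True by (subst fact_reduce) (auto simp: of_nat_diff)
  have nz: "Gamma (lam + real j + 1) \<noteq> 0" "real l - real j \<noteq> 0" "(fact (l - Suc j) :: real) \<noteq> 0" "(fact j :: real) \<noteq> 0" "real (Suc j) \<noteq> 0"
    using Gamma_real_pos[OF pos] True by auto
  show ?thesis
    using True pos nz unfolding laguerre_coeff_def G F fact_Suc
    by (simp add: divide_simps del: of_nat_Suc) (simp add: algebra_simps)
next
  case False
  then show ?thesis by (cases "j = l") (auto simp: laguerre_coeff_def)
qed

text \<open>Laguerre's equation; comparing coefficients, it is their two-term recursion.\<close>

lemma laguerre_ode:
  fixes l :: nat and lam t :: real
  assumes "lam > -1"
  defines "L \<equiv> laguerre_poly l lam"
  shows "t * poly (pderiv (pderiv L)) t + (lam + 1 - t) * poly (pderiv L) t + real l * poly L t = 0"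
proof -
  have "pCons 0 (pderiv (pderiv L)) + smult (lam + 1) (pderiv L) - pCons 0 (pderiv L) + smult (real l) L = 0"
  proof (rule poly_eqI)
    fix j
    have "coeff (pCons 0 (pderiv (pderiv L))) j = real j * (real (Suc j) * laguerre_coeff l lam (Suc j))"
      by (cases j) (auto simp: coeff_pderiv L_def coeff_laguerre)
    moreover have "coeff (pCons 0 (pderiv L)) j = real j * laguerre_coeff l lam j"
      by (cases j) (auto simp: coeff_pderiv L_def coeff_laguerre)
    ultimately show "coeff (pCons 0 (pderiv (pderiv L)) + smult (lam + 1) (pderiv L) - pCons 0 (pderiv L) + smult (real l) L) j = coeff 0 j"
      using laguerre_coeff_rec[OF assms(1), of j l]
      by (simp add: coeff_pderiv coeff_laguerre L_def algebra_simps)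
  qed
  then have "poly (pCons 0 (pderiv (pderiv L)) + smult (lam + 1) (pderiv L) - pCons 0 (pderiv L) + smult (real l) L) t = 0"
    by simp
  then show ?thesis by (simp add: algebra_simps)
qed

section \<open>The functions Phi are eigenfunctions\<close>

definition Phi_eigenvalue :: "(real^'n) set \<Rightarrow> (real^'n \<Rightarrow> real) \<Rightarrow> real \<Rightarrow> nat \<Rightarrow> nat \<Rightarrow> real" where
  "Phi_eigenvalue P k a l m = - (a * (2 * real l + lambda_kam P k a m + 1))"

text \<open>The radial factor of \<open>\<Phi>\<close> as a function of the squared norm, the variable in which
  \<open>dunkl_laplacian_radial\<close> is stated.\<close>

definition Phi_profile :: "real \<Rightarrow> real \<Rightarrow> nat \<Rightarrow> real \<Rightarrow> real" where
  "Phi_profile a lam l s = laguerre l lam (2 / a * s powr (a / 2)) * exp (- (2 / a * s powr (a / 2)) / 2)"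

lemma norm_powr_inner: "norm x powr a = (x \<bullet> x) powr (a / 2)"
proof -
  have "norm x powr 2 = x \<bullet> x" by (simp add: power2_norm_eq_inner)
  then have "(x \<bullet> x) powr (a / 2) = (norm x powr 2) powr (a / 2)" by (simp only:)
  also have "\<dots> = norm x powr (2 * (a / 2))" by (rule powr_powr)
  finally show ?thesis by simp
qed

lemma Phi_eq_profile:
  fixes x :: "real^'n"
  shows "Phi P k a l m p x = p x * complex_of_real (Phi_profile a (lambda_kam P k a m) l (x \<bullet> x))"
  by (simp add: Phi_def Phi_profile_def norm_powr_inner)

text \<open>With \<open>\<tau> s = 2 / a * s powr (a / 2)\<close> one has \<open>s * \<tau>' s = a / 2 * \<tau> s\<close>.  By the chain rule the left-hand side
  is \<open>2 a\<close> times Laguerre's operator in the variable \<open>\<tau>\<close>, conjugated with \<open>exp (- \<tau> / 2)\<close>.  The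
  coefficient \<open>a * (lam + 1) + 2 - a\<close> is the number \<open>2 m + N + 2\<langle>k\<rangle>\<close> of the radial formula.\<close>

lemma Phi_profile_derivatives:
  fixes l :: nat and a lam :: real
  assumes a: "a > 0" and lam: "lam > -1"
  obtains g' g'' where
    "\<And>s. s > 0 \<Longrightarrow> (Phi_profile a lam l has_real_derivative g' s) (at s)"
    "\<And>s. s > 0 \<Longrightarrow> (g' has_real_derivative g'' s) (at s)"
    "\<And>s. s > 0 \<Longrightarrow> s powr ((2 - a) / 2) * (2 * g' s * (a * (lam + 1) + 2 - a) + 4 * s * g'' s) - s powr (a / 2) * Phi_profile a lam l s
       = - (a * (2 * real l + lam + 1)) * Phi_profile a lam l s"
proof -
  define L where "L = laguerre_poly l lam"
  define \<tau> where "\<tau> s = 2 / a * s powr (a / 2)" for s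
  define h where "h t = poly L t * exp (- t / 2)" for t
  define h' where "h' t = (poly (pderiv L) t - poly L t / 2) * exp (- t / 2)" for t
  define h'' where "h'' t = (poly (pderiv (pderiv L)) t - poly (pderiv L) t + poly L t / 4) * exp (- t / 2)" for t
  have dh: "(h has_real_derivative h' t) (at t)" for t
    unfolding h_def[abs_def] h'_def by (auto intro!: derivative_eq_intros simp: algebra_simps)
  have dh': "(h' has_real_derivative h'' t) (at t)" for t
    unfolding h'_def[abs_def] h''_def by (auto intro!: derivative_eq_intros simp: field_simps)
  have d\<tau>: "(\<tau> has_real_derivative a / 2 * \<tau> s / s) (at s)" if "s > 0" for s
  proof -
    have "(\<tau> has_real_derivative 2 / a * (a / 2 * s powr (a / 2 - 1))) (at s)"
      unfolding \<tau>_def[abs_def] by (intro DERIV_cmult has_real_derivative_powr that)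
    moreover have "s powr (a / 2 - 1) = s powr (a / 2) / s" using that by (simp add: powr_diff)
    ultimately show ?thesis using a by (simp add: \<tau>_def field_simps)
  qed
  have prof: "Phi_profile a lam l s = h (\<tau> s)" for s
    by (simp add: Phi_profile_def h_def \<tau>_def L_def poly_laguerre)
  define g' where "g' s = h' (\<tau> s) * (a / 2 * \<tau> s / s)" for s
  define g'' where "g'' s = h'' (\<tau> s) * (a / 2 * \<tau> s / s) * (a / 2 * \<tau> s / s) + h' (\<tau> s) * (a / 2 * (a / 2 * \<tau> s / s) / s - a / 2 * \<tau> s / (s * s))" for s
  show ?thesis
  proof (rule that[of g' g''])
    fix s :: real assume s: "s > 0"
    show "(Phi_profile a lam l has_real_derivative g' s) (at s)"
      unfolding prof[abs_def] g'_def by (rule DERIV_chain2[OF dh d\<tau>[OF s]])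
    have "((\<lambda>s. h' (\<tau> s) * (a / 2 * \<tau> s / s)) has_real_derivative
       h'' (\<tau> s) * (a / 2 * \<tau> s / s) * (a / 2 * \<tau> s / s) + (a / 2 * (a / 2 * \<tau> s / s) * s - a / 2 * \<tau> s * 1) / (s * s) * h' (\<tau> s)) (at s)"
      by (intro DERIV_mult DERIV_chain2[OF dh' d\<tau>[OF s]] DERIV_divide DERIV_cmult d\<tau>[OF s] DERIV_ident) (use s in auto)
    then show "(g' has_real_derivative g'' s) (at s)"
      unfolding g'_def[abs_def] g''_def using s by (simp add: field_simps)
    have ode: "\<tau> s * h'' (\<tau> s) + (lam + 1) * h' (\<tau> s) - \<tau> s / 4 * h (\<tau> s) = - (real l + (lam + 1) / 2) * h (\<tau> s)"
    proof -
      have "\<tau> s * h'' (\<tau> s) + (lam + 1) * h' (\<tau> s) - \<tau> s / 4 * h (\<tau> s) + (real l + (lam + 1) / 2) * h (\<tau> s)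
        = (\<tau> s * poly (pderiv (pderiv L)) (\<tau> s) + (lam + 1 - \<tau> s) * poly (pderiv L) (\<tau> s) + real l * poly L (\<tau> s)) * exp (- \<tau> s / 2)"
        by (simp add: h_def h'_def h''_def algebra_simps add_divide_distrib)
      also have "\<dots> = 0" using laguerre_ode[OF lam, of "\<tau> s" l] by (simp add: L_def)
      finally show ?thesis by (simp add: algebra_simps)
    qed
    have pw: "s powr ((2 - a) / 2) * \<tau> s / s = 2 / a"
    proof -
      have "s powr ((2 - a) / 2) * s powr (a / 2) = s powr 1" by (simp flip: powr_add add: field_simps)
      then show ?thesis using s by (simp add: \<tau>_def field_simps)
    qed
    have "2 * g' s * (a * (lam + 1) + 2 - a) + 4 * s * g'' s = a * a * \<tau> s / s * (\<tau> s * h'' (\<tau> s) + (lam + 1) * h' (\<tau> s))"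
      unfolding g'_def g''_def using s by (simp add: field_simps)
    then have "s powr ((2 - a) / 2) * (2 * g' s * (a * (lam + 1) + 2 - a) + 4 * s * g'' s) = a * a * (s powr ((2 - a) / 2) * \<tau> s / s) * (\<tau> s * h'' (\<tau> s) + (lam + 1) * h' (\<tau> s))"
      by simp
    also have "\<dots> = 2 * a * (\<tau> s * h'' (\<tau> s) + (lam + 1) * h' (\<tau> s))"
      unfolding pw using a by simp
    finally have 1: "s powr ((2 - a) / 2) * (2 * g' s * (a * (lam + 1) + 2 - a) + 4 * s * g'' s) = 2 * a * (\<tau> s * h'' (\<tau> s) + (lam + 1) * h' (\<tau> s))" .
    have 2: "s powr (a / 2) = 2 * a * (\<tau> s / 4)" using a by (simp add: \<tau>_def)
    have "s powr ((2 - a) / 2) * (2 * g' s * (a * (lam + 1) + 2 - a) + 4 * s * g'' s) - s powr (a / 2) * Phi_profile a lam l s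
      = 2 * a * (\<tau> s * h'' (\<tau> s) + (lam + 1) * h' (\<tau> s) - \<tau> s / 4 * h (\<tau> s))"
      unfolding 1 2 prof by (simp add: algebra_simps)
    also have "\<dots> = - (a * (2 * real l + lam + 1)) * Phi_profile a lam l s"
      unfolding ode prof by (simp add: algebra_simps)
    finally show "s powr ((2 - a) / 2) * (2 * g' s * (a * (lam + 1) + 2 - a) + 4 * s * g'' s) - s powr (a / 2) * Phi_profile a lam l s
       = - (a * (2 * real l + lam + 1)) * Phi_profile a lam l s" .
  qed
qed

text \<open>The domain on which the Dunkl Laplacian is additive.  The origin is left out because \<open>norm x powr a\<close>
  may fail to be differentiable there; the rest is invariant under the reflections.\<close>

definition dunkl_smooth :: "(real^'n) set \<Rightarrow> (real^'n \<Rightarrow> real) \<Rightarrow> (real^'n \<Rightarrow> complex) \<Rightarrow> bool" where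
  "dunkl_smooth P k f \<longleftrightarrow> (\<forall>x\<in>-{0}. f differentiable (at x) \<and> (\<forall>\<xi>. dunkl_op P k \<xi> f differentiable (at x)))"

lemma differentiable_cong_open:
  assumes "open S" "x \<in> S" "\<And>y. y \<in> S \<Longrightarrow> f y = g y" "g differentiable (at x)"
  shows "f differentiable (at x)"
proof -
  obtain g' where "(g has_derivative g') (at x)" using assms(4) by (auto simp: differentiable_def)
  then have "(f has_derivative g') (at x)"
    using assms by (intro has_derivative_transform_within_open[of g g' x UNIV S f]) auto
  then show ?thesis by (auto simp: differentiable_def)
qed

lemma reflection_punctured: "0 \<notin> P \<Longrightarrow> \<alpha> \<in> P \<Longrightarrow> y \<in> -{0} \<Longrightarrow> reflection \<alpha> y \<in> -{0}"
  using reflection_eq_0_iff[of \<alpha> y] by auto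

lemma
  fixes p :: "real^'n \<Rightarrow> complex"
  assumes p: "p \<in> dunkl_harmonics P k m" and P: "0 \<notin> P" and a: "a > 0"
    and lam: "lambda_kam P k a m > -1"
  shows Phi_smooth: "dunkl_smooth P k (Phi P k a l m p)"
    and Phi_eigenfunction: "x \<noteq> 0 \<Longrightarrow> ka_operator P k a (Phi P k a l m p) x = complex_of_real (Phi_eigenvalue P k a l m) * Phi P k a l m p x"
proof -
  let ?lam = "lambda_kam P k a m"
  let ?g = "Phi_profile a ?lam l"
  obtain g' g'' where
    g': "\<And>s. s > 0 \<Longrightarrow> (?g has_real_derivative g' s) (at s)" and
    g'': "\<And>s. s > 0 \<Longrightarrow> (g' has_real_derivative g'' s) (at s)" and
    eq: "\<And>s. s > 0 \<Longrightarrow> s powr ((2 - a) / 2) * (2 * g' s * (a * (?lam + 1) + 2 - a) + 4 * s * g'' s) - s powr (a / 2) * ?g s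
       = - (a * (2 * real l + ?lam + 1)) * ?g s"
    using Phi_profile_derivatives[OF a lam] by blast
  note hp = dunkl_harmonicsD(1)[OF p]
  note dp = homogeneous_polynomial_differentiable[OF hp]
  have Phi: "Phi P k a l m p = (\<lambda>y. p y * complex_of_real (?g (y \<bullet> y)))"
    by (rule ext) (rule Phi_eq_profile)
  have dg: "(\<lambda>y. complex_of_real (?g (y \<bullet> y))) differentiable (at y)" "(\<lambda>y. complex_of_real (g' (y \<bullet> y))) differentiable (at y)"
    if "y \<noteq> 0" for y :: "real^'n"
    using has_derivative_radial[OF g'[of "y \<bullet> y"]] has_derivative_radial[OF g''[of "y \<bullet> y"]] that
    by (auto simp: differentiable_def)
  show "dunkl_smooth P k (Phi P k a l m p)"
    unfolding dunkl_smooth_def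
  proof (intro ballI conjI allI)
    fix x :: "real^'n" and \<xi> assume x: "x \<in> -{0}"
    then show "Phi P k a l m p differentiable (at x)"
      unfolding Phi using dg by (intro differentiable_mult dp) auto
    let ?G = "\<lambda>y. dunkl_op P k \<xi> p y * complex_of_real (?g (y \<bullet> y)) + p y * (2 * (complex_of_real (\<xi> \<bullet> y) * complex_of_real (g' (y \<bullet> y))))"
    show "dunkl_op P k \<xi> (Phi P k a l m p) differentiable (at x)"
    proof (rule differentiable_cong_open[where g = ?G, OF _ x])
      fix y :: "real^'n" assume "y \<in> -{0}"
      then show "dunkl_op P k \<xi> (Phi P k a l m p) y = ?G y"
        unfolding Phi using dunkl_op_radial[OF dp g'[of "y \<bullet> y"] P, of k \<xi>] by (simp add: inner_commute mult_ac)
    next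
      show "?G differentiable (at x)"
        using x dg by (intro differentiable_add differentiable_mult dp differentiable_const inner_of_real_differentiable
            dunkl_op_polynomial_differentiable[OF hp P]) auto
    qed auto
  qed
  show "ka_operator P k a (Phi P k a l m p) x = complex_of_real (Phi_eigenvalue P k a l m) * Phi P k a l m p x" if x: "x \<noteq> 0"
  proof -
    let ?s = "x \<bullet> x"
    have s: "?s > 0" using x by simp
    have factor: "complex_of_real A * (complex_of_real B * z) - complex_of_real C * (z * complex_of_real D) = complex_of_real (A * B - C * D) * z" for A B C D z
      by (simp add: algebra_simps)
    have N: "2 * real m + real CARD('n) + 2 * mult_index P k = a * (?lam + 1) + 2 - a"
      using a by (simp add: lambda_kam_def distrib_left)
    have "dunkl_laplacian P k (Phi P k a l m p) x = dunkl_laplacian P k p x * complex_of_real (?g ?s) +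
      complex_of_real (2 * g' ?s * (2 * real m + real CARD('n) + 2 * mult_index P k) + 4 * ?s * g'' ?s) * p x"
      unfolding Phi
      by (rule dunkl_laplacian_radial[where S = "-{0}"]) (use hp P x g' g'' reflection_punctured[OF P] in auto)
    then have "dunkl_laplacian P k (Phi P k a l m p) x = complex_of_real (2 * g' ?s * (a * (?lam + 1) + 2 - a) + 4 * ?s * g'' ?s) * p x"
      unfolding N by (simp add: dunkl_harmonicsD(2)[OF p])
    then have "ka_operator P k a (Phi P k a l m p) x = complex_of_real (?s powr ((2 - a) / 2)) * (complex_of_real (2 * g' ?s * (a * (?lam + 1) + 2 - a) + 4 * ?s * g'' ?s) * p x)
        - complex_of_real (?s powr (a / 2)) * (p x * complex_of_real (?g ?s))"
      by (simp only: ka_operator_def norm_powr_inner Phi)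
    also have "\<dots> = complex_of_real (?s powr ((2 - a) / 2) * (2 * g' ?s * (a * (?lam + 1) + 2 - a) + 4 * ?s * g'' ?s) - ?s powr (a / 2) * ?g ?s) * p x"
      by (rule factor)
    also have "\<dots> = complex_of_real (Phi_eigenvalue P k a l m) * (p x * complex_of_real (?g ?s))"
      unfolding eq[OF s] Phi_eigenvalue_def by (simp only: of_real_mult mult_ac)
    finally show ?thesis by (simp only: Phi)
  qed
qed

lemma ka_operator_sum:
  fixes f :: "'i \<Rightarrow> real^'n \<Rightarrow> complex"
  assumes P: "0 \<notin> P" and "finite I" and "\<And>i. i \<in> I \<Longrightarrow> dunkl_smooth P k (f i)" and x: "x \<noteq> 0"
  shows "ka_operator P k a (\<lambda>x. \<Sum>i\<in>I. c i * f i x) x = (\<Sum>i\<in>I. c i * ka_operator P k a (f i) x)"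
proof -
  note S = open_Compl[OF closed_singleton, of "0 :: real^'n"] reflection_punctured[OF P]
  have cm: "dunkl_smooth P k (\<lambda>x. b * f i x) \<and> dunkl_laplacian P k (\<lambda>x. b * f i x) x = b * dunkl_laplacian P k (f i) x" if "i \<in> I" for i b
  proof
    from assms(3)[OF that]
    have fi: "\<And>y. y \<in> -{0} \<Longrightarrow> f i differentiable (at y)" "\<And>\<xi> y. y \<in> -{0} \<Longrightarrow> dunkl_op P k \<xi> (f i) differentiable (at y)"
      by (auto simp: dunkl_smooth_def)
    show "dunkl_laplacian P k (\<lambda>x. b * f i x) x = b * dunkl_laplacian P k (f i) x"
      by (rule dunkl_laplacian_cmult[OF S]) (use x fi in auto)
    show "dunkl_smooth P k (\<lambda>x. b * f i x)"
      unfolding dunkl_smooth_def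
    proof (intro ballI conjI allI)
      fix y :: "real^'n" and \<xi> assume y: "y \<in> -{0}"
      show "(\<lambda>x. b * f i x) differentiable (at y)" using fi(1)[OF y] by (intro differentiable_mult) auto
      show "dunkl_op P k \<xi> (\<lambda>x. b * f i x) differentiable (at y)"
        by (rule differentiable_cong_open[OF S(1) y dunkl_op_cmult]) (use fi y in \<open>auto intro!: differentiable_mult\<close>)
    qed
  qed
  have "dunkl_smooth P k (\<lambda>x. \<Sum>i\<in>J. c i * f i x) \<and>
      dunkl_laplacian P k (\<lambda>x. \<Sum>i\<in>J. c i * f i x) x = (\<Sum>i\<in>J. c i * dunkl_laplacian P k (f i) x)" if "finite J" "J \<subseteq> I" for J
    using that
  proof (induction J rule: finite_induct)
    case empty
    show ?case by (auto simp: dunkl_smooth_def dunkl_op_zero dunkl_laplacian_zero)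
  next
    case (insert j J)
    let ?f = "\<lambda>x. c j * f j x" and ?g = "\<lambda>x. \<Sum>i\<in>J. c i * f i x"
    from insert cm[of j "c j"] have
      fi: "\<And>y. y \<in> -{0} \<Longrightarrow> ?f differentiable (at y)" "\<And>\<xi> y. y \<in> -{0} \<Longrightarrow> dunkl_op P k \<xi> ?f differentiable (at y)"
      and gi: "\<And>y. y \<in> -{0} \<Longrightarrow> ?g differentiable (at y)" "\<And>\<xi> y. y \<in> -{0} \<Longrightarrow> dunkl_op P k \<xi> ?g differentiable (at y)"
      by (auto simp: dunkl_smooth_def)
    have eq: "(\<lambda>x. \<Sum>i\<in>insert j J. c i * f i x) = (\<lambda>x. ?f x + ?g x)"
      using insert by auto
    have "dunkl_laplacian P k (\<lambda>x. ?f x + ?g x) x = dunkl_laplacian P k ?f x + dunkl_laplacian P k ?g x"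
      by (rule dunkl_laplacian_add[OF S]) (use x fi gi in auto)
    moreover have "dunkl_smooth P k (\<lambda>x. ?f x + ?g x)"
      unfolding dunkl_smooth_def
    proof (intro ballI conjI allI)
      fix y :: "real^'n" and \<xi> assume y: "y \<in> -{0}"
      show "(\<lambda>x. ?f x + ?g x) differentiable (at y)" using fi(1)[OF y] gi(1)[OF y] by (intro differentiable_add)
      show "dunkl_op P k \<xi> (\<lambda>x. ?f x + ?g x) differentiable (at y)"
        by (rule differentiable_cong_open[OF S(1) y dunkl_op_add]) (use fi gi y in \<open>auto intro!: differentiable_add\<close>)
    qed
    ultimately show ?case unfolding eq using insert cm[of j "c j"] by simp
  qed
  from this[OF assms(2) order.refl] show ?thesis
    by (simp add: ka_operator_def sum_distrib_left right_diff_distrib sum_subtractf mult_ac)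
qed

section \<open>Invariance properties of Lebesgue measure\<close>

lemma nn_integral_lborel_minus:
  fixes h :: "real^'n \<Rightarrow> ennreal"
  assumes [measurable]: "h \<in> borel_measurable borel"
  shows "(\<integral>\<^sup>+x. h (c - x) \<partial>lborel) = (\<integral>\<^sup>+x. h x \<partial>lborel)"
proof -
  have "(\<integral>\<^sup>+x. h x \<partial>lborel) = (\<integral>\<^sup>+x. h x \<partial>density (distr lborel borel (\<lambda>x. c + (-1) *\<^sub>R x)) (\<lambda>x. ennreal (\<bar>-1\<bar> ^ DIM(real^'n))))"
    using lborel_affine[of "-1" c] by simp
  also have "\<dots> = (\<integral>\<^sup>+x. h (c - x) \<partial>lborel)"
    by (simp add: nn_integral_density nn_integral_distr)
  finally show ?thesis by simp
qed

lemma nn_integral_lborel_minus':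
  fixes h :: "real^'n \<Rightarrow> ennreal"
  assumes [measurable]: "h \<in> borel_measurable borel"
  shows "(\<integral>\<^sup>+x. h (x - c) \<partial>lborel) = (\<integral>\<^sup>+x. h x \<partial>lborel)"
proof -
  have "(\<integral>\<^sup>+x. h (x - c) \<partial>lborel) = (\<integral>\<^sup>+x. h ((0 - x) - c) \<partial>lborel)"
    by (rule nn_integral_lborel_minus[symmetric]) measurable
  also have "\<dots> = (\<integral>\<^sup>+x. h (- c - x) \<partial>lborel)"
  proof -
    have "(0 - x) - c = - c - x" for x :: "real^'n" by (simp add: algebra_simps)
    then show ?thesis by (simp only:)
  qed
  also have "\<dots> = (\<integral>\<^sup>+x. h x \<partial>lborel)"
    by (rule nn_integral_lborel_minus) measurable
  finally show ?thesis .
qed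

text \<open>The image measure is translation invariant, so by Fubini it is a multiple of Lebesgue measure: with
  \<open>\<mu>\<close> the image measure, \<open>\<mu> A * vol B = vol A * \<mu> B\<close>.  The unit ball is mapped onto itself, so the
  multiple is one.\<close>

lemma lborel_orthogonal_transformation:
  fixes f :: "real^'n \<Rightarrow> real^'n"
  assumes f: "orthogonal_transformation f"
  shows "distr lborel borel f = lborel"
proof (rule measure_eqI)
  obtain g where fg: "\<And>x. f (g x) = x" and gf: "\<And>x. g (f x) = x"
    using orthogonal_transformation_bij[OF f] by (metis bij_inv_eq_iff)
  have lin: "linear f" by (rule orthogonal_transformation_linear[OF f])
  have [measurable]: "f \<in> borel_measurable borel"
    using lin by (intro borel_measurable_continuous_onI linear_continuous_on linear_conv_bounded_linear[THEN iffD1])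
  fix A assume "A \<in> sets (distr lborel borel f)"
  then have [measurable]: "A \<in> sets borel" by simp
  define B where "B = (cball 0 1 :: (real^'n) set)"
  have [measurable]: "B \<in> sets borel" by (simp add: B_def)
  define \<mu> where "\<mu> S = (\<integral>\<^sup>+x. indicator S (f x) \<partial>(lborel :: (real^'n) measure))" for S :: "(real^'n) set"
  have "f (g y - x) = y - f x" for x y
    using linear_diff[OF lin] by (simp add: fg)
  note swap = this
  have inner: "(\<integral>\<^sup>+y. indicator S (y - c) \<partial>lborel) = emeasure lborel S" if "S \<in> sets borel" for S and c :: "real^'n"
    using nn_integral_lborel_minus'[of "indicator S" c] that by simp
  have "\<mu> A * emeasure lborel B = (\<integral>\<^sup>+x. indicator A (f x) * emeasure lborel B \<partial>lborel)"
    unfolding \<mu>_def by (rule nn_integral_multc[symmetric]) measurable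
  also have "\<dots> = (\<integral>\<^sup>+x. \<integral>\<^sup>+y. indicator A (f x) * indicator B (y - f x) \<partial>lborel \<partial>lborel)"
    by (intro nn_integral_cong) (simp add: nn_integral_cmult inner)
  also have "\<dots> = (\<integral>\<^sup>+y. \<integral>\<^sup>+x. indicator A (f x) * indicator B (y - f x) \<partial>lborel \<partial>lborel)"
    by (rule lborel_pair.Fubini') measurable
  also have "\<dots> = (\<integral>\<^sup>+y. \<integral>\<^sup>+x. indicator A (y - f x) * indicator B (f x) \<partial>lborel \<partial>lborel)"
  proof (rule nn_integral_cong)
    fix y
    have "(\<integral>\<^sup>+x. indicator A (f x) * indicator B (y - f x) \<partial>lborel) = (\<integral>\<^sup>+x. indicator A (f (g y - x)) * indicator B (y - f (g y - x)) \<partial>lborel)"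
      by (rule nn_integral_lborel_minus[symmetric]) measurable
    then show "(\<integral>\<^sup>+x. indicator A (f x) * indicator B (y - f x) \<partial>lborel) = (\<integral>\<^sup>+x. indicator A (y - f x) * indicator B (f x) \<partial>lborel)"
      by (simp add: swap)
  qed
  also have "\<dots> = (\<integral>\<^sup>+x. \<integral>\<^sup>+y. indicator A (y - f x) * indicator B (f x) \<partial>lborel \<partial>lborel)"
    by (rule lborel_pair.Fubini'[symmetric]) measurable
  also have "\<dots> = (\<integral>\<^sup>+x. emeasure lborel A * indicator B (f x) \<partial>lborel)"
    by (intro nn_integral_cong) (simp add: nn_integral_multc inner)
  also have "\<dots> = emeasure lborel A * \<mu> B"
    unfolding \<mu>_def by (rule nn_integral_cmult) measurable
  also have "\<mu> B = emeasure lborel B"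
  proof -
    have "indicator B (f x) = (indicator B x :: ennreal)" for x
      by (simp add: B_def indicator_def orthogonal_transformation_norm[OF f])
    then show ?thesis by (simp add: \<mu>_def)
  qed
  finally have eq: "\<mu> A * emeasure lborel B = emeasure lborel A * emeasure lborel B" .
  have fin: "emeasure lborel B < \<infinity>"
    unfolding B_def by (rule emeasure_bounded_finite) simp
  then have "emeasure lborel B = ennreal (measure lborel B)"
    by (intro emeasure_eq_ennreal_measure) auto
  moreover have "measure lborel B > 0"
    unfolding B_def by (rule content_cball_pos) simp
  ultimately have "\<mu> A = emeasure lborel A"
    using eq by (simp add: mult_right_ennreal_cancel)
  moreover have "emeasure (distr lborel borel f) A = \<mu> A"
  proof -
    have "emeasure (distr lborel borel f) A = (\<integral>\<^sup>+x. indicator A x \<partial>distr lborel borel f)" by simp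
    also have "\<dots> = \<mu> A" unfolding \<mu>_def by (rule nn_integral_distr) measurable
    finally show ?thesis .
  qed
  ultimately show "emeasure (distr lborel borel f) A = emeasure lborel A" by simp
qed simp

lemma reflection_measurable [measurable]: "reflection \<alpha> \<in> borel_measurable borel"
  by (intro borel_measurable_continuous_onI linear_continuous_on linear_conv_bounded_linear[THEN iffD1] reflection_linear)

lemma lborel_distr_reflection: "\<alpha> \<noteq> 0 \<Longrightarrow> distr lborel borel (reflection \<alpha>) = lborel"
  by (rule lborel_orthogonal_transformation[OF reflection_orthogonal])

lemma integral_reflection:
  fixes f :: "real^'n \<Rightarrow> complex"
  assumes "\<alpha> \<noteq> 0" and [measurable]: "f \<in> borel_measurable borel"
  shows "(LINT x|lborel. f (reflection \<alpha> x)) = (LINT x|lborel. f x)"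
proof -
  have "(LINT x|lborel. f x) = (LINT x|distr lborel borel (reflection \<alpha>). f x)"
    by (simp only: lborel_distr_reflection[OF assms(1)])
  also have "\<dots> = (LINT x|lborel. f (reflection \<alpha> x))"
    by (rule integral_distr) measurable
  finally show ?thesis by simp
qed

lemma AE_not_hyperplane:
  fixes \<alpha> :: "real^'n"
  assumes "\<alpha> \<noteq> 0"
  shows "AE x in lborel. \<alpha> \<bullet> x \<noteq> 0"
proof -
  have "closed {x. \<alpha> \<bullet> x = 0}" by (rule closed_hyperplane)
  then have "{x. \<alpha> \<bullet> x = 0} \<in> sets borel" by (rule borel_closed)
  moreover have "{x. \<alpha> \<bullet> x = 0} \<in> null_sets lebesgue"
    using negligible_hyperplane[of \<alpha> 0] assms by (simp add: negligible_iff_null_sets)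
  ultimately have "{x. \<alpha> \<bullet> x = 0} \<in> null_sets lborel"
    by (simp add: null_sets_def)
  from AE_not_in[OF this] show ?thesis by simp
qed

lemma AE_off_hyperplanes:
  fixes R :: "(real^'n) set"
  assumes "finite R" "0 \<notin> R"
  shows "AE x in lborel. \<forall>\<alpha>\<in>R. \<alpha> \<bullet> x \<noteq> 0"
  using assms by (intro AE_finite_allI AE_not_hyperplane) auto

lemma nn_integral_lborel_scale:
  fixes f :: "real^'n \<Rightarrow> ennreal"
  assumes [measurable]: "f \<in> borel_measurable borel" and c: "c > 0"
  shows "(\<integral>\<^sup>+x. f x \<partial>lborel) = ennreal (c ^ CARD('n)) * (\<integral>\<^sup>+x. f (c *\<^sub>R x) \<partial>lborel)"
proof -
  have "(\<integral>\<^sup>+x. f x \<partial>lborel) = (\<integral>\<^sup>+x. f x \<partial>density (distr lborel borel (\<lambda>x. 0 + c *\<^sub>R x)) (\<lambda>x. ennreal (\<bar>c\<bar> ^ DIM(real^'n))))"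
    using lborel_affine[of c "0 :: real^'n"] c by simp
  also have "\<dots> = (\<integral>\<^sup>+x. ennreal (c ^ CARD('n)) * f (c *\<^sub>R x) \<partial>lborel)"
    using c by (simp add: nn_integral_density nn_integral_distr)
  finally show ?thesis by (simp add: nn_integral_cmult)
qed

section \<open>Integration of homogeneous functions\<close>

lemma nn_integral_homogeneous_ball_scale:
  fixes F :: "real^'n \<Rightarrow> real"
  assumes [measurable]: "F \<in> borel_measurable borel"
    and hom: "\<And>c x. c > 0 \<Longrightarrow> F (c *\<^sub>R x) = c powr d * F x" and c: "c > 0"
    and [measurable]: "Measurable.pred borel P"
  shows "(\<integral>\<^sup>+x. ennreal (F x) * indicator {x. P (norm x / c)} x \<partial>lborel) =
    ennreal (c powr (d + real CARD('n))) * (\<integral>\<^sup>+x. ennreal (F x) * indicator {x. P (norm x)} x \<partial>lborel)"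
proof -
  have "(\<integral>\<^sup>+x. ennreal (F x) * indicator {x. P (norm x / c)} x \<partial>lborel) =
     ennreal (c ^ CARD('n)) * (\<integral>\<^sup>+x. ennreal (F (c *\<^sub>R x)) * indicator {x. P (norm x / c)} (c *\<^sub>R x) \<partial>lborel)"
    by (rule nn_integral_lborel_scale[OF _ c]) measurable
  also have "(\<integral>\<^sup>+x. ennreal (F (c *\<^sub>R x)) * indicator {x. P (norm x / c)} (c *\<^sub>R x) \<partial>lborel) =
     (\<integral>\<^sup>+x. ennreal (c powr d) * (ennreal (F x) * indicator {x. P (norm x)} x) \<partial>lborel)"
    using c by (intro nn_integral_cong) (auto simp: hom ennreal_mult' indicator_def)
  also have "\<dots> = ennreal (c powr d) * (\<integral>\<^sup>+x. ennreal (F x) * indicator {x. P (norm x)} x \<partial>lborel)"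
    by (rule nn_integral_cmult) measurable
  also have "ennreal (c ^ CARD('n)) * (ennreal (c powr d) * X) = ennreal (c powr (d + real CARD('n))) * X" for X
    using c by (simp add: powr_add powr_realpow mult_ac flip: ennreal_mult')
  finally show ?thesis .
qed

text \<open>Cut the ball into dyadic shells.  By homogeneity their contributions form a geometric series, with a
  ratio below one since the degree exceeds minus the dimension.\<close>

lemma nn_integral_homogeneous_ball_finite:
  fixes F :: "real^'n \<Rightarrow> real"
  assumes [measurable]: "F \<in> borel_measurable borel"
    and hom: "\<And>c x. c > 0 \<Longrightarrow> F (c *\<^sub>R x) = c powr d * F x"
    and bnd: "\<And>x. 1/2 \<le> norm x \<Longrightarrow> norm x \<le> 1 \<Longrightarrow> F x \<le> B"
    and d: "d + real CARD('n) > 0"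
  shows "(\<integral>\<^sup>+x. ennreal (F x) * indicator {x. norm x \<le> 1} x \<partial>lborel) < \<infinity>"
proof -
  define S where "S n = {x :: real^'n. (1/2)^Suc n < norm x \<and> norm x \<le> (1/2)^n}" for n :: nat
  define e where "e = d + real CARD('n)"
  define J where "J = (\<integral>\<^sup>+x. ennreal (F x) * indicator {x. 1/2 < norm x \<and> norm x \<le> 1} x \<partial>lborel)"
  have [measurable]: "S n \<in> sets borel" for n unfolding S_def by measurable
  have shell: "(\<integral>\<^sup>+x. ennreal (F x) * indicator (S n) x \<partial>lborel) = ennreal (((1/2) powr e) ^ n) * J" for n
  proof -
    have "S n = {x. 1/2 < norm x / (1/2)^n \<and> norm x / (1/2)^n \<le> 1}"
      by (auto simp: S_def field_simps)
    moreover have "((1/2)^n) powr e = ((1/2) powr e) ^ n"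
      by (simp add: powr_realpow[symmetric] powr_powr mult.commute)
    ultimately show ?thesis
      using nn_integral_homogeneous_ball_scale[OF assms(1) hom, of "(1/2)^n" "\<lambda>r. 1/2 < r \<and> r \<le> 1"]
      by (simp add: J_def e_def)
  qed
  have "J \<le> (\<integral>\<^sup>+x. ennreal \<bar>B\<bar> * indicator (cball 0 1 :: (real^'n) set) x \<partial>lborel)"
    unfolding J_def
  proof (intro nn_integral_mono)
    fix x :: "real^'n"
    have "F x \<le> \<bar>B\<bar>" if "1/2 < norm x" "norm x \<le> 1" using bnd[of x] that by linarith
    then show "ennreal (F x) * indicator {x. 1/2 < norm x \<and> norm x \<le> 1} x \<le> ennreal \<bar>B\<bar> * indicator (cball 0 1) x"
      by (auto simp: indicator_def ennreal_leI)
  qed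
  also have "\<dots> = ennreal \<bar>B\<bar> * emeasure lborel (cball 0 1 :: (real^'n) set)"
    by (rule nn_integral_cmult_indicator) auto
  also have "\<dots> < \<infinity>"
    using emeasure_bounded_finite[of "cball 0 1 :: (real^'n) set"] by (simp add: ennreal_mult_less_top)
  finally have J: "J < \<infinity>" .
  have disj: "disjoint_family S"
    unfolding disjoint_family_on_def
  proof (intro ballI impI)
    have *: "S n \<inter> S m = {}" if "n < m" for n m
    proof -
      have "(1/2 :: real)^m \<le> (1/2)^Suc n" using that by (intro power_decreasing) auto
      then show ?thesis by (auto simp: S_def)
    qed
    fix n m :: nat assume "n \<noteq> m"
    then show "S n \<inter> S m = {}" using *[of n m] *[of m n] by (cases "n < m") auto
  qed
  have Un: "(\<Union>n. S n) = {x. norm x \<le> 1} - {0}"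
  proof (intro set_eqI iffI)
    fix x assume "x \<in> (\<Union>n. S n)"
    then obtain n where n: "(1/2)^Suc n < norm x" "norm x \<le> (1/2)^n" by (auto simp: S_def)
    have "(0::real) < (1/2)^Suc n" "(1/2 :: real)^n \<le> 1" by (auto simp: power_le_one)
    then show "x \<in> {x. norm x \<le> 1} - {0}" using n by auto
  next
    fix x :: "real^'n" assume x: "x \<in> {x. norm x \<le> 1} - {0}"
    then have "\<exists>n. (1/2)^n < norm x" by (intro real_arch_pow_inv) auto
    define n where "n = (LEAST n. (1/2)^n < norm x)"
    have n1: "(1/2)^n < norm x" unfolding n_def by (rule LeastI_ex) fact
    have "n \<noteq> 0" using n1 x by (intro notI) auto
    then obtain k where k: "n = Suc k" by (cases n) auto
    have "\<not> (1/2)^k < norm x" using not_less_Least[of k "\<lambda>n. (1/2)^n < norm x"] k by (simp add: n_def)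
    then have "x \<in> S k" using n1 by (simp add: S_def k)
    then show "x \<in> (\<Union>n. S n)" by blast
  qed
  have "(\<integral>\<^sup>+x. ennreal (F x) * indicator {x. norm x \<le> 1} x \<partial>lborel) = (\<integral>\<^sup>+x. (\<Sum>n. ennreal (F x) * indicator (S n) x) \<partial>lborel)"
  proof (rule nn_integral_cong_AE, use AE_lborel_singleton[of "0 :: real^'n"] in eventually_elim)
    case (elim x)
    have "(\<Sum>n. ennreal (F x) * indicator (S n) x) = ennreal (F x) * indicator ({x. norm x \<le> 1} - {0}) x"
      by (simp add: suminf_indicator[OF disj] Un)
    then show ?case using elim by (simp add: indicator_def)
  qed
  also have "\<dots> = (\<Sum>n. \<integral>\<^sup>+x. ennreal (F x) * indicator (S n) x \<partial>lborel)"
    by (rule nn_integral_suminf) measurable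
  also have "\<dots> = (\<Sum>n. ennreal (((1/2) powr e) ^ n)) * J"
    by (simp add: shell)
  also have "(\<Sum>n. ennreal (((1/2) powr e) ^ n)) = ennreal (\<Sum>n. ((1/2) powr e) ^ n)"
  proof (rule suminf_ennreal2)
    have "(1/2 :: real) powr e < (1/2) powr 0" using d by (intro powr_less_mono') (auto simp: e_def)
    then show "summable (\<lambda>n. ((1/2 :: real) powr e) ^ n)" by (intro summable_geometric) auto
  qed simp
  also have "\<dots> * J < \<infinity>" using J by (simp add: ennreal_mult_less_top)
  finally show ?thesis .
qed

text \<open>Polar coordinates for homogeneous functions: the image of \<open>F dx\<close> under the variable
  \<open>t = (2/a) norm x powr a\<close> of the Laguerre polynomials is a power weight on the half line.  Both measures
  give the same mass to half lines: for the image measure this is the scaling behaviour of the mass of balls.\<close>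

lemma homogeneous_radial_distr:
  fixes F :: "real^'n \<Rightarrow> real"
  assumes F [measurable]: "F \<in> borel_measurable borel" and nonneg: "\<And>x. F x \<ge> 0"
    and hom: "\<And>c x. c > 0 \<Longrightarrow> F (c *\<^sub>R x) = c powr d * F x"
    and bnd: "\<And>x. 1/2 \<le> norm x \<Longrightarrow> norm x \<le> 1 \<Longrightarrow> F x \<le> B"
    and d: "d + real CARD('n) > 0" and a: "a > 0"
  obtains C where "C \<ge> 0"
    "distr (density lborel (\<lambda>x. ennreal (F x))) borel (\<lambda>x. 2 / a * norm x powr a) =
     density lborel (\<lambda>t. ennreal (indicator {0<..} t * (C * t powr ((d + real CARD('n)) / a - 1))))"
proof -
  define e where "e = (d + real CARD('n)) / a"
  have e: "e > 0" using d a by (simp add: e_def)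
  define I where "I = enn2real (\<integral>\<^sup>+x. ennreal (F x) * indicator {x. norm x \<le> 1} x \<partial>lborel)"
  have I: "(\<integral>\<^sup>+x. ennreal (F x) * indicator {x. norm x \<le> 1} x \<partial>lborel) = ennreal I" "I \<ge> 0"
    using nn_integral_homogeneous_ball_finite[OF F hom bnd d] by (auto simp: I_def)
  define C where "C = e * (a / 2) powr e * I"
  have C: "C \<ge> 0" using e I(2) by (simp add: C_def)
  let ?T = "\<lambda>x :: real^'n. 2 / a * norm x powr a"
  let ?g = "\<lambda>t. indicator {0<..} t * (C * t powr (e - 1))"
  let ?M = "distr (density lborel (\<lambda>x. ennreal (F x))) borel ?T"
  let ?N = "density lborel (\<lambda>t. ennreal (?g t))"
  have M: "emeasure ?M {..r} = ennreal (if r > 0 then (a * r / 2) powr e * I else 0)" for r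
  proof -
    have m: "{x. ?T x \<le> r} \<in> sets borel" by measurable
    have "emeasure ?M {..r} = (\<integral>\<^sup>+x. ennreal (F x) * indicator {x. ?T x \<le> r} x \<partial>lborel)"
      using m by (subst emeasure_distr) (auto simp: emeasure_density vimage_def)
    also have "\<dots> = ennreal (if r > 0 then (a * r / 2) powr e * I else 0)"
    proof (cases "r > 0")
      case True
      \<comment> \<open>the ball in which the new variable is at most \<open>r\<close>\<close>
      define \<rho> where "\<rho> = (a * r / 2) powr (1 / a)"
      have \<rho>: "\<rho> > 0" using True a by (simp add: \<rho>_def)
      have iff: "?T x \<le> r \<longleftrightarrow> norm x / \<rho> \<le> 1" for x :: "real^'n"
      proof -
        have "?T x \<le> r \<longleftrightarrow> norm x powr a \<le> a * r / 2" using a by (simp add: field_simps)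
        also have "a * r / 2 = \<rho> powr a" using True a by (simp add: \<rho>_def powr_powr)
        also have "norm x powr a \<le> \<rho> powr a \<longleftrightarrow> norm x \<le> \<rho>"
          using a \<rho> powr_less_mono2[of a \<rho> "norm x"] powr_mono2[of a "norm x" \<rho>] by (auto simp: not_le[symmetric])
        finally show ?thesis using \<rho> by (simp add: field_simps)
      qed
      have "\<rho> powr (d + real CARD('n)) = (a * r / 2) powr e"
        using a by (simp add: \<rho>_def powr_powr e_def)
      then show ?thesis
        using nn_integral_homogeneous_ball_scale[OF F hom \<rho>, of "\<lambda>r. r \<le> 1"] True I
        by (simp only: iff ennreal_mult' if_True \<open>\<rho> powr (d + real CARD('n)) = (a * r / 2) powr e\<close>) (simp add: ennreal_mult')
    next
      case False
      have "(\<integral>\<^sup>+x. ennreal (F x) * indicator {x. ?T x \<le> r} x \<partial>lborel) = (\<integral>\<^sup>+x. 0 \<partial>(lborel :: (real^'n) measure))"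
      proof (rule nn_integral_cong_AE, use AE_lborel_singleton[of "0 :: real^'n"] in eventually_elim)
        case (elim x)
        then have "?T x > 0" using a by simp
        then show ?case using False by (simp add: indicator_def)
      qed
      then show ?thesis using False by simp
    qed
    finally show ?thesis .
  qed
  have N: "emeasure ?N {..r} = ennreal (if r > 0 then (a * r / 2) powr e * I else 0)" for r
  proof (cases "r > 0")
    case True
    have "((\<lambda>t. C * t powr (e - 1)) has_integral C * (r powr (e - 1 + 1) / (e - 1 + 1))) {0..r}"
      using True e by (intro has_integral_mult_right has_integral_powr_from_0) auto
    then have "((\<lambda>t. if t \<in> {0..r} then C * t powr (e - 1) else 0) has_integral C * (r powr e / e)) UNIV"
      by (subst has_integral_restrict_UNIV) simp
    then have "(\<integral>\<^sup>+t. ennreal (if t \<in> {0..r} then C * t powr (e - 1) else 0) \<partial>lborel) = ennreal (C * (r powr e / e))"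
      by (rule nn_integral_has_integral_lborel[rotated 2]) (use C in auto)
    moreover have "emeasure ?N {..r} = (\<integral>\<^sup>+t. ennreal (if t \<in> {0..r} then C * t powr (e - 1) else 0) \<partial>lborel)"
      by (subst emeasure_density) (auto intro!: nn_integral_cong simp: indicator_def)
    moreover have "C * (r powr e / e) = (a * r / 2) powr e * I"
      using e a True by (simp add: C_def powr_mult powr_divide)
    ultimately show ?thesis using True by simp
  next
    case False
    have "emeasure ?N {..r} = (\<integral>\<^sup>+t. ennreal (?g t) * indicator {..r} t \<partial>lborel)"
      by (rule emeasure_density) auto
    also have "\<dots> = (\<integral>\<^sup>+t. 0 \<partial>(lborel :: real measure))"
      using False by (intro nn_integral_cong) (auto simp: indicator_def)
    finally show ?thesis using False by simp
  qed
  have sets_borel: "sets (borel :: real measure) = sigma_sets UNIV (range (\<lambda>r. {..r}))"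
    unfolding borel_eq_atMost by (rule sets_measure_of) auto
  have "?M = ?N"
  proof (rule measure_eqI_generator_eq[where E = "range (\<lambda>r. {..r})" and \<Omega> = UNIV and A = "\<lambda>i. {..real i}"])
    show "Int_stable (range (\<lambda>r::real. {..r}))"
      by (auto simp: Int_stable_def intro: exI[of _ "min _ _"])
    show "sets ?M = sigma_sets UNIV (range (\<lambda>r. {..r}))" "sets ?N = sigma_sets UNIV (range (\<lambda>r. {..r}))"
      using sets_borel by simp_all
    show "(\<Union>i. {..real i}) = UNIV" using real_arch_simple by auto
    fix X assume "X \<in> range (\<lambda>r::real. {..r})"
    then show "emeasure ?M X = emeasure ?N X" by (auto simp only: M N)
  next
    fix i show "emeasure ?M {..real i} \<noteq> \<infinity>" unfolding M by simp
  qed auto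
  with C show ?thesis by (intro that[of C]) (simp_all add: e_def)
qed

lemma homogeneous_radial_integral_nonneg:
  fixes F :: "real^'n \<Rightarrow> real"
  assumes F [measurable]: "F \<in> borel_measurable borel" and nonneg: "\<And>x. F x \<ge> 0"
    and hom: "\<And>c x. c > 0 \<Longrightarrow> F (c *\<^sub>R x) = c powr d * F x"
    and bnd: "\<And>x. 1/2 \<le> norm x \<Longrightarrow> norm x \<le> 1 \<Longrightarrow> F x \<le> B"
    and d: "d + real CARD('n) > 0" and a: "a > 0"
  obtains C where "C \<ge> 0"
    "\<And>h :: real \<Rightarrow> real. h \<in> borel_measurable borel \<Longrightarrow>
      integrable lborel (\<lambda>t. indicator {0<..} t * t powr ((d + real CARD('n)) / a - 1) * h t) \<Longrightarrow>
      integrable lborel (\<lambda>x. F x * h (2 / a * norm x powr a)) \<and>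
      (LINT x|lborel. F x * h (2 / a * norm x powr a)) =
        C * (LINT t|lborel. indicator {0<..} t * t powr ((d + real CARD('n)) / a - 1) * h t)"
proof -
  let ?e = "(d + real CARD('n)) / a - 1"
  obtain C where C: "C \<ge> 0" and eq: "distr (density lborel (\<lambda>x. ennreal (F x))) borel (\<lambda>x. 2 / a * norm x powr a) =
     density lborel (\<lambda>t. ennreal (indicator {0<..} t * (C * t powr ?e)))"
    using homogeneous_radial_distr[OF assms] by blast
  show ?thesis
  proof (rule that[OF C])
    fix h :: "real \<Rightarrow> real" assume [measurable]: "h \<in> borel_measurable borel"
      and int: "integrable lborel (\<lambda>t. indicator {0<..} t * t powr ?e * h t)"
    have "integrable lborel (\<lambda>x. F x * h (2 / a * norm x powr a)) \<longleftrightarrow> integrable (density lborel (\<lambda>x. ennreal (F x))) (\<lambda>x. h (2 / a * norm x powr a))"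
      using nonneg by (simp add: integrable_density)
    also have "\<dots> \<longleftrightarrow> integrable (density lborel (\<lambda>t. ennreal (indicator {0<..} t * (C * t powr ?e)))) h"
      unfolding eq[symmetric] by (rule integrable_distr_eq[symmetric]) measurable
    also have "\<dots> \<longleftrightarrow> integrable lborel (\<lambda>t. C * (indicator {0<..} t * t powr ?e * h t))"
      using C by (simp add: integrable_density mult_ac)
    finally have 1: "integrable lborel (\<lambda>x. F x * h (2 / a * norm x powr a))" using int by simp
    have "(LINT x|lborel. F x * h (2 / a * norm x powr a)) = integral\<^sup>L (density lborel (\<lambda>x. ennreal (F x))) (\<lambda>x. h (2 / a * norm x powr a))"
      using nonneg by (simp add: integral_density)
    also have "\<dots> = integral\<^sup>L (density lborel (\<lambda>t. ennreal (indicator {0<..} t * (C * t powr ?e)))) h"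
      unfolding eq[symmetric] by (rule integral_distr[symmetric]) measurable
    also have "\<dots> = (LINT t|lborel. C * (indicator {0<..} t * t powr ?e * h t))"
      using C by (simp add: integral_density mult_ac)
    also have "\<dots> = C * (LINT t|lborel. indicator {0<..} t * t powr ?e * h t)"
      by simp
    finally show "integrable lborel (\<lambda>x. F x * h (2 / a * norm x powr a)) \<and>
      (LINT x|lborel. F x * h (2 / a * norm x powr a)) = C * (LINT t|lborel. indicator {0<..} t * t powr ?e * h t)"
      using 1 by blast
  qed
qed

lemma homogeneous_radial_integral_real:
  fixes F :: "real^'n \<Rightarrow> real"
  assumes F [measurable]: "F \<in> borel_measurable borel"
    and hom: "\<And>c x. c > 0 \<Longrightarrow> F (c *\<^sub>R x) = c powr d * F x"
    and bnd: "\<And>x. 1/2 \<le> norm x \<Longrightarrow> norm x \<le> 1 \<Longrightarrow> \<bar>F x\<bar> \<le> B"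
    and d: "d + real CARD('n) > 0" and a: "a > 0"
  obtains C where
    "\<And>h :: real \<Rightarrow> real. h \<in> borel_measurable borel \<Longrightarrow>
      integrable lborel (\<lambda>t. indicator {0<..} t * t powr ((d + real CARD('n)) / a - 1) * h t) \<Longrightarrow>
      integrable lborel (\<lambda>x. F x * h (2 / a * norm x powr a)) \<and>
      (LINT x|lborel. F x * h (2 / a * norm x powr a)) =
        C * (LINT t|lborel. indicator {0<..} t * t powr ((d + real CARD('n)) / a - 1) * h t)"
proof -
  let ?F1 = "\<lambda>x. max 0 (F x)" and ?F2 = "\<lambda>x. max 0 (- F x)"
  have hom1: "?F1 (c *\<^sub>R x) = c powr d * ?F1 x" and hom2: "?F2 (c *\<^sub>R x) = c powr d * ?F2 x" if "c > 0" for c x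
    using that by (auto simp: hom max_mult_distrib_left)
  have b1: "?F1 x \<le> B" and b2: "?F2 x \<le> B" if "1/2 \<le> norm x" "norm x \<le> 1" for x
    using bnd[OF that] by auto
  obtain C1 where C1: "\<And>h :: real \<Rightarrow> real. h \<in> borel_measurable borel \<Longrightarrow>
      integrable lborel (\<lambda>t. indicator {0<..} t * t powr ((d + real CARD('n)) / a - 1) * h t) \<Longrightarrow>
      integrable lborel (\<lambda>x. ?F1 x * h (2 / a * norm x powr a)) \<and>
      (LINT x|lborel. ?F1 x * h (2 / a * norm x powr a)) =
        C1 * (LINT t|lborel. indicator {0<..} t * t powr ((d + real CARD('n)) / a - 1) * h t)"
    by (rule homogeneous_radial_integral_nonneg[OF _ _ hom1 b1 d a]) auto
  obtain C2 where C2: "\<And>h :: real \<Rightarrow> real. h \<in> borel_measurable borel \<Longrightarrow>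
      integrable lborel (\<lambda>t. indicator {0<..} t * t powr ((d + real CARD('n)) / a - 1) * h t) \<Longrightarrow>
      integrable lborel (\<lambda>x. ?F2 x * h (2 / a * norm x powr a)) \<and>
      (LINT x|lborel. ?F2 x * h (2 / a * norm x powr a)) =
        C2 * (LINT t|lborel. indicator {0<..} t * t powr ((d + real CARD('n)) / a - 1) * h t)"
    by (rule homogeneous_radial_integral_nonneg[OF _ _ hom2 b2 d a]) auto
  show ?thesis
  proof (rule that[of "C1 - C2"])
    fix h :: "real \<Rightarrow> real" assume h: "h \<in> borel_measurable borel"
      "integrable lborel (\<lambda>t. indicator {0<..} t * t powr ((d + real CARD('n)) / a - 1) * h t)"
    have eq: "F x * h (2 / a * norm x powr a) = ?F1 x * h (2 / a * norm x powr a) - ?F2 x * h (2 / a * norm x powr a)" for x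
      by (auto simp: max_def)
    show "integrable lborel (\<lambda>x. F x * h (2 / a * norm x powr a)) \<and>
      (LINT x|lborel. F x * h (2 / a * norm x powr a)) =
        (C1 - C2) * (LINT t|lborel. indicator {0<..} t * t powr ((d + real CARD('n)) / a - 1) * h t)"
      unfolding eq using C1[OF h] C2[OF h] by (simp add: left_diff_distrib)
  qed
qed

text \<open>Real and imaginary parts, and these again positive and negative parts, are homogeneous
  of the same degree.  The constant depends on \<open>F\<close> alone.\<close>

lemma homogeneous_radial_integral:
  fixes F :: "real^'n \<Rightarrow> complex"
  assumes F [measurable]: "F \<in> borel_measurable borel"
    and hom: "\<And>c x. c > 0 \<Longrightarrow> F (c *\<^sub>R x) = complex_of_real (c powr d) * F x"
    and bnd: "\<And>x. 1/2 \<le> norm x \<Longrightarrow> norm x \<le> 1 \<Longrightarrow> cmod (F x) \<le> B"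
    and d: "d + real CARD('n) > 0" and a: "a > 0"
  obtains C where
    "\<And>h :: real \<Rightarrow> real. h \<in> borel_measurable borel \<Longrightarrow>
      integrable lborel (\<lambda>t. indicator {0<..} t * t powr ((d + real CARD('n)) / a - 1) * h t) \<Longrightarrow>
      integrable lborel (\<lambda>x. F x * complex_of_real (h (2 / a * norm x powr a))) \<and>
      (LINT x|lborel. F x * complex_of_real (h (2 / a * norm x powr a))) =
        C * complex_of_real (LINT t|lborel. indicator {0<..} t * t powr ((d + real CARD('n)) / a - 1) * h t)"
proof -
  have [measurable]: "(\<lambda>x. Re (F x)) \<in> borel_measurable borel" "(\<lambda>x. Im (F x)) \<in> borel_measurable borel"
    using F by (auto intro: borel_measurable_continuous_on[of Re, OF _ F] borel_measurable_continuous_on[of Im, OF _ F])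
  have b1: "\<bar>Re (F x)\<bar> \<le> B" and b2: "\<bar>Im (F x)\<bar> \<le> B" if "1/2 \<le> norm x" "norm x \<le> 1" for x
    using bnd[OF that] abs_Re_le_cmod[of "F x"] abs_Im_le_cmod[of "F x"] by linarith+
  obtain C1 where C1: "\<And>h :: real \<Rightarrow> real. h \<in> borel_measurable borel \<Longrightarrow>
      integrable lborel (\<lambda>t. indicator {0<..} t * t powr ((d + real CARD('n)) / a - 1) * h t) \<Longrightarrow>
      integrable lborel (\<lambda>x. Re (F x) * h (2 / a * norm x powr a)) \<and>
      (LINT x|lborel. Re (F x) * h (2 / a * norm x powr a)) =
        C1 * (LINT t|lborel. indicator {0<..} t * t powr ((d + real CARD('n)) / a - 1) * h t)"
    by (rule homogeneous_radial_integral_real[OF _ _ b1 d a]) (auto simp: hom)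
  obtain C2 where C2: "\<And>h :: real \<Rightarrow> real. h \<in> borel_measurable borel \<Longrightarrow>
      integrable lborel (\<lambda>t. indicator {0<..} t * t powr ((d + real CARD('n)) / a - 1) * h t) \<Longrightarrow>
      integrable lborel (\<lambda>x. Im (F x) * h (2 / a * norm x powr a)) \<and>
      (LINT x|lborel. Im (F x) * h (2 / a * norm x powr a)) =
        C2 * (LINT t|lborel. indicator {0<..} t * t powr ((d + real CARD('n)) / a - 1) * h t)"
    by (rule homogeneous_radial_integral_real[OF _ _ b2 d a]) (auto simp: hom)
  show ?thesis
  proof (rule that[of "Complex C1 C2"])
    fix h :: "real \<Rightarrow> real" assume h: "h \<in> borel_measurable borel"
      "integrable lborel (\<lambda>t. indicator {0<..} t * t powr ((d + real CARD('n)) / a - 1) * h t)"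
    have eq: "F x * complex_of_real (h (2 / a * norm x powr a)) = complex_of_real (Re (F x) * h (2 / a * norm x powr a))
        + \<i> * complex_of_real (Im (F x) * h (2 / a * norm x powr a))" for x
      by (simp add: complex_eq_iff)
    show "integrable lborel (\<lambda>x. F x * complex_of_real (h (2 / a * norm x powr a))) \<and>
      (LINT x|lborel. F x * complex_of_real (h (2 / a * norm x powr a))) =
        Complex C1 C2 * complex_of_real (LINT t|lborel. indicator {0<..} t * t powr ((d + real CARD('n)) / a - 1) * h t)"
      unfolding eq using C1[OF h] C2[OF h]
      by (simp add: complex_eq_iff del: of_real_mult)
  qed
qed

section \<open>Skew-symmetry of the Dunkl operators\<close>

text \<open>All properties of the Dunkl operators themselves are independent of the parameter \<open>a\<close>.\<close>

locale dunkl_setting =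
  fixes R P :: "(real^'n) set" and k :: "real^'n \<Rightarrow> real"
  assumes R: "root_system R" and P: "positive_subsystem R P"
    and k: "multiplicity_function R k" and k_nonneg: "\<And>\<alpha>. \<alpha> \<in> R \<Longrightarrow> 0 \<le> k \<alpha>"
begin

lemma finite_R: "finite R" and zero_notin_R: "0 \<notin> R"
  using R by (auto simp: root_system_def)

lemma root_nonzero: "\<alpha> \<in> R \<Longrightarrow> \<alpha> \<noteq> 0"
  using zero_notin_R by auto

lemma reflection_image: "\<alpha> \<in> R \<Longrightarrow> reflection \<alpha> ` R = R"
  using R by (auto simp: root_system_def)

lemma P_subset: "P \<subseteq> R"
  using P by (auto simp: positive_subsystem_def)

lemma zero_notin_P: "0 \<notin> P"
  using P_subset zero_notin_R by auto

lemma finite_P: "finite P"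
  using P_subset finite_R by (rule finite_subset)

lemma uminus_root: "\<alpha> \<in> R \<Longrightarrow> - \<alpha> \<in> R"
  using R by (auto simp: root_system_def)

lemma reflection_bij: "\<alpha> \<in> R \<Longrightarrow> bij_betw (reflection \<alpha>) R R"
  unfolding bij_betw_def using reflection_image[of \<alpha>] reflection_involution[OF root_nonzero, of \<alpha>]
  by (metis inj_on_inverseI)

lemma k_reflection: "\<beta> \<in> R \<Longrightarrow> \<alpha> \<in> R \<Longrightarrow> k (reflection \<beta> \<alpha>) = k \<alpha>"
  using k coxeter_group.step[OF _ coxeter_group.one, of \<beta> R]
  by (auto simp: multiplicity_function_def)

lemma k_uminus:
  assumes "\<alpha> \<in> R" shows "k (- \<alpha>) = k \<alpha>"
proof -
  have "reflection \<alpha> \<alpha> = - \<alpha>"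
    using root_nonzero[OF assms] by (simp add: reflection_def power2_norm_eq_inner algebra_simps)
      (simp add: scaleR_2)
  then show ?thesis using k_reflection[OF assms assms] by simp
qed

text \<open>Roots come in pairs of opposite sign, one of which is positive.\<close>

lemma sum_R_eq_sum_P:
  fixes f :: "real^'n \<Rightarrow> complex"
  assumes "\<And>\<alpha>. \<alpha> \<in> R \<Longrightarrow> f (- \<alpha>) = f \<alpha>"
  shows "(\<Sum>\<alpha>\<in>R. f \<alpha>) = 2 * (\<Sum>\<alpha>\<in>P. f \<alpha>)"
proof -
  obtain v where v: "\<And>\<alpha>. \<alpha> \<in> R \<Longrightarrow> \<alpha> \<bullet> v \<noteq> 0" and Pv: "P = {\<alpha>\<in>R. \<alpha> \<bullet> v > 0}"
    using P by (auto simp: positive_subsystem_def)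
  have RP: "R = P \<union> uminus ` P"
  proof (intro set_eqI iffI)
    fix \<alpha> assume a: "\<alpha> \<in> R"
    then show "\<alpha> \<in> P \<union> uminus ` P"
      using v[OF a] uminus_root[OF a] by (cases "\<alpha> \<bullet> v > 0") (auto simp: Pv image_iff intro!: bexI[of _ "- \<alpha>"])
  qed (auto simp: Pv intro: uminus_root)
  have "P \<inter> uminus ` P = {}" by (auto simp: Pv)
  then have "(\<Sum>\<alpha>\<in>R. f \<alpha>) = (\<Sum>\<alpha>\<in>P. f \<alpha>) + (\<Sum>\<alpha>\<in>uminus ` P. f \<alpha>)"
    using finite_P by (subst RP) (rule sum.union_disjoint, auto)
  also have "(\<Sum>\<alpha>\<in>uminus ` P. f \<alpha>) = (\<Sum>\<alpha>\<in>P. f (- \<alpha>))"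
    by (subst sum.reindex) (auto simp: inj_on_def)
  also have "\<dots> = (\<Sum>\<alpha>\<in>P. f \<alpha>)"
    using P_subset by (intro sum.cong assms) auto
  finally show ?thesis by simp
qed

definition root_weight :: "real^'n \<Rightarrow> real" where
  "root_weight x = (\<Prod>\<alpha>\<in>R. \<bar>\<alpha> \<bullet> x\<bar> powr k \<alpha>)"

text \<open>The product of the powers \<open>((\<alpha> \<bullet> x)\<^sup>2 + \<epsilon>) powr (k \<alpha> / 2)\<close>, written so that it is easy to
  differentiate.  It tends to \<open>root_weight\<close> as \<open>\<epsilon>\<close> tends to zero, is smooth for \<open>\<epsilon> > 0\<close>, and it is still
  invariant under the reflections.\<close>

definition smooth_weight :: "real \<Rightarrow> real^'n \<Rightarrow> real" where
  "smooth_weight \<epsilon> x = exp (\<Sum>\<alpha>\<in>R. k \<alpha> / 2 * ln ((\<alpha> \<bullet> x)\<^sup>2 + \<epsilon>))"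

lemma root_inner_reflection: "\<alpha> \<bullet> reflection \<beta> x = reflection \<beta> \<alpha> \<bullet> x"
  by (simp add: reflection_self_adjoint)

lemma root_weight_reflection:
  assumes "\<beta> \<in> R" shows "root_weight (reflection \<beta> x) = root_weight x"
proof -
  have "root_weight (reflection \<beta> x) = (\<Prod>\<alpha>\<in>R. \<bar>reflection \<beta> \<alpha> \<bullet> x\<bar> powr k (reflection \<beta> \<alpha>))"
    unfolding root_weight_def using assms by (intro prod.cong) (auto simp: root_inner_reflection k_reflection)
  also have "\<dots> = root_weight x"
    unfolding root_weight_def by (rule prod.reindex_bij_betw[OF reflection_bij[OF assms]])
  finally show ?thesis .
qed

lemma smooth_weight_reflection:
  assumes "\<beta> \<in> R" shows "smooth_weight \<epsilon> (reflection \<beta> x) = smooth_weight \<epsilon> x"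
proof -
  have "(\<Sum>\<alpha>\<in>R. k \<alpha> / 2 * ln ((\<alpha> \<bullet> reflection \<beta> x)\<^sup>2 + \<epsilon>)) = (\<Sum>\<alpha>\<in>R. k (reflection \<beta> \<alpha>) / 2 * ln ((reflection \<beta> \<alpha> \<bullet> x)\<^sup>2 + \<epsilon>))"
    using assms by (intro sum.cong) (auto simp: root_inner_reflection k_reflection)
  also have "\<dots> = (\<Sum>\<alpha>\<in>R. k \<alpha> / 2 * ln ((\<alpha> \<bullet> x)\<^sup>2 + \<epsilon>))"
    by (rule sum.reindex_bij_betw[OF reflection_bij[OF assms]])
  finally show ?thesis by (simp add: smooth_weight_def)
qed

lemma root_weight_measurable [measurable]: "root_weight \<in> borel_measurable borel"
  unfolding root_weight_def[abs_def] by measurable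

lemma square_plus_pos: "\<epsilon> > 0 \<Longrightarrow> (y::real)\<^sup>2 + \<epsilon> > 0"
  by (simp add: add_nonneg_pos)

lemma smooth_weight_continuous: "\<epsilon> > 0 \<Longrightarrow> continuous_on S (smooth_weight \<epsilon>)"
  unfolding smooth_weight_def[abs_def]
  by (intro continuous_intros ballI) (metis less_irrefl square_plus_pos)

lemma smooth_weight_has_derivative:
  assumes \<epsilon>: "\<epsilon> > 0"
  shows "(smooth_weight \<epsilon> has_derivative (\<lambda>h. smooth_weight \<epsilon> x * (\<Sum>\<alpha>\<in>R. k \<alpha> * (\<alpha> \<bullet> h) * ((\<alpha> \<bullet> x) / ((\<alpha> \<bullet> x)\<^sup>2 + \<epsilon>))))) (at x)"
proof -
  have "((\<lambda>x. ln ((\<alpha> \<bullet> x)\<^sup>2 + \<epsilon>)) has_derivative (\<lambda>h. 2 * (\<alpha> \<bullet> x) * (\<alpha> \<bullet> h) / ((\<alpha> \<bullet> x)\<^sup>2 + \<epsilon>))) (at x)" for \<alpha> :: "real^'n"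
    using square_plus_pos[OF \<epsilon>, of "\<alpha> \<bullet> x"]
    by (auto intro!: derivative_eq_intros simp: fun_eq_iff field_simps)
  then have "((\<lambda>x. \<Sum>\<alpha>\<in>R. k \<alpha> / 2 * ln ((\<alpha> \<bullet> x)\<^sup>2 + \<epsilon>)) has_derivative (\<lambda>h. \<Sum>\<alpha>\<in>R. k \<alpha> / 2 * (2 * (\<alpha> \<bullet> x) * (\<alpha> \<bullet> h) / ((\<alpha> \<bullet> x)\<^sup>2 + \<epsilon>)))) (at x)"
    by (intro has_derivative_sum has_derivative_mult_right)
  from has_derivative_exp[OF this] show ?thesis
    unfolding smooth_weight_def[abs_def] by (simp add: mult_ac)
qed

lemma smooth_weight_nonneg: "0 \<le> smooth_weight \<epsilon> x"
  by (simp add: smooth_weight_def)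

lemma smooth_weight_bound:
  assumes "0 < \<epsilon>" "\<epsilon> \<le> 1" "norm x \<le> 1"
  shows "smooth_weight \<epsilon> x \<le> exp (\<Sum>\<alpha>\<in>R. k \<alpha> / 2 * ln ((norm \<alpha>)\<^sup>2 + 1))"
  unfolding smooth_weight_def exp_le_cancel_iff
proof (intro sum_mono mult_left_mono)
  fix \<alpha> assume "\<alpha> \<in> R"
  then show "0 \<le> k \<alpha> / 2" using k_nonneg by simp
  have "\<bar>\<alpha> \<bullet> x\<bar> \<le> norm \<alpha> * norm x" by (rule Cauchy_Schwarz_ineq2)
  also have "\<dots> \<le> norm \<alpha>" using assms(3) by (simp add: mult_left_le)
  finally have "\<bar>\<alpha> \<bullet> x\<bar> \<le> \<bar>norm \<alpha>\<bar>" by simp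
  then have "(\<alpha> \<bullet> x)\<^sup>2 \<le> (norm \<alpha>)\<^sup>2" by (simp only: abs_le_square_iff)
  then show "ln ((\<alpha> \<bullet> x)\<^sup>2 + \<epsilon>) \<le> ln ((norm \<alpha>)\<^sup>2 + 1)"
    using assms square_plus_pos[OF assms(1), of "\<alpha> \<bullet> x"] by (intro ln_mono) auto
qed

lemma smooth_weight_tendsto:
  assumes "\<And>\<alpha>. \<alpha> \<in> R \<Longrightarrow> \<alpha> \<bullet> x \<noteq> 0"
  shows "(\<lambda>n. smooth_weight (1 / real (Suc n)) x) \<longlonglongrightarrow> root_weight x"
proof -
  have eps: "(\<lambda>n. 1 / real (Suc n)) \<longlonglongrightarrow> 0" using LIMSEQ_inverse_real_of_nat by (simp add: inverse_eq_divide)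
  have "(\<lambda>n. smooth_weight (1 / real (Suc n)) x) \<longlonglongrightarrow> exp (\<Sum>\<alpha>\<in>R. k \<alpha> / 2 * ln ((\<alpha> \<bullet> x)\<^sup>2 + 0))"
    unfolding smooth_weight_def using assms
    by (intro tendsto_exp tendsto_sum tendsto_mult tendsto_const tendsto_ln tendsto_add eps) auto
  also have "exp (\<Sum>\<alpha>\<in>R. k \<alpha> / 2 * ln ((\<alpha> \<bullet> x)\<^sup>2 + 0)) = (\<Prod>\<alpha>\<in>R. exp (k \<alpha> / 2 * ln ((\<alpha> \<bullet> x)\<^sup>2)))"
    using finite_R by (simp add: exp_sum)
  also have "\<dots> = root_weight x"
    unfolding root_weight_def
  proof (intro prod.cong refl)
    fix \<alpha> assume "\<alpha> \<in> R"
    then have nz: "\<bar>\<alpha> \<bullet> x\<bar> > 0" using assms by simp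
    have "ln ((\<alpha> \<bullet> x)\<^sup>2) = 2 * ln \<bar>\<alpha> \<bullet> x\<bar>"
      using ln_realpow[of "\<bar>\<alpha> \<bullet> x\<bar>" 2] by simp
    then show "exp (k \<alpha> / 2 * ln ((\<alpha> \<bullet> x)\<^sup>2)) = \<bar>\<alpha> \<bullet> x\<bar> powr k \<alpha>"
      using nz by (simp add: powr_def)
  qed
  finally show ?thesis .
qed

end

text \<open>The integral of a directional derivative of a compactly supported function vanishes, by
  translation invariance of the integral.\<close>

lemma integral_dir_deriv_zero:
  fixes G :: "real^'n \<Rightarrow> complex"
  assumes G: "\<And>x. (G has_derivative G' x) (at x)"
    and cont: "continuous_on UNIV (\<lambda>x. G' x \<xi>)"
    and supp: "\<And>x. norm x \<ge> 1 \<Longrightarrow> G x = 0"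
  shows "(LINT x|lborel. G' x \<xi>) = 0"
proof -
  let ?h = "\<lambda>n. 1 / real (Suc n)"
  let ?Q = "\<lambda>n x. (G (x + ?h n *\<^sub>R \<xi>) - G x) / complex_of_real (?h n)"
  have h: "0 < ?h n" "?h n \<le> 1" for n by auto
  have Gc: "continuous_on S G" for S
    using G by (intro continuous_at_imp_continuous_on ballI has_derivative_continuous) auto
  have Gm [measurable]: "G \<in> borel_measurable borel" by (intro borel_measurable_continuous_onI Gc)
  have G'm [measurable]: "(\<lambda>x. G' x \<xi>) \<in> borel_measurable borel" by (intro borel_measurable_continuous_onI cont)
  define S where "S = cball (0 :: real^'n) (1 + 2 * norm \<xi>)"
  have "bounded ((\<lambda>x. G' x \<xi>) ` S)"
    unfolding S_def by (intro compact_imp_bounded compact_continuous_image continuous_on_subset[OF cont]) auto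
  then obtain K where K: "\<And>x. x \<in> S \<Longrightarrow> norm (G' x \<xi>) \<le> K" by (auto simp: bounded_iff)
  have K0: "K \<ge> 0" using K[of 0] order_trans[OF norm_ge_zero] by (auto simp: S_def)
  have "(\<lambda>n. integral\<^sup>L lborel (?Q n)) \<longlonglongrightarrow> (LINT x|lborel. G' x \<xi>)"
  proof (rule integral_dominated_convergence)
    show "integrable lborel (\<lambda>x :: real^'n. indicator (cball 0 (1 + norm \<xi>)) x *\<^sub>R K)"
      by (rule borel_integrable_compact) auto
    show "AE x in lborel. (\<lambda>n. ?Q n x) \<longlonglongrightarrow> G' x \<xi>"
    proof (intro AE_I2)
      fix x
      have "((\<lambda>t::real. x + t *\<^sub>R \<xi>) has_derivative (\<lambda>t. t *\<^sub>R \<xi>)) (at 0)"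
        by (auto intro!: derivative_eq_intros)
      moreover have "(G has_derivative G' x) (at (x + 0 *\<^sub>R \<xi>))" using G by simp
      ultimately have "((\<lambda>t. G (x + t *\<^sub>R \<xi>)) has_derivative (\<lambda>t. G' x (t *\<^sub>R \<xi>))) (at 0)"
        by (rule has_derivative_compose)
      then have "((\<lambda>h. norm (G (x + (0 + h) *\<^sub>R \<xi>) - G (x + 0 *\<^sub>R \<xi>) - G' x (h *\<^sub>R \<xi>)) / norm h) \<longlongrightarrow> 0) (at 0)"
        unfolding has_derivative_at by blast
      moreover have "filterlim ?h (at 0) sequentially"
        unfolding filterlim_at using LIMSEQ_inverse_real_of_nat by (auto simp: inverse_eq_divide)
      ultimately have "(\<lambda>n. norm (G (x + (0 + ?h n) *\<^sub>R \<xi>) - G (x + 0 *\<^sub>R \<xi>) - G' x (?h n *\<^sub>R \<xi>)) / norm (?h n)) \<longlonglongrightarrow> 0"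
        by (rule filterlim_compose)
      moreover have "norm (G (x + (0 + ?h n) *\<^sub>R \<xi>) - G (x + 0 *\<^sub>R \<xi>) - G' x (?h n *\<^sub>R \<xi>)) / norm (?h n) = norm (?Q n x - G' x \<xi>)" for n
      proof -
        have "G' x (?h n *\<^sub>R \<xi>) = complex_of_real (?h n) * G' x \<xi>"
          using linear_simps(5)[OF has_derivative_bounded_linear[OF G[of x]], of "?h n" \<xi>] by (simp only: scaleR_conv_of_real)
        note G'h = this
        have c: "complex_of_real (?h n) \<noteq> 0" by (subst of_real_eq_0_iff) (rule less_imp_neq[OF h(1), symmetric])
        have "?Q n x - G' x \<xi> = (G (x + ?h n *\<^sub>R \<xi>) - G x - complex_of_real (?h n) * G' x \<xi>) / complex_of_real (?h n)"
          by (simp only: diff_divide_distrib nonzero_mult_div_cancel_left[OF c])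
        then show ?thesis
          by (simp only: G'h norm_divide norm_of_real real_norm_def add_0 add_0_right scaleR_zero_left)
      qed
      ultimately have "(\<lambda>n. norm (?Q n x - G' x \<xi>)) \<longlonglongrightarrow> 0" by (simp only:)
      then show "(\<lambda>n. ?Q n x) \<longlonglongrightarrow> G' x \<xi>"
        by (simp only: tendsto_norm_zero_iff LIM_zero_iff)
    qed
    show "AE x in lborel. norm (?Q n x) \<le> indicator (cball 0 (1 + norm \<xi>)) x *\<^sub>R K" for n
    proof (intro AE_I2)
      fix x :: "real^'n"
      show "norm (?Q n x) \<le> indicator (cball 0 (1 + norm \<xi>)) x *\<^sub>R K"
      proof (cases "norm x \<le> 1 + norm \<xi>")
        case True
        have "norm ((\<lambda>t. G (x + t *\<^sub>R \<xi>)) (?h n) - (\<lambda>t. G (x + t *\<^sub>R \<xi>)) 0) \<le> K * norm (?h n - 0)"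
        proof (rule differentiable_bound[of "{0..1::real}"])
          fix t :: real assume t: "t \<in> {0..1}"
          have "((\<lambda>t::real. x + t *\<^sub>R \<xi>) has_derivative (\<lambda>t. t *\<^sub>R \<xi>)) (at t within {0..1})"
            by (auto intro!: derivative_eq_intros)
          from has_derivative_compose[OF this G]
          show "((\<lambda>t. G (x + t *\<^sub>R \<xi>)) has_derivative (\<lambda>s. G' (x + t *\<^sub>R \<xi>) (s *\<^sub>R \<xi>))) (at t within {0..1})" .
          have "norm (x + t *\<^sub>R \<xi>) \<le> norm x + \<bar>t\<bar> * norm \<xi>" using norm_triangle_ineq[of x "t *\<^sub>R \<xi>"] by simp
          also have "\<bar>t\<bar> * norm \<xi> \<le> norm \<xi>" using t by (simp add: mult_left_le_one_le)
          finally have "x + t *\<^sub>R \<xi> \<in> S" using True by (simp add: S_def)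
          from K[OF this] show "onorm (\<lambda>s. G' (x + t *\<^sub>R \<xi>) (s *\<^sub>R \<xi>)) \<le> K"
            by (intro onorm_bound K0) (simp add: linear_simps(5)[OF has_derivative_bounded_linear[OF G]] mult.commute[of K] mult_left_mono)
        qed (use h[of n] in auto)
        then have "norm (G (x + ?h n *\<^sub>R \<xi>) - G x) \<le> K * ?h n"
          by (simp only: diff_zero real_norm_def abs_of_pos[OF h(1)] scaleR_zero_left add_0_right)
        then have "norm (?Q n x) \<le> K"
          by (simp only: norm_divide norm_of_real abs_of_pos[OF h(1)] pos_divide_le_eq[OF h(1)])
        then show ?thesis using True by simp
      next
        case False
        have "norm x \<le> norm (x + ?h n *\<^sub>R \<xi>) + norm (?h n *\<^sub>R \<xi>)"
          using norm_triangle_ineq4[of "x + ?h n *\<^sub>R \<xi>" "?h n *\<^sub>R \<xi>"] by simp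
        moreover have "norm (?h n *\<^sub>R \<xi>) \<le> norm \<xi>"
          using mult_right_mono[OF h(2)[of n] norm_ge_zero[of \<xi>]] h(1)[of n] by simp
        ultimately have "norm (x + ?h n *\<^sub>R \<xi>) \<ge> 1" "norm x \<ge> 1" using False norm_ge_zero[of \<xi>] by linarith+
        then show ?thesis using False supp by (simp add: K0)
      qed
    qed
  qed measurable
  moreover have "integral\<^sup>L lborel (?Q n) = 0" for n
  proof -
    have "integrable lborel (\<lambda>x. indicator (cball 0 1) x *\<^sub>R G x)"
      by (intro borel_integrable_compact Gc) auto
    moreover have "indicator (cball 0 1) x *\<^sub>R G x = G x" for x using supp[of x] by (auto simp: indicator_def)
    ultimately have I: "integrable lborel G" by simp
    have "integrable (distr lborel borel ((+) (?h n *\<^sub>R \<xi>))) G"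
      unfolding lborel_distr_plus by (rule I)
    then have I': "integrable lborel (\<lambda>x. G (x + ?h n *\<^sub>R \<xi>))"
      by (subst (asm) integrable_distr_eq) (auto simp: add.commute)
    have "integral\<^sup>L lborel G = integral\<^sup>L (distr lborel borel ((+) (?h n *\<^sub>R \<xi>))) G"
      unfolding lborel_distr_plus ..
    also have "\<dots> = (LINT x|lborel. G (x + ?h n *\<^sub>R \<xi>))"
      by (subst integral_distr) (auto simp: add.commute)
    finally show ?thesis using I I' by simp
  qed
  ultimately have "(\<lambda>n::nat. 0 :: complex) \<longlonglongrightarrow> (LINT x|lborel. G' x \<xi>)" by (simp only:)
  then show ?thesis by (simp only: LIMSEQ_const_iff)
qed

text \<open>A cut-off function, to be applied to the squared norm.  Continuous first derivatives are all that
  integration by parts asks for.\<close>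

definition cutoff :: "real \<Rightarrow> real" where
  "cutoff s = (max 0 (1 - s))\<^sup>2"

definition cutoff' :: "real \<Rightarrow> real" where
  "cutoff' s = - 2 * max 0 (1 - s)"

lemma cutoff_derivative: "(cutoff has_real_derivative cutoff' s) (at s)"
proof -
  have "((\<lambda>y::real. (max 0 y)\<^sup>2) has_real_derivative 2 * max 0 y) (at y)" for y
  proof (cases y "0 :: real" rule: linorder_cases)
    case less
    have "((\<lambda>y::real. 0) has_real_derivative 0) (at y)" by simp
    then have "((\<lambda>y::real. (max 0 y)\<^sup>2) has_real_derivative 0) (at y)"
      by (rule has_field_derivative_transform_within_open[where S = "{..<0}"]) (use less in auto)
    then show ?thesis using less by simp
  next
    case greater
    have "((\<lambda>y::real. y\<^sup>2) has_real_derivative 2 * y) (at y)" by (auto intro!: derivative_eq_intros)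
    then have "((\<lambda>y::real. (max 0 y)\<^sup>2) has_real_derivative 2 * y) (at y)"
      by (rule has_field_derivative_transform_within_open[where S = "{0<..}"]) (use greater in auto)
    then show ?thesis using greater by simp
  next
    case equal
    have "((\<lambda>h::real. ((max 0 (0 + h))\<^sup>2 - (max 0 0)\<^sup>2) / h) \<longlongrightarrow> 0) (at 0)"
    proof (rule Lim_null_comparison)
      show "((\<lambda>h::real. \<bar>h\<bar>) \<longlongrightarrow> 0) (at 0)" by (intro tendsto_rabs_zero tendsto_ident_at)
      show "\<forall>\<^sub>F h::real in at 0. norm (((max 0 (0 + h))\<^sup>2 - (max 0 0)\<^sup>2) / h) \<le> \<bar>h\<bar>"
        by (intro always_eventually allI) (auto simp: max_def power2_eq_square)
    qed
    then show ?thesis using equal by (simp add: DERIV_def)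
  qed
  note sqd = this
  have "((\<lambda>s. 1 - s) has_real_derivative -1) (at s)" by (auto intro!: derivative_eq_intros)
  from DERIV_chain2[OF sqd this] show ?thesis
    unfolding cutoff_def[abs_def] cutoff'_def by simp
qed

lemma cutoff_zero: "s \<ge> 1 \<Longrightarrow> cutoff s = 0" "s \<ge> 1 \<Longrightarrow> cutoff' s = 0"
  by (auto simp: cutoff_def cutoff'_def)

lemma cutoff_continuous: "continuous_on S cutoff" "continuous_on S cutoff'"
  unfolding cutoff_def[abs_def] cutoff'_def[abs_def] by (intro continuous_intros)+

context dunkl_setting
begin

lemma dunkl_quotient_uminus:
  assumes "f differentiable (at x)"
  shows "dunkl_quotient (- \<alpha>) f x = - dunkl_quotient \<alpha> f x"
proof -
  have "dir_deriv (- \<alpha>) f x = - dir_deriv \<alpha> f x"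
    using dir_deriv_scaleR[OF assms, of "-1" \<alpha>] by simp
  moreover have "reflection (- \<alpha>) x = reflection \<alpha> x" by (simp add: reflection_def)
  ultimately show ?thesis by (simp add: dunkl_quotient_def)
qed

lemma integrable_compact_support:
  fixes f :: "real^'n \<Rightarrow> complex"
  assumes [measurable]: "f \<in> borel_measurable borel"
    and "\<And>x. norm x \<ge> 1 \<Longrightarrow> f x = 0" "\<And>x. norm x \<le> 1 \<Longrightarrow> cmod (f x) \<le> B"
  shows "integrable lborel f"
proof (rule Bochner_Integration.integrable_bound)
  show "integrable lborel (\<lambda>x :: real^'n. indicator (cball 0 1) x *\<^sub>R \<bar>B\<bar>)"
    by (rule borel_integrable_compact) auto
  show "AE x in lborel. norm (f x) \<le> norm (indicator (cball 0 1) x *\<^sub>R \<bar>B\<bar>)"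
  proof (intro AE_I2)
    fix x show "norm (f x) \<le> norm (indicator (cball 0 1) x *\<^sub>R \<bar>B\<bar>)"
      using assms(2,3)[of x] by (cases "norm x \<le> 1") (auto simp: indicator_def)
  qed
qed simp

lemma continuous_bounded_ball:
  fixes f :: "real^'n \<Rightarrow> complex"
  assumes "continuous_on UNIV f"
  obtains B where "\<And>x. norm x \<le> 1 \<Longrightarrow> cmod (f x) \<le> B"
proof -
  have "bounded (f ` cball 0 1)"
    by (intro compact_imp_bounded compact_continuous_image continuous_on_subset[OF assms]) auto
  then obtain B where "\<forall>y\<in>f ` cball 0 1. cmod y \<le> B" by (auto simp: bounded_iff)
  then show ?thesis by (intro that[of B]) auto
qed

lemma radial_continuous:
  assumes "continuous_on UNIV g"
  shows "continuous_on S (\<lambda>x :: real^'n. complex_of_real (g (x \<bullet> x)))"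
proof (rule continuous_on_of_real)
  have "continuous_on S (\<lambda>x :: real^'n. x \<bullet> x)" by (intro continuous_intros)
  then show "continuous_on S (\<lambda>x :: real^'n. g (x \<bullet> x))"
    by (rule continuous_on_compose2[OF assms]) simp
qed

text \<open>The derivative part, integrated by parts against the smooth weight, produces the singular terms
  \<open>F * (\<alpha> \<bullet> x) / ((\<alpha> \<bullet> x)\<^sup>2 + \<epsilon>)\<close>.  The reflection in \<open>\<alpha>\<close> changes the sign of the fraction, so \<open>F\<close> may be
  replaced by half of \<open>F x - F (reflection \<alpha> x)\<close>, which is divisible by \<open>\<alpha> \<bullet> x\<close>.  This leaves half of the Dunkl
  quotient times a factor that is bounded by one and tends to one; summed over all roots these terms
  compensate the difference part of the Dunkl operator in the limit.\<close>

lemma integral_dunkl_op_cutoff: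
  assumes p: "homogeneous_polynomial m p"
  shows "(LINT x|lborel. complex_of_real (root_weight x) * dunkl_op P k \<xi> (\<lambda>y. p y * complex_of_real (cutoff (y \<bullet> y))) x) = 0"
proof -
  define F where "F = (\<lambda>y. p y * complex_of_real (cutoff (y \<bullet> y)))"
  define dF where "dF x = dir_deriv \<xi> p x * complex_of_real (cutoff (x \<bullet> x)) + p x * complex_of_real (2 * cutoff' (x \<bullet> x) * (x \<bullet> \<xi>))" for x
  define Q where "Q \<alpha> x = dunkl_quotient \<alpha> p x * complex_of_real (cutoff (x \<bullet> x))" for \<alpha> x
  note dp = homogeneous_polynomial_differentiable[OF p]
  have dc: "(\<lambda>y. complex_of_real (cutoff (y \<bullet> y))) differentiable (at x)" for x :: "real^'n"
    using has_derivative_radial[OF cutoff_derivative] by (auto simp: differentiable_def)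
  have Fd: "F differentiable (at x)" for x unfolding F_def by (intro differentiable_mult dp dc)
  have Fc: "continuous_on S F" for S
    unfolding F_def by (intro continuous_intros homogeneous_polynomial_continuous[OF p] radial_continuous cutoff_continuous)
  have dFe: "dir_deriv \<xi> F x = dF x" for x
    unfolding F_def dF_def by (simp add: dir_deriv_mult[OF dp dc] dir_deriv_radial[OF cutoff_derivative])
  have hdp: "continuous_on S (dir_deriv \<xi> p)" for S
    using homogeneous_polynomial_dir_deriv[OF p, of \<xi>] homogeneous_polynomial_continuous
    by (auto split: if_splits)
  have dFc: "continuous_on S dF" for S
    unfolding dF_def[abs_def] of_real_mult
    by (intro continuous_intros hdp homogeneous_polynomial_continuous[OF p] radial_continuous cutoff_continuous)
  have Qe: "dunkl_quotient \<alpha> F x = Q \<alpha> x" if "\<alpha> \<in> R" for \<alpha> x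
    unfolding F_def Q_def by (rule dunkl_quotient_radial[OF dp cutoff_derivative root_nonzero[OF that]])
  have Qc: "continuous_on S (Q \<alpha>)" if "\<alpha> \<in> R" for \<alpha> S
  proof -
    have "continuous_on S (dunkl_quotient \<alpha> p)"
      using homogeneous_polynomial_dunkl_quotient[OF p root_nonzero[OF that]] homogeneous_polynomial_continuous
      by (auto split: if_splits)
    then show ?thesis unfolding Q_def[abs_def] by (intro continuous_intros radial_continuous cutoff_continuous)
  qed
  have supp: "F x = 0" "dF x = 0" "Q \<alpha> x = 0" if "norm x \<ge> 1" for x \<alpha>
  proof -
    have "x \<bullet> x \<ge> 1" using that by (simp add: dot_square_norm)
    then show "F x = 0" "dF x = 0" "Q \<alpha> x = 0" by (simp_all add: F_def dF_def Q_def cutoff_zero)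
  qed
  \<comment> \<open>the Dunkl operator applied to \<open>F\<close>, with the difference part damped near the hyperplanes\<close>
  define A where "A \<epsilon> x = dF x + (\<Sum>\<alpha>\<in>R. complex_of_real (k \<alpha> * (\<alpha> \<bullet> \<xi>) / 2 * ((\<alpha> \<bullet> x)\<^sup>2 / ((\<alpha> \<bullet> x)\<^sup>2 + \<epsilon>))) * Q \<alpha> x)" for \<epsilon> x
  have zero: "(LINT x|lborel. complex_of_real (smooth_weight \<epsilon> x) * A \<epsilon> x) = 0" if \<epsilon>: "\<epsilon> > 0" for \<epsilon>
  proof -
    let ?w = "\<lambda>x. complex_of_real (smooth_weight \<epsilon> x)"
    let ?r = "\<lambda>\<alpha> x. complex_of_real ((\<alpha> \<bullet> x) / ((\<alpha> \<bullet> x)\<^sup>2 + \<epsilon>))"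
    have wc: "continuous_on S ?w" for S by (intro continuous_intros smooth_weight_continuous \<epsilon>)
    have rc: "continuous_on S (?r \<alpha>)" for S \<alpha>
      using square_plus_pos[OF \<epsilon>] by (intro continuous_intros ballI) (metis less_irrefl)
    \<comment> \<open>the derivative of the smooth weight times \<open>F\<close>, whose integral vanishes\<close>
    define G' where "G' x h = F x * complex_of_real (smooth_weight \<epsilon> x * (\<Sum>\<alpha>\<in>R. k \<alpha> * (\<alpha> \<bullet> h) * ((\<alpha> \<bullet> x) / ((\<alpha> \<bullet> x)\<^sup>2 + \<epsilon>)))) + frechet_derivative F (at x) h * ?w x" for x h
    have G'\<xi>: "G' x \<xi> = ?w x * dF x + (\<Sum>\<alpha>\<in>R. complex_of_real (k \<alpha> * (\<alpha> \<bullet> \<xi>)) * (F x * ?w x * ?r \<alpha> x))" for x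
    proof -
      have "frechet_derivative F (at x) \<xi> = dF x"
        using Fd[of x] dir_deriv_eq[of F "frechet_derivative F (at x)" x \<xi>] dFe by (simp add: frechet_derivative_works)
      then show ?thesis unfolding G'_def by (simp add: sum_distrib_left mult_ac)
    qed
    have i1: "integrable lborel (\<lambda>x. ?w x * dF x)"
    proof -
      have c: "continuous_on UNIV (\<lambda>x. ?w x * dF x)" by (intro continuous_intros wc dFc)
      obtain B where "\<And>x. norm x \<le> 1 \<Longrightarrow> cmod (?w x * dF x) \<le> B" using continuous_bounded_ball[OF c] by blast
      then show ?thesis by (intro integrable_compact_support borel_measurable_continuous_onI c) (auto simp: supp)
    qed
    have i2: "integrable lborel (\<lambda>x. F x * ?w x * ?r \<alpha> x)" for \<alpha>
    proof -
      have c: "continuous_on UNIV (\<lambda>x. F x * ?w x * ?r \<alpha> x)" by (intro continuous_on_mult wc Fc rc)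
      obtain B where "\<And>x. norm x \<le> 1 \<Longrightarrow> cmod (F x * ?w x * ?r \<alpha> x) \<le> B" using continuous_bounded_ball[OF c] by blast
      then show ?thesis by (intro integrable_compact_support borel_measurable_continuous_onI c) (auto simp: supp)
    qed
    have "0 = (LINT x|lborel. G' x \<xi>)"
    proof (rule integral_dir_deriv_zero[symmetric, where G = "\<lambda>x. F x * ?w x"])
      fix x
      show "((\<lambda>x. F x * ?w x) has_derivative G' x) (at x)"
        unfolding G'_def[abs_def]
        by (intro has_derivative_mult has_derivative_of_real smooth_weight_has_derivative \<epsilon>)
          (use Fd[of x] in \<open>simp add: frechet_derivative_works\<close>)
    next
      show "continuous_on UNIV (\<lambda>x. G' x \<xi>)"
        unfolding G'\<xi> by (intro continuous_on_add continuous_on_sum continuous_on_mult continuous_on_const wc Fc dFc rc)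
    qed (simp add: supp)
    also have "\<dots> = (LINT x|lborel. ?w x * dF x) + (\<Sum>\<alpha>\<in>R. complex_of_real (k \<alpha> * (\<alpha> \<bullet> \<xi>)) * (LINT x|lborel. F x * ?w x * ?r \<alpha> x))"
    proof -
      have i4: "integrable lborel (\<lambda>x. complex_of_real (k \<alpha> * (\<alpha> \<bullet> \<xi>)) * (F x * ?w x * ?r \<alpha> x))" for \<alpha>
        by (intro integrable_mult_right i2)
      have "(LINT x|lborel. (\<Sum>\<alpha>\<in>R. complex_of_real (k \<alpha> * (\<alpha> \<bullet> \<xi>)) * (F x * ?w x * ?r \<alpha> x))) = (\<Sum>\<alpha>\<in>R. (LINT x|lborel. complex_of_real (k \<alpha> * (\<alpha> \<bullet> \<xi>)) * (F x * ?w x * ?r \<alpha> x)))"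
        by (rule Bochner_Integration.integral_sum[OF i4])
      also have "\<dots> = (\<Sum>\<alpha>\<in>R. complex_of_real (k \<alpha> * (\<alpha> \<bullet> \<xi>)) * (LINT x|lborel. F x * ?w x * ?r \<alpha> x))"
        by (intro sum.cong refl integral_mult_right_zero)
      finally show ?thesis
        unfolding G'\<xi> by (subst Bochner_Integration.integral_add[OF i1 Bochner_Integration.integrable_sum[OF i4]]) simp
    qed
    also have "(\<Sum>\<alpha>\<in>R. complex_of_real (k \<alpha> * (\<alpha> \<bullet> \<xi>)) * (LINT x|lborel. F x * ?w x * ?r \<alpha> x)) =
       (\<Sum>\<alpha>\<in>R. complex_of_real (k \<alpha> * (\<alpha> \<bullet> \<xi>)) * (LINT x|lborel. 1/2 * (Q \<alpha> x * ?w x * complex_of_real ((\<alpha> \<bullet> x)\<^sup>2 / ((\<alpha> \<bullet> x)\<^sup>2 + \<epsilon>)))))"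
    proof (intro sum.cong refl arg_cong2[of _ _ _ _ "(*)"])
      fix \<alpha> assume \<alpha>: "\<alpha> \<in> R"
      note \<alpha>0 = root_nonzero[OF \<alpha>]
      let ?f = "\<lambda>x. F x * ?w x * ?r \<alpha> x"
      have fm: "?f \<in> borel_measurable borel"
        by (intro borel_measurable_continuous_onI continuous_on_mult wc Fc rc)
      have fneg: "?f (reflection \<alpha> x) = - (F (reflection \<alpha> x) * ?w x * ?r \<alpha> x)" for x
        by (simp add: smooth_weight_reflection[OF \<alpha>] reflection_root_inner[OF \<alpha>0])
      then have fr: "(LINT x|lborel. - (F (reflection \<alpha> x) * ?w x * ?r \<alpha> x)) = (LINT x|lborel. ?f x)"
        using integral_reflection[OF \<alpha>0 fm] by simp
      have "integrable (distr lborel borel (reflection \<alpha>)) ?f"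
        unfolding lborel_distr_reflection[OF \<alpha>0] by (rule i2)
      then have "integrable lborel (\<lambda>x. ?f (reflection \<alpha> x))"
        using fm by (subst (asm) integrable_distr_eq) auto
      then have ir: "integrable lborel (\<lambda>x. - (F (reflection \<alpha> x) * ?w x * ?r \<alpha> x))"
        by (simp only: fneg)
      \<comment> \<open>average the integral with its reflected form\<close>
      have "(LINT x|lborel. ?f x) = 1/2 * ((LINT x|lborel. ?f x) + (LINT x|lborel. - (F (reflection \<alpha> x) * ?w x * ?r \<alpha> x)))"
        unfolding fr by simp
      also have "\<dots> = 1/2 * (LINT x|lborel. ?f x + - (F (reflection \<alpha> x) * ?w x * ?r \<alpha> x))"
        by (simp only: Bochner_Integration.integral_add[OF i2 ir])
      also have "\<dots> = (LINT x|lborel. 1/2 * (?f x + - (F (reflection \<alpha> x) * ?w x * ?r \<alpha> x)))"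
        by (rule integral_mult_right_zero[symmetric])
      also have "\<dots> = (LINT x|lborel. 1/2 * (Q \<alpha> x * ?w x * complex_of_real ((\<alpha> \<bullet> x)\<^sup>2 / ((\<alpha> \<bullet> x)\<^sup>2 + \<epsilon>))))"
      proof (intro Bochner_Integration.integral_cong refl arg_cong2[of _ _ _ _ "(*)"])
        fix x
        have "?f x + - (F (reflection \<alpha> x) * ?w x * ?r \<alpha> x) = (F x - F (reflection \<alpha> x)) * ?w x * ?r \<alpha> x"
          by (simp only: left_diff_distrib) simp
        also have "F x - F (reflection \<alpha> x) = complex_of_real (\<alpha> \<bullet> x) * Q \<alpha> x"
          using dunkl_quotient_times[of \<alpha> x F] Qe[OF \<alpha>] by simp
        also have "complex_of_real (\<alpha> \<bullet> x) * Q \<alpha> x * ?w x * ?r \<alpha> x = Q \<alpha> x * ?w x * complex_of_real ((\<alpha> \<bullet> x)\<^sup>2 / ((\<alpha> \<bullet> x)\<^sup>2 + \<epsilon>))"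
          by (simp add: power2_eq_square mult_ac)
        finally show "?f x + - (F (reflection \<alpha> x) * ?w x * ?r \<alpha> x) = Q \<alpha> x * ?w x * complex_of_real ((\<alpha> \<bullet> x)\<^sup>2 / ((\<alpha> \<bullet> x)\<^sup>2 + \<epsilon>))" .
      qed
      finally show "(LINT x|lborel. ?f x) = (LINT x|lborel. 1/2 * (Q \<alpha> x * ?w x * complex_of_real ((\<alpha> \<bullet> x)\<^sup>2 / ((\<alpha> \<bullet> x)\<^sup>2 + \<epsilon>))))" .
    qed
    also have "(LINT x|lborel. ?w x * dF x) + \<dots> = (LINT x|lborel. ?w x * A \<epsilon> x)"
    proof -
      have i3: "integrable lborel (\<lambda>x. 1/2 * (Q \<alpha> x * ?w x * complex_of_real ((\<alpha> \<bullet> x)\<^sup>2 / ((\<alpha> \<bullet> x)\<^sup>2 + \<epsilon>))))" if "\<alpha> \<in> R" for \<alpha>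
      proof -
        have "continuous_on UNIV (\<lambda>x. complex_of_real ((\<alpha> \<bullet> x)\<^sup>2 / ((\<alpha> \<bullet> x)\<^sup>2 + \<epsilon>)))"
          using square_plus_pos[OF \<epsilon>] by (intro continuous_intros ballI) (metis less_irrefl)
        then have c: "continuous_on UNIV (\<lambda>x. 1/2 * (Q \<alpha> x * ?w x * complex_of_real ((\<alpha> \<bullet> x)\<^sup>2 / ((\<alpha> \<bullet> x)\<^sup>2 + \<epsilon>))))"
          by (intro continuous_on_mult continuous_on_const wc Qc that)
        obtain B where "\<And>x. norm x \<le> 1 \<Longrightarrow> cmod (1/2 * (Q \<alpha> x * ?w x * complex_of_real ((\<alpha> \<bullet> x)\<^sup>2 / ((\<alpha> \<bullet> x)\<^sup>2 + \<epsilon>)))) \<le> B"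
          using continuous_bounded_ball[OF c] by blast
        then show ?thesis by (intro integrable_compact_support borel_measurable_continuous_onI c) (auto simp: supp)
      qed
      have "(LINT x|lborel. ?w x * A \<epsilon> x) = (LINT x|lborel. ?w x * dF x + (\<Sum>\<alpha>\<in>R. complex_of_real (k \<alpha> * (\<alpha> \<bullet> \<xi>)) * (1/2 * (Q \<alpha> x * ?w x * complex_of_real ((\<alpha> \<bullet> x)\<^sup>2 / ((\<alpha> \<bullet> x)\<^sup>2 + \<epsilon>))))))"
        by (intro Bochner_Integration.integral_cong refl) (simp add: A_def distrib_left sum_distrib_left mult_ac)
      also have "\<dots> = (LINT x|lborel. ?w x * dF x) + (\<Sum>\<alpha>\<in>R. complex_of_real (k \<alpha> * (\<alpha> \<bullet> \<xi>)) * (LINT x|lborel. 1/2 * (Q \<alpha> x * ?w x * complex_of_real ((\<alpha> \<bullet> x)\<^sup>2 / ((\<alpha> \<bullet> x)\<^sup>2 + \<epsilon>)))))"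
      proof -
        let ?q = "\<lambda>\<alpha> x. 1/2 * (Q \<alpha> x * ?w x * complex_of_real ((\<alpha> \<bullet> x)\<^sup>2 / ((\<alpha> \<bullet> x)\<^sup>2 + \<epsilon>)))"
        have i4: "integrable lborel (\<lambda>x. complex_of_real (k \<alpha> * (\<alpha> \<bullet> \<xi>)) * ?q \<alpha> x)" if "\<alpha> \<in> R" for \<alpha>
          by (intro integrable_mult_right i3 that)
        have "(LINT x|lborel. (\<Sum>\<alpha>\<in>R. complex_of_real (k \<alpha> * (\<alpha> \<bullet> \<xi>)) * ?q \<alpha> x)) = (\<Sum>\<alpha>\<in>R. (LINT x|lborel. complex_of_real (k \<alpha> * (\<alpha> \<bullet> \<xi>)) * ?q \<alpha> x))"
          by (rule Bochner_Integration.integral_sum[OF i4])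
        also have "\<dots> = (\<Sum>\<alpha>\<in>R. complex_of_real (k \<alpha> * (\<alpha> \<bullet> \<xi>)) * (LINT x|lborel. ?q \<alpha> x))"
          by (intro sum.cong refl integral_mult_right_zero)
        finally show ?thesis
          by (subst Bochner_Integration.integral_add[OF i1 Bochner_Integration.integrable_sum[OF i4]]) (simp_all only:)
      qed
      finally show ?thesis by simp
    qed
    finally show ?thesis by simp
  qed
  obtain B1 where B1: "\<And>x. norm x \<le> 1 \<Longrightarrow> cmod (dF x) \<le> B1" using continuous_bounded_ball[OF dFc] by blast
  have "\<exists>B. \<forall>x. norm x \<le> 1 \<longrightarrow> cmod (Q \<alpha> x) \<le> B" if "\<alpha> \<in> R" for \<alpha>
    by (rule continuous_bounded_ball[OF Qc[OF that]]) blast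
  then have "\<forall>\<alpha>\<in>R. \<exists>B. \<forall>x. norm x \<le> 1 \<longrightarrow> cmod (Q \<alpha> x) \<le> B" by blast
  from bchoice[OF this] obtain B2 where "\<forall>\<alpha>\<in>R. \<forall>x. norm x \<le> 1 \<longrightarrow> cmod (Q \<alpha> x) \<le> B2 \<alpha>" by blast
  then have B2: "cmod (Q \<alpha> x) \<le> B2 \<alpha>" if "\<alpha> \<in> R" "norm x \<le> 1" for \<alpha> x using that by blast
  \<comment> \<open>a bound on the unit ball that is uniform in \<open>\<epsilon>\<close>\<close>
  define B where "B = exp (\<Sum>\<alpha>\<in>R. k \<alpha> / 2 * ln ((norm \<alpha>)\<^sup>2 + 1)) * (B1 + (\<Sum>\<alpha>\<in>R. \<bar>k \<alpha> * (\<alpha> \<bullet> \<xi>) / 2\<bar> * B2 \<alpha>))"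
  have "(\<lambda>n. LINT x|lborel. complex_of_real (smooth_weight (1 / real (Suc n)) x) * A (1 / real (Suc n)) x) \<longlonglongrightarrow>
    (LINT x|lborel. complex_of_real (root_weight x) * A 0 x)"
  proof (rule integral_dominated_convergence)
    show "integrable lborel (\<lambda>x :: real^'n. indicator (cball 0 1) x *\<^sub>R B)"
      by (rule borel_integrable_compact) auto
    fix n :: nat
    let ?\<epsilon> = "1 / real (Suc n)"
    have \<epsilon>: "0 < ?\<epsilon>" "?\<epsilon> \<le> 1" by auto
    show "AE x in lborel. norm (complex_of_real (smooth_weight ?\<epsilon> x) * A ?\<epsilon> x) \<le> indicator (cball 0 1) x *\<^sub>R B"
    proof (intro AE_I2)
      fix x :: "real^'n"
      show "norm (complex_of_real (smooth_weight ?\<epsilon> x) * A ?\<epsilon> x) \<le> indicator (cball 0 1) x *\<^sub>R B"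
      proof (cases "norm x \<le> 1")
        case True
        have "cmod (A ?\<epsilon> x) \<le> B1 + (\<Sum>\<alpha>\<in>R. \<bar>k \<alpha> * (\<alpha> \<bullet> \<xi>) / 2\<bar> * B2 \<alpha>)"
          unfolding A_def
        proof (intro norm_triangle_mono B1 True sum_norm_le)
          fix \<alpha> assume \<alpha>: "\<alpha> \<in> R"
          have "\<bar>(\<alpha> \<bullet> x)\<^sup>2 / ((\<alpha> \<bullet> x)\<^sup>2 + ?\<epsilon>)\<bar> \<le> 1"
            using square_plus_pos[OF \<epsilon>(1), of "\<alpha> \<bullet> x"] \<epsilon> by (simp add: divide_le_eq_1 abs_of_nonneg)
          then have "\<bar>k \<alpha> * (\<alpha> \<bullet> \<xi>) / 2\<bar> * \<bar>(\<alpha> \<bullet> x)\<^sup>2 / ((\<alpha> \<bullet> x)\<^sup>2 + ?\<epsilon>)\<bar> \<le> \<bar>k \<alpha> * (\<alpha> \<bullet> \<xi>) / 2\<bar> * 1"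
            by (intro mult_left_mono) auto
          then have "cmod (complex_of_real (k \<alpha> * (\<alpha> \<bullet> \<xi>) / 2 * ((\<alpha> \<bullet> x)\<^sup>2 / ((\<alpha> \<bullet> x)\<^sup>2 + ?\<epsilon>)))) \<le> \<bar>k \<alpha> * (\<alpha> \<bullet> \<xi>) / 2\<bar>"
            unfolding norm_of_real abs_mult[of "k \<alpha> * (\<alpha> \<bullet> \<xi>) / 2"] by simp
          then show "cmod (complex_of_real (k \<alpha> * (\<alpha> \<bullet> \<xi>) / 2 * ((\<alpha> \<bullet> x)\<^sup>2 / ((\<alpha> \<bullet> x)\<^sup>2 + ?\<epsilon>))) * Q \<alpha> x) \<le> \<bar>k \<alpha> * (\<alpha> \<bullet> \<xi>) / 2\<bar> * B2 \<alpha>"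
            unfolding norm_mult[of _ "Q \<alpha> x"] by (intro mult_mono B2 \<alpha> True) auto
        qed
        then have "smooth_weight ?\<epsilon> x * cmod (A ?\<epsilon> x) \<le> B"
          unfolding B_def by (intro mult_mono smooth_weight_bound \<epsilon> True) auto
        then show ?thesis using True by (simp add: norm_mult smooth_weight_nonneg)
      next
        case False
        then have "A ?\<epsilon> x = 0" using supp[of x] by (simp add: A_def)
        then show ?thesis using False by simp
      qed
    qed
    show "(\<lambda>x. complex_of_real (smooth_weight ?\<epsilon> x) * A ?\<epsilon> x) \<in> borel_measurable lborel"
    proof -
      have cc: "continuous_on UNIV (\<lambda>x. complex_of_real (k \<alpha> * (\<alpha> \<bullet> \<xi>) / 2 * ((\<alpha> \<bullet> x)\<^sup>2 / ((\<alpha> \<bullet> x)\<^sup>2 + ?\<epsilon>))))" for \<alpha> :: "real^'n"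
        using square_plus_pos[OF \<epsilon>(1)] by (intro continuous_intros ballI) (metis less_irrefl)
      have wc: "continuous_on UNIV (\<lambda>x. complex_of_real (smooth_weight ?\<epsilon> x))"
        by (intro continuous_on_of_real smooth_weight_continuous \<epsilon>)
      have "continuous_on UNIV (\<lambda>x. complex_of_real (smooth_weight ?\<epsilon> x) * A ?\<epsilon> x)"
        unfolding A_def
        by (intro continuous_on_add continuous_on_sum continuous_on_mult wc cc Qc dFc)
      then show ?thesis by (simp add: borel_measurable_continuous_onI)
    qed
  next
    have dFm [measurable]: "dF \<in> borel_measurable borel" by (intro borel_measurable_continuous_onI dFc)
    have Qm [measurable]: "Q \<alpha> \<in> borel_measurable borel" if "\<alpha> \<in> R" for \<alpha>
      by (intro borel_measurable_continuous_onI Qc that)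
    have "(\<lambda>x. A 0 x) \<in> borel_measurable borel"
      unfolding A_def by (intro borel_measurable_add dFm borel_measurable_sum borel_measurable_times Qm) measurable
    then show "(\<lambda>x. complex_of_real (root_weight x) * A 0 x) \<in> borel_measurable lborel" by simp
    show "AE x in lborel. (\<lambda>n. complex_of_real (smooth_weight (1 / real (Suc n)) x) * A (1 / real (Suc n)) x) \<longlonglongrightarrow> complex_of_real (root_weight x) * A 0 x"
      using AE_off_hyperplanes[OF finite_R zero_notin_R]
    proof eventually_elim
      case (elim x)
      have eps: "(\<lambda>n. 1 / real (Suc n)) \<longlonglongrightarrow> 0" using LIMSEQ_inverse_real_of_nat by (simp add: inverse_eq_divide)
      show ?case
        unfolding A_def using elim
        by (intro tendsto_intros smooth_weight_tendsto eps) auto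
    qed
  qed
  then have lim0: "(LINT x|lborel. complex_of_real (root_weight x) * A 0 x) = 0"
    by (simp add: zero LIMSEQ_const_iff)
  have "(LINT x|lborel. complex_of_real (root_weight x) * dunkl_op P k \<xi> F x) = (LINT x|lborel. complex_of_real (root_weight x) * A 0 x)"
  proof (rule integral_cong_AE)
    have Tc: "continuous_on UNIV (dunkl_op P k \<xi> F)"
    proof -
      have "dunkl_op P k \<xi> F = (\<lambda>x. dF x + (\<Sum>\<alpha>\<in>P. complex_of_real (k \<alpha> * (\<alpha> \<bullet> \<xi>)) * Q \<alpha> x))"
      proof -
        have "dunkl_quotient \<alpha> F x = Q \<alpha> x" if "\<alpha> \<in> P" for \<alpha> x using Qe P_subset that by blast
        then have "(\<Sum>\<alpha>\<in>P. complex_of_real (k \<alpha> * (\<alpha> \<bullet> \<xi>)) * dunkl_quotient \<alpha> F x) = (\<Sum>\<alpha>\<in>P. complex_of_real (k \<alpha> * (\<alpha> \<bullet> \<xi>)) * Q \<alpha> x)" for x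
          by (intro sum.cong refl) (simp only:)
        then show ?thesis by (intro ext) (simp only: dunkl_op_def dFe)
      qed
      then show ?thesis using P_subset by (auto intro!: continuous_on_add continuous_on_sum continuous_on_mult continuous_on_const dFc Qc)
    qed
    then have [measurable]: "dunkl_op P k \<xi> F \<in> borel_measurable borel" by (rule borel_measurable_continuous_onI)
    show "(\<lambda>x. complex_of_real (root_weight x) * dunkl_op P k \<xi> F x) \<in> borel_measurable lborel" by measurable
    have dFm [measurable]: "dF \<in> borel_measurable borel" by (intro borel_measurable_continuous_onI dFc)
    have Qm [measurable]: "Q \<alpha> \<in> borel_measurable borel" if "\<alpha> \<in> R" for \<alpha>
      by (intro borel_measurable_continuous_onI Qc that)
    have "(\<lambda>x. A 0 x) \<in> borel_measurable borel"
      unfolding A_def by (intro borel_measurable_add dFm borel_measurable_sum borel_measurable_times Qm) measurable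
    then show "(\<lambda>x. complex_of_real (root_weight x) * A 0 x) \<in> borel_measurable lborel" by simp
    show "AE x in lborel. complex_of_real (root_weight x) * dunkl_op P k \<xi> F x = complex_of_real (root_weight x) * A 0 x"
      using AE_off_hyperplanes[OF finite_R zero_notin_R]
    proof eventually_elim
      case (elim x)
      have "A 0 x = dF x + (\<Sum>\<alpha>\<in>R. complex_of_real (k \<alpha> * (\<alpha> \<bullet> \<xi>) / 2) * dunkl_quotient \<alpha> F x)"
        unfolding A_def using elim by (auto intro!: sum.cong simp: Qe)
      also have "(\<Sum>\<alpha>\<in>R. complex_of_real (k \<alpha> * (\<alpha> \<bullet> \<xi>) / 2) * dunkl_quotient \<alpha> F x) = 2 * (\<Sum>\<alpha>\<in>P. complex_of_real (k \<alpha> * (\<alpha> \<bullet> \<xi>) / 2) * dunkl_quotient \<alpha> F x)"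
        by (rule sum_R_eq_sum_P) (simp add: k_uminus dunkl_quotient_uminus[OF Fd])
      also have "dF x + \<dots> = dunkl_op P k \<xi> F x"
        by (simp add: dunkl_op_def dFe sum_distrib_left)
      finally show ?case by simp
    qed
  qed
  then show ?thesis using lim0 by (simp add: F_def)
qed

end

section \<open>Orthogonality of Dunkl harmonics\<close>

lemma dunkl_quotient_mult:
  assumes "f differentiable (at x)" "g differentiable (at x)"
  shows "dunkl_quotient \<alpha> (\<lambda>y. f y * g y) x = dunkl_quotient \<alpha> f x * g x + f x * dunkl_quotient \<alpha> g x
    - complex_of_real (\<alpha> \<bullet> x) * dunkl_quotient \<alpha> f x * dunkl_quotient \<alpha> g x"
proof (cases "\<alpha> \<bullet> x = 0")
  case True
  then show ?thesis by (simp add: dunkl_quotient_def dir_deriv_mult[OF assms] algebra_simps)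
next
  case False
  then have nz: "complex_of_real (\<alpha> \<bullet> x) \<noteq> 0" by simp
  have gen: "(F * G - F' * G') / c = (F - F') / c * G + F * ((G - G') / c) - c * ((F - F') / c) * ((G - G') / c)"
    if "c \<noteq> 0" for F G F' G' c :: complex
    using that by (simp add: field_simps)
  show ?thesis using gen[OF nz] False by (simp only: dunkl_quotient_def if_False)
qed

text \<open>The failure of the Leibniz rule: every summand of the correction is odd under its own reflection, so
  it does not contribute to weighted integrals.\<close>

lemma dunkl_op_mult:
  assumes "f differentiable (at x)" "g differentiable (at x)"
  shows "dunkl_op P k \<xi> (\<lambda>y. f y * g y) x = dunkl_op P k \<xi> f x * g x + f x * dunkl_op P k \<xi> g x
    - (\<Sum>\<alpha>\<in>P. complex_of_real (k \<alpha> * (\<alpha> \<bullet> \<xi>)) * (complex_of_real (\<alpha> \<bullet> x) * dunkl_quotient \<alpha> f x * dunkl_quotient \<alpha> g x))"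
  unfolding dunkl_op_def dir_deriv_mult[OF assms] dunkl_quotient_mult[OF assms]
  by (simp add: algebra_simps sum.distrib sum_subtractf sum_distrib_left sum_distrib_right)

lemma dir_deriv_cnj:
  assumes "f differentiable (at x)"
  shows "dir_deriv \<xi> (\<lambda>y. cnj (f y)) x = cnj (dir_deriv \<xi> f x)"
proof -
  obtain f' where d: "(f has_derivative f') (at x)" using assms by (auto simp: differentiable_def)
  have "((\<lambda>y. cnj (f y)) has_derivative (\<lambda>h. cnj (f' h))) (at x)"
    by (rule bounded_linear.has_derivative[OF bounded_linear_cnj d])
  then show ?thesis by (simp add: dir_deriv_eq[OF d] dir_deriv_eq)
qed

lemma dunkl_op_cnj:
  assumes "f differentiable (at x)"
  shows "dunkl_op P k \<xi> (\<lambda>y. cnj (f y)) x = cnj (dunkl_op P k \<xi> f x)"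
proof -
  have "dunkl_quotient \<alpha> (\<lambda>y. cnj (f y)) x = cnj (dunkl_quotient \<alpha> f x)" for \<alpha>
    by (simp add: dunkl_quotient_def dir_deriv_cnj[OF assms])
  then show ?thesis by (simp add: dunkl_op_def dir_deriv_cnj[OF assms])
qed

lemma dunkl_harmonics_cnj:
  assumes p: "p \<in> dunkl_harmonics P k m" and P: "0 \<notin> P"
  shows "(\<lambda>x. cnj (p x)) \<in> dunkl_harmonics P k m"
proof -
  note hp = dunkl_harmonicsD(1)[OF p]
  have "dunkl_op P k \<xi> (\<lambda>y. cnj (p y)) = (\<lambda>x. cnj (dunkl_op P k \<xi> p x))" for \<xi>
    by (intro ext dunkl_op_cnj homogeneous_polynomial_differentiable[OF hp])
  then have "dunkl_laplacian P k (\<lambda>y. cnj (p y)) x = cnj (dunkl_laplacian P k p x)" for x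
    unfolding dunkl_laplacian_def
    by (simp add: dunkl_op_cnj[OF dunkl_op_polynomial_differentiable[OF hp P]])
  then show ?thesis
    using hp dunkl_harmonicsD(2)[OF p] by (simp add: dunkl_harmonics_def homogeneous_polynomial_cnj)
qed

context dunkl_setting
begin

lemma root_weight_nonneg: "0 \<le> root_weight x"
  unfolding root_weight_def by (intro prod_nonneg) auto

lemma root_weight_bound:
  assumes "norm x \<le> 1"
  shows "root_weight x \<le> (\<Prod>\<alpha>\<in>R. norm \<alpha> powr k \<alpha>)"
  unfolding root_weight_def
proof (intro prod_mono conjI)
  fix \<alpha> assume "\<alpha> \<in> R"
  have "\<bar>\<alpha> \<bullet> x\<bar> \<le> norm \<alpha> * norm x" by (rule Cauchy_Schwarz_ineq2)
  also have "\<dots> \<le> norm \<alpha>" using assms by (simp add: mult_left_le)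
  finally show "\<bar>\<alpha> \<bullet> x\<bar> powr k \<alpha> \<le> norm \<alpha> powr k \<alpha>"
    using k_nonneg[OF \<open>\<alpha> \<in> R\<close>] by (intro powr_mono2) auto
qed auto

lemma integrable_weight:
  fixes f :: "real^'n \<Rightarrow> complex"
  assumes f: "continuous_on UNIV f" and supp: "\<And>x. norm x \<ge> 1 \<Longrightarrow> f x = 0"
  shows "integrable lborel (\<lambda>x. complex_of_real (root_weight x) * f x)"
proof -
  have [measurable]: "f \<in> borel_measurable borel" by (rule borel_measurable_continuous_onI[OF f])
  obtain B where B: "\<And>x. norm x \<le> 1 \<Longrightarrow> cmod (f x) \<le> B" using continuous_bounded_ball[OF f] by blast
  show ?thesis
  proof (rule integrable_compact_support)
    show "(\<lambda>x. complex_of_real (root_weight x) * f x) \<in> borel_measurable borel" by measurable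
    fix x :: "real^'n" assume "norm x \<le> 1"
    then show "cmod (complex_of_real (root_weight x) * f x) \<le> (\<Prod>\<alpha>\<in>R. norm \<alpha> powr k \<alpha>) * B"
      unfolding norm_mult norm_of_real abs_of_nonneg[OF root_weight_nonneg]
      by (intro mult_mono root_weight_bound B prod_nonneg) auto
  qed (simp add: supp)
qed

lemma integral_odd_zero:
  fixes f :: "real^'n \<Rightarrow> complex"
  assumes "\<alpha> \<in> R" "f \<in> borel_measurable borel" "\<And>x. f (reflection \<alpha> x) = - f x"
  shows "(LINT x|lborel. complex_of_real (root_weight x) * f x) = 0"
proof -
  note [measurable] = assms(2)
  have "(LINT x|lborel. complex_of_real (root_weight x) * f x) = (LINT x|lborel. complex_of_real (root_weight (reflection \<alpha> x)) * f (reflection \<alpha> x))"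
    by (rule integral_reflection[OF root_nonzero[OF assms(1)], symmetric]) measurable
  also have "\<dots> = - (LINT x|lborel. complex_of_real (root_weight x) * f x)"
    by (simp add: root_weight_reflection[OF assms(1)] assms(3))
  finally show ?thesis by simp
qed

lemma cutoff_support: "norm x \<ge> 1 \<Longrightarrow> cutoff (x \<bullet> x) = 0" "norm x \<ge> 1 \<Longrightarrow> cutoff' (x \<bullet> x) = 0"
  for x :: "real^'n"
  by (simp_all add: cutoff_zero dot_square_norm)

lemma polynomial_dunkl_op:
  assumes "homogeneous_polynomial m p"
  shows "\<exists>n. homogeneous_polynomial n (dunkl_op P k \<xi> p)"
  using homogeneous_polynomial_dunkl_op[OF assms zero_notin_P, of k \<xi>] homogeneous_polynomial_zero
  by (auto split: if_splits)

lemma polynomial_dunkl_quotient_continuous: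
  assumes "homogeneous_polynomial m p" "\<alpha> \<noteq> 0"
  shows "continuous_on S (dunkl_quotient \<alpha> p)"
  using homogeneous_polynomial_dunkl_quotient[OF assms] homogeneous_polynomial_continuous
  by (auto split: if_splits)

lemma dunkl_quotient_reflection:
  assumes "\<alpha> \<noteq> 0"
  shows "complex_of_real (\<alpha> \<bullet> reflection \<alpha> x) * dunkl_quotient \<alpha> f (reflection \<alpha> x) * dunkl_quotient \<alpha> g (reflection \<alpha> x)
    = - (complex_of_real (\<alpha> \<bullet> x) * dunkl_quotient \<alpha> f x * dunkl_quotient \<alpha> g x)"
proof (cases "\<alpha> \<bullet> x = 0")
  case True
  then show ?thesis by (simp add: reflection_fixed)
next
  case False
  have "dunkl_quotient \<alpha> h (reflection \<alpha> x) = dunkl_quotient \<alpha> h x" for h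
    using False by (simp add: dunkl_quotient_def reflection_root_inner[OF assms] reflection_involution[OF assms] field_simps)
  then show ?thesis by (simp add: reflection_root_inner[OF assms])
qed

text \<open>By the Leibniz rule up to odd terms, the integrand is a Dunkl operator applied to a compactly supported
  function.\<close>

lemma dunkl_op_skew:
  assumes p: "homogeneous_polynomial m p" and q: "homogeneous_polynomial n q"
  shows "(LINT x|lborel. complex_of_real (root_weight x) *
     (dunkl_op P k \<xi> p x * (q x * complex_of_real (cutoff (x \<bullet> x))) +
      p x * dunkl_op P k \<xi> (\<lambda>y. q y * complex_of_real (cutoff (y \<bullet> y))) x)) = 0"
proof -
  note dp = homogeneous_polynomial_differentiable[OF p]
  note dq = homogeneous_polynomial_differentiable[OF q]
  note pq = homogeneous_polynomial_mult[OF p q]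
  let ?u = "\<lambda>x :: real^'n. complex_of_real (cutoff (x \<bullet> x))"
  let ?c = "\<lambda>\<alpha> x. complex_of_real (\<alpha> \<bullet> x) * dunkl_quotient \<alpha> p x * dunkl_quotient \<alpha> q x"
  have uc: "continuous_on S ?u" for S by (intro radial_continuous cutoff_continuous)
  have pc: "continuous_on S p" "continuous_on S q" for S
    by (intro homogeneous_polynomial_continuous[OF p] homogeneous_polynomial_continuous[OF q])+
  have eq: "dunkl_op P k \<xi> p x * (q x * ?u x) + p x * dunkl_op P k \<xi> (\<lambda>y. q y * ?u y) x =
     dunkl_op P k \<xi> (\<lambda>y. (p y * q y) * ?u y) x + (\<Sum>\<alpha>\<in>P. complex_of_real (k \<alpha> * (\<alpha> \<bullet> \<xi>)) * (?c \<alpha> x * ?u x))" for x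
  proof -
    have "dunkl_op P k \<xi> (\<lambda>y. (p y * q y) * ?u y) x = dunkl_op P k \<xi> (\<lambda>y. p y * q y) x * ?u x + (p x * q x) * complex_of_real (2 * cutoff' (x \<bullet> x) * (x \<bullet> \<xi>))"
      by (rule dunkl_op_radial[OF homogeneous_polynomial_differentiable[OF pq] cutoff_derivative zero_notin_P])
    moreover have "dunkl_op P k \<xi> (\<lambda>y. q y * ?u y) x = dunkl_op P k \<xi> q x * ?u x + q x * complex_of_real (2 * cutoff' (x \<bullet> x) * (x \<bullet> \<xi>))"
      by (rule dunkl_op_radial[OF dq cutoff_derivative zero_notin_P])
    moreover have "(\<Sum>\<alpha>\<in>P. complex_of_real (k \<alpha> * (\<alpha> \<bullet> \<xi>)) * (?c \<alpha> x * ?u x)) = (\<Sum>\<alpha>\<in>P. complex_of_real (k \<alpha> * (\<alpha> \<bullet> \<xi>)) * ?c \<alpha> x) * ?u x"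
      by (simp only: sum_distrib_right mult.assoc)
    ultimately show ?thesis by (simp only: dunkl_op_mult[OF dp dq]) (simp add: algebra_simps)
  qed
  have Tc: "continuous_on UNIV (dunkl_op P k \<xi> (\<lambda>y. (p y * q y) * ?u y))"
  proof -
    obtain n' where n': "homogeneous_polynomial n' (dunkl_op P k \<xi> (\<lambda>y. p y * q y))"
      using polynomial_dunkl_op[OF pq] by blast
    have "dunkl_op P k \<xi> (\<lambda>y. (p y * q y) * ?u y) = (\<lambda>x. dunkl_op P k \<xi> (\<lambda>y. p y * q y) x * ?u x + (p x * q x) * (complex_of_real (2 * (x \<bullet> \<xi>)) * complex_of_real (cutoff' (x \<bullet> x))))"
      by (intro ext, subst dunkl_op_radial[OF homogeneous_polynomial_differentiable[OF pq] cutoff_derivative zero_notin_P]) simp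
    moreover have "continuous_on UNIV (\<lambda>x. complex_of_real (2 * (x \<bullet> \<xi>)))" by (intro continuous_intros)
    moreover have "continuous_on UNIV (\<lambda>x :: real^'n. complex_of_real (cutoff' (x \<bullet> x)))"
      by (intro radial_continuous cutoff_continuous)
    ultimately show ?thesis
      by (simp only:) (intro continuous_on_add continuous_on_mult pc uc homogeneous_polynomial_continuous[OF n'])
  qed
  have supp0: "dunkl_op P k \<xi> (\<lambda>y. (p y * q y) * ?u y) x = 0" if "norm x \<ge> 1" for x
    by (subst dunkl_op_radial[OF homogeneous_polynomial_differentiable[OF pq] cutoff_derivative zero_notin_P])
      (simp add: cutoff_support[OF that])
  have i1: "integrable lborel (\<lambda>x. complex_of_real (root_weight x) * dunkl_op P k \<xi> (\<lambda>y. (p y * q y) * ?u y) x)"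
    by (rule integrable_weight[OF Tc supp0])
  have cc: "continuous_on UNIV (\<lambda>x. ?c \<alpha> x * ?u x)" if "\<alpha> \<in> P" for \<alpha>
  proof -
    have "\<alpha> \<noteq> 0" using that zero_notin_P by auto
    then show ?thesis
      by (intro continuous_on_mult continuous_on_of_real continuous_on_inner continuous_on_const continuous_on_id
          polynomial_dunkl_quotient_continuous[OF p] polynomial_dunkl_quotient_continuous[OF q] uc)
  qed
  have i2: "integrable lborel (\<lambda>x. complex_of_real (k \<alpha> * (\<alpha> \<bullet> \<xi>)) * (complex_of_real (root_weight x) * (?c \<alpha> x * ?u x)))" if "\<alpha> \<in> P" for \<alpha>
    by (intro integrable_mult_right integrable_weight[OF cc[OF that]]) (simp add: cutoff_support)
  have odd: "(LINT x|lborel. complex_of_real (root_weight x) * (?c \<alpha> x * ?u x)) = 0" if "\<alpha> \<in> P" for \<alpha>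
  proof (rule integral_odd_zero)
    show \<alpha>: "\<alpha> \<in> R" using that P_subset by auto
    show "(\<lambda>x. ?c \<alpha> x * ?u x) \<in> borel_measurable borel" by (rule borel_measurable_continuous_onI[OF cc[OF that]])
    fix x show "?c \<alpha> (reflection \<alpha> x) * ?u (reflection \<alpha> x) = - (?c \<alpha> x * ?u x)"
      by (simp only: dunkl_quotient_reflection[OF root_nonzero[OF \<alpha>]] reflection_inner_inner[OF root_nonzero[OF \<alpha>]] minus_mult_left)
  qed
  have "(LINT x|lborel. complex_of_real (root_weight x) * (dunkl_op P k \<xi> p x * (q x * ?u x) + p x * dunkl_op P k \<xi> (\<lambda>y. q y * ?u y) x))
    = (LINT x|lborel. complex_of_real (root_weight x) * dunkl_op P k \<xi> (\<lambda>y. (p y * q y) * ?u y) x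
       + (\<Sum>\<alpha>\<in>P. complex_of_real (k \<alpha> * (\<alpha> \<bullet> \<xi>)) * (complex_of_real (root_weight x) * (?c \<alpha> x * ?u x))))"
    unfolding eq by (intro Bochner_Integration.integral_cong refl) (simp only: distrib_left sum_distrib_left mult.left_commute)
  also have "\<dots> = (LINT x|lborel. complex_of_real (root_weight x) * dunkl_op P k \<xi> (\<lambda>y. (p y * q y) * ?u y) x)
     + (LINT x|lborel. (\<Sum>\<alpha>\<in>P. complex_of_real (k \<alpha> * (\<alpha> \<bullet> \<xi>)) * (complex_of_real (root_weight x) * (?c \<alpha> x * ?u x))))"
    by (rule Bochner_Integration.integral_add[OF i1 Bochner_Integration.integrable_sum[OF i2]])
  also have "(LINT x|lborel. (\<Sum>\<alpha>\<in>P. complex_of_real (k \<alpha> * (\<alpha> \<bullet> \<xi>)) * (complex_of_real (root_weight x) * (?c \<alpha> x * ?u x))))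
     = (\<Sum>\<alpha>\<in>P. (LINT x|lborel. complex_of_real (k \<alpha> * (\<alpha> \<bullet> \<xi>)) * (complex_of_real (root_weight x) * (?c \<alpha> x * ?u x))))"
    by (rule Bochner_Integration.integral_sum[OF i2])
  also have "\<dots> = 0"
    by (intro sum.neutral ballI) (simp only: integral_mult_right_zero odd mult_zero_right)
  finally show ?thesis using integral_dunkl_op_cutoff[OF pq, of \<xi>] by simp
qed

text \<open>Skew-symmetry applied to \<open>dunkl_op P k \<xi> p\<close> and \<open>q\<close>, summed over an orthonormal basis.  The Laplacian of \<open>p\<close>
  is zero; the second term comes from the derivative of the cut-off.\<close>

lemma harmonic_green:
  assumes p: "p \<in> dunkl_harmonics P k m" and q: "q \<in> dunkl_harmonics P k n"
  shows "(LINT x|lborel. complex_of_real (root_weight x) *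
     (complex_of_real (cutoff (x \<bullet> x)) * (\<Sum>\<xi>\<in>Basis. dunkl_op P k \<xi> p x * dunkl_op P k \<xi> q x) +
      complex_of_real (2 * cutoff' (x \<bullet> x)) * q x * (\<Sum>\<xi>\<in>Basis. complex_of_real (x \<bullet> \<xi>) * dunkl_op P k \<xi> p x))) = 0"
    (is "(LINT x|lborel. complex_of_real (root_weight x) * ?f x) = 0")
    and "continuous_on UNIV (\<lambda>x. complex_of_real (cutoff (x \<bullet> x)) * (\<Sum>\<xi>\<in>Basis. dunkl_op P k \<xi> p x * dunkl_op P k \<xi> q x) +
      complex_of_real (2 * cutoff' (x \<bullet> x)) * q x * (\<Sum>\<xi>\<in>Basis. complex_of_real (x \<bullet> \<xi>) * dunkl_op P k \<xi> p x))"
proof -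
  note hp = dunkl_harmonicsD(1)[OF p] and hq = dunkl_harmonicsD(1)[OF q]
  note dq = homogeneous_polynomial_differentiable[OF hq]
  let ?u = "\<lambda>x :: real^'n. complex_of_real (cutoff (x \<bullet> x))"
  have uc: "continuous_on S ?u" for S by (intro radial_continuous cutoff_continuous)
  have u'c: "continuous_on S (\<lambda>x :: real^'n. complex_of_real (2 * cutoff' (x \<bullet> x)))" for S
    unfolding of_real_mult by (intro continuous_on_mult continuous_on_const radial_continuous cutoff_continuous)
  have Tc: "continuous_on S (dunkl_op P k \<xi> r)" if "homogeneous_polynomial j r" for S \<xi> r j
    using polynomial_dunkl_op[OF that, of \<xi>] homogeneous_polynomial_continuous by blast
  have xc: "continuous_on S (\<lambda>x. complex_of_real (x \<bullet> \<xi>))" for S and \<xi> :: "real^'n" by (intro continuous_intros)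
  show "continuous_on UNIV ?f"
    by (intro continuous_on_add continuous_on_mult continuous_on_sum uc u'c Tc[OF hp] Tc[OF hq] xc homogeneous_polynomial_continuous[OF hq])
  let ?g = "\<lambda>\<xi> x. dunkl_op P k \<xi> (dunkl_op P k \<xi> p) x * (q x * ?u x) + dunkl_op P k \<xi> p x * dunkl_op P k \<xi> (\<lambda>y. q y * ?u y) x"
  have rad: "dunkl_op P k \<xi> (\<lambda>y. q y * ?u y) x = dunkl_op P k \<xi> q x * ?u x + q x * (complex_of_real (2 * cutoff' (x \<bullet> x)) * complex_of_real (x \<bullet> \<xi>))" for \<xi> x
    by (subst dunkl_op_radial[OF dq cutoff_derivative zero_notin_P]) (simp only: of_real_mult)
  have zero: "(LINT x|lborel. complex_of_real (root_weight x) * ?g \<xi> x) = 0" for \<xi>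
  proof -
    obtain j where "homogeneous_polynomial j (dunkl_op P k \<xi> p)" using polynomial_dunkl_op[OF hp] by blast
    from dunkl_op_skew[OF this hq] show ?thesis .
  qed
  have int: "integrable lborel (\<lambda>x. complex_of_real (root_weight x) * ?g \<xi> x)" for \<xi>
  proof (rule integrable_weight)
    obtain j where j: "homogeneous_polynomial j (dunkl_op P k \<xi> p)" using polynomial_dunkl_op[OF hp] by blast
    show "continuous_on UNIV (?g \<xi>)"
      unfolding rad
      by (intro continuous_on_add continuous_on_mult uc u'c xc Tc[OF j] Tc[OF hp] Tc[OF hq] homogeneous_polynomial_continuous[OF hq])
    fix x :: "real^'n" assume "norm x \<ge> 1"
    then show "?g \<xi> x = 0" unfolding rad by (simp add: cutoff_support)
  qed
  have "(\<Sum>\<xi>\<in>Basis. ?g \<xi> x) = ?f x" for x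
  proof -
    have "(\<Sum>\<xi>\<in>Basis. ?g \<xi> x) = dunkl_laplacian P k p x * (q x * ?u x) +
       (\<Sum>\<xi>\<in>Basis. ?u x * (dunkl_op P k \<xi> p x * dunkl_op P k \<xi> q x) + complex_of_real (2 * cutoff' (x \<bullet> x)) * q x * (complex_of_real (x \<bullet> \<xi>) * dunkl_op P k \<xi> p x))"
      unfolding rad dunkl_laplacian_def sum_distrib_right sum.distrib[symmetric]
      by (intro sum.cong refl) (simp add: algebra_simps)
    then show ?thesis by (simp add: dunkl_harmonicsD(2)[OF p] sum.distrib sum_distrib_left)
  qed
  then have "(LINT x|lborel. complex_of_real (root_weight x) * ?f x) = (LINT x|lborel. (\<Sum>\<xi>\<in>Basis. complex_of_real (root_weight x) * ?g \<xi> x))"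
    by (simp only: sum_distrib_left[symmetric])
  also have "\<dots> = (\<Sum>\<xi>\<in>Basis. (LINT x|lborel. complex_of_real (root_weight x) * ?g \<xi> x))"
    by (rule Bochner_Integration.integral_sum[OF int])
  finally show "(LINT x|lborel. complex_of_real (root_weight x) * ?f x) = 0" by (simp only: zero sum.neutral_const)
qed

text \<open>Subtract the two Green formulas for \<open>(p, q)\<close> and \<open>(q, p)\<close>.  The gradient terms are symmetric and
  cancel, and the radial derivatives give \<open>(m - n) p q\<close> plus terms that are odd under reflections.\<close>

theorem harmonic_orthogonal_cutoff:
  assumes p: "p \<in> dunkl_harmonics P k m" and q: "q \<in> dunkl_harmonics P k n" and mn: "m \<noteq> n"
  shows "(LINT x|lborel. complex_of_real (root_weight x) * (complex_of_real (cutoff' (x \<bullet> x)) * (p x * q x))) = 0"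
proof -
  note hp = dunkl_harmonicsD(1)[OF p] and hq = dunkl_harmonicsD(1)[OF q]
  let ?w = "\<lambda>x. complex_of_real (root_weight x)"
  let ?v = "\<lambda>x :: real^'n. complex_of_real (2 * cutoff' (x \<bullet> x))"
  let ?X = "\<lambda>r x. (\<Sum>\<xi>\<in>Basis. complex_of_real (x \<bullet> \<xi>) * dunkl_op P k \<xi> r x)"
  let ?f = "\<lambda>p q x. complex_of_real (cutoff (x \<bullet> x)) * (\<Sum>\<xi>\<in>Basis. dunkl_op P k \<xi> p x * dunkl_op P k \<xi> q x) + ?v x * q x * ?X p x"
  have i: "integrable lborel (\<lambda>x. ?w x * ?f p q x)" "integrable lborel (\<lambda>x. ?w x * ?f q p x)"
    by (intro integrable_weight harmonic_green(2)[OF p q] harmonic_green(2)[OF q p]; simp add: cutoff_support)+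
  let ?e = "\<lambda>\<alpha> x. ?v x * (p x * q (reflection \<alpha> x) - q x * p (reflection \<alpha> x))"
  have u'c: "continuous_on S ?v" for S
    unfolding of_real_mult by (intro continuous_on_mult continuous_on_const radial_continuous cutoff_continuous)
  have ec: "continuous_on UNIV (?e \<alpha>)" for \<alpha>
    by (intro continuous_on_mult continuous_on_diff u'c homogeneous_polynomial_continuous[OF hp] homogeneous_polynomial_continuous[OF hq]
        homogeneous_polynomial_continuous[OF homogeneous_polynomial_reflection[OF hp]] homogeneous_polynomial_continuous[OF homogeneous_polynomial_reflection[OF hq]])
  have ei: "integrable lborel (\<lambda>x. complex_of_real (k \<alpha>) * (?w x * ?e \<alpha> x))" for \<alpha>
    by (intro integrable_mult_right integrable_weight ec) (simp add: cutoff_support)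
  have ez: "(LINT x|lborel. ?w x * ?e \<alpha> x) = 0" if "\<alpha> \<in> P" for \<alpha>
  proof (rule integral_odd_zero)
    show \<alpha>: "\<alpha> \<in> R" using that P_subset by auto
    show "?e \<alpha> \<in> borel_measurable borel" by (rule borel_measurable_continuous_onI[OF ec])
    fix x show "?e \<alpha> (reflection \<alpha> x) = - ?e \<alpha> x"
      by (simp only: reflection_involution[OF root_nonzero[OF \<alpha>]] reflection_inner_inner[OF root_nonzero[OF \<alpha>]])
        (simp add: algebra_simps)
  qed
  have eq: "?w x * ?f p q x - ?w x * ?f q p x = complex_of_real (2 * (real m - real n)) * (?w x * (complex_of_real (cutoff' (x \<bullet> x)) * (p x * q x)))
     + (\<Sum>\<alpha>\<in>P. complex_of_real (k \<alpha>) * (?w x * ?e \<alpha> x))" for x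
  proof -
    have "?w x * ?f p q x - ?w x * ?f q p x = ?w x * (?v x * (q x * ?X p x - p x * ?X q x))"
      by (simp add: algebra_simps)
    also have "q x * ?X p x - p x * ?X q x = (of_nat m - of_nat n) * (p x * q x) + (\<Sum>\<alpha>\<in>P. complex_of_real (k \<alpha>) * (p x * q (reflection \<alpha> x) - q x * p (reflection \<alpha> x)))"
    proof -
      have "q x * ?X p x - p x * ?X q x = (of_nat m - of_nat n) * (p x * q x) +
        ((\<Sum>\<alpha>\<in>P. q x * (complex_of_real (k \<alpha>) * (p x - p (reflection \<alpha> x)))) - (\<Sum>\<alpha>\<in>P. p x * (complex_of_real (k \<alpha>) * (q x - q (reflection \<alpha> x)))))"
        by (simp only: sum_inner_dunkl_op[OF hp] sum_inner_dunkl_op[OF hq] distrib_left sum_distrib_left) (simp add: algebra_simps)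
      also have "(\<Sum>\<alpha>\<in>P. q x * (complex_of_real (k \<alpha>) * (p x - p (reflection \<alpha> x)))) - (\<Sum>\<alpha>\<in>P. p x * (complex_of_real (k \<alpha>) * (q x - q (reflection \<alpha> x))))
        = (\<Sum>\<alpha>\<in>P. complex_of_real (k \<alpha>) * (p x * q (reflection \<alpha> x) - q x * p (reflection \<alpha> x)))"
        unfolding sum_subtractf[symmetric] by (intro sum.cong refl) (simp add: algebra_simps)
      finally show ?thesis .
    qed
    also have "?w x * (?v x * ((of_nat m - of_nat n) * (p x * q x) + (\<Sum>\<alpha>\<in>P. complex_of_real (k \<alpha>) * (p x * q (reflection \<alpha> x) - q x * p (reflection \<alpha> x)))))
      = complex_of_real (2 * (real m - real n)) * (?w x * (complex_of_real (cutoff' (x \<bullet> x)) * (p x * q x))) + (\<Sum>\<alpha>\<in>P. complex_of_real (k \<alpha>) * (?w x * ?e \<alpha> x))"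
    proof -
      have "?w x * (?v x * (\<Sum>\<alpha>\<in>P. complex_of_real (k \<alpha>) * (p x * q (reflection \<alpha> x) - q x * p (reflection \<alpha> x)))) = (\<Sum>\<alpha>\<in>P. complex_of_real (k \<alpha>) * (?w x * ?e \<alpha> x))"
        unfolding sum_distrib_left by (intro sum.cong refl) (simp only: mult_ac)
      then show ?thesis by (simp only: distrib_left) (simp add: algebra_simps)
    qed
    finally show ?thesis .
  qed
  have i0: "integrable lborel (\<lambda>x. complex_of_real (2 * (real m - real n)) * (?w x * (complex_of_real (cutoff' (x \<bullet> x)) * (p x * q x))))"
    by (intro integrable_mult_right integrable_weight continuous_on_mult radial_continuous cutoff_continuous
        homogeneous_polynomial_continuous[OF hp] homogeneous_polynomial_continuous[OF hq]) (simp add: cutoff_support)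
  have "0 = (LINT x|lborel. ?w x * ?f p q x - ?w x * ?f q p x)"
    by (simp only: Bochner_Integration.integral_diff[OF i] harmonic_green(1)[OF p q] harmonic_green(1)[OF q p]) simp
  also have "\<dots> = (LINT x|lborel. complex_of_real (2 * (real m - real n)) * (?w x * (complex_of_real (cutoff' (x \<bullet> x)) * (p x * q x))))
     + (LINT x|lborel. (\<Sum>\<alpha>\<in>P. complex_of_real (k \<alpha>) * (?w x * ?e \<alpha> x)))"
    unfolding eq by (rule Bochner_Integration.integral_add[OF i0 Bochner_Integration.integrable_sum[OF ei]])
  also have "(LINT x|lborel. (\<Sum>\<alpha>\<in>P. complex_of_real (k \<alpha>) * (?w x * ?e \<alpha> x))) = (\<Sum>\<alpha>\<in>P. (LINT x|lborel. complex_of_real (k \<alpha>) * (?w x * ?e \<alpha> x)))"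
    by (rule Bochner_Integration.integral_sum[OF ei])
  also have "\<dots> = 0"
    by (intro sum.neutral ballI) (simp only: integral_mult_right_zero ez mult_zero_right)
  finally have "complex_of_real (2 * (real m - real n)) * (LINT x|lborel. ?w x * (complex_of_real (cutoff' (x \<bullet> x)) * (p x * q x))) = 0"
    by (simp only: integral_mult_right_zero add_0_right)
  then show ?thesis using mn by simp
qed

end

section \<open>Orthogonality of the Laguerre polynomials\<close>

lemma gamma_integral:
  fixes b s :: real
  assumes b: "b > -1" and s: "s > 0"
  shows gamma_integrable: "integrable lborel (\<lambda>t. indicator {0<..} t * t powr b * (t ^ j * exp (- (s * t))))"
    and gamma_integral_1: "(LINT t|lborel. indicator {0<..} t * t powr b * (t ^ j * exp (- t))) = Gamma (b + real j + 1)"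
proof -
  let ?f = "\<lambda>t :: real. indicator {0<..} t * t powr b * (t ^ j * exp (- t))"
  define \<sigma> where "\<sigma> = b + real j + 1"
  have \<sigma>: "\<sigma> > 0" using b by (simp add: \<sigma>_def)
  have f_eq: "?f t = indicator {0..} t * t powr (\<sigma> - 1) / exp t" for t
  proof (cases "t > 0")
    case True
    then have "t powr (\<sigma> - 1) = t powr b * t ^ j" by (simp add: \<sigma>_def powr_add powr_realpow)
    then show ?thesis using True by (simp add: exp_minus divide_inverse)
  next
    case False
    then show ?thesis by (cases "t = 0") (auto simp: indicator_def)
  qed
  have "has_bochner_integral lborel ?f (Gamma \<sigma>)"
  proof (rule has_bochner_integral_nn_integral)
    show "(\<integral>\<^sup>+t. ennreal (?f t) \<partial>lborel) = ennreal (Gamma \<sigma>)"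
      unfolding f_eq by (rule Gamma_conv_nn_integral_real[OF \<sigma>, symmetric])
    show "AE t in lborel. 0 \<le> ?f t" by (auto simp: indicator_def)
    show "0 \<le> Gamma \<sigma>" using Gamma_real_pos[OF \<sigma>] by simp
  qed measurable
  then have 1: "integrable lborel ?f" "integral\<^sup>L lborel ?f = Gamma \<sigma>"
    by (auto simp: has_bochner_integral_iff)
  from 1(2) show "(LINT t|lborel. indicator {0<..} t * t powr b * (t ^ j * exp (- t))) = Gamma (b + real j + 1)"
    by (simp add: \<sigma>_def)
  have "integrable lborel (\<lambda>t. ?f (0 + s * t))"
    using s by (intro lborel_integrable_real_affine 1) auto
  then have "integrable lborel (\<lambda>t. (s powr b * s ^ j) * (indicator {0<..} t * t powr b * (t ^ j * exp (- (s * t)))))"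
  proof (rule Bochner_Integration.integrable_cong[THEN iffD1, rotated 2])
    fix t :: real
    show "?f (0 + s * t) = (s powr b * s ^ j) * (indicator {0<..} t * t powr b * (t ^ j * exp (- (s * t))))"
      using s by (cases "t > 0") (auto simp: indicator_def powr_mult power_mult_distrib zero_less_mult_iff)
  qed simp
  then show "integrable lborel (\<lambda>t. indicator {0<..} t * t powr b * (t ^ j * exp (- (s * t))))"
  proof -
    assume *: "integrable lborel (\<lambda>t. (s powr b * s ^ j) * (indicator {0<..} t * t powr b * (t ^ j * exp (- (s * t)))))"
    have "inverse c * (c * X) = X" if "c \<noteq> 0" for c X :: real using that by simp
    then have inv: "inverse (s powr b * s ^ j) * ((s powr b * s ^ j) * X) = X" for X :: real
      using s by (metis less_irrefl mult_eq_0_iff powr_gt_zero zero_less_power)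
    from integrable_mult_right[OF *, of "inverse (s powr b * s ^ j)"]
    show ?thesis by (simp only: inv)
  qed
qed

lemma poly_exp_integrable:
  fixes b s :: real and q :: "real poly"
  assumes "b > -1" "s > 0"
  shows "integrable lborel (\<lambda>t. indicator {0<..} t * t powr b * (poly q t * exp (- (s * t))))"
proof -
  have "integrable lborel (\<lambda>t. \<Sum>i\<le>degree q. coeff q i * (indicator {0<..} t * t powr b * (t ^ i * exp (- (s * t)))))"
    by (intro Bochner_Integration.integrable_sum integrable_mult_right gamma_integrable assms)
  moreover have "(\<Sum>i\<le>degree q. coeff q i * (indicator {0<..} t * t powr b * (t ^ i * exp (- (s * t)))))
    = indicator {0<..} t * t powr b * (poly q t * exp (- (s * t)))" for t
    unfolding poly_altdef sum_distrib_left sum_distrib_right by (intro sum.cong refl) (simp only: mult_ac)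
  ultimately show ?thesis by (simp only:)
qed

lemma binomial_alternating_sum_Suc:
  fixes f :: "nat \<Rightarrow> real"
  shows "(\<Sum>j\<le>Suc l. (-1) ^ j * real (Suc l choose j) * f j) = (\<Sum>j\<le>l. (-1) ^ j * real (l choose j) * (f j - f (Suc j)))"
proof -
  have 1: "(\<Sum>j\<le>Suc l. (-1) ^ j * real (l choose j) * f j) = f 0 + (\<Sum>j\<le>l. (-1) ^ Suc j * real (l choose Suc j) * f (Suc j))"
    by (subst sum.atMost_Suc_shift) simp
  have 2: "(\<Sum>j\<le>Suc l. (-1) ^ j * real (l choose j) * f j) = (\<Sum>j\<le>l. (-1) ^ j * real (l choose j) * f j)"
    by simp
  have "(\<Sum>j\<le>Suc l. (-1) ^ j * real (Suc l choose j) * f j) = f 0 + (\<Sum>j\<le>l. (-1) ^ Suc j * real (Suc l choose Suc j) * f (Suc j))"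
    by (subst sum.atMost_Suc_shift) simp
  also have "(\<Sum>j\<le>l. (-1) ^ Suc j * real (Suc l choose Suc j) * f (Suc j)) =
     (\<Sum>j\<le>l. (-1) ^ Suc j * real (l choose j) * f (Suc j)) + (\<Sum>j\<le>l. (-1) ^ Suc j * real (l choose Suc j) * f (Suc j))"
    unfolding sum.distrib[symmetric] by (intro sum.cong refl) (simp add: algebra_simps)
  finally show ?thesis using 1 2
    by (simp add: right_diff_distrib sum_subtractf sum_negf)
qed

text \<open>An \<open>l\<close>-th finite difference of a polynomial of degree \<open>i < l\<close>.\<close>

lemma binomial_alternating_sum_pochhammer:
  fixes c :: real
  assumes "i < l"
  shows "(\<Sum>j\<le>l. (-1) ^ j * real (l choose j) * pochhammer (c + real j) i) = 0"
  using assms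
proof (induction l arbitrary: i c)
  case (Suc l)
  show ?case
  proof (cases i)
    case 0
    then show ?thesis by (simp only: binomial_alternating_sum_Suc) simp
  next
    case (Suc i')
    have "pochhammer (c + real j) (Suc i') - pochhammer (c + real (Suc j)) (Suc i') = - (1 + real i') * pochhammer (c + 1 + real j) i'" for j
    proof -
      have "pochhammer (c + real j) (Suc i') = (c + real j) * pochhammer (c + 1 + real j) i'"
        by (simp add: pochhammer_rec add_ac)
      moreover have "pochhammer (c + real (Suc j)) (Suc i') = (c + 1 + real j + real i') * pochhammer (c + 1 + real j) i'"
        by (simp add: pochhammer_rec' add_ac)
      ultimately show ?thesis by (simp add: algebra_simps)
    qed
    then have "(\<Sum>j\<le>Suc l. (-1) ^ j * real (Suc l choose j) * pochhammer (c + real j) i) =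
       (\<Sum>j\<le>l. - (1 + real i') * ((-1) ^ j * real (l choose j) * pochhammer ((c + 1) + real j) i'))"
      unfolding Suc binomial_alternating_sum_Suc by (intro sum.cong refl) (simp only: mult_ac)
    also have "\<dots> = - (1 + real i') * (\<Sum>j\<le>l. (-1) ^ j * real (l choose j) * pochhammer ((c + 1) + real j) i')"
      by (rule sum_distrib_left[symmetric])
    also have "\<dots> = 0" using Suc.IH[of i' "c + 1"] Suc.prems Suc by simp
    finally show ?thesis .
  qed
qed simp

text \<open>The moments are Gamma values, and the Gamma factors of the coefficients turn the sum into an \<open>l\<close>-th
  finite difference.\<close>

lemma laguerre_moment_zero:
  assumes lam: "lam > -1" and i: "i < l"
  shows "(LINT t|lborel. indicator {0<..} t * t powr lam * (t ^ i * laguerre l lam t * exp (- t))) = 0"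
proof -
  have "(LINT t|lborel. indicator {0<..} t * t powr lam * (t ^ i * laguerre l lam t * exp (- t)))
    = (LINT t|lborel. (\<Sum>j\<le>l. laguerre_coeff l lam j * (indicator {0<..} t * t powr lam * (t ^ (i + j) * exp (- t)))))"
    unfolding poly_laguerre[symmetric] laguerre_poly_def poly_sum poly_monom sum_distrib_left sum_distrib_right power_add
    by (intro Bochner_Integration.integral_cong refl sum.cong) (simp only: mult_ac)
  also have "\<dots> = (\<Sum>j\<le>l. laguerre_coeff l lam j * Gamma (lam + real (i + j) + 1))"
    using gamma_integrable[OF lam zero_less_one] gamma_integral_1[OF lam zero_less_one]
    by (subst Bochner_Integration.integral_sum) (auto intro!: integrable_mult_right)
  also have "\<dots> = (\<Sum>j\<le>l. Gamma (lam + real l + 1) / fact l * ((-1) ^ j * real (l choose j) * pochhammer ((lam + 1) + real j) i))"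
  proof (intro sum.cong refl)
    fix j assume "j \<in> {..l}"
    then have j: "j \<le> l" by simp
    have pos: "lam + 1 + real j > 0" using lam by simp
    then have n: "lam + 1 + real j \<notin> \<int>\<^sub>\<le>\<^sub>0" using nonpos_Ints_nonpos[of "lam + 1 + real j"] by auto
    have G: "Gamma (lam + real (i + j) + 1) = pochhammer (lam + 1 + real j) i * Gamma (lam + 1 + real j)"
      using pochhammer_Gamma[OF n, of i] Gamma_real_pos[OF pos] by (simp add: add_ac)
    have B: "real (l choose j) = fact l / (fact j * fact (l - j))" by (rule binomial_fact[OF j])
    show "laguerre_coeff l lam j * Gamma (lam + real (i + j) + 1) = Gamma (lam + real l + 1) / fact l * ((-1) ^ j * real (l choose j) * pochhammer ((lam + 1) + real j) i)"
      unfolding G B using j Gamma_real_pos[OF pos] by (simp add: laguerre_coeff_def add_ac mult_ac)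
  qed
  also have "\<dots> = Gamma (lam + real l + 1) / fact l * (\<Sum>j\<le>l. (-1) ^ j * real (l choose j) * pochhammer ((lam + 1) + real j) i)"
    by (rule sum_distrib_left[symmetric])
  also have "\<dots> = 0" by (simp only: binomial_alternating_sum_pochhammer[OF i] mult_zero_right)
  finally show ?thesis .
qed

lemma laguerre_orthogonal_less:
  assumes lam: "lam > -1" and "l' < l"
  shows "(LINT t|lborel. indicator {0<..} t * t powr lam * (laguerre l' lam t * laguerre l lam t * exp (- t))) = 0"
proof -
  have int: "integrable lborel (\<lambda>t. laguerre_coeff l' lam i * (indicator {0<..} t * t powr lam * (t ^ i * laguerre l lam t * exp (- t))))" for i
  proof (intro integrable_mult_right)
    have "integrable lborel (\<lambda>t. indicator {0<..} t * t powr lam * (poly (monom 1 i * laguerre_poly l lam) t * exp (- (1 * t))))"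
      by (intro poly_exp_integrable lam) simp
    then show "integrable lborel (\<lambda>t. indicator {0<..} t * t powr lam * (t ^ i * laguerre l lam t * exp (- t)))"
      by (simp add: poly_monom poly_laguerre)
  qed
  have "(LINT t|lborel. indicator {0<..} t * t powr lam * (laguerre l' lam t * laguerre l lam t * exp (- t)))
    = (LINT t|lborel. (\<Sum>i\<le>l'. laguerre_coeff l' lam i * (indicator {0<..} t * t powr lam * (t ^ i * laguerre l lam t * exp (- t)))))"
    unfolding poly_laguerre[of l', symmetric] laguerre_poly_def poly_sum poly_monom sum_distrib_left sum_distrib_right
    by (intro Bochner_Integration.integral_cong refl sum.cong) (simp only: mult_ac)
  also have "\<dots> = (\<Sum>i\<le>l'. (LINT t|lborel. laguerre_coeff l' lam i * (indicator {0<..} t * t powr lam * (t ^ i * laguerre l lam t * exp (- t)))))"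
    by (rule Bochner_Integration.integral_sum[OF int])
  also have "\<dots> = 0"
    using assms by (intro sum.neutral ballI) (simp only: integral_mult_right_zero laguerre_moment_zero[OF lam] mult_zero_right atMost_iff le_less_trans)
  finally show ?thesis .
qed

lemma laguerre_orthogonal:
  assumes lam: "lam > -1" and "l \<noteq> l'"
  shows "(LINT t|lborel. indicator {0<..} t * t powr lam * (laguerre l lam t * laguerre l' lam t * exp (- t))) = 0"
proof (cases "l < l'")
  case True
  then show ?thesis by (rule laguerre_orthogonal_less[OF lam])
next
  case False
  then have "l' < l" using assms by simp
  from laguerre_orthogonal_less[OF lam this] show ?thesis by (simp only: mult.commute[of "laguerre l' lam _"])
qed

section \<open>The functions Phi are orthogonal\<close>

locale ka_setting = dunkl_setting R P k for R P :: "(real^'n) set" and k :: "real^'n \<Rightarrow> real" +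
  fixes a :: real
  assumes a_pos: "0 < a" and admissible: "a + 2 * mult_index P k + real CARD('n) > 2"
begin

text \<open>The variable of the Laguerre polynomials in \<open>\<Phi>\<close>.\<close>

definition radius :: "real^'n \<Rightarrow> real" where
  "radius x = 2 / a * norm x powr a"

abbreviation M :: "(real^'n) measure" where
  "M \<equiv> weight_measure R k a"

lemma mult_index_nonneg: "0 \<le> mult_index P k"
  unfolding mult_index_def using k_nonneg P_subset by (intro sum_nonneg) auto

lemma lambda_gt: "lambda_kam P k a m > -1"
proof -
  have "2 * real m + 2 * mult_index P k + real CARD('n) - 2 > - a" using admissible by linarith
  then show ?thesis using a_pos by (simp add: lambda_kam_def field_simps)
qed

lemma weight_eq: "weight R k a x = norm x powr (a - 2) * root_weight x"
  by (simp add: weight_def root_weight_def)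

lemma weight_measurable [measurable]: "weight R k a \<in> borel_measurable borel"
  unfolding weight_eq[abs_def] by measurable

lemma radius_measurable [measurable]: "radius \<in> borel_measurable borel"
  unfolding radius_def[abs_def] by measurable

lemma weight_nonneg: "0 \<le> weight R k a x"
  by (simp add: weight_eq root_weight_nonneg)

lemma sets_M [simp]: "sets M = sets borel" and space_M [simp]: "space M = UNIV"
  by (simp_all add: weight_measure_def)

lemma borel_measurable_M [simp]:
  "(borel_measurable M :: (real^'n \<Rightarrow> 'b::topological_space) set) = borel_measurable borel"
  by (rule measurable_cong_sets) auto

lemma sum_k: "(\<Sum>\<alpha>\<in>R. k \<alpha>) = 2 * mult_index P k"
proof -
  have "(\<Sum>\<alpha>\<in>R. complex_of_real (k \<alpha>)) = 2 * (\<Sum>\<alpha>\<in>P. complex_of_real (k \<alpha>))"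
    by (rule sum_R_eq_sum_P) (simp add: k_uminus)
  also have "\<dots> = complex_of_real (2 * mult_index P k)" by (simp add: mult_index_def)
  finally show ?thesis by (simp only: of_real_sum[symmetric] of_real_eq_iff)
qed

lemma weight_homogeneous:
  assumes c: "c > 0"
  shows "weight R k a (c *\<^sub>R x) = c powr (a - 2 + 2 * mult_index P k) * weight R k a x"
proof -
  have "root_weight (c *\<^sub>R x) = (\<Prod>\<alpha>\<in>R. c powr k \<alpha> * \<bar>\<alpha> \<bullet> x\<bar> powr k \<alpha>)"
    unfolding root_weight_def using c by (intro prod.cong) (auto simp: abs_mult powr_mult)
  also have "\<dots> = c powr (\<Sum>\<alpha>\<in>R. k \<alpha>) * root_weight x"
    using c by (simp add: prod.distrib root_weight_def powr_sum)
  finally have "root_weight (c *\<^sub>R x) = c powr (2 * mult_index P k) * root_weight x" by (simp only: sum_k)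
  moreover have "norm (c *\<^sub>R x) powr (a - 2) = c powr (a - 2) * norm x powr (a - 2)"
    using c by (simp add: powr_mult)
  ultimately show ?thesis by (simp add: weight_eq powr_add)
qed

text \<open>Near the origin, a homogeneous function of sufficiently large degree is controlled by a bound on a shell; the
  exponent \<open>a - 2\<close> may have either sign.\<close>

lemma weight_shell_bound:
  assumes "1/2 \<le> norm x" "norm x \<le> 1"
  shows "weight R k a x \<le> (1 + (1/2) powr (a - 2)) * (\<Prod>\<alpha>\<in>R. norm \<alpha> powr k \<alpha>)"
proof -
  have "norm x powr (a - 2) \<le> 1 + (1/2) powr (a - 2)"
  proof (cases "a \<ge> 2")
    case True
    then have "norm x powr (a - 2) \<le> 1 powr (a - 2)" using assms by (intro powr_mono2) auto
    then show ?thesis by (simp add: add_increasing2)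
  next
    case False
    then have "norm x powr (a - 2) \<le> (1/2) powr (a - 2)" using assms by (intro powr_mono2') auto
    then show ?thesis by simp
  qed
  then show ?thesis unfolding weight_eq
    using root_weight_bound[OF assms(2)] root_weight_nonneg by (intro mult_mono) auto
qed

lemma AE_weight_pos: "AE x in lborel. weight R k a x > 0"
  using AE_off_hyperplanes[OF finite_R zero_notin_R] AE_lborel_singleton[of "0 :: real^'n"]
  by eventually_elim (auto simp: weight_eq root_weight_def intro!: mult_pos_pos prod_pos)

lemma AE_M_iff: "Measurable.pred borel Q \<Longrightarrow> (AE x in M. Q x) \<longleftrightarrow> (AE x in lborel. Q x)"
proof -
  assume "Measurable.pred borel Q"
  have "(AE x in M. Q x) \<longleftrightarrow> (AE x in lborel. 0 < ennreal (weight R k a x) \<longrightarrow> Q x)"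
    unfolding weight_measure_def by (rule AE_density) measurable
  also have "\<dots> \<longleftrightarrow> (AE x in lborel. Q x)"
    using AE_weight_pos by (auto elim: eventually_elim2)
  finally show ?thesis .
qed

lemma AE_M_I: "(AE x in lborel. Q x) \<Longrightarrow> (AE x in M. Q x)"
  unfolding weight_measure_def by (subst AE_density) (auto elim: eventually_mono)

lemma integral_M:
  fixes f :: "real^'n \<Rightarrow> complex"
  assumes [measurable]: "f \<in> borel_measurable borel"
  shows "(LINT x|M. f x) = (LINT x|lborel. complex_of_real (weight R k a x) * f x)"
    and "integrable M f \<longleftrightarrow> integrable lborel (\<lambda>x. complex_of_real (weight R k a x) * f x)"
  unfolding weight_measure_def using weight_nonneg
  by (simp_all add: integral_density integrable_density scaleR_conv_of_real)

lemma radial_exponent: "(real m + real m + (a - 2 + 2 * mult_index P k) + real CARD('n)) / a - 1 = lambda_kam P k a m"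
  using a_pos by (simp add: lambda_kam_def field_simps)

lemma radial_exponent_gt: "(real m + real n + (a - 2 + 2 * mult_index P k) + real CARD('n)) / a - 1 > -1"
proof -
  have "real m + real n + (a - 2 + 2 * mult_index P k) + real CARD('n) > 0" using admissible by linarith
  then show ?thesis using a_pos by simp
qed

text \<open>The constant depends on \<open>p\<close> and \<open>q\<close> but not on the radial factor \<open>h\<close>.  The integrability of the
  homogeneous part is where the assumption on \<open>a\<close> enters.\<close>

lemma radial_formula:
  assumes p: "homogeneous_polynomial m p" and q: "homogeneous_polynomial n q"
  obtains C where
    "\<And>h :: real \<Rightarrow> real. h \<in> borel_measurable borel \<Longrightarrow>
      integrable lborel (\<lambda>t. indicator {0<..} t * t powr ((real m + real n + (a - 2 + 2 * mult_index P k) + real CARD('n)) / a - 1) * h t) \<Longrightarrow>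
      integrable M (\<lambda>x. p x * q x * complex_of_real (h (radius x))) \<and>
      (LINT x|M. p x * q x * complex_of_real (h (radius x))) =
        C * complex_of_real (LINT t|lborel. indicator {0<..} t * t powr ((real m + real n + (a - 2 + 2 * mult_index P k) + real CARD('n)) / a - 1) * h t)"
proof -
  define d where "d = real m + real n + (a - 2 + 2 * mult_index P k)"
  define F where "F x = complex_of_real (weight R k a x) * (p x * q x)" for x
  have pqc: "continuous_on UNIV (\<lambda>x. p x * q x)"
    by (intro continuous_on_mult homogeneous_polynomial_continuous[OF p] homogeneous_polynomial_continuous[OF q])
  have pm [measurable]: "p \<in> borel_measurable borel" "q \<in> borel_measurable borel"
    by (intro borel_measurable_continuous_onI homogeneous_polynomial_continuous[OF p] homogeneous_polynomial_continuous[OF q])+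
  have Fm: "F \<in> borel_measurable borel" unfolding F_def[abs_def] by measurable
  have Fh: "F (c *\<^sub>R x) = complex_of_real (c powr d) * F x" if "c > 0" for c x
  proof -
    have "c powr d = c ^ m * c ^ n * c powr (a - 2 + 2 * mult_index P k)"
      unfolding d_def using that by (simp only: powr_add powr_realpow)
    then show ?thesis
      unfolding F_def weight_homogeneous[OF that] homogeneous_polynomial_scale[OF p] homogeneous_polynomial_scale[OF q]
      by (simp add: mult_ac)
  qed
  obtain B where B: "\<And>x. norm x \<le> 1 \<Longrightarrow> cmod (p x * q x) \<le> B" using continuous_bounded_ball[OF pqc] by blast
  have Fb: "cmod (F x) \<le> ((1 + (1/2) powr (a - 2)) * (\<Prod>\<alpha>\<in>R. norm \<alpha> powr k \<alpha>)) * B" if x: "1/2 \<le> norm x" "norm x \<le> 1" for x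
    unfolding F_def norm_mult[of "complex_of_real _"] norm_of_real abs_of_nonneg[OF weight_nonneg]
    by (intro mult_mono weight_shell_bound x B) (auto intro!: mult_nonneg_nonneg prod_nonneg)
  have d: "d + real CARD('n) > 0" using admissible by (simp add: d_def)
  obtain C where C: "\<And>h :: real \<Rightarrow> real. h \<in> borel_measurable borel \<Longrightarrow>
      integrable lborel (\<lambda>t. indicator {0<..} t * t powr ((d + real CARD('n)) / a - 1) * h t) \<Longrightarrow>
      integrable lborel (\<lambda>x. F x * complex_of_real (h (2 / a * norm x powr a))) \<and>
      (LINT x|lborel. F x * complex_of_real (h (2 / a * norm x powr a))) =
        C * complex_of_real (LINT t|lborel. indicator {0<..} t * t powr ((d + real CARD('n)) / a - 1) * h t)"
    using homogeneous_radial_integral[OF Fm Fh Fb d a_pos] by blast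
  show ?thesis
  proof (rule that[of C])
    fix h :: "real \<Rightarrow> real"
    assume h [measurable]: "h \<in> borel_measurable borel"
      and int: "integrable lborel (\<lambda>t. indicator {0<..} t * t powr ((real m + real n + (a - 2 + 2 * mult_index P k) + real CARD('n)) / a - 1) * h t)"
    have meas: "(\<lambda>x. p x * q x * complex_of_real (h (radius x))) \<in> borel_measurable borel" by measurable
    have eq: "complex_of_real (weight R k a x) * (p x * q x * complex_of_real (h (radius x))) = F x * complex_of_real (h (2 / a * norm x powr a))" for x
      by (simp only: F_def radius_def mult.assoc)
    show "integrable M (\<lambda>x. p x * q x * complex_of_real (h (radius x))) \<and>
      (LINT x|M. p x * q x * complex_of_real (h (radius x))) =
        C * complex_of_real (LINT t|lborel. indicator {0<..} t * t powr ((real m + real n + (a - 2 + 2 * mult_index P k) + real CARD('n)) / a - 1) * h t)"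
      unfolding integral_M[OF meas] eq using C[OF h] int by (simp only: d_def)
  qed
qed

text \<open>The constant of the radial formula does not depend on \<open>h\<close>, so it is enough to find one radial factor
  with non-zero one-dimensional integral for which the integral vanishes.\<close>

lemma harmonic_orthogonal:
  assumes p: "p \<in> dunkl_harmonics P k m" and q: "q \<in> dunkl_harmonics P k n" and mn: "m \<noteq> n"
    and h: "h \<in> borel_measurable borel"
      "integrable lborel (\<lambda>t. indicator {0<..} t * t powr ((real m + real n + (a - 2 + 2 * mult_index P k) + real CARD('n)) / a - 1) * h t)"
  shows "(LINT x|M. p x * q x * complex_of_real (h (radius x))) = 0"
proof -
  note hp = dunkl_harmonicsD(1)[OF p] and hq = dunkl_harmonicsD(1)[OF q]
  define e where "e = (real m + real n + (a - 2 + 2 * mult_index P k) + real CARD('n)) / a - 1"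
  obtain C where C: "\<And>h :: real \<Rightarrow> real. h \<in> borel_measurable borel \<Longrightarrow>
      integrable lborel (\<lambda>t. indicator {0<..} t * t powr e * h t) \<Longrightarrow>
      integrable M (\<lambda>x. p x * q x * complex_of_real (h (radius x))) \<and>
      (LINT x|M. p x * q x * complex_of_real (h (radius x))) = C * complex_of_real (LINT t|lborel. indicator {0<..} t * t powr e * h t)"
    using radial_formula[OF hp hq] unfolding e_def by blast
  \<comment> \<open>this factor turns the weight into the root weight times the derivative of the cut-off, up to sign\<close>
  define \<phi> where "\<phi> t = - cutoff' ((a * t / 2) powr (2 / a)) * (a * t / 2) powr ((2 - a) / a)" for t
  define g where "g t = indicator {0<..} t * t powr e * \<phi> t" for t
  have cm [measurable]: "cutoff' \<in> borel_measurable borel"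
    by (intro borel_measurable_continuous_onI cutoff_continuous)
  have \<phi>m [measurable]: "\<phi> \<in> borel_measurable borel" unfolding \<phi>_def[abs_def] by measurable
  have gm [measurable]: "g \<in> borel_measurable borel" unfolding g_def[abs_def] by measurable
  have g0: "g t \<ge> 0" for t by (simp add: g_def \<phi>_def cutoff'_def)
  \<comment> \<open>the exponent of the integrand at the origin, where the cut-off is bounded\<close>
  define \<gamma> where "\<gamma> = e + (2 - a) / a"
  have \<gamma>: "\<gamma> > -1"
  proof -
    have "\<gamma> = (real m + real n + 2 * mult_index P k + real CARD('n)) / a - 1"
      using a_pos by (simp add: \<gamma>_def e_def field_simps)
    moreover have "real m + real n + 2 * mult_index P k + real CARD('n) > 0"
      using mult_index_nonneg by (intro add_nonneg_pos add_nonneg_nonneg) auto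
    ultimately show ?thesis using a_pos by simp
  qed
  define K where "K = 2 * (a / 2) powr ((2 - a) / a)"
  have gK: "g t \<le> (if t \<in> {0..2/a} then K * t powr \<gamma> else 0)" for t
  proof (cases "t \<in> {0<..2/a}")
    case True
    then have t: "t > 0" by simp
    have "- cutoff' s \<le> 2" if "s \<ge> 0" for s using that by (simp add: cutoff'_def)
    then have "\<phi> t \<le> 2 * (a * t / 2) powr ((2 - a) / a)"
      unfolding \<phi>_def by (intro mult_right_mono) auto
    also have "\<dots> = K * t powr ((2 - a) / a)"
      using powr_mult[of "a / 2" t "(2 - a) / a"] t a_pos by (simp add: K_def)
    finally have "t powr e * \<phi> t \<le> t powr e * (K * t powr ((2 - a) / a))" by (intro mult_left_mono) auto
    also have "\<dots> = K * t powr \<gamma>" by (simp add: \<gamma>_def powr_add)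
    finally show ?thesis using True by (simp add: g_def)
  next
    case False
    then consider "t \<le> 0" | "t > 2 / a" by force
    then show ?thesis
    proof cases
      case 1
      then show ?thesis by (simp add: g_def K_def)
    next
      case 2
      then have "a * t / 2 \<ge> 1" using a_pos by (simp add: field_simps)
      then have "(a * t / 2) powr (2 / a) \<ge> 1" using a_pos by (intro ge_one_powr_ge_zero) auto
      then have "\<phi> t = 0" by (simp add: \<phi>_def cutoff_zero)
      then show ?thesis by (simp add: g_def K_def)
    qed
  qed
  have gi: "integrable lborel g"
  proof (rule integrableI_nonneg)
    have "((\<lambda>t. K * t powr \<gamma>) has_integral K * ((2/a) powr (\<gamma> + 1) / (\<gamma> + 1))) {0..2/a}"
      using \<gamma> a_pos by (intro has_integral_mult_right has_integral_powr_from_0) auto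
    then have "((\<lambda>t. if t \<in> {0..2/a} then K * t powr \<gamma> else 0) has_integral K * ((2/a) powr (\<gamma> + 1) / (\<gamma> + 1))) UNIV"
      by (subst has_integral_restrict_UNIV)
    then have "(\<integral>\<^sup>+t. ennreal (if t \<in> {0..2/a} then K * t powr \<gamma> else 0) \<partial>lborel) = ennreal (K * ((2/a) powr (\<gamma> + 1) / (\<gamma> + 1)))"
      by (rule nn_integral_has_integral_lborel[rotated 2]) (auto simp: K_def)
    moreover have "(\<integral>\<^sup>+t. ennreal (g t) \<partial>lborel) \<le> (\<integral>\<^sup>+t. ennreal (if t \<in> {0..2/a} then K * t powr \<gamma> else 0) \<partial>lborel)"
      by (intro nn_integral_mono ennreal_leI gK)
    ultimately show "(\<integral>\<^sup>+t. ennreal (g t) \<partial>lborel) < \<infinity>" by (simp add: le_less_trans[OF _ ennreal_less_top])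
  qed (use g0 in auto)
  have gpos: "integral\<^sup>L lborel g \<noteq> 0"
  proof
    assume "integral\<^sup>L lborel g = 0"
    then have AE0: "AE t in lborel. g t = 0"
      using integral_nonneg_eq_0_iff_AE[OF gi] g0 by auto
    have "g t \<noteq> 0" if "t \<in> {0<..<2/a}" for t
    proof -
      have "a * t / 2 > 0" "a * t / 2 < 1" using that a_pos by (auto simp: field_simps)
      then have "(a * t / 2) powr (2 / a) < 1 powr (2 / a)" using a_pos by (intro powr_less_mono2) auto
      then show ?thesis using that \<open>a * t / 2 > 0\<close> a_pos by (simp add: g_def \<phi>_def cutoff'_def)
    qed
    then have "AE t in lborel. t \<notin> {0<..<2/a}" using AE0 by (auto elim: eventually_mono)
    then have "{0<..<2/a} \<in> null_sets lborel" by (subst AE_iff_null_sets) auto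
    then have "emeasure lborel {0<..<2/a} = 0" by (rule null_setsD1)
    then show False using a_pos by simp
  qed
  have "(LINT x|M. p x * q x * complex_of_real (\<phi> (radius x))) = (LINT x|lborel. - (complex_of_real (root_weight x) * (complex_of_real (cutoff' (x \<bullet> x)) * (p x * q x))))"
  proof -
    have [measurable]: "p \<in> borel_measurable borel" "q \<in> borel_measurable borel"
      by (intro borel_measurable_continuous_onI homogeneous_polynomial_continuous[OF hp] homogeneous_polynomial_continuous[OF hq])+
    have "(LINT x|M. p x * q x * complex_of_real (\<phi> (radius x))) = (LINT x|lborel. complex_of_real (weight R k a x) * (p x * q x * complex_of_real (\<phi> (radius x))))"
      by (rule integral_M) measurable
    also have "\<dots> = (LINT x|lborel. - (complex_of_real (root_weight x) * (complex_of_real (cutoff' (x \<bullet> x)) * (p x * q x))))"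
    proof (rule integral_cong_AE)
      show "AE x in lborel. complex_of_real (weight R k a x) * (p x * q x * complex_of_real (\<phi> (radius x))) = - (complex_of_real (root_weight x) * (complex_of_real (cutoff' (x \<bullet> x)) * (p x * q x)))"
        using AE_lborel_singleton[of "0 :: real^'n"]
      proof eventually_elim
        case (elim x)
        have r: "a * radius x / 2 = norm x powr a" using a_pos by (simp add: radius_def)
        have "(norm x powr a) powr (2 / a) = x \<bullet> x"
          using a_pos elim by (simp add: powr_powr powr_numeral power2_norm_eq_inner)
        moreover have "(norm x powr a) powr ((2 - a) / a) = norm x powr (2 - a)"
          using a_pos by (simp add: powr_powr)
        moreover have "norm x powr (a - 2) * norm x powr (2 - a) = 1"
          using elim by (simp flip: powr_add)
        ultimately have "weight R k a x * \<phi> (radius x) = - (root_weight x * cutoff' (x \<bullet> x))"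
          unfolding \<phi>_def r weight_eq by (simp add: mult_ac)
        then have f: "complex_of_real (weight R k a x) * complex_of_real (\<phi> (radius x)) = - (complex_of_real (root_weight x) * complex_of_real (cutoff' (x \<bullet> x)))"
          by (simp flip: of_real_mult of_real_minus)
        have "complex_of_real (weight R k a x) * (p x * q x * complex_of_real (\<phi> (radius x))) = complex_of_real (weight R k a x) * complex_of_real (\<phi> (radius x)) * (p x * q x)"
          by (simp only: mult_ac)
        also have "\<dots> = - (complex_of_real (root_weight x) * complex_of_real (cutoff' (x \<bullet> x))) * (p x * q x)"
          by (simp only: f)
        also have "\<dots> = - (complex_of_real (root_weight x) * (complex_of_real (cutoff' (x \<bullet> x)) * (p x * q x)))"
          by simp
        finally show ?case .
      qed
    qed measurable
    finally show ?thesis .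
  qed
  also have "\<dots> = 0" using harmonic_orthogonal_cutoff[OF p q mn] by simp
  finally have "C = 0"
    using C[OF \<phi>m] gi gpos by (simp add: g_def[abs_def])
  then show ?thesis using C[OF h(1)] h(2) by (simp add: e_def)
qed

lemma Phi_eq: "Phi P k a l m p x = p x * complex_of_real (laguerre l (lambda_kam P k a m) (radius x) * exp (- radius x / 2))"
  by (simp add: Phi_def radius_def)

lemma laguerre_measurable [measurable]: "laguerre l lam \<in> borel_measurable borel"
  unfolding laguerre_def[abs_def] by measurable

text \<open>More than the functions \<open>\<Phi>\<close>: all exponents \<open>s > 0\<close> occur in the proof of completeness.\<close>

lemma polynomial_exp_L2:
  assumes p: "homogeneous_polynomial m p" and s: "s > 0"
  shows "(\<lambda>x. p x * complex_of_real (poly q (radius x) * exp (- (s * radius x)))) \<in> L2_fun M"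
proof -
  let ?h = "\<lambda>t. poly (q * q) t * exp (- ((2 * s) * t))"
  let ?e = "(real m + real m + (a - 2 + 2 * mult_index P k) + real CARD('n)) / a - 1"
  have qm [measurable]: "poly q \<in> borel_measurable borel"
    by (intro borel_measurable_continuous_onI continuous_intros)
  have pm [measurable]: "p \<in> borel_measurable borel"
    by (intro borel_measurable_continuous_onI homogeneous_polynomial_continuous[OF p])
  have hm: "?h \<in> borel_measurable borel" unfolding poly_mult by measurable
  have hi: "integrable lborel (\<lambda>t. indicator {0<..} t * t powr ?e * ?h t)"
    using s by (intro poly_exp_integrable radial_exponent_gt) auto
  obtain C where C: "\<And>h :: real \<Rightarrow> real. h \<in> borel_measurable borel \<Longrightarrow>
      integrable lborel (\<lambda>t. indicator {0<..} t * t powr ?e * h t) \<Longrightarrow>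
      integrable M (\<lambda>x. p x * cnj (p x) * complex_of_real (h (radius x))) \<and>
      (LINT x|M. p x * cnj (p x) * complex_of_real (h (radius x))) = C * complex_of_real (LINT t|lborel. indicator {0<..} t * t powr ?e * h t)"
    using radial_formula[OF p homogeneous_polynomial_cnj[OF p]] by blast
  have "integrable M (\<lambda>x. p x * cnj (p x) * complex_of_real (?h (radius x)))"
    using C[OF hm hi] by blast
  moreover have "p x * cnj (p x) * complex_of_real (?h (radius x)) = complex_of_real ((cmod (p x * complex_of_real (poly q (radius x) * exp (- (s * radius x)))))\<^sup>2)" for x
  proof -
    have "exp (- ((2 * s) * t)) = exp (- (s * t)) * exp (- (s * t))" for t by (simp flip: exp_add)
    then show ?thesis
      unfolding norm_mult norm_of_real power_mult_distrib of_real_mult complex_norm_square of_real_power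
      by (simp add: power2_eq_square complex_norm_square[symmetric, unfolded power2_eq_square] flip: of_real_mult)
  qed
  ultimately have "integrable M (\<lambda>x. complex_of_real ((cmod (p x * complex_of_real (poly q (radius x) * exp (- (s * radius x)))))\<^sup>2))"
    by (simp only:)
  then have "integrable M (\<lambda>x. (cmod (p x * complex_of_real (poly q (radius x) * exp (- (s * radius x)))))\<^sup>2)"
    by (simp only: complex_of_real_integrable_eq)
  moreover have "(\<lambda>x. p x * complex_of_real (poly q (radius x) * exp (- (s * radius x)))) \<in> borel_measurable borel" by measurable
  ultimately show ?thesis by (simp add: L2_fun_def)
qed

lemma Phi_L2:
  assumes "homogeneous_polynomial m p"
  shows "Phi P k a l m p \<in> L2_fun M"
proof -
  have "(\<lambda>x. p x * complex_of_real (poly (laguerre_poly l (lambda_kam P k a m)) (radius x) * exp (- ((1/2) * radius x)))) \<in> L2_fun M"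
    by (rule polynomial_exp_L2[OF assms]) simp
  moreover have "(\<lambda>x. p x * complex_of_real (poly (laguerre_poly l (lambda_kam P k a m)) (radius x) * exp (- ((1/2) * radius x)))) = Phi P k a l m p"
    by (rule ext) (simp add: Phi_eq poly_laguerre)
  ultimately show ?thesis by simp
qed

theorem Phi_orthogonal:
  assumes p: "p \<in> dunkl_harmonics P k m" and q: "q \<in> dunkl_harmonics P k n" and ne: "(l, m) \<noteq> (l', n)"
  shows "ip M (Phi P k a l m p) (Phi P k a l' n q) = 0"
proof -
  note hp = dunkl_harmonicsD(1)[OF p] and hq = dunkl_harmonicsD(1)[OF q]
  let ?h = "\<lambda>t. laguerre l (lambda_kam P k a m) t * laguerre l' (lambda_kam P k a n) t * exp (- t)"
  let ?e = "(real m + real n + (a - 2 + 2 * mult_index P k) + real CARD('n)) / a - 1"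
  have hm: "?h \<in> borel_measurable borel" by measurable
  have hi: "integrable lborel (\<lambda>t. indicator {0<..} t * t powr ?e * ?h t)"
    using poly_exp_integrable[OF radial_exponent_gt[of m n] zero_less_one, of "laguerre_poly l (lambda_kam P k a m) * laguerre_poly l' (lambda_kam P k a n)"]
    by (simp add: poly_laguerre)
  have "ip M (Phi P k a l m p) (Phi P k a l' n q) = (LINT x|M. p x * cnj (q x) * complex_of_real (?h (radius x)))"
    unfolding ip_def
  proof (intro Bochner_Integration.integral_cong refl)
    fix x
    have e: "exp (- radius x) = exp (- radius x / 2) * exp (- radius x / 2)" by (simp flip: exp_add)
    show "Phi P k a l m p x * cnj (Phi P k a l' n q x) = p x * cnj (q x) * complex_of_real (?h (radius x))"
      unfolding Phi_eq e complex_cnj_mult complex_cnj_complex_of_real of_real_mult by (simp only: mult_ac)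
  qed
  also have "\<dots> = 0"
  proof (cases "m = n")
    case False
    then show ?thesis by (intro harmonic_orthogonal[OF p dunkl_harmonics_cnj[OF q zero_notin_P] _ hm hi])
  next
    case True
    then have "l \<noteq> l'" using ne by simp
    obtain C where C: "\<And>h :: real \<Rightarrow> real. h \<in> borel_measurable borel \<Longrightarrow>
      integrable lborel (\<lambda>t. indicator {0<..} t * t powr ?e * h t) \<Longrightarrow>
      integrable M (\<lambda>x. p x * cnj (q x) * complex_of_real (h (radius x))) \<and>
      (LINT x|M. p x * cnj (q x) * complex_of_real (h (radius x))) = C * complex_of_real (LINT t|lborel. indicator {0<..} t * t powr ?e * h t)"
      using radial_formula[OF hp homogeneous_polynomial_cnj[OF hq]] by blast
    have "?e = lambda_kam P k a m" using True radial_exponent by simp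
    then have "(LINT t|lborel. indicator {0<..} t * t powr ?e * ?h t) = 0"
      using laguerre_orthogonal[OF lambda_gt \<open>l \<noteq> l'\<close>] True by simp
    then show ?thesis using C[OF hm hi] by simp
  qed
  finally show ?thesis .
qed

end

section \<open>Completeness\<close>

text \<open>The theorem of Stone and Weierstrass works with an algebra, so different degrees have to be added.\<close>

inductive polynomial_fun :: "(real^'n \<Rightarrow> complex) \<Rightarrow> bool" where
  homogeneous: "homogeneous_polynomial m p \<Longrightarrow> polynomial_fun p"
| add: "polynomial_fun p \<Longrightarrow> polynomial_fun q \<Longrightarrow> polynomial_fun (\<lambda>x. p x + q x)"

lemma polynomial_fun_mult:
  assumes "polynomial_fun p" "polynomial_fun q"
  shows "polynomial_fun (\<lambda>x. p x * q x)"
  using assms(1)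
proof induction
  case (homogeneous m p)
  show ?case
    using assms(2)
  proof induction
    case (homogeneous n q)
    then show ?case using \<open>homogeneous_polynomial m p\<close> homogeneous_polynomial_mult polynomial_fun.homogeneous by blast
  next
    case (add q q')
    from polynomial_fun.add[OF add.IH] show ?case by (simp add: distrib_left)
  qed
next
  case (add p p')
  from polynomial_fun.add[OF add.IH] show ?case by (simp add: distrib_right)
qed

lemma polynomial_fun_real_polynomial:
  fixes f :: "real^'n \<Rightarrow> real"
  assumes "real_polynomial_function f"
  shows "polynomial_fun (\<lambda>x. complex_of_real (f x))"
  using assms
proof induction
  case (linear f)
  have "f x = (\<Sum>b\<in>Basis. f b *\<^sub>R b) \<bullet> x" for x
  proof -
    interpret f: bounded_linear f by fact
    have "f x = f (\<Sum>b\<in>Basis. (x \<bullet> b) *\<^sub>R b)" by (simp add: euclidean_representation)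
    also have "\<dots> = (\<Sum>b\<in>Basis. (x \<bullet> b) * f b)" by (simp add: f.sum f.scaleR)
    also have "\<dots> = (\<Sum>b\<in>Basis. f b *\<^sub>R b) \<bullet> x"
      unfolding inner_sum_left inner_scaleR_left by (intro sum.cong refl) (simp add: inner_commute mult.commute)
    finally show ?thesis .
  qed
  note rep = this
  have eq: "(\<lambda>x. complex_of_real (f x)) = (\<lambda>x. complex_of_real ((\<Sum>b\<in>Basis. f b *\<^sub>R b) \<bullet> x) * 1)"
    by (rule ext, subst rep, rule mult_1_right[symmetric])
  show ?case
    by (subst eq) (rule polynomial_fun.homogeneous[OF homogeneous_polynomial_inner[OF homogeneous_polynomial_const]])
next
  case (const c)
  show ?case by (rule polynomial_fun.homogeneous[OF homogeneous_polynomial_const])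
next
  case (add f g)
  from polynomial_fun.add[OF add.IH] show ?case by simp
next
  case (mult f g)
  from polynomial_fun_mult[OF mult.IH] show ?case by simp
qed

text \<open>Continuous functions decreasing to the indicator of a closed set show that the integral over every
  closed set is zero; by Dynkin's theorem this extends to all Borel sets.\<close>

lemma AE_zero_if_orthogonal_continuous:
  fixes G :: "real^'n \<Rightarrow> complex"
  assumes G: "integrable lborel G"
    and orth: "\<And>f. continuous_on UNIV f \<Longrightarrow> (\<And>x. 0 \<le> f x \<and> f x \<le> 1) \<Longrightarrow> (LINT x|lborel. complex_of_real (f x) * G x) = 0"
  shows "AE x in lborel. G x = 0"
proof -
  note [measurable] = borel_measurable_integrable[OF G]
  have si: "set_integrable lborel A G" if "A \<in> sets borel" for A
    using that by (simp add: set_integrable_def integrable_mult_indicator[OF _ G, simplified])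
  have closed: "(LINT x:A|lborel. G x) = 0" if A: "closed A" for A
  proof (cases "A = {}")
    case False
    define f where "f n x = max 0 (1 - real n * infdist x A)" for n x
    have fc: "continuous_on UNIV (f n)" for n
      unfolding f_def by (intro continuous_intros)
    have fm [measurable]: "f n \<in> borel_measurable borel" for n by (intro borel_measurable_continuous_onI fc)
    have f01: "0 \<le> f n x \<and> f n x \<le> 1" for n x by (simp add: f_def infdist_nonneg)
    have Am: "A \<in> sets borel" using A by simp
    have "(\<lambda>n. LINT x|lborel. complex_of_real (f n x) * G x) \<longlonglongrightarrow> (LINT x|lborel. complex_of_real (indicator A x) * G x)"
    proof (rule integral_dominated_convergence)
      show "integrable lborel (\<lambda>x. norm (G x))" using G by simp
      show "(\<lambda>x. complex_of_real (indicator A x) * G x) \<in> borel_measurable lborel" using Am by measurable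
      show "(\<lambda>x. complex_of_real (f n x) * G x) \<in> borel_measurable lborel" for n by measurable
      show "AE x in lborel. norm (complex_of_real (f n x) * G x) \<le> norm (G x)" for n
        using f01[of n] by (intro AE_I2) (simp add: norm_mult mult_left_le_one_le)
      show "AE x in lborel. (\<lambda>n. complex_of_real (f n x) * G x) \<longlonglongrightarrow> complex_of_real (indicator A x) * G x"
      proof (intro AE_I2 tendsto_mult tendsto_of_real tendsto_const)
        fix x
        show "(\<lambda>n. f n x) \<longlonglongrightarrow> indicator A x"
        proof (cases "x \<in> A")
          case True
          then show ?thesis by (simp add: f_def)
        next
          case x: False
          then have "infdist x A > 0" using infdist_pos_not_in_closed[OF A False] by simp
          then obtain N where N: "1 < real N * infdist x A" using reals_Archimedean3 by blast
          have "f n x = 0" if "n \<ge> N" for n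
          proof -
            have "real N * infdist x A \<le> real n * infdist x A" using that by (intro mult_right_mono infdist_nonneg) auto
            then show ?thesis using N by (simp add: f_def)
          qed
          then have "(\<lambda>n. f n x) \<longlonglongrightarrow> 0" by (intro tendsto_eventually eventually_sequentiallyI)
          then show ?thesis using x by simp
        qed
      qed
    qed
    moreover have "(LINT x|lborel. complex_of_real (f n x) * G x) = 0" for n by (rule orth[OF fc f01])
    ultimately have "(LINT x|lborel. complex_of_real (indicator A x) * G x) = 0" by (simp add: LIMSEQ_const_iff)
    then show ?thesis by (simp add: set_lebesgue_integral_def scaleR_conv_of_real)
  qed (simp add: set_lebesgue_integral_def)
  have sub: "{S :: (real^'n) set. closed S} \<subseteq> Pow UNIV" by simp
  have IS: "Int_stable {S :: (real^'n) set. closed S}" by (auto simp: Int_stable_def)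
  have all: "(LINT x:A|lborel. G x) = 0" if "A \<in> sigma_sets UNIV {S :: (real^'n) set. closed S}" for A
    using IS sub that
  proof (induction rule: sigma_sets_induct_disjoint)
    case (basic A)
    then show ?case using closed by simp
  next
    case empty
    show ?case by (simp add: set_lebesgue_integral_def)
  next
    case (compl A)
    have Am: "A \<in> sets borel" using compl by (simp add: borel_eq_closed sets_measure_of_conv)
    have "(LINT x:UNIV|lborel. G x) = 0" by (rule closed) simp
    then have U: "(LINT x|lborel. G x) = 0" by (simp add: set_lebesgue_integral_def)
    have "(LINT x:UNIV - A|lborel. G x) = (LINT x|lborel. G x - indicator A x *\<^sub>R G x)"
      unfolding set_lebesgue_integral_def by (intro Bochner_Integration.integral_cong) (auto simp: indicator_def)
    also have "\<dots> = (LINT x|lborel. G x) - (LINT x|lborel. indicator A x *\<^sub>R G x)"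
      using si[OF Am] by (intro Bochner_Integration.integral_diff G) (simp add: set_integrable_def)
    finally show ?case using U compl.IH by (simp add: set_lebesgue_integral_def)
  next
    case (union A)
    have Am: "A i \<in> sets borel" for i using union by (auto simp: borel_eq_closed sets_measure_of_conv)
    have "(LINT x:(\<Union>i. A i)|lborel. G x) = (\<Sum>i. (LINT x:(A i)|lborel. G x))"
      using union(1) Am by (intro lebesgue_integral_countable_add si) (auto simp: disjoint_family_on_def)
    then show ?case using union by simp
  qed
  have "AE x in lborel. G x = (\<lambda>x. 0) x"
  proof (rule sigma_finite_measure.density_unique_banach[OF lborel.sigma_finite_measure_axioms])
    fix A :: "(real^'n) set" assume "A \<in> sets lborel"
    then have "A \<in> sigma_sets UNIV {S. closed S}" by (simp add: borel_eq_closed sets_measure_of_conv)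
    from all[OF this] show "(LINT x:A|lborel. G x) = (LINT x:A|lborel. 0)" by (simp add: set_lebesgue_integral_def)
  qed (use G in auto)
  then show ?thesis by simp
qed

lemma laguerre_lead_coeff: "lam > -1 \<Longrightarrow> laguerre_coeff l lam l \<noteq> 0"
proof -
  assume "lam > -1"
  then have "Gamma (lam + real l + 1) > 0" by (intro Gamma_real_pos) simp
  then show ?thesis by (simp add: laguerre_coeff_def)
qed

context ka_setting
begin

lemma radius_nonneg: "0 \<le> radius x"
  using a_pos by (simp add: radius_def)

context
  fixes g :: "real^'n \<Rightarrow> complex"
  assumes g: "g \<in> L2_fun M"
    and g_orth: "\<And>l m p. p \<in> dunkl_harmonics P k m \<Longrightarrow> ip M g (Phi P k a l m p) = 0"
begin

lemma g_measurable [measurable]: "g \<in> borel_measurable borel"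
  using L2_funD(1)[OF g] by simp

lemma moment_integrable:
  assumes p: "homogeneous_polynomial m p" and s: "s > 0"
  shows "integrable M (\<lambda>x. g x * cnj (p x) * complex_of_real (poly q (radius x) * exp (- (s * radius x))))"
  using L2_fun_mult_integrable[OF g polynomial_exp_L2[OF p s, of q]] by (simp add: mult.assoc)

lemma moment_integrable_power:
  assumes p: "homogeneous_polynomial m p" and s: "s > 0"
  shows "integrable M (\<lambda>x. g x * cnj (p x) * complex_of_real (radius x ^ j * exp (- (s * radius x))))"
  using moment_integrable[OF assms, of "monom 1 j"] by (simp add: poly_monom)

text \<open>The Laguerre polynomials have non-zero leading coefficients, so by induction the monomials can be recovered
  from them.\<close>

lemma moment_zero_half:
  assumes p: "p \<in> dunkl_harmonics P k m"
  shows "(LINT x|M. g x * cnj (p x) * complex_of_real (radius x ^ j * exp (- (1/2 * radius x)))) = 0"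
proof (induction j rule: less_induct)
  case (less j)
  note hp = dunkl_harmonicsD(1)[OF p]
  let ?lam = "lambda_kam P k a m"
  let ?J = "\<lambda>i x. g x * cnj (p x) * complex_of_real (radius x ^ i * exp (- (1/2 * radius x)))"
  have int: "integrable M (\<lambda>x. complex_of_real (laguerre_coeff j ?lam i) * ?J i x)" for i
    by (intro integrable_mult_right moment_integrable_power[OF hp]) simp
  have "0 = ip M g (Phi P k a j m p)" using g_orth[OF p] by simp
  also have "\<dots> = (LINT x|M. (\<Sum>i\<le>j. complex_of_real (laguerre_coeff j ?lam i) * ?J i x))"
    unfolding ip_def
  proof (intro Bochner_Integration.integral_cong refl)
    fix x
    have "laguerre j ?lam (radius x) = (\<Sum>i\<le>j. laguerre_coeff j ?lam i * radius x ^ i)"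
      by (simp add: poly_laguerre[symmetric] laguerre_poly_def poly_sum poly_monom)
    then have "cnj (Phi P k a j m p x) = cnj (p x) * complex_of_real (\<Sum>i\<le>j. laguerre_coeff j ?lam i * (radius x ^ i * exp (- (1/2 * radius x))))"
      by (simp add: Phi_eq sum_distrib_right mult.assoc)
    then show "g x * cnj (Phi P k a j m p x) = (\<Sum>i\<le>j. complex_of_real (laguerre_coeff j ?lam i) * ?J i x)"
      by (simp only: of_real_sum of_real_mult sum_distrib_left mult_ac)
  qed
  also have "\<dots> = (\<Sum>i\<le>j. (LINT x|M. complex_of_real (laguerre_coeff j ?lam i) * ?J i x))"
    by (rule Bochner_Integration.integral_sum[OF int])
  also have "\<dots> = (\<Sum>i\<le>j. complex_of_real (laguerre_coeff j ?lam i) * (LINT x|M. ?J i x))"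
    by (simp only: integral_mult_right_zero)
  also have "\<dots> = (\<Sum>i<j. complex_of_real (laguerre_coeff j ?lam i) * (LINT x|M. ?J i x)) + complex_of_real (laguerre_coeff j ?lam j) * (LINT x|M. ?J j x)"
    by (simp only: lessThan_Suc_atMost[symmetric] sum.lessThan_Suc)
  also have "(\<Sum>i<j. complex_of_real (laguerre_coeff j ?lam i) * (LINT x|M. ?J i x)) = 0"
    by (intro sum.neutral ballI) (simp only: less.IH lessThan_iff mult_zero_right)
  finally show ?case using laguerre_lead_coeff[OF lambda_gt, of j m] by (simp only: add_0 mult_eq_0_iff of_real_eq_0_iff eq_commute[of 0]) blast
qed

text \<open>Write \<open>exp (- s t) = exp (- s0 t) * exp ((s0 - s) t)\<close> and expand the second factor.  The partial sums
  are dominated by \<open>exp (- \<delta> t)\<close> with \<open>\<delta> = s0 - \<bar>s0 - s\<bar>\<close>, which is positive for \<open>s < 2 * s0\<close>.\<close>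

lemma moment_zero_step:
  assumes p: "homogeneous_polynomial m p" and s: "0 < s" "s < 2 * s0"
    and zero: "\<And>j. (LINT x|M. g x * cnj (p x) * complex_of_real (radius x ^ j * exp (- (s0 * radius x)))) = 0"
  shows "(LINT x|M. g x * cnj (p x) * complex_of_real (radius x ^ j * exp (- (s * radius x)))) = 0"
proof -
  have s0: "s0 > 0" using s by simp
  define \<delta> where "\<delta> = s0 - \<bar>s0 - s\<bar>"
  have \<delta>: "\<delta> > 0" using s by (simp add: \<delta>_def abs_real_def)
  define S where "S n x = g x * cnj (p x) * complex_of_real (radius x ^ j * exp (- (s0 * radius x)) * (\<Sum>i<n. ((s0 - s) * radius x) ^ i / fact i))" for n x
  have pm [measurable]: "p \<in> borel_measurable borel"
    by (intro borel_measurable_continuous_onI homogeneous_polynomial_continuous[OF p])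
  have [measurable]: "cnj \<in> borel_measurable borel" by (rule borel_measurable_cnj)
  have "(\<lambda>n. integral\<^sup>L M (S n)) \<longlonglongrightarrow> (LINT x|M. g x * cnj (p x) * complex_of_real (radius x ^ j * exp (- (s * radius x))))"
  proof (rule integral_dominated_convergence)
    show "integrable M (\<lambda>x. norm (g x * cnj (p x) * complex_of_real (radius x ^ j * exp (- (\<delta> * radius x)))))"
      by (intro integrable_norm moment_integrable_power[OF p \<delta>])
    show "AE x in M. (\<lambda>n. S n x) \<longlonglongrightarrow> g x * cnj (p x) * complex_of_real (radius x ^ j * exp (- (s * radius x)))"
    proof (intro AE_I2)
      fix x
      have "(\<lambda>n. \<Sum>i<n. ((s0 - s) * radius x) ^ i / fact i) \<longlonglongrightarrow> exp ((s0 - s) * radius x)"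
        using exp_converges[of "(s0 - s) * radius x"] by (simp add: sums_def divide_inverse mult.commute)
      then have "(\<lambda>n. S n x) \<longlonglongrightarrow> g x * cnj (p x) * complex_of_real (radius x ^ j * exp (- (s0 * radius x)) * exp ((s0 - s) * radius x))"
        unfolding S_def by (intro tendsto_intros)
      moreover have "exp (- (s0 * radius x)) * exp ((s0 - s) * radius x) = exp (- (s * radius x))"
        by (simp add: algebra_simps flip: exp_add)
      ultimately show "(\<lambda>n. S n x) \<longlonglongrightarrow> g x * cnj (p x) * complex_of_real (radius x ^ j * exp (- (s * radius x)))"
        by (simp only: mult.assoc)
    qed
    show "AE x in M. norm (S n x) \<le> norm (g x * cnj (p x) * complex_of_real (radius x ^ j * exp (- (\<delta> * radius x))))" for n
    proof (intro AE_I2)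
      fix x
      let ?y = "(s0 - s) * radius x"
      have "\<bar>\<Sum>i<n. ?y ^ i / fact i\<bar> \<le> (\<Sum>i<n. \<bar>?y\<bar> ^ i / fact i)"
        by (rule order_trans[OF sum_abs]) (simp add: power_abs)
      also have "\<dots> \<le> (\<Sum>i. \<bar>?y\<bar> ^ i / fact i)"
        using exp_converges[of "\<bar>?y\<bar>"] by (intro sum_le_suminf) (auto simp: sums_iff divide_inverse mult.commute)
      also have "\<dots> = exp \<bar>?y\<bar>"
        using exp_converges[of "\<bar>?y\<bar>"] by (simp add: sums_iff divide_inverse mult.commute)
      finally have "exp (- (s0 * radius x)) * \<bar>\<Sum>i<n. ?y ^ i / fact i\<bar> \<le> exp (- (s0 * radius x)) * exp \<bar>?y\<bar>"
        by (intro mult_left_mono) auto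
      also have "\<dots> = exp (- (\<delta> * radius x))"
      proof -
        have "\<bar>?y\<bar> = \<bar>s0 - s\<bar> * radius x" using radius_nonneg[of x] by (simp add: abs_mult)
        then have "- (s0 * radius x) + \<bar>?y\<bar> = - (\<delta> * radius x)" by (simp add: \<delta>_def left_diff_distrib)
        then show ?thesis by (simp only: exp_add[symmetric])
      qed
      finally have b: "exp (- (s0 * radius x)) * \<bar>\<Sum>i<n. ?y ^ i / fact i\<bar> \<le> exp (- (\<delta> * radius x))" .
      have "\<bar>radius x ^ j * exp (- (s0 * radius x)) * (\<Sum>i<n. ?y ^ i / fact i)\<bar> = \<bar>radius x ^ j\<bar> * (exp (- (s0 * radius x)) * \<bar>\<Sum>i<n. ?y ^ i / fact i\<bar>)"
        by (simp only: abs_mult abs_exp_cancel mult.assoc)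
      also have "\<dots> \<le> \<bar>radius x ^ j\<bar> * exp (- (\<delta> * radius x))" by (intro mult_left_mono b) auto
      also have "\<dots> = \<bar>radius x ^ j * exp (- (\<delta> * radius x))\<bar>" by (simp only: abs_mult abs_exp_cancel)
      finally show "norm (S n x) \<le> norm (g x * cnj (p x) * complex_of_real (radius x ^ j * exp (- (\<delta> * radius x))))"
        unfolding S_def norm_mult[of "g x * cnj (p x)"] norm_of_real by (intro mult_left_mono) auto
    qed
    show "(\<lambda>x. g x * cnj (p x) * complex_of_real (radius x ^ j * exp (- (s * radius x)))) \<in> borel_measurable M"
      by (rule borel_measurable_integrable[OF moment_integrable_power[OF p s(1)]])
    have "S n \<in> borel_measurable borel" for n unfolding S_def[abs_def] by measurable
    then show "S n \<in> borel_measurable M" for n by simp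
  qed
  moreover have "integral\<^sup>L M (S n) = 0" for n
  proof -
    let ?J = "\<lambda>i x. g x * cnj (p x) * complex_of_real (radius x ^ (j + i) * exp (- (s0 * radius x)))"
    have int: "integrable M (\<lambda>x. complex_of_real ((s0 - s) ^ i / fact i) * ?J i x)" for i
      by (intro integrable_mult_right moment_integrable_power[OF p s0])
    have "S n x = (\<Sum>i<n. complex_of_real ((s0 - s) ^ i / fact i) * ?J i x)" for x
    proof -
      have "radius x ^ j * exp (- (s0 * radius x)) * (\<Sum>i<n. ((s0 - s) * radius x) ^ i / fact i) = (\<Sum>i<n. (s0 - s) ^ i / fact i * (radius x ^ (j + i) * exp (- (s0 * radius x))))"
        unfolding sum_distrib_left by (intro sum.cong refl) (simp add: power_mult_distrib power_add)
      then show ?thesis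
        unfolding S_def by (simp only: of_real_sum of_real_mult sum_distrib_left mult_ac)
    qed
    then have "integral\<^sup>L M (S n) = (LINT x|M. (\<Sum>i<n. complex_of_real ((s0 - s) ^ i / fact i) * ?J i x))"
      by (intro Bochner_Integration.integral_cong refl)
    also have "\<dots> = (\<Sum>i<n. (LINT x|M. complex_of_real ((s0 - s) ^ i / fact i) * ?J i x))"
      by (rule Bochner_Integration.integral_sum[OF int])
    also have "\<dots> = 0"
      by (intro sum.neutral ballI) (simp only: integral_mult_right_zero zero mult_zero_right)
    finally show ?thesis .
  qed
  ultimately show ?thesis by (simp add: LIMSEQ_const_iff)
qed

text \<open>Any ratio below two works for the steps; \<open>3/2\<close> is used, starting from \<open>1/2\<close>.\<close>

lemma moment_zero:
  assumes p: "p \<in> dunkl_harmonics P k m" and s: "s > 0"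
  shows "(LINT x|M. g x * cnj (p x) * complex_of_real (radius x ^ j * exp (- (s * radius x)))) = 0"
proof -
  note hp = dunkl_harmonicsD(1)[OF p]
  have pw: "\<forall>j. (LINT x|M. g x * cnj (p x) * complex_of_real (radius x ^ j * exp (- ((1/2 * (3/2) ^ n) * radius x)))) = 0" for n
  proof (induction n)
    case 0
    then show ?case using moment_zero_half[OF p] by simp
  next
    case (Suc n)
    have pos: "(0::real) < (3/2) ^ n" by simp
    have step: "0 < (1/2 * (3/2) ^ Suc n :: real)" "1/2 * (3/2) ^ Suc n < 2 * (1/2 * (3/2) ^ n :: real)"
      using pos by simp_all
    show ?case by (rule allI, rule moment_zero_step[OF hp step Suc.IH[rule_format]])
  qed
  obtain n where "s < (3/2 :: real) ^ n" using real_arch_pow[of "3/2" s] by auto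
  then have "s < 2 * (1/2 * (3/2) ^ n)" by simp
  from moment_zero_step[OF hp s this pw[rule_format]] show ?thesis .
qed

text \<open>In the variable \<open>y = exp (- t)\<close> the vanishing integrals are those against \<open>y * y ^ i\<close>, hence against \<open>y\<close> times
  any polynomial, and the interval of \<open>y\<close> is compact.\<close>

lemma radial_zero_exp:
  assumes p: "p \<in> dunkl_harmonics P k m" and \<phi>: "continuous_on UNIV \<phi>"
  shows "integrable M (\<lambda>x. g x * cnj (p x) * complex_of_real (exp (- radius x) * \<phi> (exp (- radius x))))"
    and "(LINT x|M. g x * cnj (p x) * complex_of_real (exp (- radius x) * \<phi> (exp (- radius x)))) = 0"
proof -
  note hp = dunkl_harmonicsD(1)[OF p]
  have pm [measurable]: "p \<in> borel_measurable borel"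
    by (intro borel_measurable_continuous_onI homogeneous_polynomial_continuous[OF hp])
  note [measurable] = borel_measurable_cnj
  let ?G = "\<lambda>x. g x * cnj (p x) * complex_of_real (exp (- radius x))"
  have Gi: "integrable M ?G" using moment_integrable_power[OF hp zero_less_one, of 0] by simp
  have e01: "exp (- radius x) \<in> {0..1}" for x using radius_nonneg[of x] by simp
  have bound: "integrable M (\<lambda>x. ?G x * complex_of_real (\<psi> (exp (- radius x)))) \<and>
      cmod (LINT x|M. ?G x * complex_of_real (\<psi> (exp (- radius x)))) \<le> B * (LINT x|M. norm (?G x))"
    if \<psi>: "continuous_on UNIV \<psi>" and B: "\<And>y. y \<in> {0..1} \<Longrightarrow> \<bar>\<psi> y\<bar> \<le> B" for \<psi> B
  proof
    have [measurable]: "\<psi> \<in> borel_measurable borel" by (rule borel_measurable_continuous_onI[OF \<psi>])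
    have B0: "B \<ge> 0" using B[of 0] by simp
    have m: "(\<lambda>x. ?G x * complex_of_real (\<psi> (exp (- radius x)))) \<in> borel_measurable borel" by measurable
    have le: "norm (?G x * complex_of_real (\<psi> (exp (- radius x)))) \<le> B * norm (?G x)" for x
      using mult_left_mono[OF B[OF e01[of x]] norm_ge_zero[of "?G x"]]
      unfolding norm_mult[of "?G x"] norm_of_real by (simp only: mult.commute)
    show i: "integrable M (\<lambda>x. ?G x * complex_of_real (\<psi> (exp (- radius x))))"
    proof (rule Bochner_Integration.integrable_bound)
      show "integrable M (\<lambda>x. B * norm (?G x))" using Gi by (intro integrable_mult_right integrable_norm)
      show "AE x in M. norm (?G x * complex_of_real (\<psi> (exp (- radius x)))) \<le> norm (B * norm (?G x))"
        using le B0 by (intro AE_I2) (metis abs_of_nonneg mult_nonneg_nonneg norm_ge_zero real_norm_def)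
    qed (use m in simp)
    have "cmod (LINT x|M. ?G x * complex_of_real (\<psi> (exp (- radius x)))) \<le> (LINT x|M. norm (?G x * complex_of_real (\<psi> (exp (- radius x)))))"
      by (rule integral_norm_bound)
    also have "\<dots> \<le> (LINT x|M. B * norm (?G x))"
      using i Gi le by (intro integral_mono integrable_norm integrable_mult_right) auto
    finally show "cmod (LINT x|M. ?G x * complex_of_real (\<psi> (exp (- radius x)))) \<le> B * (LINT x|M. norm (?G x))" by simp
  qed
  have "bounded (\<phi> ` {0..1})" by (intro compact_imp_bounded compact_continuous_image continuous_on_subset[OF \<phi>]) auto
  then obtain B where "\<forall>y\<in>\<phi> ` {0..1}. norm y \<le> B" by (auto simp: bounded_iff)
  then have B: "\<bar>\<phi> y\<bar> \<le> B" if "y \<in> {0..1}" for y using that by auto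
  have \<phi>i: "integrable M (\<lambda>x. ?G x * complex_of_real (\<phi> (exp (- radius x))))" using bound[OF \<phi> B] by blast
  then show "integrable M (\<lambda>x. g x * cnj (p x) * complex_of_real (exp (- radius x) * \<phi> (exp (- radius x))))"
    by (simp only: of_real_mult mult.assoc)
  have pz: "(LINT x|M. ?G x * complex_of_real (\<Sum>i\<le>n. c i * exp (- radius x) ^ i)) = 0" for c n
  proof -
    let ?J = "\<lambda>i x. g x * cnj (p x) * complex_of_real (radius x ^ 0 * exp (- (real (Suc i) * radius x)))"
    have int: "integrable M (\<lambda>x. complex_of_real (c i) * ?J i x)" for i
      by (intro integrable_mult_right moment_integrable_power[OF hp]) simp
    have "exp (- radius x) * exp (- radius x) ^ i = exp (- (real (Suc i) * radius x))" for x i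
      by (simp add: exp_of_nat_mult[symmetric] algebra_simps flip: exp_add)
    then have "?G x * complex_of_real (\<Sum>i\<le>n. c i * exp (- radius x) ^ i) = (\<Sum>i\<le>n. complex_of_real (c i) * ?J i x)" for x
      unfolding of_real_sum sum_distrib_left
      by (intro sum.cong refl) (simp only: power_0 mult_1_left of_real_mult[symmetric] mult.assoc mult.left_commute[of "c _"] mult.commute[of "complex_of_real (c _)"] mult.left_commute[of "complex_of_real (c _)"],
          simp add: mult_ac)
    then have "(LINT x|M. ?G x * complex_of_real (\<Sum>i\<le>n. c i * exp (- radius x) ^ i)) = (LINT x|M. (\<Sum>i\<le>n. complex_of_real (c i) * ?J i x))"
      by (intro Bochner_Integration.integral_cong refl)
    also have "\<dots> = (\<Sum>i\<le>n. (LINT x|M. complex_of_real (c i) * ?J i x))"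
      by (rule Bochner_Integration.integral_sum[OF int])
    also have "\<dots> = 0"
      by (intro sum.neutral ballI) (simp only: integral_mult_right_zero moment_zero[OF p] of_nat_0_less_iff zero_less_Suc mult_zero_right)
    finally show ?thesis .
  qed
  have "cmod (LINT x|M. ?G x * complex_of_real (\<phi> (exp (- radius x)))) \<le> \<epsilon> * (LINT x|M. norm (?G x))" if e0: "\<epsilon> > 0" for \<epsilon>
  proof -
    obtain q where q: "real_polynomial_function q" "\<And>y. y \<in> {0..1} \<Longrightarrow> \<bar>\<phi> y - q y\<bar> < \<epsilon>"
      using Stone_Weierstrass_real_polynomial_function[OF compact_Icc continuous_on_subset[OF \<phi> subset_UNIV] e0, of 0 1] by auto
    from q(1) obtain c n where qc: "q = (\<lambda>y. \<Sum>i\<le>n. c i * y ^ i)" by (auto simp: real_polynomial_function_iff_sum)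
    have qcont: "continuous_on UNIV q" unfolding qc by (intro continuous_intros)
    have dc: "continuous_on UNIV (\<lambda>y. \<phi> y - q y)" by (intro continuous_on_diff \<phi> qcont)
    have db: "\<bar>\<phi> y - q y\<bar> \<le> \<epsilon>" if "y \<in> {0..1}" for y using q(2)[OF that] by simp
    have "bounded (q ` {0..1})" by (intro compact_imp_bounded compact_continuous_image continuous_on_subset[OF qcont]) auto
    then obtain B' where "\<forall>y\<in>q ` {0..1}. norm y \<le> B'" by (auto simp: bounded_iff)
    then have B': "\<bar>q y\<bar> \<le> B'" if "y \<in> {0..1}" for y using that by auto
    have qi: "integrable M (\<lambda>x. ?G x * complex_of_real (q (exp (- radius x))))" using bound[OF qcont B'] by blast
    have "(LINT x|M. ?G x * complex_of_real (\<phi> (exp (- radius x)))) = (LINT x|M. ?G x * complex_of_real (\<phi> (exp (- radius x)))) - (LINT x|M. ?G x * complex_of_real (q (exp (- radius x))))"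
      unfolding qc pz by simp
    also have "\<dots> = (LINT x|M. ?G x * complex_of_real (\<phi> (exp (- radius x))) - ?G x * complex_of_real (q (exp (- radius x))))"
      by (rule Bochner_Integration.integral_diff[OF \<phi>i qi, symmetric])
    also have "\<dots> = (LINT x|M. ?G x * complex_of_real (\<phi> (exp (- radius x)) - q (exp (- radius x))))"
      by (simp only: of_real_diff right_diff_distrib)
    finally show ?thesis using bound[OF dc db] by simp
  qed
  note eps = this
  have "cmod (LINT x|M. ?G x * complex_of_real (\<phi> (exp (- radius x)))) \<le> 0"
  proof (rule field_le_epsilon)
    fix e :: real assume e: "e > 0"
    let ?I = "LINT x|M. norm (?G x)"
    have I0: "?I \<ge> 0" by simp
    have "cmod (LINT x|M. ?G x * complex_of_real (\<phi> (exp (- radius x)))) \<le> e / (?I + 1) * ?I"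
      using e I0 by (intro eps) (simp add: add_nonneg_pos)
    also have "\<dots> \<le> e" using e I0 by (simp add: divide_le_eq add_nonneg_pos mult_left_mono)
    finally show "cmod (LINT x|M. ?G x * complex_of_real (\<phi> (exp (- radius x)))) \<le> 0 + e" by simp
  qed
  then show "(LINT x|M. g x * cnj (p x) * complex_of_real (exp (- radius x) * \<phi> (exp (- radius x)))) = 0"
    by (simp add: mult.assoc)
qed

text \<open>Every continuous function \<open>h\<close> that vanishes for large arguments has the form \<open>y * \<phi> y\<close> with
  \<open>y = exp (- r)\<close> and \<open>\<phi>\<close> continuous, since \<open>\<phi>\<close> vanishes near zero.\<close>

lemma radial_zero:
  assumes p: "p \<in> dunkl_harmonics P k m" and \<chi>: "continuous_on UNIV h" and supp: "\<And>r. r \<ge> T \<Longrightarrow> h r = 0"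
  shows "integrable M (\<lambda>x. g x * cnj (p x) * complex_of_real (h (radius x)))"
    and "(LINT x|M. g x * cnj (p x) * complex_of_real (h (radius x))) = 0"
proof -
  define \<phi> where "\<phi> y = (if y \<le> 0 then 0 else h (- ln y) / y)" for y
  have "continuous_on ({..<exp (- T)} \<union> {0<..}) \<phi>"
  proof (rule continuous_on_open_Un)
    have z: "\<phi> y = 0" if "y \<in> {..<exp (- T)}" for y
    proof (cases "y \<le> 0")
      case False
      then have "ln y < - T" using that by (metis exp_gt_zero lessThan_iff ln_exp ln_less_cancel_iff not_le)
      then show ?thesis using supp[of "- ln y"] by (simp add: \<phi>_def)
    qed (simp add: \<phi>_def)
    show "continuous_on {..<exp (- T)} \<phi>"
      by (rule continuous_on_cong[THEN iffD1, OF refl _ continuous_on_const[of _ 0]]) (simp add: z)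
    have "continuous_on {0<..} (\<lambda>y. h (- ln y) / y)"
      by (intro continuous_on_divide continuous_on_compose2[OF \<chi>] continuous_intros) auto
    then show "continuous_on {0<..} \<phi>"
      by (rule continuous_on_cong[THEN iffD1, OF refl, rotated]) (simp add: \<phi>_def)
  qed auto
  moreover have "{..<exp (- T)} \<union> {0<..} = (UNIV :: real set)" using less_le_trans[of _ 0 "exp (- T)"] by (auto simp: not_less) (meson exp_gt_zero le_less_trans)
  ultimately have \<phi>: "continuous_on UNIV \<phi>" by simp
  have eq: "exp (- r) * \<phi> (exp (- r)) = h r" for r by (simp add: \<phi>_def)
  show "integrable M (\<lambda>x. g x * cnj (p x) * complex_of_real (h (radius x)))"
    and "(LINT x|M. g x * cnj (p x) * complex_of_real (h (radius x))) = 0"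
    using radial_zero_exp[OF p \<phi>] by (simp_all only: eq)
qed

text \<open>The maximum makes the right-hand side a continuous function of the radius on the whole line.\<close>

lemma inner_eq_radius: "x \<bullet> x = (a * max 0 (radius x) / 2) powr (2 / a)"
proof (cases "x = 0")
  case True
  then show ?thesis by (simp add: radius_def)
next
  case False
  have "a * max 0 (radius x) / 2 = norm x powr a" using a_pos by (simp add: radius_def max_def)
  then show ?thesis using a_pos False by (simp add: powr_powr powr_numeral power2_norm_eq_inner)
qed

text \<open>In the Fischer decomposition the powers of the squared norm are functions of the radius and can be
  absorbed into the radial factor.\<close>

lemma polynomial_zero_homogeneous:
  assumes q: "homogeneous_polynomial m q"
  shows "integrable M (\<lambda>x. g x * cnj (q x) * complex_of_real (max 0 (T - radius x)))
    \<and> (LINT x|M. g x * cnj (q x) * complex_of_real (max 0 (T - radius x))) = 0"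
proof -
  obtain h where h: "\<And>i. i \<le> m div 2 \<Longrightarrow> h i \<in> dunkl_harmonics P k (m - 2 * i)"
    and qh: "q = (\<lambda>x. \<Sum>i\<le>m div 2. complex_of_real ((x \<bullet> x) ^ i) * h i x)"
    using Fischer_decomposition[OF zero_notin_P mult_index_nonneg q] by blast
  define \<psi> where "\<psi> i r = ((a * max 0 r / 2) powr (2 / a)) ^ i * max 0 (T - r)" for i r
  have \<psi>c: "continuous_on UNIV (\<psi> i)" for i
    unfolding \<psi>_def[abs_def] using a_pos
    by (intro continuous_on_mult continuous_on_power continuous_on_powr' continuous_on_divide continuous_on_max continuous_on_diff continuous_on_const continuous_on_id) auto
  have \<psi>s: "\<psi> i r = 0" if "r \<ge> T" for i r using that by (simp add: \<psi>_def)
  let ?J = "\<lambda>i x. g x * cnj (h i x) * complex_of_real (\<psi> i (radius x))"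
  have i: "integrable M (?J i)" "integral\<^sup>L M (?J i) = 0" if "i \<in> {..m div 2}" for i
    using radial_zero[OF h \<psi>c \<psi>s] that by auto
  have eq: "g x * cnj (q x) * complex_of_real (max 0 (T - radius x)) = (\<Sum>i\<le>m div 2. ?J i x)" for x
    unfolding qh cnj_sum sum_distrib_left sum_distrib_right
    by (intro sum.cong refl) (simp only: \<psi>_def inner_eq_radius[symmetric] complex_cnj_mult complex_cnj_complex_of_real of_real_mult mult_ac)
  show ?thesis
  proof
    show "integrable M (\<lambda>x. g x * cnj (q x) * complex_of_real (max 0 (T - radius x)))"
      unfolding eq by (rule Bochner_Integration.integrable_sum[OF i(1)])
    have "(LINT x|M. (\<Sum>i\<le>m div 2. ?J i x)) = (\<Sum>i\<le>m div 2. integral\<^sup>L M (?J i))"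
      by (rule Bochner_Integration.integral_sum[OF i(1)])
    also have "\<dots> = 0" by (rule sum.neutral) (use i(2) in blast)
    finally show "(LINT x|M. g x * cnj (q x) * complex_of_real (max 0 (T - radius x))) = 0" unfolding eq .
  qed
qed

lemma polynomial_zero:
  assumes "polynomial_fun q"
  shows "integrable M (\<lambda>x. g x * q x * complex_of_real (max 0 (T - radius x)))
    \<and> (LINT x|M. g x * q x * complex_of_real (max 0 (T - radius x))) = 0"
  using assms
proof induction
  case (homogeneous m p)
  from polynomial_zero_homogeneous[OF homogeneous_polynomial_cnj[OF this]] show ?case by simp
next
  case (add p q)
  then show ?case by (simp add: distrib_left distrib_right)
qed

text \<open>The radial factor has compact support, so \<open>f\<close> can be approximated uniformly by polynomials there.\<close>

lemma continuous_zero: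
  fixes f :: "real^'n \<Rightarrow> real"
  assumes f: "continuous_on UNIV f"
  shows "(LINT x|M. g x * complex_of_real (f x) * complex_of_real (max 0 (T - radius x))) = 0"
proof -
  let ?w = "\<lambda>x. max 0 (T - radius x)"
  let ?G = "\<lambda>x. g x * complex_of_real (?w x)"
  have Gi: "integrable M ?G"
    using polynomial_zero[OF polynomial_fun.homogeneous[OF homogeneous_polynomial_const[of 1]], of T] by simp
  define \<rho> where "\<rho> = (a * \<bar>T\<bar> / 2) powr (1 / a)"
  have out: "?w x = 0" if "x \<notin> cball 0 \<rho>" for x :: "real^'n"
  proof -
    have "norm x > \<rho>" using that by simp
    then have "norm x powr a > \<rho> powr a" using a_pos by (intro powr_less_mono2) (auto simp: \<rho>_def)
    also have "\<rho> powr a = a * \<bar>T\<bar> / 2" using a_pos by (cases "T = 0") (auto simp: \<rho>_def powr_powr)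
    finally have "radius x > \<bar>T\<bar>" using a_pos by (simp add: radius_def field_simps)
    then show ?thesis by simp
  qed
  have [measurable]: "f \<in> borel_measurable borel" by (rule borel_measurable_continuous_onI[OF f])
  have eps: "cmod (LINT x|M. g x * complex_of_real (f x) * complex_of_real (?w x)) \<le> \<epsilon> * (LINT x|M. norm (?G x))" if e0: "\<epsilon> > 0" for \<epsilon>
  proof -
    obtain q where q: "real_polynomial_function q" "\<And>y. y \<in> cball 0 \<rho> \<Longrightarrow> \<bar>f y - q y\<bar> < \<epsilon>"
      using Stone_Weierstrass_real_polynomial_function[OF compact_cball continuous_on_subset[OF f subset_UNIV] e0, of 0 \<rho>] by auto
    note qz = polynomial_zero[OF polynomial_fun_real_polynomial[OF q(1)], of T]
    have qc: "continuous_on UNIV q" by (intro continuous_at_imp_continuous_on ballI continuous_real_polymonial_function q(1))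
    have [measurable]: "q \<in> borel_measurable borel" by (rule borel_measurable_continuous_onI[OF qc])
    have le: "norm (?G x * complex_of_real (f x - q x)) \<le> \<epsilon> * norm (?G x)" for x
    proof (cases "x \<in> cball 0 \<rho>")
      case True
      have "\<bar>f x - q x\<bar> \<le> \<epsilon>" using q(2)[OF True] by simp
      from mult_left_mono[OF this norm_ge_zero[of "?G x"]]
      show ?thesis unfolding norm_mult[of "?G x"] norm_of_real by (simp only: mult.commute)
    next
      case False
      then show ?thesis by (simp add: out)
    qed
    have m: "(\<lambda>x. ?G x * complex_of_real (f x - q x)) \<in> borel_measurable borel" by measurable
    have di: "integrable M (\<lambda>x. ?G x * complex_of_real (f x - q x))"
    proof (rule Bochner_Integration.integrable_bound)
      show "integrable M (\<lambda>x. \<epsilon> * norm (?G x))" using Gi by (intro integrable_mult_right integrable_norm)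
      show "AE x in M. norm (?G x * complex_of_real (f x - q x)) \<le> norm (\<epsilon> * norm (?G x))"
        using le \<open>\<epsilon> > 0\<close> by (intro AE_I2) (metis abs_of_nonneg less_imp_le mult_nonneg_nonneg norm_ge_zero real_norm_def)
    qed (use m in simp)
    have "(LINT x|M. g x * complex_of_real (f x) * complex_of_real (?w x)) = (LINT x|M. ?G x * complex_of_real (f x - q x) + g x * complex_of_real (q x) * complex_of_real (?w x))"
      by (intro Bochner_Integration.integral_cong refl) (simp add: algebra_simps)
    also have "\<dots> = (LINT x|M. ?G x * complex_of_real (f x - q x)) + (LINT x|M. g x * complex_of_real (q x) * complex_of_real (?w x))"
      using qz by (intro Bochner_Integration.integral_add di) blast
    also have "\<dots> = (LINT x|M. ?G x * complex_of_real (f x - q x))" using qz by simp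
    finally have "cmod (LINT x|M. g x * complex_of_real (f x) * complex_of_real (?w x)) = cmod (LINT x|M. ?G x * complex_of_real (f x - q x))" by simp
    also have "\<dots> \<le> (LINT x|M. norm (?G x * complex_of_real (f x - q x)))" by (rule integral_norm_bound)
    also have "\<dots> \<le> (LINT x|M. \<epsilon> * norm (?G x))"
      using di Gi le by (intro integral_mono integrable_norm integrable_mult_right) auto
    finally show ?thesis by simp
  qed
  have "cmod (LINT x|M. g x * complex_of_real (f x) * complex_of_real (?w x)) \<le> 0"
  proof (rule field_le_epsilon)
    fix e :: real assume e: "e > 0"
    let ?I = "LINT x|M. norm (?G x)"
    have I0: "?I \<ge> 0" by simp
    have "cmod (LINT x|M. g x * complex_of_real (f x) * complex_of_real (?w x)) \<le> e / (?I + 1) * ?I"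
      using e I0 by (intro eps) (simp add: add_nonneg_pos)
    also have "\<dots> \<le> e" using e I0 by (simp add: divide_le_eq add_nonneg_pos mult_left_mono)
    finally show "cmod (LINT x|M. g x * complex_of_real (f x) * complex_of_real (?w x)) \<le> 0 + e" by simp
  qed
  then show ?thesis by simp
qed

text \<open>The cut-offs \<open>max 0 (n - radius x)\<close> exhaust the space.\<close>

theorem Phi_total: "AE x in M. g x = 0"
proof -
  have "AE x in lborel. complex_of_real (weight R k a x) * (g x * complex_of_real (max 0 (real n - radius x))) = 0" for n :: nat
  proof (rule AE_zero_if_orthogonal_continuous)
    let ?G = "\<lambda>x. g x * complex_of_real (max 0 (real n - radius x))"
    have m: "?G \<in> borel_measurable borel" by measurable
    have "integrable M ?G"
      using polynomial_zero[OF polynomial_fun.homogeneous[OF homogeneous_polynomial_const[of 1]], of "real n"] by simp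
    then show "integrable lborel (\<lambda>x. complex_of_real (weight R k a x) * ?G x)"
      using integral_M(2)[OF m] by simp
    fix f :: "real^'n \<Rightarrow> real" assume f: "continuous_on UNIV f"
    have [measurable]: "f \<in> borel_measurable borel" by (rule borel_measurable_continuous_onI[OF f])
    have m': "(\<lambda>x. g x * complex_of_real (f x) * complex_of_real (max 0 (real n - radius x))) \<in> borel_measurable borel" by measurable
    have "(LINT x|lborel. complex_of_real (f x) * (complex_of_real (weight R k a x) * ?G x)) = (LINT x|lborel. complex_of_real (weight R k a x) * (g x * complex_of_real (f x) * complex_of_real (max 0 (real n - radius x))))"
      by (intro Bochner_Integration.integral_cong refl) (simp only: mult_ac)
    also have "\<dots> = 0" using continuous_zero[OF f, of "real n"] integral_M(1)[OF m'] by simp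
    finally show "(LINT x|lborel. complex_of_real (f x) * (complex_of_real (weight R k a x) * ?G x)) = 0" .
  qed
  then have "AE x in lborel. \<forall>n::nat. complex_of_real (weight R k a x) * (g x * complex_of_real (max 0 (real n - radius x))) = 0"
    by (subst AE_all_countable) blast
  then have "AE x in lborel. g x = 0"
    using AE_weight_pos
  proof eventually_elim
    case (elim x)
    obtain n :: nat where n: "radius x < real n" using reals_Archimedean2 by blast
    then have "max 0 (real n - radius x) > 0" by simp
    moreover have "complex_of_real (weight R k a x) * (g x * complex_of_real (max 0 (real n - radius x))) = 0" using elim(1) by blast
    ultimately show ?case using elim(2) by (metis less_irrefl mult_eq_0_iff of_real_eq_0_iff)
  qed
  then show ?thesis by (rule AE_M_I)
qed

end

end

section \<open>An orthonormal basis of eigenfunctions\<close>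

text \<open>A subspace of a finitely generated space of functions is finitely generated: if some \<open>s\<close> in \<open>V\<close> involves
  the last generator, then \<open>V\<close> is spanned by \<open>s\<close> and the elements that do not.\<close>

lemma finite_spanning_family:
  fixes f :: "nat \<Rightarrow> 'a \<Rightarrow> complex"
  assumes zero: "(\<lambda>x. 0) \<in> V"
    and add: "\<And>p q. p \<in> V \<Longrightarrow> q \<in> V \<Longrightarrow> (\<lambda>x. p x + q x) \<in> V"
    and scale: "\<And>c p. p \<in> V \<Longrightarrow> (\<lambda>x. c * p x) \<in> V"
    and span: "\<And>p. p \<in> V \<Longrightarrow> \<exists>c. p = (\<lambda>x. \<Sum>i<N. c i * f i x)"
  shows "\<exists>(b :: nat \<Rightarrow> 'a \<Rightarrow> complex) n. (\<forall>i. b i \<in> V) \<and> (\<forall>p\<in>V. \<exists>c. p = (\<lambda>x. \<Sum>i<n. c i * b i x))"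
  using assms
proof (induction N arbitrary: V)
  case 0
  have "p = (\<lambda>x. \<Sum>i<0. c i * (0 :: complex))" if "p \<in> V" for p and c :: "nat \<Rightarrow> complex"
    using "0.prems"(4)[OF that] by simp
  with "0.prems"(1) show ?case by (intro exI[of _ "\<lambda>i x. 0"] exI[of _ 0]) blast
next
  case (Suc N)
  define W where "W = {p \<in> V. \<exists>c. p = (\<lambda>x. \<Sum>i<N. c i * f i x)}"
  have WI: "p \<in> W" if "p \<in> V" "p = (\<lambda>x. \<Sum>i<N. c i * f i x)" for p c
    unfolding W_def using that(1) by (intro CollectI conjI exI[of _ c] that(2))
  have "\<exists>(b :: nat \<Rightarrow> 'a \<Rightarrow> complex) n. (\<forall>i. b i \<in> W) \<and> (\<forall>p\<in>W. \<exists>c. p = (\<lambda>x. \<Sum>i<n. c i * b i x))"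
  proof (rule Suc.IH)
    show "(\<lambda>x. 0) \<in> W"
      by (rule WI[OF Suc.prems(1), of "\<lambda>i. 0"]) simp
  next
    fix p q assume "p \<in> W" "q \<in> W"
    then obtain c d where p: "p \<in> V" "p = (\<lambda>x. \<Sum>i<N. c i * f i x)" and q: "q \<in> V" "q = (\<lambda>x. \<Sum>i<N. d i * f i x)"
      by (auto simp: W_def)
    have "(\<lambda>x. p x + q x) = (\<lambda>x. \<Sum>i<N. (c i + d i) * f i x)"
      unfolding p(2) q(2) by (simp add: sum.distrib distrib_right)
    then show "(\<lambda>x. p x + q x) \<in> W" by (rule WI[OF Suc.prems(2)[OF p(1) q(1)]])
  next
    fix r p assume "p \<in> W"
    then obtain c where p: "p \<in> V" "p = (\<lambda>x. \<Sum>i<N. c i * f i x)" by (auto simp: W_def)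
    have "(\<lambda>x. r * p x) = (\<lambda>x. \<Sum>i<N. (r * c i) * f i x)"
      unfolding p(2) by (simp add: sum_distrib_left mult.assoc)
    then show "(\<lambda>x. r * p x) \<in> W" by (rule WI[OF Suc.prems(3)[OF p(1)]])
  qed (auto simp: W_def)
  then obtain b :: "nat \<Rightarrow> 'a \<Rightarrow> complex" and n where b: "\<And>i. b i \<in> W" "\<And>p. p \<in> W \<Longrightarrow> \<exists>c. p = (\<lambda>x. \<Sum>i<n. c i * b i x)" by blast
  show ?case
  proof (cases "V \<subseteq> W")
    case True
    then show ?thesis using b unfolding W_def by blast
  next
    case False
    then obtain s where s: "s \<in> V" "s \<notin> W" by blast
    obtain c where c: "s = (\<lambda>x. \<Sum>i<Suc N. c i * f i x)" using Suc.prems(4)[OF s(1)] by blast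
    have cN: "c N \<noteq> 0"
    proof
      assume "c N = 0"
      then have "s = (\<lambda>x. \<Sum>i<N. c i * f i x)" using c by simp
      from WI[OF s(1) this] show False using s(2) by blast
    qed
    show ?thesis
    proof (intro exI[of _ "b(n := s)"] exI[of _ "Suc n"] conjI allI ballI)
      show "(b(n := s)) i \<in> V" for i using b(1)[of i] s(1) by (simp add: W_def)
    next
      fix p assume p: "p \<in> V"
      obtain d where d: "p = (\<lambda>x. \<Sum>i<Suc N. d i * f i x)" using Suc.prems(4)[OF p] by blast
      define r where "r = d N / c N"
      have r: "r * c N = d N" using cN by (simp add: r_def)
      let ?q = "\<lambda>x. p x + (- r) * s x"
      have "?q x = (\<Sum>i<N. (d i - r * c i) * f i x)" for x
      proof -
        have "?q x = (\<Sum>i<N. d i * f i x) + r * c N * f N x - r * ((\<Sum>i<N. c i * f i x) + c N * f N x)"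
          unfolding d c r by simp
        also have "\<dots> = (\<Sum>i<N. d i * f i x) - r * (\<Sum>i<N. c i * f i x)"
          by (simp add: distrib_left mult.assoc)
        also have "\<dots> = (\<Sum>i<N. (d i - r * c i) * f i x)"
          unfolding sum_distrib_left sum_subtractf[symmetric] by (intro sum.cong refl) (simp add: left_diff_distrib mult.assoc)
        finally show ?thesis .
      qed
      then have eq: "?q = (\<lambda>x. \<Sum>i<N. (d i - r * c i) * f i x)" by (rule ext)
      have "?q \<in> W" by (rule WI[OF Suc.prems(2)[OF p Suc.prems(3)[OF s(1)]] eq])
      then obtain e where e: "?q = (\<lambda>x. \<Sum>i<n. e i * b i x)" using b(2) by blast
      have "p x = (\<Sum>i<Suc n. (e(n := r)) i * (b(n := s)) i x)" for x
      proof -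
        have "(\<Sum>i<n. (e(n := r)) i * (b(n := s)) i x) = (\<Sum>i<n. e i * b i x)" by (intro sum.cong refl) auto
        also have "\<dots> = p x - r * s x" using fun_cong[OF e, of x] by simp
        finally show ?thesis by simp
      qed
      then show "\<exists>c. p = (\<lambda>x. \<Sum>i<Suc n. c i * (b(n := s)) i x)" by blast
    qed
  qed
qed

lemma L2_fun_cong_AE:
  assumes "f \<in> borel_measurable M" "g \<in> L2_fun M" "AE x in M. f x = g x"
  shows "f \<in> L2_fun M"
proof -
  note [measurable] = assms(1) L2_funD(1)[OF assms(2)]
  have "integrable M (\<lambda>x. (cmod (f x))\<^sup>2) \<longleftrightarrow> integrable M (\<lambda>x. (cmod (g x))\<^sup>2)"
    using assms(3) by (intro integrable_cong_AE) auto
  then show ?thesis using L2_funD(2)[OF assms(2)] assms(1) by (simp add: L2_fun_def)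
qed

lemma L2_dist_class:
  assumes "f \<in> L2_fun M" "u \<in> L2 M"
  shows "L2_dist M (L2_class M f) u = sqrt (sq M (\<lambda>x. L2_rep u x - f x))"
proof -
  have "sq M (\<lambda>x. L2_rep u x - f x) = sq M (\<lambda>x. f x - L2_rep u x)" by (rule sq_commute)
  also have "\<dots> = sq M (\<lambda>x. L2_rep (L2_class M f) x - L2_rep u x)"
    using L2_rep_class[OF assms(1)] by (intro sq_cong_AE L2_fun_diff L2_rep_in L2_class_in assms) auto
  finally show ?thesis by (simp add: L2_dist_sq)
qed

lemma complex_span_base: "f \<in> S \<Longrightarrow> f \<in> complex_span S"
  unfolding complex_span_def by (intro CollectI exI[of _ "{f}"] exI[of _ "\<lambda>_. 1"]) auto

lemma complex_span_zero: "(\<lambda>x. 0) \<in> complex_span S"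
  unfolding complex_span_def by (intro CollectI exI[of _ "{}"]) auto

lemma complex_span_scale:
  assumes "f \<in> complex_span S" shows "(\<lambda>x. r * f x) \<in> complex_span S"
proof -
  obtain F c where "finite F" "F \<subseteq> S" "f = (\<lambda>x. \<Sum>f\<in>F. c f * f x)" using assms by (auto simp: complex_span_def)
  then show ?thesis
    unfolding complex_span_def by (intro CollectI exI[of _ F] exI[of _ "\<lambda>f. r * c f"]) (auto simp: sum_distrib_left mult.assoc)
qed

lemma complex_span_add:
  assumes "f \<in> complex_span S" "g \<in> complex_span S" shows "(\<lambda>x. f x + g x) \<in> complex_span S"
proof -
  obtain F c where F: "finite F" "F \<subseteq> S" "f = (\<lambda>x. \<Sum>f\<in>F. c f * f x)" using assms(1) by (auto simp: complex_span_def)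
  obtain G d where G: "finite G" "G \<subseteq> S" "g = (\<lambda>x. \<Sum>f\<in>G. d f * f x)" using assms(2) by (auto simp: complex_span_def)
  have "f x + g x = (\<Sum>f\<in>F \<union> G. ((if f \<in> F then c f else 0) + (if f \<in> G then d f else 0)) * f x)" for x
  proof -
    have "f x = (\<Sum>f\<in>F \<union> G. (if f \<in> F then c f else 0) * f x)"
      unfolding F(3) using F(1) G(1) by (intro sum.mono_neutral_cong_left) auto
    moreover have "g x = (\<Sum>f\<in>F \<union> G. (if f \<in> G then d f else 0) * f x)"
      unfolding G(3) using F(1) G(1) by (intro sum.mono_neutral_cong_left) auto
    ultimately show ?thesis by (simp only: distrib_right sum.distrib)
  qed
  then show ?thesis
    unfolding complex_span_def using F(1,2) G(1,2)
    by (intro CollectI exI[of _ "F \<union> G"] exI[of _ "\<lambda>f. (if f \<in> F then c f else 0) + (if f \<in> G then d f else 0)"]) auto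
qed

lemma Phi_zero: "Phi P k a l m (\<lambda>x. 0) = (\<lambda>x. 0)"
  by (simp add: Phi_def fun_eq_iff)

lemma Phi_add: "Phi P k a l m (\<lambda>x. p x + q x) = (\<lambda>x. Phi P k a l m p x + Phi P k a l m q x)"
  by (simp add: Phi_def fun_eq_iff distrib_right)

lemma Phi_cmult: "Phi P k a l m (\<lambda>x. c * p x) = (\<lambda>x. c * Phi P k a l m p x)"
  by (simp add: Phi_def fun_eq_iff)

lemma Phi_sum: "Phi P k a l m (\<lambda>x. \<Sum>i\<in>I. c i * p i x) = (\<lambda>x. \<Sum>i\<in>I. c i * Phi P k a l m (p i) x)"
  by (simp add: Phi_def fun_eq_iff sum_distrib_right mult.assoc)

text \<open>The set where \<open>F\<close> is non-zero is open, and non-empty open sets have positive measure.\<close>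

lemma continuous_AE_zero:
  fixes F :: "real^'n \<Rightarrow> complex"
  assumes F: "continuous_on UNIV F" and ae: "AE x in lborel. F x = 0"
  shows "F x = 0"
proof -
  have open_ne: "open {x. F x \<noteq> 0}" by (intro open_Collect_neq F continuous_on_const)
  then have "{x. F x \<noteq> 0} \<in> sets lborel" by simp
  then have "{x. F x \<noteq> 0} \<in> null_sets lborel" using ae by (subst AE_iff_null_sets) auto
  then have "negligible {x. F x \<noteq> 0}" by (intro negligible_iff_null_sets[THEN iffD2] null_sets_completionI)
  then have "{x. F x \<noteq> 0} = {}" using open_not_negligible[OF open_ne] by blast
  then show ?thesis by blast
qed

context ka_setting
begin

lemma harmonic_spanning_family:
  "\<exists>b :: nat \<Rightarrow> real^'n \<Rightarrow> complex. (\<forall>i. b i \<in> dunkl_harmonics P k m) \<and>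
    (\<forall>p\<in>dunkl_harmonics P k m. \<exists>n c. p = (\<lambda>x. \<Sum>i<n. c i * b i x))"
proof -
  let ?A = "{\<nu> :: 'n \<Rightarrow> nat. (\<Sum>i\<in>UNIV. \<nu> i) = m}"
  obtain h where h: "bij_betw h {0..<card ?A} ?A" using ex_bij_betw_nat_finite[OF finite_multiindices] by blast
  let ?f = "\<lambda>j x. \<Prod>i\<in>UNIV. complex_of_real (x $ i) ^ h j i"
  have "\<exists>(b :: nat \<Rightarrow> real^'n \<Rightarrow> complex) n. (\<forall>i. b i \<in> dunkl_harmonics P k m) \<and>
    (\<forall>p\<in>dunkl_harmonics P k m. \<exists>c. p = (\<lambda>x. \<Sum>i<n. c i * b i x))"
  proof (rule finite_spanning_family[where N = "card ?A" and f = ?f])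
    fix p assume "p \<in> dunkl_harmonics P k m"
    then have "homogeneous_polynomial m p" by (rule dunkl_harmonicsD)
    then obtain c where c: "p = (\<lambda>x. \<Sum>\<nu>\<in>?A. c \<nu> * (\<Prod>i\<in>UNIV. complex_of_real (x $ i) ^ \<nu> i))"
      by (auto simp: homogeneous_polynomial_def)
    have "p = (\<lambda>x. \<Sum>j<card ?A. c (h j) * ?f j x)"
      unfolding c by (rule ext) (simp only: atLeast0LessThan[symmetric] sum.reindex_bij_betw[OF h, symmetric])
    then show "\<exists>c. p = (\<lambda>x. \<Sum>j<card ?A. c j * ?f j x)" by (rule exI[of _ "\<lambda>j. c (h j)"])
  qed (rule dunkl_harmonics_zero[OF zero_notin_P], erule (1) dunkl_harmonics_add[OF zero_notin_P], erule dunkl_harmonics_cmult[OF zero_notin_P])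
  then show ?thesis by blast
qed

definition harmonic_family :: "nat \<Rightarrow> nat \<Rightarrow> real^'n \<Rightarrow> complex" where
  "harmonic_family m = (SOME b. (\<forall>i. b i \<in> dunkl_harmonics P k m) \<and>
    (\<forall>p\<in>dunkl_harmonics P k m. \<exists>n c. p = (\<lambda>x. \<Sum>i<n. c i * b i x)))"

lemma harmonic_family:
  "harmonic_family m i \<in> dunkl_harmonics P k m"
  "p \<in> dunkl_harmonics P k m \<Longrightarrow> \<exists>n c. p = (\<lambda>x. \<Sum>i<n. c i * harmonic_family m i x)"
  using someI_ex[OF harmonic_spanning_family[of m]] unfolding harmonic_family_def by blast+

text \<open>A single index encodes the triple \<open>(l, m, i)\<close> of the \<open>i\<close>-th vector of the block
  \<open>{Phi P k a l m p | p \<in> dunkl_harmonics P k m}\<close>.\<close>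

definition index_l :: "nat \<Rightarrow> nat" where "index_l n = fst (prod_decode n)"
definition index_m :: "nat \<Rightarrow> nat" where "index_m n = fst (prod_decode (snd (prod_decode n)))"
definition index_i :: "nat \<Rightarrow> nat" where "index_i n = snd (prod_decode (snd (prod_decode n)))"

lemma index_surj: "\<exists>n. index_l n = l \<and> index_m n = m \<and> index_i n = i"
  by (rule exI[of _ "prod_encode (l, prod_encode (m, i))"]) (simp add: index_l_def index_m_def index_i_def)

lemma index_inj: "index_l n = index_l n' \<Longrightarrow> index_m n = index_m n' \<Longrightarrow> index_i n = index_i n' \<Longrightarrow> n = n'"
  unfolding index_l_def index_m_def index_i_def by (metis prod.collapse prod_decode_inverse)

definition eigenbasis :: "nat \<Rightarrow> real^'n \<Rightarrow> complex" where
  "eigenbasis n = gram_schmidt M (\<lambda>i. Phi P k a (index_l n) (index_m n) (harmonic_family (index_m n) i)) (index_i n)"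

definition eigenvalue :: "nat \<Rightarrow> real" where
  "eigenvalue n = Phi_eigenvalue P k a (index_l n) (index_m n)"

lemma eigenbasis_Phi: "\<exists>q\<in>dunkl_harmonics P k (index_m n). eigenbasis n = Phi P k a (index_l n) (index_m n) q"
proof -
  let ?V = "Phi P k a (index_l n) (index_m n) ` dunkl_harmonics P k (index_m n)"
  have "eigenbasis n \<in> ?V"
    unfolding eigenbasis_def
  proof (rule gram_schmidt_in)
    show "Phi P k a (index_l n) (index_m n) (harmonic_family (index_m n) i) \<in> ?V" for i
      using harmonic_family(1) by blast
  next
    show "(\<lambda>x. 0) \<in> ?V"
      by (rule image_eqI[where x = "\<lambda>x. 0"]) (simp_all add: Phi_zero dunkl_harmonics_zero zero_notin_P)
  next
    fix f h assume "f \<in> ?V" "h \<in> ?V"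
    then obtain p q where pq: "p \<in> dunkl_harmonics P k (index_m n)" "q \<in> dunkl_harmonics P k (index_m n)"
      "f = Phi P k a (index_l n) (index_m n) p" "h = Phi P k a (index_l n) (index_m n) q" by blast
    show "(\<lambda>x. f x + h x) \<in> ?V"
      by (rule image_eqI[where x = "\<lambda>x. p x + q x"]) (simp_all add: pq Phi_add dunkl_harmonics_add zero_notin_P)
  next
    fix c f assume "f \<in> ?V"
    then obtain p where p: "p \<in> dunkl_harmonics P k (index_m n)" "f = Phi P k a (index_l n) (index_m n) p" by blast
    show "(\<lambda>x. c * f x) \<in> ?V"
      by (rule image_eqI[where x = "\<lambda>x. c * p x"]) (simp_all add: p Phi_cmult dunkl_harmonics_cmult zero_notin_P)
  qed
  then show ?thesis by blast
qed

lemma Phi_harmonic_L2: "p \<in> dunkl_harmonics P k m \<Longrightarrow> Phi P k a l m p \<in> L2_fun M"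
  by (intro Phi_L2 dunkl_harmonicsD(1))

text \<open>Vectors of different blocks are orthogonal by \<open>Phi_orthogonal\<close>, vectors of one block by construction.
  A function orthogonal to all of them is orthogonal to every \<open>\<Phi>\<close>, since each block is spanned by its
  vectors.\<close>

lemma eigenbasis_orthonormal: "orthonormal_basis M eigenbasis"
proof
  note gL2 = Phi_harmonic_L2[OF harmonic_family(1)]
  show "eigenbasis n \<in> L2_fun M" for n
    unfolding eigenbasis_def by (rule gram_schmidt_L2[OF gL2])
  show "sq M (eigenbasis n) = 0 \<or> sq M (eigenbasis n) = 1" for n
    unfolding eigenbasis_def by (rule gram_schmidt_norm[OF gL2])
  show "ip M (eigenbasis i) (eigenbasis j) = 0" if "i \<noteq> j" for i j
  proof (cases "index_l i = index_l j \<and> index_m i = index_m j")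
    case True
    then have "index_i i \<noteq> index_i j" using that index_inj by blast
    then show ?thesis unfolding eigenbasis_def using True gram_schmidt_orth[OF gL2] by simp
  next
    case False
    obtain p where p: "p \<in> dunkl_harmonics P k (index_m i)" "eigenbasis i = Phi P k a (index_l i) (index_m i) p"
      using eigenbasis_Phi by blast
    obtain q where q: "q \<in> dunkl_harmonics P k (index_m j)" "eigenbasis j = Phi P k a (index_l j) (index_m j) q"
      using eigenbasis_Phi by blast
    show ?thesis unfolding p(2) q(2) using False by (intro Phi_orthogonal p(1) q(1)) simp
  qed
  fix f assume f: "f \<in> L2_fun M" and orth: "\<And>n. ip M f (eigenbasis n) = 0"
  show "AE x in M. f x = 0"
  proof (rule Phi_total[OF f])
    fix l m p assume p: "p \<in> dunkl_harmonics P k m"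
    let ?g = "\<lambda>i. Phi P k a l m (harmonic_family m i)"
    let ?e = "gram_schmidt M ?g"
    have eL2: "?e i \<in> L2_fun M" for i by (rule gram_schmidt_L2[OF gL2])
    have e: "ip M (?e i) f = 0" for i
    proof -
      obtain n where n: "index_l n = l" "index_m n = m" "index_i n = i" using index_surj by blast
      have "ip M f (?e i) = 0" using orth[of n] unfolding eigenbasis_def n .
      then show ?thesis by (subst ip_commute) simp
    qed
    have g: "ip M (?g i) f = 0" for i
    proof -
      obtain c d where cd: "AE x in M. ?g i x = (\<Sum>j\<in>{..<i}. c j * ?e j x) + d * ?e i x"
        using gram_schmidt_span[where g = ?g and n = i, OF gL2] by blast
      have s: "(\<lambda>x. \<Sum>j\<in>{..<i}. c j * ?e j x) \<in> L2_fun M" by (intro L2_fun_sum L2_fun_cmult eL2)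
      have "ip M (?g i) f = ip M (\<lambda>x. (\<Sum>j\<in>{..<i}. c j * ?e j x) + d * ?e i x) f"
        using cd by (intro ip_cong_AE gL2 f L2_fun_add s L2_fun_cmult eL2) auto
      also have "\<dots> = ip M (\<lambda>x. \<Sum>j\<in>{..<i}. c j * ?e j x) f + ip M (\<lambda>x. d * ?e i x) f"
        by (intro ip_add_left s L2_fun_cmult eL2 f)
      also have "ip M (\<lambda>x. \<Sum>j\<in>{..<i}. c j * ?e j x) f = (\<Sum>j\<in>{..<i}. ip M (\<lambda>x. c j * ?e j x) f)"
        by (intro ip_sum_left L2_fun_cmult eL2 f)
      finally show ?thesis by (simp only: ip_cmult_left e) simp
    qed
    obtain n c where c: "p = (\<lambda>x. \<Sum>i<n. c i * harmonic_family m i x)" using harmonic_family(2)[OF p] by blast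
    have "ip M (Phi P k a l m p) f = (\<Sum>i<n. ip M (\<lambda>x. c i * ?g i x) f)"
      unfolding c Phi_sum by (intro ip_sum_left L2_fun_cmult gL2 f)
    then have "ip M (Phi P k a l m p) f = 0" by (simp only: ip_cmult_left g) simp
    then show "ip M f (Phi P k a l m p) = 0" by (subst ip_commute) simp
  qed
qed

sublocale eigen: orthonormal_basis M eigenbasis
  by (rule eigenbasis_orthonormal)

lemma Phi_coef_nonzero:
  assumes p: "p \<in> dunkl_harmonics P k m" and nz: "ip M (Phi P k a l m p) (eigenbasis n) \<noteq> 0"
  shows "index_l n = l" "index_m n = m"
proof -
  obtain q where q: "q \<in> dunkl_harmonics P k (index_m n)" "eigenbasis n = Phi P k a (index_l n) (index_m n) q"
    using eigenbasis_Phi by blast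
  have "(l, m) = (index_l n, index_m n)"
    using Phi_orthogonal[OF p q(1)] nz unfolding q(2) by blast
  then show "index_l n = l" "index_m n = m" by auto
qed

text \<open>The coefficient of \<open>\<Phi>\<close> at an index of another block is zero, so in each summand the eigenvalue may be replaced
  by the eigenvalue of the index.  The operator agrees with the sum of eigenvalues times \<open>\<Phi>\<close> off the
  origin, which determines its class.\<close>

lemma Phi_span_operator:
  assumes f: "f \<in> Phi_span P k a"
  shows "f \<in> L2_fun M" "ka_operator P k a f \<in> L2_fun M"
    "eigen.coef (L2_class M (ka_operator P k a f)) n = complex_of_real (eigenvalue n) * eigen.coef (L2_class M f) n"
proof -
  obtain F c where F: "finite F" "F \<subseteq> {Phi P k a l m p |l m p. p \<in> dunkl_harmonics P k m}"
    and fc: "f = (\<lambda>x. \<Sum>\<phi>\<in>F. c \<phi> * \<phi> x)"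
    using f by (auto simp: Phi_span_def complex_span_def)
  have "\<forall>\<phi>\<in>F. \<exists>l m p. p \<in> dunkl_harmonics P k m \<and> \<phi> = Phi P k a l m p" using F(2) by blast
  then obtain l m p where lmp: "\<And>\<phi>. \<phi> \<in> F \<Longrightarrow> p \<phi> \<in> dunkl_harmonics P k (m \<phi>)"
    "\<And>\<phi>. \<phi> \<in> F \<Longrightarrow> \<phi> = Phi P k a (l \<phi>) (m \<phi>) (p \<phi>)" by metis
  let ?ev = "\<lambda>\<phi>. complex_of_real (Phi_eigenvalue P k a (l \<phi>) (m \<phi>))"
  have \<phi>L2: "\<phi> \<in> L2_fun M" if "\<phi> \<in> F" for \<phi>
    using lmp[OF that] Phi_harmonic_L2 by metis
  show fL2: "f \<in> L2_fun M" unfolding fc by (intro L2_fun_sum L2_fun_cmult \<phi>L2)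
  let ?g = "\<lambda>x. \<Sum>\<phi>\<in>F. c \<phi> * (?ev \<phi> * \<phi> x)"
  have gL2: "?g \<in> L2_fun M" by (intro L2_fun_sum L2_fun_cmult \<phi>L2)
  have off0: "ka_operator P k a f x = ?g x" if x: "x \<noteq> 0" for x
  proof -
    have sm: "dunkl_smooth P k \<phi>" if "\<phi> \<in> F" for \<phi>
      using Phi_smooth[OF lmp(1)[OF that] zero_notin_P a_pos lambda_gt] lmp(2)[OF that] by metis
    have "ka_operator P k a f x = (\<Sum>\<phi>\<in>F. c \<phi> * ka_operator P k a \<phi> x)"
      unfolding fc by (rule ka_operator_sum[OF zero_notin_P F(1) sm x])
    also have "\<dots> = ?g x"
    proof (intro sum.cong refl arg_cong2[where f = "(*)"])
      fix \<phi> assume "\<phi> \<in> F"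
      then show "ka_operator P k a \<phi> x = ?ev \<phi> * \<phi> x"
        using Phi_eigenfunction[OF lmp(1) zero_notin_P a_pos lambda_gt x] lmp(2) by metis
    qed
    finally show ?thesis .
  qed
  have "ka_operator P k a f = (\<lambda>x. if x = 0 then ka_operator P k a f 0 else ?g x)"
    using off0 by (simp add: fun_eq_iff)
  moreover have "(\<lambda>x. if x = 0 then ka_operator P k a f 0 else ?g x) \<in> borel_measurable M"
    using L2_funD(1)[OF gL2] by (intro measurable_If) auto
  ultimately have meas: "ka_operator P k a f \<in> borel_measurable M" by simp
  have "AE x in lborel. x \<noteq> (0 :: real^'n)" by (rule AE_lborel_singleton)
  then have ae: "AE x in M. ka_operator P k a f x = ?g x"
    by (intro AE_M_I) (auto intro: off0 elim!: eventually_mono)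
  show TL2: "ka_operator P k a f \<in> L2_fun M" by (rule L2_fun_cong_AE[OF meas gL2 ae])
  have "eigen.coef (L2_class M (ka_operator P k a f)) n = ip M ?g (eigenbasis n)"
    unfolding eigen.coef_class[OF TL2] by (intro ip_cong_AE TL2 gL2 eigen.e_L2 ae) auto
  also have "\<dots> = (\<Sum>\<phi>\<in>F. c \<phi> * (?ev \<phi> * ip M \<phi> (eigenbasis n)))"
  proof -
    have "ip M ?g (eigenbasis n) = (\<Sum>\<phi>\<in>F. ip M (\<lambda>x. c \<phi> * (?ev \<phi> * \<phi> x)) (eigenbasis n))"
      by (intro ip_sum_left L2_fun_cmult \<phi>L2 eigen.e_L2)
    then show ?thesis by (simp only: ip_cmult_left)
  qed
  also have "\<dots> = (\<Sum>\<phi>\<in>F. complex_of_real (eigenvalue n) * (c \<phi> * ip M \<phi> (eigenbasis n)))"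
  proof (intro sum.cong refl)
    fix \<phi> assume \<phi>: "\<phi> \<in> F"
    show "c \<phi> * (?ev \<phi> * ip M \<phi> (eigenbasis n)) = complex_of_real (eigenvalue n) * (c \<phi> * ip M \<phi> (eigenbasis n))"
    proof (cases "ip M \<phi> (eigenbasis n) = 0")
      case False
      then have "ip M (Phi P k a (l \<phi>) (m \<phi>) (p \<phi>)) (eigenbasis n) \<noteq> 0" using lmp(2)[OF \<phi>] by metis
      from Phi_coef_nonzero[OF lmp(1)[OF \<phi>] this] show ?thesis by (simp add: eigenvalue_def)
    qed simp
  qed
  also have "\<dots> = complex_of_real (eigenvalue n) * (\<Sum>\<phi>\<in>F. ip M (\<lambda>x. c \<phi> * \<phi> x) (eigenbasis n))"
    by (simp add: sum_distrib_left ip_cmult_left)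
  also have "(\<Sum>\<phi>\<in>F. ip M (\<lambda>x. c \<phi> * \<phi> x) (eigenbasis n)) = ip M f (eigenbasis n)"
    unfolding fc by (rule ip_sum_left[symmetric]) (auto intro: L2_fun_cmult \<phi>L2 eigen.e_L2)
  finally show "eigen.coef (L2_class M (ka_operator P k a f)) n = complex_of_real (eigenvalue n) * eigen.coef (L2_class M f) n"
    unfolding eigen.coef_class[OF fL2] .
qed

lemma part_Phi_span: "eigen.part c {..<N} \<in> Phi_span P k a"
proof (induction N)
  case 0
  then show ?case by (simp add: eigen.part_def Phi_span_def complex_span_zero)
next
  case (Suc N)
  have "eigenbasis N \<in> Phi_span P k a"
    unfolding Phi_span_def using eigenbasis_Phi[of N] by (intro complex_span_base) blast
  then have "(\<lambda>x. eigen.part c {..<N} x + c N * eigenbasis N x) \<in> Phi_span P k a"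
    using Suc unfolding Phi_span_def by (intro complex_span_add complex_span_scale)
  then show ?case by (simp add: eigen.part_def)
qed

lemma operator_part:
  "L2_class M (ka_operator P k a (eigen.part c {..<N})) = L2_class M (eigen.part (\<lambda>n. complex_of_real (eigenvalue n) * c n) {..<N})"
proof (rule eigen.coef_inject)
  note S = Phi_span_operator[OF part_Phi_span[of c N]]
  show "L2_class M (ka_operator P k a (eigen.part c {..<N})) \<in> L2 M" by (intro L2_class_in S(2))
  show "L2_class M (eigen.part (\<lambda>n. complex_of_real (eigenvalue n) * c n) {..<N}) \<in> L2 M"
    by (intro L2_class_in eigen.part_L2)
  show "eigen.coef (L2_class M (ka_operator P k a (eigen.part c {..<N}))) n =
    eigen.coef (L2_class M (eigen.part (\<lambda>n. complex_of_real (eigenvalue n) * c n) {..<N})) n" for n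
    unfolding S(3) eigen.coef_class[OF eigen.part_L2] by (simp add: eigen.ip_part)
qed

lemma part_approximates:
  assumes u: "u \<in> L2 M"
  shows "(\<lambda>N. L2_dist M (L2_class M (eigen.part (eigen.coef u) {..<N})) u) \<longlonglongrightarrow> 0"
proof -
  have "(\<lambda>N. sqrt (sq M (\<lambda>x. L2_rep u x - eigen.part (eigen.coef u) {..<N} x))) \<longlonglongrightarrow> sqrt 0"
    using eigen.expansion[OF L2_rep_in[OF u]] unfolding eigen.coef_def[abs_def] by (intro tendsto_real_sqrt)
  then show ?thesis by (simp add: L2_dist_class[OF eigen.part_L2 u])
qed

text \<open>Coefficients are continuous, so the relation between the coefficients passes to the closure.
  Conversely, the partial sums of the expansion of \<open>u\<close> lie in the span of the \<open>\<Phi>\<close>, and the operator maps them to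
  the partial sums of the expansion of \<open>v\<close>.\<close>

theorem closure_ka_graph:
  "graph_closure M (ka_graph R P k a) = eigen.diagonal_graph (\<lambda>n. complex_of_real (eigenvalue n))"
proof (intro equalityI subsetI)
  fix z assume "z \<in> graph_closure M (ka_graph R P k a)"
  then obtain u v where z: "z = (u, v)" and u: "u \<in> L2 M" and v: "v \<in> L2 M"
    and appr: "\<And>\<epsilon>. \<epsilon> > 0 \<Longrightarrow> \<exists>(u', v')\<in>ka_graph R P k a. L2_dist M u' u < \<epsilon> \<and> L2_dist M v' v < \<epsilon>"
    by (auto simp: graph_closure_def)
  have "eigen.coef v n = complex_of_real (eigenvalue n) * eigen.coef u n" for n
  proof -
    let ?\<mu> = "complex_of_real (eigenvalue n)"
    have "cmod (eigen.coef v n - ?\<mu> * eigen.coef u n) \<le> 0"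
    proof (rule field_le_epsilon)
      fix \<epsilon> :: real assume \<epsilon>: "\<epsilon> > 0"
      let ?d = "\<epsilon> / (1 + cmod ?\<mu>)"
      have d: "?d > 0" using \<epsilon> by (intro divide_pos_pos) (auto simp: add_pos_nonneg)
      obtain u' v' where uv: "(u', v') \<in> ka_graph R P k a" "L2_dist M u' u < ?d" "L2_dist M v' v < ?d"
        using appr[OF d] by blast
      obtain f where f: "f \<in> Phi_span P k a" "u' = L2_class M f" "v' = L2_class M (ka_operator P k a f)"
        using uv(1) by (auto simp: ka_graph_def Let_def)
      note S = Phi_span_operator[OF f(1)]
      have u': "u' \<in> L2 M" and v': "v' \<in> L2 M" unfolding f(2,3) by (intro L2_class_in S)+
      have "eigen.coef v n - ?\<mu> * eigen.coef u n = - (eigen.coef v' n - eigen.coef v n) + ?\<mu> * (eigen.coef u' n - eigen.coef u n)"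
        unfolding f(2,3) S(3) by (simp add: algebra_simps)
      then have "cmod (eigen.coef v n - ?\<mu> * eigen.coef u n) \<le> cmod (eigen.coef v' n - eigen.coef v n) + cmod ?\<mu> * cmod (eigen.coef u' n - eigen.coef u n)"
        using norm_triangle_ineq[of "- (eigen.coef v' n - eigen.coef v n)" "?\<mu> * (eigen.coef u' n - eigen.coef u n)"]
        by (simp only: norm_minus_cancel norm_mult)
      also have "\<dots> \<le> ?d + cmod ?\<mu> * ?d"
        using order_trans[OF eigen.coef_dist_le[OF v' v, of n] less_imp_le[OF uv(3)]]
          order_trans[OF eigen.coef_dist_le[OF u' u, of n] less_imp_le[OF uv(2)]]
        by (intro add_mono mult_left_mono) auto
      also have "\<dots> = (1 + cmod ?\<mu>) * ?d" by (simp only: distrib_right mult_1_left)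
      also have "\<dots> = \<epsilon>"
      proof -
        have "1 + cmod ?\<mu> \<noteq> 0" using norm_ge_zero[of ?\<mu>] by linarith
        then show ?thesis by simp
      qed
      finally show "cmod (eigen.coef v n - ?\<mu> * eigen.coef u n) \<le> 0 + \<epsilon>" by simp
    qed
    then show ?thesis by simp
  qed
  then show "z \<in> eigen.diagonal_graph (\<lambda>n. complex_of_real (eigenvalue n))"
    using u v by (simp add: z eigen.diagonal_graph_def)
next
  fix z assume "z \<in> eigen.diagonal_graph (\<lambda>n. complex_of_real (eigenvalue n))"
  then obtain u v where z: "z = (u, v)" and u: "u \<in> L2 M" and v: "v \<in> L2 M"
    and vu: "\<And>n. eigen.coef v n = complex_of_real (eigenvalue n) * eigen.coef u n"
    by (auto simp: eigen.diagonal_graph_def)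
  have cv: "eigen.coef v = (\<lambda>n. complex_of_real (eigenvalue n) * eigen.coef u n)" using vu by (simp add: fun_eq_iff)
  have "\<exists>(u', v')\<in>ka_graph R P k a. L2_dist M u' u < \<epsilon> \<and> L2_dist M v' v < \<epsilon>" if \<epsilon>: "\<epsilon> > 0" for \<epsilon>
  proof -
    have "\<forall>\<^sub>F N in sequentially. L2_dist M (L2_class M (eigen.part (eigen.coef u) {..<N})) u < \<epsilon> \<and>
        L2_dist M (L2_class M (eigen.part (eigen.coef v) {..<N})) v < \<epsilon>"
      using order_tendstoD(2)[OF part_approximates[OF u] \<epsilon>] order_tendstoD(2)[OF part_approximates[OF v] \<epsilon>]
      by (rule eventually_conj)
    then obtain N where N: "L2_dist M (L2_class M (eigen.part (eigen.coef u) {..<N})) u < \<epsilon>"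
      "L2_dist M (L2_class M (eigen.part (eigen.coef v) {..<N})) v < \<epsilon>"
      using eventually_sequentially by (metis (mono_tags, lifting) order_refl)
    have "(L2_class M (eigen.part (eigen.coef u) {..<N}), L2_class M (ka_operator P k a (eigen.part (eigen.coef u) {..<N}))) \<in> ka_graph R P k a"
      unfolding ka_graph_def Let_def using part_Phi_span by blast
    then show ?thesis using N unfolding operator_part cv[symmetric] by blast
  qed
  then show "z \<in> graph_closure M (ka_graph R P k a)"
    unfolding graph_closure_def z using u v by blast
qed

section \<open>The Fourier transform as a multiplier\<close>

definition fourier_multiplier :: "nat \<Rightarrow> complex" where
  "fourier_multiplier n = exp (- (\<i> * complex_of_real (pi * (real (index_l n) + real (index_m n) / a))))"

lemma norm_fourier_multiplier: "cmod (fourier_multiplier n) = 1"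
  by (simp add: fourier_multiplier_def norm_exp_eq_Re)

lemma fourier_multiplier_eq:
  "exp (\<i> * complex_of_real (pi / 2 * ((2 * mult_index P k + real CARD('n) + a - 2) / a))) *
    exp (\<i> * complex_of_real (pi / (2 * a) * eigenvalue n)) = fourier_multiplier n"
proof -
  have "pi / 2 * ((2 * mult_index P k + real CARD('n) + a - 2) / a) + pi / (2 * a) * eigenvalue n
      = - (pi * (real (index_l n) + real (index_m n) / a))"
    using a_pos by (simp add: eigenvalue_def Phi_eigenvalue_def lambda_kam_def field_simps)
  then have "\<i> * complex_of_real (pi / 2 * ((2 * mult_index P k + real CARD('n) + a - 2) / a)) + \<i> * complex_of_real (pi / (2 * a) * eigenvalue n)
      = - (\<i> * complex_of_real (pi * (real (index_l n) + real (index_m n) / a)))"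
    by (simp only: distrib_left[symmetric] of_real_add[symmetric]) simp
  then show ?thesis unfolding fourier_multiplier_def exp_add[symmetric] by simp
qed

text \<open>The function has modulus one, so the diagonal operator is defined everywhere; its graph contains
  exactly one pair with first component \<open>u\<close>.\<close>

lemma ka_fourier:
  assumes u: "u \<in> L2 M"
  shows "ka_fourier R P k a u \<in> L2 M" "eigen.coef (ka_fourier R P k a u) n = fourier_multiplier n * eigen.coef u n"
proof -
  let ?h = "\<lambda>t. exp (\<i> * complex_of_real (pi / (2 * a) * t))"
  have h: "?h \<in> borel_measurable borel" by (intro borel_measurable_continuous_onI continuous_intros)
  have U: "functional_calculus M (graph_closure M (ka_graph R P k a)) ?h = eigen.diagonal_graph (\<lambda>n. ?h (eigenvalue n))"
    unfolding closure_ka_graph by (rule eigen.functional_calculus_diagonal[OF h])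
  obtain w where w: "w \<in> L2 M" "\<And>n. eigen.coef w n = ?h (eigenvalue n) * eigen.coef u n"
    using eigen.bounded_multiplier_exists[OF u, of "\<lambda>n. ?h (eigenvalue n)"] by (auto simp: norm_exp_eq_Re)
  have "(THE w. (u, w) \<in> eigen.diagonal_graph (\<lambda>n. ?h (eigenvalue n))) = w"
  proof (rule the_equality)
    show "(u, w) \<in> eigen.diagonal_graph (\<lambda>n. ?h (eigenvalue n))" using u w by (simp add: eigen.diagonal_graph_def)
  next
    fix v assume "(u, v) \<in> eigen.diagonal_graph (\<lambda>n. ?h (eigenvalue n))"
    then show "v = w" using w by (intro eigen.coef_inject) (auto simp: eigen.diagonal_graph_def)
  qed
  then have F: "ka_fourier R P k a u = L2_scale M (exp (\<i> * complex_of_real (pi / 2 * ((2 * mult_index P k + real CARD('n) + a - 2) / a)))) w"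
    unfolding ka_fourier_def Let_def U by simp
  show "ka_fourier R P k a u \<in> L2 M" unfolding F by (intro L2_scale_in w)
  show "eigen.coef (ka_fourier R P k a u) n = fourier_multiplier n * eigen.coef u n"
    unfolding F eigen.coef_scale[OF w(1)] w(2) fourier_multiplier_eq[symmetric] by (simp only: mult.assoc)
qed

lemma ka_fourier_linear: "L2_linear M (ka_fourier R P k a)"
  unfolding L2_linear_def
proof (intro conjI ballI allI)
  show "ka_fourier R P k a u \<in> L2 M" if "u \<in> L2 M" for u using that by (rule ka_fourier)
  show "ka_fourier R P k a (L2_add M u v) = L2_add M (ka_fourier R P k a u) (ka_fourier R P k a v)"
    if "u \<in> L2 M" "v \<in> L2 M" for u v
    using that by (intro eigen.coef_inject ka_fourier L2_add_in)
      (simp_all add: ka_fourier L2_add_in eigen.coef_add distrib_left)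
  show "ka_fourier R P k a (L2_scale M c u) = L2_scale M c (ka_fourier R P k a u)" if "u \<in> L2 M" for c u
    using that by (intro eigen.coef_inject ka_fourier L2_scale_in)
      (simp_all add: ka_fourier L2_scale_in eigen.coef_scale)
qed

lemma ka_fourier_norm:
  assumes u: "u \<in> L2 M" shows "L2_norm M (ka_fourier R P k a u) = L2_norm M u"
proof -
  have "(\<lambda>n. (cmod (eigen.coef u n))\<^sup>2) sums (L2_norm M (ka_fourier R P k a u))\<^sup>2"
    using eigen.coef_norm[OF ka_fourier(1)[OF u]] by (simp add: ka_fourier(2)[OF u] norm_mult norm_fourier_multiplier)
  from sums_unique2[OF this eigen.coef_norm[OF u]]
  show ?thesis by (simp add: L2_norm_sq sq_nonneg)
qed

lemma ka_fourier_bij: "bij_betw (ka_fourier R P k a) (L2 M) (L2 M)"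
proof (rule bij_betw_imageI)
  have nz: "fourier_multiplier n \<noteq> 0" for n by (simp add: fourier_multiplier_def)
  show "inj_on (ka_fourier R P k a) (L2 M)"
  proof (rule inj_onI)
    fix u v assume uv: "u \<in> L2 M" "v \<in> L2 M" and eq: "ka_fourier R P k a u = ka_fourier R P k a v"
    show "u = v"
    proof (rule eigen.coef_inject[OF uv])
      fix n
      have "fourier_multiplier n * eigen.coef u n = fourier_multiplier n * eigen.coef v n"
        using ka_fourier(2)[OF uv(1)] ka_fourier(2)[OF uv(2)] eq by metis
      then show "eigen.coef u n = eigen.coef v n" using nz by simp
    qed
  qed
  show "ka_fourier R P k a ` L2 M = L2 M"
  proof (intro equalityI subsetI)
    fix w assume w: "w \<in> L2 M"
    obtain u where u: "u \<in> L2 M" "\<And>n. eigen.coef u n = inverse (fourier_multiplier n) * eigen.coef w n"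
      using eigen.bounded_multiplier_exists[OF w, of "\<lambda>n. inverse (fourier_multiplier n)"]
      by (auto simp: norm_inverse norm_fourier_multiplier)
    have "ka_fourier R P k a u = w"
      using nz by (intro eigen.coef_inject ka_fourier(1) u(1) w) (simp add: ka_fourier(2)[OF u(1)] u(2))
    then show "w \<in> ka_fourier R P k a ` L2 M" using u(1) by blast
  qed (auto intro: ka_fourier)
qed

lemma ka_fourier_Phi:
  assumes p: "p \<in> dunkl_harmonics P k m"
  shows "ka_fourier R P k a (L2_class M (Phi P k a l m p))
    = L2_scale M (exp (- (\<i> * complex_of_real (pi * (real l + real m / a))))) (L2_class M (Phi P k a l m p))"
proof (rule eigen.coef_inject)
  note L = Phi_harmonic_L2[OF p, of l]
  note C = L2_class_in[OF L]
  show "ka_fourier R P k a (L2_class M (Phi P k a l m p)) \<in> L2 M" by (rule ka_fourier[OF C])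
  show "L2_scale M (exp (- (\<i> * complex_of_real (pi * (real l + real m / a))))) (L2_class M (Phi P k a l m p)) \<in> L2 M"
    by (rule L2_scale_in[OF C])
  show "eigen.coef (ka_fourier R P k a (L2_class M (Phi P k a l m p))) n =
      eigen.coef (L2_scale M (exp (- (\<i> * complex_of_real (pi * (real l + real m / a))))) (L2_class M (Phi P k a l m p))) n" for n
  proof (cases "ip M (Phi P k a l m p) (eigenbasis n) = 0")
    case True
    then show ?thesis unfolding ka_fourier(2)[OF C] eigen.coef_scale[OF C] eigen.coef_class[OF L] by simp
  next
    case False
    note Phi_coef_nonzero[OF p False]
    then show ?thesis unfolding ka_fourier(2)[OF C] eigen.coef_scale[OF C] fourier_multiplier_def by simp
  qed
qed

text \<open>If \<open>\<Phi>\<close> vanishes almost everywhere, then by continuity \<open>p x * laguerre l \<lambda> (radius x)\<close> vanishes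
  everywhere.  On a ray on which \<open>p\<close> is non-zero this forces the Laguerre polynomial to vanish at the points
  of a sequence tending to zero, hence at zero; but its constant coefficient is non-zero.\<close>

lemma Phi_nonzero:
  assumes p: "p \<in> dunkl_harmonics P k m" and ne: "p \<noteq> (\<lambda>x. 0)"
  shows "L2_class M (Phi P k a l m p) \<noteq> L2_class M (\<lambda>x. 0)"
proof
  let ?lam = "lambda_kam P k a m"
  note L = Phi_harmonic_L2[OF p, of l] and hp = dunkl_harmonicsD(1)[OF p]
  assume "L2_class M (Phi P k a l m p) = L2_class M (\<lambda>x. 0)"
  then have "AE x in M. Phi P k a l m p x = 0" using L2_class_eq_iff[OF L L2_fun_zero] by simp
  moreover have [measurable]: "Phi P k a l m p \<in> borel_measurable borel" using L2_funD(1)[OF L] by simp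
  have "Measurable.pred borel (\<lambda>x. Phi P k a l m p x = 0)" by measurable
  ultimately have "AE x in lborel. Phi P k a l m p x = 0" using AE_M_iff by blast
  then have ae: "AE x in lborel. p x * complex_of_real (laguerre l ?lam (radius x)) = 0"
    by (rule eventually_mono) (auto simp: Phi_eq)
  have rc: "continuous_on UNIV radius"
    unfolding radius_def[abs_def] using a_pos
    by (intro continuous_on_mult continuous_on_powr' continuous_on_norm continuous_on_const continuous_on_id) auto
  have lc: "continuous_on UNIV (\<lambda>x. laguerre l ?lam (radius x))"
    unfolding poly_laguerre[symmetric] by (intro continuous_on_poly rc)
  have z: "p x * complex_of_real (laguerre l ?lam (radius x)) = 0" for x
    by (rule continuous_AE_zero[OF _ ae])
      (intro continuous_on_mult continuous_on_of_real lc homogeneous_polynomial_continuous[OF hp])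
  obtain x where x: "p x \<noteq> 0" using ne by auto
  have s: "laguerre l ?lam (radius (inverse (real (Suc n)) *\<^sub>R x)) = 0" for n
    using z[of "inverse (real (Suc n)) *\<^sub>R x"] x 
      homogeneous_polynomial_scale[OF hp, of "inverse (real (Suc n))" x] by (simp del: of_nat_Suc)
  have "(\<lambda>n. inverse (real (Suc n)) *\<^sub>R x) \<longlonglongrightarrow> 0 *\<^sub>R x"
    by (intro tendsto_scaleR LIMSEQ_inverse_real_of_nat tendsto_const)
  then have "(\<lambda>n. laguerre l ?lam (radius (inverse (real (Suc n)) *\<^sub>R x))) \<longlonglongrightarrow> laguerre l ?lam (radius (0 *\<^sub>R x))"
    using lc by (intro isCont_tendsto_compose[where g = "\<lambda>x. laguerre l ?lam (radius x)"]) (simp_all add: continuous_on_eq_continuous_at)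
  then have "laguerre l ?lam 0 = 0" unfolding s using a_pos by (simp add: LIMSEQ_const_iff radius_def)
  then have "laguerre_coeff l ?lam 0 = 0"
    unfolding poly_laguerre[symmetric] poly_0_coeff_0 coeff_laguerre .
  moreover have "Gamma (?lam + real l + 1) > 0" "Gamma (?lam + 1) > 0"
    using lambda_gt[of m] by (auto intro!: Gamma_real_pos)
  ultimately show False by (simp add: laguerre_coeff_def)
qed

end

theorem theorem5p1:
  fixes R P :: "(real^'n) set" and k :: "real^'n \<Rightarrow> real" and a :: real
  assumes "root_system R"
    and "positive_subsystem R P"
    and "multiplicity_function R k"
    and "\<forall>\<alpha>\<in>R. 0 \<le> k \<alpha>"
    and "0 < a"
    and "a + 2 * mult_index P k + real CARD('n) > 2"
  shows "let M = weight_measure R k a; \<F> = ka_fourier R P k a in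
      (L2_linear M \<F>
       \<and> bij_betw \<F> (L2 M) (L2 M)
       \<and> (\<forall>u\<in>L2 M. L2_norm M (\<F> u) = L2_norm M u))
    \<and> (\<forall>l m. \<forall>p\<in>dunkl_harmonics P k m.
         Phi P k a l m p \<in> L2_fun M
         \<and> (p \<noteq> (\<lambda>x. 0) \<longrightarrow> L2_class M (Phi P k a l m p) \<noteq> L2_class M (\<lambda>x. 0))
         \<and> \<F> (L2_class M (Phi P k a l m p))
             = L2_scale M (exp (- (\<i> * complex_of_real (pi * (real l + real m / a)))))
                 (L2_class M (Phi P k a l m p)))"
proof -
  interpret ka_setting R P k a
    using assms by unfold_locales auto
  show ?thesis
    unfolding Let_def
    by (intro conjI allI ballI impI ka_fourier_linear ka_fourier_bij ka_fourier_norm Phi_harmonic_L2 Phi_nonzero ka_fourier_Phi)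
qed

end
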